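(* Let $\mathcal{O}$ be a bounded Lipschitz domain in $\mathbb{R}^d$. Let $p\in[2,\infty)$ and $\gamma,\nu\in(0,\infty)$. Then $$H^\gamma_{p,d-\nu p}(\mathcal{O})\hookrightarrow B^\alpha_{\tau,\tau}(\mathcal{O}),\qquad\frac1\tau=\frac\alpha d+\frac1p,\qquad\text{for all}\quad0<\alpha<\min\Big\{\gamma,\ \nu\frac{d}{d-1}\Big\},$$ with the convention $1/0:=\infty$.
   Context: $X_1\hookrightarrow X_2$ means that $X_1$ is continuously linearly embedded in $X_2$ (for quasi-normed spaces). Lipschitz domain. A bounded domain $\mathcal{O}\subset\mathbb{R}^d$ is a Lipschitz domain iff for any $x_0=(x_0^1,x_0')\in\partial\mathcal{O}$ there is a Lipschitz continuous $\mu_0:\mathbb{R}^{d-1}\to\mathbb{R}$ such that, upon relabeling and reorienting the coordinate axes if necessary, (i) $\mathcal{O}\cap B_{r_0}(x_0)=\{x=(x^1,x')\in B_{r_0}(x_0):x^1>\mu_0(x')\}$ and (ii) $|\mu_0(x')-\mu_0(y')|\le K_0|x'-y'|$ for all $x',y'\in\mathbb{R}^{d-1}$, where $r_0,K_0$ are independent of $x_0$. Weighted Sobolev spaces. Let $\rho(x)=\mathrm{dist}(x,\partial\mathcal{O})$. Fix an infinitely differentiable function $\psi$ on $\mathcal{O}$ with $\rho(x)\le N\psi(x)$ and $\rho(x)^{m-1}|D^m\psi(x)|\le N(m)<\infty$ for all $x\in\mathcal{O}$, $m\in\mathbb{N}_0$. Fix a non-negative $\zeta\in C_0^\infty(\mathbb{R}_+)$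 with $\sum_{n\in\mathbb{Z}}\zeta(e^{n+t})>c>0$ for all $t\in\mathbb{R}$ and put $\zeta_n(x)=\zeta(e^n\psi(x))$. For $p\in(1,\infty)$, $\gamma\in\mathbb{R}$ let $H^\gamma_p=(1-\Delta)^{-\gamma/2}L_p(\mathbb{R}^d)$ with norm $\|(1-\Delta)^{\gamma/2}u\|_{L_p(\mathbb{R}^d)}$. For $\theta\in\mathbb{R}$, $H^\gamma_{p,\theta}(\mathcal{O})$ is the space of distributions $u$ on $\mathcal{O}$ with $\|u\|^p_{H^\gamma_{p,\theta}(\mathcal{O})}=\sum_{n\in\mathbb{Z}}e^{n\theta}\|\zeta_{-n}(e^n\cdot)u(e^n\cdot)\|^p_{H^\gamma_p}<\infty$. Besov spaces. For a domain $G\subseteq\mathbb{R}^d$, $f:G\to\mathbb{R}$, $n\in\mathbb{N}$, $h\in\mathbb{R}^d$ let $\Delta^n_hf(x)=\prod_{i=0}^n\mathbf{1}_G(x+ih)\cdot\sum_{j=0}^n\binom nj(-1)^{n-j}f(x+jh)$, and for $p\in(0,\infty)$ let $\omega^n(t,f)_p=\sup_{|h|<t}\|\Delta_h^nf\|_{L_p(G)}$, $t>0$. For $s,p,q\in(0,\infty)$ and $n\in\mathbb{N}$ with $n>s$, $B^s_{p,q}(G)$ is the set of $f\in L_p(G)$ with $|f|_{B^s_{p,q}(G)}=\big(\int_0^\infty[t^{-s}\omega^n(t,f)_p]^q\frac{dt}t\big)^{1/q}<\infty$, with (quasi-)norm $\|f\|_{B^s_{p,q}(G)}=\|f\|_{L_p(G)}+|f|_{B^s_{p,q}(G)}$.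 *)

theory Defs
  imports "HOL-Analysis.Analysis"
begin

text \<open>
  The space \<open>R^d\<close> is a type \<open>'a :: euclidean_space\<close> with \<open>d = DIM('a)\<close>; the members of \<open>Basis\<close> are
  the coordinate directions. All functions and distributions are real-valued, and norms take values
  in \<open>ennreal\<close>, the value \<open>\<infinity>\<close> meaning that the argument is not in the space.
\<close>

section \<open>Bounded Lipschitz domains\<close>

definition domain :: "'a::euclidean_space set \<Rightarrow> bool" where
  "domain D \<longleftrightarrow> open D \<and> connected D \<and> D \<noteq> {}"

text \<open>
  The orthogonal map \<open>T\<close> reorients the axes and \<open>b\<close> is the axis that is relabelled as the first one:
  a point \<open>x\<close> has new coordinates \<open>x^1 = T x \<bullet> b\<close> and \<open>x' = T x - (T x \<bullet> b) b\<close>. The space of all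
  \<open>x'\<close>, a copy of \<open>R^(d-1)\<close>, is the hyperplane orthogonal to \<open>b\<close>.
\<close>

definition bounded_lipschitz_domain :: "'a::euclidean_space set \<Rightarrow> bool" where
  "bounded_lipschitz_domain D \<longleftrightarrow> domain D \<and> bounded D \<and>
     (\<exists>r0>0. \<exists>K0. \<forall>x0\<in>frontier D.
        \<exists>T b (\<mu> :: 'a \<Rightarrow> real). orthogonal_transformation T \<and> b \<in> Basis \<and>
          D \<inter> ball x0 r0 = {x \<in> ball x0 r0. T x \<bullet> b > \<mu> (T x - (T x \<bullet> b) *\<^sub>R b)} \<and>
          K0-lipschitz_on {y. y \<bullet> b = 0} \<mu>)"


section \<open>Smooth functions and distributions\<close>

definition partial_deriv :: "'a::euclidean_space \<Rightarrow> ('a \<Rightarrow> real) \<Rightarrow> 'a \<Rightarrow> real" where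
  "partial_deriv b f x = frechet_derivative f (at x) b"

primrec iter_partial :: "'a::euclidean_space list \<Rightarrow> ('a \<Rightarrow> real) \<Rightarrow> 'a \<Rightarrow> real" where
  "iter_partial [] f = f"
| "iter_partial (b # bs) f = partial_deriv b (iter_partial bs f)"

definition smooth_on :: "'a::euclidean_space set \<Rightarrow> ('a \<Rightarrow> real) \<Rightarrow> bool" where
  "smooth_on D f \<longleftrightarrow> (\<forall>bs\<in>lists Basis. \<forall>x\<in>D. iter_partial bs f differentiable (at x))"

definition supp :: "('a::topological_space \<Rightarrow> real) \<Rightarrow> 'a set" where
  "supp f = closure {x. f x \<noteq> 0}"

definition test_functions :: "'a::euclidean_space set \<Rightarrow> ('a \<Rightarrow> real) set" where
  "test_functions D = {\<phi>. smooth_on UNIV \<phi> \<and> compact (supp \<phi>) \<and> supp \<phi> \<subseteq> D}"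

definition schwartz :: "('a::euclidean_space \<Rightarrow> real) set" where
  "schwartz = {\<phi>. smooth_on UNIV \<phi> \<and>
     (\<forall>k::nat. \<forall>bs\<in>lists Basis. bounded (range (\<lambda>x. norm x ^ k * iter_partial bs \<phi> x)))}"

text \<open>
  Distributions on \<open>D\<close>. A functional is made total by the value 0 outside the test functions, so
  that equality of distributions is equality of functions in HOL.
\<close>

definition distributions :: "'a::euclidean_space set \<Rightarrow> (('a \<Rightarrow> real) \<Rightarrow> real) set" where
  "distributions D = {u.
     (\<forall>\<phi>. \<phi> \<notin> test_functions D \<longrightarrow> u \<phi> = 0) \<and>
     (\<forall>\<phi>\<in>test_functions D. \<forall>\<eta>\<in>test_functions D. \<forall>a b.
        u (\<lambda>x. a * \<phi> x + b * \<eta> x) = a * u \<phi> + b * u \<eta>) \<and>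
     (\<forall>K. compact K \<and> K \<subseteq> D \<longrightarrow>
        (\<exists>C m. \<forall>\<phi>\<in>test_functions D. supp \<phi> \<subseteq> K \<longrightarrow>
           \<bar>u \<phi>\<bar> \<le> C * (\<Sum>bs\<in>{bs\<in>lists Basis. length bs \<le> m}. SUP x. \<bar>iter_partial bs \<phi> x\<bar>)))}"

definition locally_integrable :: "'a::euclidean_space set \<Rightarrow> ('a \<Rightarrow> real) \<Rightarrow> bool" where
  "locally_integrable D f \<longleftrightarrow> (\<forall>K. compact K \<and> K \<subseteq> D \<longrightarrow> set_integrable lborel K f)"

definition regular_distribution ::
  "'a::euclidean_space set \<Rightarrow> ('a \<Rightarrow> real) \<Rightarrow> ('a \<Rightarrow> real) \<Rightarrow> real" where
  "regular_distribution D f \<phi> =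
     (if \<phi> \<in> test_functions D then LINT x:D|lborel. f x * \<phi> x else 0)"


section \<open>Lebesgue norms and Bessel potential spaces\<close>

text \<open>Only used with positive exponents \<open>r\<close>.\<close>

definition ennreal_powr :: "ennreal \<Rightarrow> real \<Rightarrow> ennreal" where
  "ennreal_powr x r = (if x = \<infinity> then \<infinity> else ennreal (enn2real x powr r))"

definition Lp_norm :: "real \<Rightarrow> 'a::euclidean_space set \<Rightarrow> ('a \<Rightarrow> real) \<Rightarrow> ennreal" where
  "Lp_norm p G f = ennreal_powr (\<integral>\<^sup>+x\<in>G. ennreal (\<bar>f x\<bar> powr p) \<partial>lborel) (1 / p)"

definition Lp_space :: "real \<Rightarrow> 'a::euclidean_space set \<Rightarrow> ('a \<Rightarrow> real) set" where
  "Lp_space p G = {f. set_borel_measurable lborel G f \<and> Lp_norm p G f < \<infinity>}"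

definition fourier :: "('a::euclidean_space \<Rightarrow> real) \<Rightarrow> 'a \<Rightarrow> complex" where
  "fourier \<phi> \<xi> = (LINT x|lborel. cis (- (x \<bullet> \<xi>)) * of_real (\<phi> x))"

text \<open>
  The operator \<open>(1 - \<Delta>)^(s/2)\<close> on Schwartz functions, with Fourier multiplier \<open>(1 + |\<xi>|^2)^(s/2)\<close>.
  As the multiplier is real and even, the result is real for real \<open>\<phi>\<close>, so \<open>Re\<close> loses nothing.
\<close>

definition bessel_op :: "real \<Rightarrow> ('a::euclidean_space \<Rightarrow> real) \<Rightarrow> 'a \<Rightarrow> real" where
  "bessel_op s \<phi> x = Re (of_real (1 / (2 * pi) ^ DIM('a)) *
     (LINT \<xi>|lborel. cis (x \<bullet> \<xi>) * of_real ((1 + (norm \<xi>)\<^sup>2) powr (s / 2)) * fourier \<phi> \<xi>))"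

text \<open>
  The norm of \<open>H^\<gamma>_p\<close>. A tempered distribution \<open>v\<close> is given by its values on Schwartz functions, where
  \<open>(1 - \<Delta>)^(\<gamma>/2) v\<close> acts by \<open>\<phi> \<mapsto> v ((1 - \<Delta>)^(\<gamma>/2) \<phi>)\<close>. The norm is the \<open>L_p\<close> norm of the
  (almost everywhere unique) function \<open>g\<close> in \<open>L_p\<close> that equals \<open>(1 - \<Delta>)^(\<gamma>/2) v\<close>, and \<open>\<infinity>\<close>, the
  infimum of the empty set, if there is none.
\<close>

definition bessel_norm :: "real \<Rightarrow> real \<Rightarrow> (('a::euclidean_space \<Rightarrow> real) \<Rightarrow> real) \<Rightarrow> ennreal" where
  "bessel_norm \<gamma> p v =
     (INF g\<in>{g \<in> Lp_space p UNIV. \<forall>\<phi>\<in>schwartz. v (bessel_op \<gamma> \<phi>) = (LINT x|lborel. g x * \<phi> x)}.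
        Lp_norm p UNIV g)"


section \<open>Weighted Sobolev spaces\<close>

definition bdist :: "'a::euclidean_space set \<Rightarrow> 'a \<Rightarrow> real" where
  "bdist D x = infdist x (frontier D)"

definition regularized_distance :: "'a::euclidean_space set \<Rightarrow> ('a \<Rightarrow> real) \<Rightarrow> bool" where
  "regularized_distance D \<psi> \<longleftrightarrow> smooth_on D \<psi> \<and>
     (\<exists>N>0. \<forall>x\<in>D. bdist D x \<le> N * \<psi> x) \<and>
     (\<forall>m. \<exists>N. \<forall>x\<in>D. \<forall>bs\<in>lists Basis. length bs = m \<longrightarrow>
        bdist D x powr (real m - 1) * \<bar>iter_partial bs \<psi> x\<bar> \<le> N)"

definition partition_profile :: "(real \<Rightarrow> real) \<Rightarrow> bool" where
  "partition_profile \<zeta> \<longleftrightarrow> \<zeta> \<in> test_functions {0<..} \<and> (\<forall>t. \<zeta> t \<ge> 0) \<and>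
     (\<exists>c>0. \<forall>t. (\<Sum>\<^sub>\<infinity>n::int. \<zeta> (exp (of_int n + t))) > c)"

text \<open>
  The distribution \<open>\<zeta>_(-n)(e^n \<sqdot>) u(e^n \<sqdot>)\<close> on \<open>R^d\<close>. By change of variables its value at \<open>\<phi>\<close> is the
  value of \<open>u\<close> at \<open>y \<mapsto> e^(-nd) \<zeta>_(-n)(y) \<phi>(e^(-n) y)\<close>, where \<open>\<zeta>_(-n)(y) = \<zeta>(e^(-n) \<psi>(y))\<close> has compact
  support in \<open>D\<close>, so that \<open>\<phi>\<close> may be any smooth function on \<open>R^d\<close>.
\<close>

definition localized_dilation ::
  "'a::euclidean_space set \<Rightarrow> ('a \<Rightarrow> real) \<Rightarrow> (real \<Rightarrow> real) \<Rightarrow> int \<Rightarrow>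
   (('a \<Rightarrow> real) \<Rightarrow> real) \<Rightarrow> ('a \<Rightarrow> real) \<Rightarrow> real" where
  "localized_dilation D \<psi> \<zeta> n u \<phi> =
     u (\<lambda>y. if y \<in> D
            then exp (- of_int n * real DIM('a)) * \<zeta> (exp (- of_int n) * \<psi> y) *
                 \<phi> (exp (- of_int n) *\<^sub>R y)
            else 0)"

definition weighted_sobolev_norm ::
  "'a::euclidean_space set \<Rightarrow> ('a \<Rightarrow> real) \<Rightarrow> (real \<Rightarrow> real) \<Rightarrow> real \<Rightarrow> real \<Rightarrow> real \<Rightarrow>
   (('a \<Rightarrow> real) \<Rightarrow> real) \<Rightarrow> ennreal" where
  "weighted_sobolev_norm D \<psi> \<zeta> \<gamma> p \<theta> u =
     ennreal_powr
       (\<Sum>\<^sub>\<infinity>n::int. ennreal (exp (of_int n * \<theta>)) *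
          ennreal_powr (bessel_norm \<gamma> p (localized_dilation D \<psi> \<zeta> n u)) p) (1 / p)"

definition weighted_sobolev_space ::
  "'a::euclidean_space set \<Rightarrow> ('a \<Rightarrow> real) \<Rightarrow> (real \<Rightarrow> real) \<Rightarrow> real \<Rightarrow> real \<Rightarrow> real \<Rightarrow>
   (('a \<Rightarrow> real) \<Rightarrow> real) set" where
  "weighted_sobolev_space D \<psi> \<zeta> \<gamma> p \<theta> =
     {u \<in> distributions D. weighted_sobolev_norm D \<psi> \<zeta> \<gamma> p \<theta> u < \<infinity>}"


section \<open>Besov spaces\<close>

definition nth_difference ::
  "'a::euclidean_space set \<Rightarrow> nat \<Rightarrow> 'a \<Rightarrow> ('a \<Rightarrow> real) \<Rightarrow> 'a \<Rightarrow> real" where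
  "nth_difference G n h f x =
     (\<Prod>i=0..n. indicator G (x + real i *\<^sub>R h)) *
     (\<Sum>j=0..n. real (n choose j) * (-1) ^ (n - j) * f (x + real j *\<^sub>R h))"

definition modulus_of_smoothness ::
  "'a::euclidean_space set \<Rightarrow> nat \<Rightarrow> real \<Rightarrow> real \<Rightarrow> ('a \<Rightarrow> real) \<Rightarrow> ennreal" where
  "modulus_of_smoothness G n p t f = (SUP h\<in>{h. norm h < t}. Lp_norm p G (nth_difference G n h f))"

definition besov_seminorm ::
  "'a::euclidean_space set \<Rightarrow> nat \<Rightarrow> real \<Rightarrow> real \<Rightarrow> real \<Rightarrow> ('a \<Rightarrow> real) \<Rightarrow> ennreal" where
  "besov_seminorm G n s p q f =
     ennreal_powr
       (\<integral>\<^sup>+t\<in>{0<..}. ennreal_powr (ennreal (t powr (- s)) * modulus_of_smoothness G n p t f) q *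
          ennreal (1 / t) \<partial>lborel) (1 / q)"

definition besov_norm ::
  "'a::euclidean_space set \<Rightarrow> nat \<Rightarrow> real \<Rightarrow> real \<Rightarrow> real \<Rightarrow> ('a \<Rightarrow> real) \<Rightarrow> ennreal" where
  "besov_norm G n s p q f = Lp_norm p G f + besov_seminorm G n s p q f"

definition besov_space ::
  "'a::euclidean_space set \<Rightarrow> nat \<Rightarrow> real \<Rightarrow> real \<Rightarrow> real \<Rightarrow> ('a \<Rightarrow> real) set" where
  "besov_space G n s p q = {f \<in> Lp_space p G. besov_seminorm G n s p q f < \<infinity>}"


section \<open>Continuous linear embeddings\<close>

text \<open>
  \<open>X\<close> is a space of distributions on \<open>D\<close> and \<open>Y\<close> a space of functions on \<open>D\<close> that are identified
  when they agree almost everywhere on \<open>D\<close>. The embedding is the natural one: it sends a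
  distribution to the locally integrable function that represents it. (Members of \<open>Y\<close> need not be
  locally integrable, for instance in \<open>L_p\<close> with \<open>p < 1\<close>, so \<open>Y\<close> itself is not a space of
  distributions.)
\<close>

definition continuously_linearly_embedded ::
  "'a::euclidean_space set \<Rightarrow>
   (('a \<Rightarrow> real) \<Rightarrow> real) set \<Rightarrow> ((('a \<Rightarrow> real) \<Rightarrow> real) \<Rightarrow> ennreal) \<Rightarrow>
   ('a \<Rightarrow> real) set \<Rightarrow> (('a \<Rightarrow> real) \<Rightarrow> ennreal) \<Rightarrow> bool" where
  "continuously_linearly_embedded D X normX Y normY \<longleftrightarrow>
     (\<exists>\<iota> :: (('a \<Rightarrow> real) \<Rightarrow> real) \<Rightarrow> ('a \<Rightarrow> real).
        (\<forall>u\<in>X. \<iota> u \<in> Y \<and> locally_integrable D (\<iota> u) \<and> u = regular_distribution D (\<iota> u)) \<and>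
        (\<forall>u\<in>X. \<forall>v\<in>X. \<forall>a b. AE x in lborel. x \<in> D \<longrightarrow>
           \<iota> (\<lambda>\<phi>. a * u \<phi> + b * v \<phi>) x = a * \<iota> u x + b * \<iota> v x) \<and>
        (\<forall>u\<in>X. \<forall>v\<in>X. (AE x in lborel. x \<in> D \<longrightarrow> \<iota> u x = \<iota> v x) \<longrightarrow> u = v) \<and>
        (\<exists>C::real. \<forall>u\<in>X. normY (\<iota> u) \<le> ennreal C * normX u))"

end

theory Submission
  imports Defs "HOL-Probability.Characteristic_Functions" "HOL-Probability.Sinc_Integral"
begin

text \<open>
  Cut the domain into layers \<open>A j\<close> at distance about \<open>1 / l j\<close> from the boundary, with \<open>l j\<close> growing
  geometrically. On a layer a distribution \<open>u\<close> of the weighted space, dilated by \<open>l j\<close>, is a Bessel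
  potential of a function in \<open>L_p\<close>. The potential is an \<open>n\<close>-fold convolution with the Bessel kernel of order
  \<open>\<gamma> / n\<close>, and the translates of the kernel are Hoelder continuous in \<open>L_1\<close> with every exponent
  \<open>s / n < \<gamma> / n\<close>; so the \<open>i\<close>-th differences of the potential are of order \<open>|h| powr (i * s / n)\<close> in \<open>L_p\<close>, and
  dividing by the cutoff bounds the \<open>n\<close>-th difference of \<open>u\<close> itself by \<open>(l j * |h|) powr s\<close> as long as
  \<open>l j * |h|\<close> is small.

  Choose \<open>s\<close> strictly between \<open>\<alpha>\<close> and \<open>min \<gamma> (\<nu> + \<alpha> / d)\<close>, with \<open>s \<le> n\<close>. A layer has measure at most a constant times
  \<open>1 / l j\<close>, and Hoelder's inequality from \<open>L_p\<close> to \<open>L_\<tau>\<close> turns the weighted norm into a bound for the \<open>\<tau>\<close>-th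
  powers that is \<open>|h| powr (s * \<tau>)\<close> times a decaying geometric sequence in \<open>j\<close>. The points for which
  \<open>l j * |h|\<close> is not small lie in a boundary layer of width of order \<open>|h|\<close>, where \<open>u\<close> itself satisfies the same
  bound. Hence the modulus of smoothness is \<open>O(t powr s)\<close> with \<open>s > \<alpha>\<close>, and the Besov integral converges.
\<close>


section \<open>Smooth functions\<close>

text \<open>Two things shape the estimates. The exponent \<tau> may lie below 1, where convolution
  has no norm bound; so all potential estimates are made in L_p, layer by layer, and only then
  lowered to \<tau>, after which \<tau>-th powers of integrals are added up. Lowering gains the
  power 1 - \<tau> / p = \<tau> * \<alpha> / d of the measure of a layer. This is the origin of
  \<alpha> / d in s < \<nu> + \<alpha> / d, a condition which for s near \<alpha> says \<alpha> * (d
  - 1) < \<nu> * d. Second, the L_1 modulus of a kernel controls one difference, with an exponent of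
  at most 1; the n kernels supply one for each difference. The Bessel kernel is a Gamma mixture of
  Gaussians, so its moments, transform and modulus come from the standard Gaussian. The profile
  gives no partition of unity, only a sum bounded below; layers are therefore sets where one cutoff
  exceeds a constant, and they may overlap. Finally, the identity behind \<open>bessel_norm\<close>
  tests a distribution only on images of Schwartz functions under \<open>bessel_op\<close>; Fourier
  inversion shows that every test function is such an image.\<close>

lemma iter_partial_append: "iter_partial (as @ bs) f = iter_partial as (iter_partial bs f)"
  by (induction as) auto

lemma smooth_on_differentiable: "smooth_on D f \<Longrightarrow> x \<in> D \<Longrightarrow> f differentiable (at x)"
  unfolding smooth_on_def by (metis iter_partial.simps(1) lists.Nil)

lemma smooth_on_iter_partial:
  assumes "smooth_on D f" "bs \<in> lists Basis"
  shows "smooth_on D (iter_partial bs f)"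
  unfolding smooth_on_def
proof (intro ballI)
  fix as x assume "as \<in> lists (Basis :: 'a set)" "x \<in> D"
  then show "iter_partial as (iter_partial bs f) differentiable at x"
    using assms unfolding smooth_on_def iter_partial_append[symmetric] by auto
qed

lemma smooth_on_partial_deriv:
  assumes "smooth_on D f" "b \<in> Basis"
  shows "smooth_on D (partial_deriv b f)"
  using smooth_on_iter_partial[of D f "[b]"] assms by simp

lemma has_derivative_partial_deriv:
  assumes "f differentiable (at x)"
  shows "(f has_derivative (\<lambda>v. \<Sum>b\<in>Basis. (v \<bullet> b) * partial_deriv b f x)) (at x)"
proof -
  have d: "(f has_derivative frechet_derivative f (at x)) (at x)"
    using assms frechet_derivative_works by blast
  then interpret l: linear "frechet_derivative f (at x)"
    using has_derivative_linear by blast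
  have "frechet_derivative f (at x) v = (\<Sum>b\<in>Basis. (v \<bullet> b) * partial_deriv b f x)" for v
  proof -
    have "frechet_derivative f (at x) v = frechet_derivative f (at x) (\<Sum>b\<in>Basis. (v \<bullet> b) *\<^sub>R b)"
      by (simp add: euclidean_representation)
    also have "\<dots> = (\<Sum>b\<in>Basis. (v \<bullet> b) * partial_deriv b f x)"
      by (simp add: l.sum l.scaleR partial_deriv_def)
    finally show ?thesis .
  qed
  then show ?thesis using d by presburger
qed

lemma partial_deriv_eqI:
  assumes "(f has_derivative f') (at x)"
  shows "partial_deriv b f x = f' b"
  unfolding partial_deriv_def using frechet_derivative_at[OF assms] by simp

lemma differentiable_transform_open:
  assumes "open D" "x \<in> D" "\<And>y. y \<in> D \<Longrightarrow> f y = g y"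
  shows "f differentiable (at x) \<longleftrightarrow> g differentiable (at x)"
  unfolding differentiable_def
  using has_derivative_transform_within_open[OF _ assms(1,2)] assms(3) by metis

text \<open>\<open>frechet_derivative\<close> is a choice from the set of derivatives at the point,
  and this set depends only on the values near \<open>x\<close>. Hence the equality also covers
  points where neither function is differentiable.\<close>

lemma partial_deriv_transform_open:
  assumes "open D" "x \<in> D" "\<And>y. y \<in> D \<Longrightarrow> f y = g y"
  shows "partial_deriv b f x = partial_deriv b g x"
proof -
  have "(f has_derivative F) (at x) \<longleftrightarrow> (g has_derivative F) (at x)" for F
    using has_derivative_transform_within_open[OF _ assms(1,2)] assms(3) by metis
  then show ?thesis
    unfolding partial_deriv_def frechet_derivative_def by simp
qed

text \<open>Smoothness is a greatest fixed point: a class of differentiable functions that is closed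
  under partial derivatives consists of smooth functions. Closure is asked only up to agreement on
  \<open>D\<close>, and openness of \<open>D\<close> makes that enough, since derivatives are
  local.\<close>

lemma smooth_on_coinduct:
  assumes D: "open D" and P: "P f"
    and step: "\<And>f. P f \<Longrightarrow> (\<forall>x\<in>D. f differentiable (at x)) \<and>
                 (\<forall>b\<in>Basis. \<exists>g. P g \<and> (\<forall>x\<in>D. partial_deriv b f x = g x))"
  shows "smooth_on D f"
proof -
  have *: "\<exists>g. P g \<and> (\<forall>x\<in>D. iter_partial bs f x = g x)" if "bs \<in> lists Basis" for bs
    using that
  proof (induction bs)
    case Nil then show ?case using P by auto
  next
    case (Cons b bs)
    then obtain g where g: "P g" "\<forall>x\<in>D. iter_partial bs f x = g x" by auto
    with step[OF g(1)] Cons.hyps obtain k where k: "P k" "\<forall>x\<in>D. partial_deriv b g x = k x" by blast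
    have "\<forall>x\<in>D. iter_partial (b # bs) f x = k x"
      using k(2) g(2) partial_deriv_transform_open[OF D, of _ "iter_partial bs f" g b] by simp
    with k show ?case by blast
  qed
  show ?thesis unfolding smooth_on_def
  proof (intro ballI)
    fix bs x assume b: "bs \<in> lists (Basis :: 'a set)" and x: "x \<in> D"
    obtain g where g: "P g" "\<forall>x\<in>D. iter_partial bs f x = g x" using *[OF b] by blast
    then show "iter_partial bs f differentiable at x"
      using step[OF g(1)] x differentiable_transform_open[OF D x, of "iter_partial bs f" g] by auto
  qed
qed

lemma iter_partial_transform_open:
  assumes "open D" "x \<in> D" "\<And>y. y \<in> D \<Longrightarrow> f y = g y"
  shows "iter_partial bs f x = iter_partial bs g x"
  using assms(2)
proof (induction bs arbitrary: x)
  case Nil then show ?case using assms by simp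
next
  case (Cons b bs)
  then show ?case
    using partial_deriv_transform_open[OF assms(1), of x "iter_partial bs f" "iter_partial bs g" b] by simp
qed

lemma smooth_on_transform:
  assumes "open D" "smooth_on D f" "\<And>y. y \<in> D \<Longrightarrow> f y = g y"
  shows "smooth_on D g"
  unfolding smooth_on_def
proof (intro ballI)
  fix bs x assume b: "bs \<in> lists (Basis :: 'a set)" and x: "x \<in> D"
  have "iter_partial bs f differentiable at x" using assms(2) b x by (auto simp: smooth_on_def)
  then show "iter_partial bs g differentiable at x"
    using differentiable_transform_open[OF assms(1) x, of "iter_partial bs f" "iter_partial bs g"]
      iter_partial_transform_open[OF assms(1) _ assms(3)] by simp
qed

lemma smooth_on_subset: "smooth_on D f \<Longrightarrow> E \<subseteq> D \<Longrightarrow> smooth_on E f"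
  unfolding smooth_on_def by auto

lemma smooth_on_Un: "smooth_on D f \<Longrightarrow> smooth_on E f \<Longrightarrow> smooth_on (D \<union> E) f"
  unfolding smooth_on_def by auto

lemma smooth_on_const: "open D \<Longrightarrow> smooth_on D (\<lambda>_. c)"
proof (rule smooth_on_coinduct[where P="\<lambda>f. \<exists>c. f = (\<lambda>_. c)"])
  fix f :: "'a \<Rightarrow> real" assume "\<exists>c. f = (\<lambda>_. c)"
  then obtain c where f: "f = (\<lambda>_. c)" by blast
  have "partial_deriv b f = (\<lambda>_. 0)" for b
    unfolding f by (simp add: fun_eq_iff partial_deriv_eqI[OF has_derivative_const])
  then show "(\<forall>x\<in>D. f differentiable at x) \<and> (\<forall>b\<in>Basis. \<exists>g. (\<exists>c. g = (\<lambda>_. c)) \<and> (\<forall>x\<in>D. partial_deriv b f x = g x))"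
    unfolding f by auto
qed auto

text \<open>An algebra of functions that contains its own partial derivatives; this makes all closure
  properties of smooth functions instances of one coinduction.\<close>

inductive smooth_alg :: "'a::euclidean_space set \<Rightarrow> ('a \<Rightarrow> real) \<Rightarrow> bool" for D where
  base: "smooth_on D f \<Longrightarrow> smooth_alg D f"
| add: "smooth_alg D f \<Longrightarrow> smooth_alg D g \<Longrightarrow> smooth_alg D (\<lambda>x. f x + g x)"
| mult: "smooth_alg D f \<Longrightarrow> smooth_alg D g \<Longrightarrow> smooth_alg D (\<lambda>x. f x * g x)"
| comp: "smooth_on UNIV F \<Longrightarrow> smooth_on D q \<Longrightarrow> smooth_alg D (\<lambda>x. F (q x :: real))"
| inv: "smooth_on D f \<Longrightarrow> (\<And>x. x \<in> D \<Longrightarrow> f x \<noteq> 0) \<Longrightarrow> smooth_alg D (\<lambda>x. inverse (f x))"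

lemma has_derivative_comp_real:
  fixes F :: "real \<Rightarrow> real" and q :: "'a::euclidean_space \<Rightarrow> real"
  assumes "F differentiable (at (q x))" "q differentiable (at x)"
  shows "((\<lambda>x. F (q x)) has_derivative (\<lambda>v. (\<Sum>b\<in>Basis. (v \<bullet> b) * partial_deriv b q x) * partial_deriv 1 F (q x))) (at x)"
  using has_derivative_compose[OF has_derivative_partial_deriv[OF assms(2)] has_derivative_partial_deriv[OF assms(1)]]
  by simp

text \<open>The sum, product, chain and quotient rules express a derivative by the same
  constructors. \<open>comp\<close> and \<open>inv\<close> take smooth arguments rather than members
  of the algebra, so their derivatives are products of a base function with a function of the same
  form.\<close>

lemma smooth_alg_step:
  assumes "open D" "smooth_alg D f"
  shows "(\<forall>x\<in>D. f differentiable (at x)) \<and>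
         (\<forall>b\<in>Basis. \<exists>g. smooth_alg D g \<and> (\<forall>x\<in>D. partial_deriv b f x = g x))"
  using assms(2)
proof (induction rule: smooth_alg.induct)
  case (base f)
  then show ?case
    using smooth_on_differentiable smooth_on_partial_deriv smooth_alg.base by blast
next
  case (add f g)
  show ?case
  proof (intro conjI ballI)
    fix b :: 'a assume b: "b \<in> Basis"
    obtain f' where f': "smooth_alg D f'" "\<forall>x\<in>D. partial_deriv b f x = f' x" using add b by blast
    obtain g' where g': "smooth_alg D g'" "\<forall>x\<in>D. partial_deriv b g x = g' x" using add b by blast
    show "\<exists>k. smooth_alg D k \<and> (\<forall>x\<in>D. partial_deriv b (\<lambda>x. f x + g x) x = k x)"
    proof (intro exI[of _ "\<lambda>x. f' x + g' x"] conjI ballI)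
      fix x assume x: "x \<in> D"
      have "(f has_derivative frechet_derivative f (at x)) (at x)"
           "(g has_derivative frechet_derivative g (at x)) (at x)"
        using add x frechet_derivative_works by blast+
      from partial_deriv_eqI[OF has_derivative_add[OF this]]
      show "partial_deriv b (\<lambda>x. f x + g x) x = f' x + g' x"
        using f' g' x by (simp add: partial_deriv_def)
    qed (rule smooth_alg.add[OF f'(1) g'(1)])
  qed (use add in auto)
next
  case (mult f g)
  show ?case
  proof (intro conjI ballI)
    fix b :: 'a assume b: "b \<in> Basis"
    obtain f' where f': "smooth_alg D f'" "\<forall>x\<in>D. partial_deriv b f x = f' x" using mult b by blast
    obtain g' where g': "smooth_alg D g'" "\<forall>x\<in>D. partial_deriv b g x = g' x" using mult b by blast
    show "\<exists>k. smooth_alg D k \<and> (\<forall>x\<in>D. partial_deriv b (\<lambda>x. f x * g x) x = k x)"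
    proof (intro exI[of _ "\<lambda>x. f x * g' x + f' x * g x"] conjI ballI)
      fix x assume x: "x \<in> D"
      have "(f has_derivative frechet_derivative f (at x)) (at x)"
           "(g has_derivative frechet_derivative g (at x)) (at x)"
        using mult x frechet_derivative_works by blast+
      from partial_deriv_eqI[OF has_derivative_mult[OF this]]
      show "partial_deriv b (\<lambda>x. f x * g x) x = f x * g' x + f' x * g x"
        using f' g' x by (simp add: partial_deriv_def)
    qed (rule smooth_alg.add[OF smooth_alg.mult[OF mult(1) g'(1)] smooth_alg.mult[OF f'(1) mult(2)]])
  qed (use mult in auto)
next
  case (comp F q)
  have d: "((\<lambda>x. F (q x)) has_derivative (\<lambda>v. (\<Sum>b\<in>Basis. (v \<bullet> b) * partial_deriv b q x) * partial_deriv 1 F (q x))) (at x)"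
    if "x \<in> D" for x
    using comp that by (intro has_derivative_comp_real smooth_on_differentiable) auto
  show ?case
  proof (intro conjI ballI)
    fix b :: 'a assume b: "b \<in> Basis"
    have "smooth_alg D (\<lambda>x. partial_deriv b q x * partial_deriv 1 F (q x))"
      using comp b smooth_on_partial_deriv[of UNIV F 1]
      by (intro smooth_alg.mult smooth_alg.comp smooth_alg.base smooth_on_partial_deriv) auto
    moreover have "partial_deriv b (\<lambda>x. F (q x)) x = partial_deriv b q x * partial_deriv 1 F (q x)"
      if "x \<in> D" for x
      using partial_deriv_eqI[OF d[OF that], of b] b
      by (simp add: inner_Basis if_distrib[of "\<lambda>x. x * _"] sum.delta' cong: if_cong)
    ultimately show "\<exists>k. smooth_alg D k \<and> (\<forall>x\<in>D. partial_deriv b (\<lambda>x. F (q x)) x = k x)" by blast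
  qed (rule differentiableI[OF d])
next
  case (inv f)
  have d: "((\<lambda>x. inverse (f x)) has_derivative (\<lambda>v. - (inverse (f x) * frechet_derivative f (at x) v * inverse (f x)))) (at x)"
    if "x \<in> D" for x
    using inv that frechet_derivative_works smooth_on_differentiable[OF inv(1) that]
    by (intro Deriv.has_derivative_inverse) blast+
  show ?case
  proof (intro conjI ballI)
    fix b :: 'a assume b: "b \<in> Basis"
    have "smooth_alg D (\<lambda>x. (- 1) * (inverse (f x) * partial_deriv b f x * inverse (f x)))"
      using inv b assms(1) smooth_on_const
      by (intro smooth_alg.mult smooth_alg.inv) (auto intro!: smooth_alg.base smooth_on_partial_deriv)
    moreover have "partial_deriv b (\<lambda>x. inverse (f x)) x = (- 1) * (inverse (f x) * partial_deriv b f x * inverse (f x))"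
      if "x \<in> D" for x
      using partial_deriv_eqI[OF d[OF that], of b] by (simp add: partial_deriv_def)
    ultimately show "\<exists>k. smooth_alg D k \<and> (\<forall>x\<in>D. partial_deriv b (\<lambda>x. inverse (f x)) x = k x)" by blast
  qed (rule differentiableI[OF d])
qed

lemma smooth_alg_smooth: "open D \<Longrightarrow> smooth_alg D f \<Longrightarrow> smooth_on D f"
  by (rule smooth_on_coinduct[where P="smooth_alg D"]) (auto dest: smooth_alg_step)

lemma smooth_on_add: "open D \<Longrightarrow> smooth_on D f \<Longrightarrow> smooth_on D g \<Longrightarrow> smooth_on D (\<lambda>x. f x + g x)"
  by (simp add: smooth_alg.add smooth_alg.base smooth_alg_smooth)

lemma smooth_on_mult: "open D \<Longrightarrow> smooth_on D f \<Longrightarrow> smooth_on D g \<Longrightarrow> smooth_on D (\<lambda>x. f x * g x)"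
  by (simp add: smooth_alg.mult smooth_alg.base smooth_alg_smooth)

lemma smooth_on_comp:
  "open D \<Longrightarrow> smooth_on UNIV F \<Longrightarrow> smooth_on D q \<Longrightarrow> smooth_on D (\<lambda>x. F (q x :: real))"
  by (simp add: smooth_alg.comp smooth_alg_smooth)

lemma smooth_on_inverse:
  "open D \<Longrightarrow> smooth_on D f \<Longrightarrow> (\<And>x. x \<in> D \<Longrightarrow> f x \<noteq> 0) \<Longrightarrow> smooth_on D (\<lambda>x. inverse (f x))"
  by (simp add: smooth_alg.inv smooth_alg_smooth)

lemma smooth_on_sum:
  assumes "open D" "\<And>i. i \<in> I \<Longrightarrow> smooth_on D (f i)"
  shows "smooth_on D (\<lambda>x. \<Sum>i\<in>I. f i x)"
  using assms(2)
proof (induction I rule: infinite_finite_induct)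
  case (insert i I)
  then show ?case using smooth_on_add[OF assms(1), of "f i" "\<lambda>x. \<Sum>i\<in>I. f i x"] by simp
qed (simp_all add: smooth_on_const[OF assms(1)])

lemma smooth_on_prod:
  assumes "open D" "\<And>i. i \<in> I \<Longrightarrow> smooth_on D (f i)"
  shows "smooth_on D (\<lambda>x. \<Prod>i\<in>I. f i x)"
  using assms(2)
proof (induction I rule: infinite_finite_induct)
  case (insert i I)
  then show ?case using smooth_on_mult[OF assms(1), of "f i" "\<lambda>x. \<Prod>i\<in>I. f i x"] by simp
qed (simp_all add: smooth_on_const[OF assms(1)])

lemma smooth_on_inner:
  assumes "open D"
  shows "smooth_on D (\<lambda>x. x \<bullet> c)"
proof -
  have d: "((\<lambda>x. x \<bullet> c) has_derivative (\<lambda>v. v \<bullet> c)) (at x)" for x :: 'a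
    by (auto intro!: derivative_eq_intros)
  have p: "partial_deriv b (\<lambda>x. x \<bullet> c) x = b \<bullet> c" for b x :: 'a
    by (rule partial_deriv_eqI[OF d])
  show ?thesis
  proof (rule smooth_on_coinduct[where P="\<lambda>f. f = (\<lambda>x. x \<bullet> c) \<or> smooth_on D f"])
    fix f :: "'a \<Rightarrow> real" assume "f = (\<lambda>x. x \<bullet> c) \<or> smooth_on D f"
    then show "(\<forall>x\<in>D. f differentiable at x) \<and>
      (\<forall>b\<in>Basis. \<exists>g. (g = (\<lambda>x. x \<bullet> c) \<or> smooth_on D g) \<and> (\<forall>x\<in>D. partial_deriv b f x = g x))"
    proof
      assume f: "f = (\<lambda>x. x \<bullet> c)"
      show ?thesis unfolding f p
      proof (intro conjI ballI)
        fix b :: 'a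
        show "\<exists>g. (g = (\<lambda>x. x \<bullet> c) \<or> smooth_on D g) \<and> (\<forall>x\<in>D. b \<bullet> c = g x)"
          using smooth_on_const[OF assms, of "b \<bullet> c"] by (intro exI[of _ "\<lambda>_. b \<bullet> c"]) simp
      qed (rule differentiableI[OF d])
    next
      assume f: "smooth_on D f"
      show ?thesis using smooth_on_differentiable[OF f] smooth_on_partial_deriv[OF f] by blast
    qed
  qed (use assms in auto)
qed

lemma smooth_on_affine_comp:
  fixes \<phi> :: "'a::euclidean_space \<Rightarrow> real"
  assumes "smooth_on UNIV \<phi>"
  shows "smooth_on UNIV (\<lambda>x. \<phi> (c *\<^sub>R x + a))"
\<comment> \<open>The scalar \<open>k\<close> makes the class closed: each derivative brings out
  another factor \<open>c\<close>.\<close>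
proof (rule smooth_on_coinduct[where P="\<lambda>f. \<exists>k \<phi>. smooth_on UNIV \<phi> \<and> f = (\<lambda>x. k * \<phi> (c *\<^sub>R x + a))"])
  show "\<exists>k \<phi>'. smooth_on UNIV \<phi>' \<and> (\<lambda>x. \<phi> (c *\<^sub>R x + a)) = (\<lambda>x. k * \<phi>' (c *\<^sub>R x + a))"
    using assms by (intro exI[of _ 1]) auto
next
  fix f assume "\<exists>k \<phi>. smooth_on UNIV \<phi> \<and> f = (\<lambda>x. k * \<phi> (c *\<^sub>R x + a))"
  then obtain k \<phi> where s: "smooth_on UNIV \<phi>" and f: "f = (\<lambda>x. k * \<phi> (c *\<^sub>R x + a))" by blast
  have d: "(f has_derivative (\<lambda>v. k * (c * frechet_derivative \<phi> (at (c *\<^sub>R x + a)) v))) (at x)" for x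
  proof -
    have 1: "(\<phi> has_derivative frechet_derivative \<phi> (at (c *\<^sub>R x + a))) (at (c *\<^sub>R x + a))"
      using s smooth_on_differentiable frechet_derivative_works by blast
    have 2: "((\<lambda>x. c *\<^sub>R x + a) has_derivative (\<lambda>v. c *\<^sub>R v)) (at x)"
      by (auto intro!: derivative_eq_intros)
    from has_derivative_linear[OF 1] have "linear (frechet_derivative \<phi> (at (c *\<^sub>R x + a)))" .
    then show ?thesis
      using has_derivative_mult_right[OF has_derivative_compose[OF 2 1], of k] unfolding f
      by (simp add: linear_scale)
  qed
  show "(\<forall>x\<in>UNIV. f differentiable at x) \<and>
        (\<forall>b\<in>Basis. \<exists>g. (\<exists>k \<phi>. smooth_on UNIV \<phi> \<and> g = (\<lambda>x. k * \<phi> (c *\<^sub>R x + a))) \<and> (\<forall>x\<in>UNIV. partial_deriv b f x = g x))"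
  proof (intro conjI ballI)
    fix b :: 'a assume "b \<in> Basis"
    then have "smooth_on UNIV (partial_deriv b \<phi>)" using s smooth_on_partial_deriv by blast
    moreover have "partial_deriv b f x = (k * c) * partial_deriv b \<phi> (c *\<^sub>R x + a)" for x
      using partial_deriv_eqI[OF d, of b] by (simp add: partial_deriv_def)
    ultimately show "\<exists>g. (\<exists>k \<phi>. smooth_on UNIV \<phi> \<and> g = (\<lambda>x. k * \<phi> (c *\<^sub>R x + a))) \<and> (\<forall>x\<in>UNIV. partial_deriv b f x = g x)"
      by blast
  qed (rule differentiableI[OF d])
qed auto

lemma smooth_on_continuous_on: "smooth_on D f \<Longrightarrow> continuous_on D f"
  by (intro continuous_at_imp_continuous_on ballI differentiable_imp_continuous_within)
     (rule smooth_on_differentiable)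

lemma smooth_borel_measurable: "smooth_on UNIV f \<Longrightarrow> f \<in> borel_measurable borel"
  by (rule borel_measurable_continuous_onI) (rule smooth_on_continuous_on)


section \<open>Test functions\<close>

lemma test_functions_smooth: "\<phi> \<in> test_functions D \<Longrightarrow> smooth_on UNIV \<phi>"
  and test_functions_compact: "\<phi> \<in> test_functions D \<Longrightarrow> compact (supp \<phi>)"
  and test_functions_supp: "\<phi> \<in> test_functions D \<Longrightarrow> supp \<phi> \<subseteq> D"
  by (auto simp: test_functions_def)

lemma not_in_supp: "x \<notin> supp \<phi> \<Longrightarrow> \<phi> x = 0"
  unfolding supp_def by (metis (mono_tags, lifting) closure_subset mem_Collect_eq subsetD)

lemma test_functions_mono: "D \<subseteq> E \<Longrightarrow> test_functions D \<subseteq> test_functions E"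
  by (auto simp: test_functions_def)

text \<open>The open sets \<open>D\<close> and \<open>- K\<close> cover the space; the extension is
  \<open>f\<close> on the first and 0 on the second.\<close>

lemma smooth_on_zero_ext:
  assumes "open D" "closed K" "K \<subseteq> D" "smooth_on D f" "\<And>x. x \<in> D - K \<Longrightarrow> f x = 0"
  shows "smooth_on UNIV (\<lambda>x. if x \<in> D then f x else 0)" (is "smooth_on UNIV ?g")
proof -
  have "smooth_on D ?g" using smooth_on_transform[OF assms(1,4)] by simp
  moreover have "smooth_on (- K) ?g"
  proof (rule smooth_on_transform[where f="\<lambda>_. 0"])
    show "open (- K)" using assms by auto
    then show "smooth_on (- K) (\<lambda>_. 0)" by (rule smooth_on_const)
  qed (use assms in auto)
  moreover have "UNIV = D \<union> - K" using assms by auto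
  ultimately show ?thesis using smooth_on_Un[of D ?g "-K"] by simp
qed

lemma test_functionsI:
  assumes "open D" "compact K" "K \<subseteq> D" "smooth_on D f" "\<And>x. x \<in> D - K \<Longrightarrow> f x = 0"
  shows "(\<lambda>x. if x \<in> D then f x else 0) \<in> test_functions D" (is "?g \<in> _")
proof -
  have "{x. ?g x \<noteq> 0} \<subseteq> K" using assms by auto
  then have s: "supp ?g \<subseteq> K"
    unfolding supp_def using assms(2) closure_minimal compact_imp_closed by blast
  have "compact (supp ?g)"
    using s assms(2) unfolding supp_def by (meson bounded_subset compact_closure closed_closure compact_eq_bounded_closed compact_imp_bounded)
  then show ?thesis
    using s assms smooth_on_zero_ext[OF assms(1) compact_imp_closed[OF assms(2)] assms(3-5)]
    unfolding test_functions_def by auto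
qed

lemma test_functions_mult:
  assumes "open D" "\<phi> \<in> test_functions D" "smooth_on D f"
  shows "(\<lambda>x. if x \<in> D then f x * \<phi> x else 0) \<in> test_functions D"
proof (rule test_functionsI[where K="supp \<phi>"])
  show "smooth_on D (\<lambda>x. f x * \<phi> x)"
    using assms test_functions_smooth smooth_on_subset by (intro smooth_on_mult) blast+
  show "supp \<phi> \<subseteq> D" "compact (supp \<phi>)"
    using assms test_functions_supp test_functions_compact by blast+
qed (use assms not_in_supp in auto)

lemma iter_partial_zero: "iter_partial bs (\<lambda>_. 0) = (\<lambda>_. 0)"
proof (induction bs)
  case (Cons b bs)
  have "iter_partial (b # bs) (\<lambda>_. 0) = partial_deriv b (\<lambda>_. 0)" by (simp add: Cons.IH)
  then show ?case by (simp add: fun_eq_iff partial_deriv_eqI[OF has_derivative_const])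
qed auto

lemma iter_partial_not_in_supp:
  assumes "x \<notin> supp \<phi>"
  shows "iter_partial bs \<phi> x = 0"
proof -
  have "iter_partial bs \<phi> x = iter_partial bs (\<lambda>_. 0) x"
    by (rule iter_partial_transform_open[of "- supp \<phi>"])
       (use assms not_in_supp in \<open>auto simp: supp_def open_Compl\<close>)
  then show ?thesis by (simp add: iter_partial_zero)
qed

lemma test_functions_bounded:
  assumes "\<phi> \<in> test_functions D" "bs \<in> lists Basis"
  shows "bounded (range (iter_partial bs \<phi>))"
proof -
  have "continuous_on (supp \<phi>) (iter_partial bs \<phi>)"
    using smooth_on_iter_partial[OF test_functions_smooth[OF assms(1)] assms(2)]
      smooth_on_continuous_on continuous_on_subset by blast
  then have "bounded (iter_partial bs \<phi> ` supp \<phi>)"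
    using test_functions_compact[OF assms(1)] compact_continuous_image compact_imp_bounded by blast
  then have "bounded (insert 0 (iter_partial bs \<phi> ` supp \<phi>))" by simp
  then show ?thesis by (rule bounded_subset) (use iter_partial_not_in_supp in auto)
qed

lemma test_functions_partial_deriv:
  assumes "\<phi> \<in> test_functions D" "b \<in> Basis"
  shows "partial_deriv b \<phi> \<in> test_functions D"
proof -
  have "partial_deriv b \<phi> x = 0" if "x \<notin> supp \<phi>" for x
    using iter_partial_not_in_supp[OF that, of "[b]"] by simp
  then have "supp (partial_deriv b \<phi>) \<subseteq> supp \<phi>"
    unfolding supp_def[of "partial_deriv b \<phi>"] by (intro closure_minimal) (auto simp: supp_def)
  moreover have "compact (supp (partial_deriv b \<phi>))"
    using calculation test_functions_compact[OF assms(1)]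
    by (metis closed_closure closed_subset compact_Int_closed inf.absorb_iff2 supp_def)
  ultimately show ?thesis
    using assms smooth_on_partial_deriv unfolding test_functions_def by blast
qed

lemma test_functions_integrable:
  assumes "\<phi> \<in> test_functions D"
  shows "integrable lborel \<phi>"
proof -
  have "integrable lborel (\<lambda>x. indicator (supp \<phi>) x *\<^sub>R \<phi> x)"
    using smooth_on_continuous_on[OF test_functions_smooth[OF assms]] continuous_on_subset
    by (intro borel_integrable_compact test_functions_compact[OF assms]) blast
  moreover have "(\<lambda>x. indicator (supp \<phi>) x *\<^sub>R \<phi> x) = \<phi>"
    using not_in_supp by (auto simp: indicator_def fun_eq_iff)
  ultimately show ?thesis by simp
qed


section \<open>The fundamental lemma of the calculus of variations\<close>

lemma test_functions_supp_real:
  assumes "\<zeta> \<in> test_functions {0<..}"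
  obtains a b :: real where "0 < a" "a < b" "\<forall>t. t \<notin> {a..b} \<longrightarrow> \<zeta> t = 0"
proof (cases "supp \<zeta> = {}")
  case True
  then have "\<zeta> t = 0" for t using not_in_supp[of t \<zeta>] by simp
  then show ?thesis using that[of 1 2] by simp
next
  case False
  have c: "compact (supp \<zeta>)" and s: "supp \<zeta> \<subseteq> {0<..}"
    using assms by (auto simp: test_functions_def)
  obtain a where a: "a \<in> supp \<zeta>" "\<forall>t\<in>supp \<zeta>. a \<le> t"
    using compact_attains_inf[OF c False] by blast
  obtain b where b: "b \<in> supp \<zeta>" "\<forall>t\<in>supp \<zeta>. t \<le> b"
    using compact_attains_sup[OF c False] by blast
  show ?thesis
  proof (rule that[of a "b + 1"])
    show "\<forall>t. t \<notin> {a..b + 1} \<longrightarrow> \<zeta> t = 0"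
    proof (intro allI impI)
      fix t assume "t \<notin> {a..b + 1}"
      then show "\<zeta> t = 0" using a b by (intro not_in_supp) force
    qed
  qed (use a b s in force)+
qed

lemma partition_profile_pos:
  assumes "partition_profile \<zeta>"
  obtains t where "\<zeta> t > 0"
proof -
  obtain c where c: "c > 0" "\<And>t. (\<Sum>\<^sub>\<infinity>n::int. \<zeta> (exp (of_int n + t))) > c"
    and nn: "\<And>t. \<zeta> t \<ge> 0"
    using assms by (auto simp: partition_profile_def)
  show ?thesis
  proof (rule ccontr)
    assume "\<not> thesis"
    then have "\<zeta> t = 0" for t using nn[of t] that[of t] by force
    then show False using c(1) c(2)[of 0] by simp
  qed
qed

text \<open>No bump function has to be built from exponentials: the profile is itself smooth,
  nonnegative, compactly supported and somewhere positive, so its primitive divided by the total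
  mass is a smooth step.\<close>

lemma exists_smooth_step:
  assumes "partition_profile \<zeta>"
  obtains S :: "real \<Rightarrow> real" and R :: real
  where "smooth_on UNIV S" "\<forall>t. 0 \<le> S t" "\<forall>t. S t \<le> 1" "\<forall>t\<le>0. S t = 0" "\<forall>t\<ge>R. S t = 1"
proof -
  have \<zeta>: "\<zeta> \<in> test_functions {0<..}" and nn: "\<And>t. \<zeta> t \<ge> 0"
    using assms by (auto simp: partition_profile_def)
  have sm: "smooth_on UNIV \<zeta>" using \<zeta> test_functions_smooth by blast
  then have cont: "continuous_on A \<zeta>" for A
    using smooth_on_continuous_on continuous_on_subset by blast
  obtain a R where ab: "0 < a" "a < R" "\<And>t. t \<notin> {a..R} \<Longrightarrow> \<zeta> t = 0"
    using test_functions_supp_real[OF \<zeta>] by metis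
  \<comment> \<open>The base point -1 lies to the left of the support in \<open>{a..R}\<close>. So
    \<open>J\<close> vanishes on all of \<open>{..<a}\<close>; below -1 the interval of integration
    is empty.\<close>
  define J where "J t = integral {-1..t} \<zeta>" for t
  have J0: "J t = 0" if "t < a" for t
  proof -
    have "J t = integral {-1..t} (\<lambda>_. 0 :: real)"
      unfolding J_def using that ab by (intro integral_cong) auto
    then show ?thesis by simp
  qed
  have DJ: "(J has_real_derivative \<zeta> t) (at t)" for t
  proof (cases "t < a")
    case True
    have "(J has_real_derivative 0) (at t)"
      by (rule has_field_derivative_transform_within_open[of "\<lambda>_. 0" 0 t "{..<a}"]) (use True J0 in auto)
    moreover have "\<zeta> t = 0" using True ab by auto
    ultimately show ?thesis by simp
  next
    case False
    then have t: "-1 < t" using ab by simp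
    have "((\<lambda>x. integral {-1..x} \<zeta>) has_real_derivative \<zeta> t) (at t within {-1..t+1})"
      by (rule integral_has_real_derivative) (use t cont in auto)
    moreover have "at t within {-1..t+1} = at t"
      using t by (intro at_within_interior) auto
    ultimately show ?thesis unfolding J_def by simp
  qed
  have mono: "J s \<le> J t" if "s \<le> t" for s t
    by (rule DERIV_nonneg_imp_nondecreasing[OF that]) (use DJ nn in blast)
  have JR: "J t = J R" if "R \<le> t" for t
  proof (rule antisym)
    have "continuous_on {R..t} J" using DJ DERIV_continuous_on has_field_derivative_at_within by blast
    moreover have "\<exists>y. (J has_real_derivative y) (at x) \<and> y \<le> 0" if "R < x" for x
      using DJ[of x] ab(3)[of x] that by (intro exI[of _ "\<zeta> x"]) auto
    ultimately show "J t \<le> J R"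
      by (intro DERIV_nonpos_imp_decreasing_open[OF that]) auto
  qed (rule mono[OF that])
  obtain t0 where t0: "\<zeta> t0 > 0" by (rule partition_profile_pos[OF assms])
  obtain h where "0 < h" "J t0 < J (t0 + h)"
    using DERIV_pos_inc_right[OF DJ t0] by (meson dense)
  moreover have "J (t0 + h) \<le> J (max R (t0 + h))" by (rule mono) simp
  moreover have "J (max R (t0 + h)) = J R" by (rule JR) simp
  moreover have "0 \<le> J t0"
    using mono[of "min 0 t0" t0] J0[of "min 0 t0"] ab(1) by simp
  ultimately have JR0: "J R > 0" by linarith
  define S where "S t = J t / J R" for t
  have DS: "(S has_real_derivative \<zeta> t / J R) (at t)" for t
    unfolding S_def using DJ by (rule DERIV_cdivide)
  have sS: "smooth_on UNIV S"
  proof (rule smooth_on_coinduct[where P="\<lambda>f. f = S \<or> smooth_on UNIV f"])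
    fix f assume "f = S \<or> smooth_on UNIV f"
    then show "(\<forall>x\<in>UNIV. f differentiable at x) \<and>
      (\<forall>b\<in>Basis. \<exists>g. (g = S \<or> smooth_on UNIV g) \<and> (\<forall>x\<in>UNIV. partial_deriv b f x = g x))"
    proof
      assume f: "f = S"
      have "smooth_on UNIV (\<lambda>t. \<zeta> t / J R)"
        using smooth_on_mult[OF open_UNIV sm smooth_on_const[OF open_UNIV, of "1 / J R"]] by simp
      moreover have "partial_deriv 1 S t = \<zeta> t / J R" for t
        using partial_deriv_eqI[OF DS[unfolded has_field_derivative_def]] by simp
      moreover have "S differentiable at t" for t
        using DS real_differentiable_def by blast
      ultimately show ?thesis unfolding f by auto
    next
      assume f: "smooth_on UNIV f"
      show ?thesis using smooth_on_differentiable[OF f] smooth_on_partial_deriv[OF f] by blast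
    qed
  qed auto
  have J1: "0 \<le> J t" "J t \<le> J R" for t
  proof -
    show "0 \<le> J t" using mono[of "min 0 t" t] J0[of "min 0 t"] ab(1) by simp
    show "J t \<le> J R" using mono[of t "max R t"] JR[of "max R t"] by simp
  qed
  show ?thesis
  proof (rule that[of S R])
    show "\<forall>t. 0 \<le> S t" "\<forall>t. S t \<le> 1" using J1 JR0 by (simp_all add: S_def)
    show "\<forall>t\<le>0. S t = 0" using J0 ab(1) by (simp add: S_def)
    show "\<forall>t\<ge>R. S t = 1"
    proof (intro allI impI)
      fix t assume "R \<le> t"
      from JR[OF this] show "S t = 1" using JR0 by (simp add: S_def)
    qed
  qed (rule sS)
qed

text \<open>Sets over which \<open>f\<close> integrates to 0 form a Dynkin system, and boxes are an
  intersection-stable generator of the Borel sets. Closure under complements needs the integral over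
  the whole space, which vanishes because growing boxes exhaust the space.\<close>

lemma AE_zero_if_box_integrals_zero:
  fixes f :: "'a::euclidean_space \<Rightarrow> real"
  assumes f: "integrable lborel f" and box: "\<And>a b. (LINT x:box a b|lborel. f x) = 0"
  shows "AE x in lborel. f x = 0"
proof -
  let ?E = "range (\<lambda>(a, b). box a b::'a set)"
  let ?A = "\<lambda>n::nat. box (- (real n *\<^sub>R One)) (real n *\<^sub>R One) :: 'a set"
  have UA: "(\<Union>i. ?A i) = UNIV" unfolding UN_box_eq_UNIV by auto
  have "(\<lambda>n. LINT x:?A n|lborel. f x) \<longlonglongrightarrow> (LINT x:(\<Union>i. ?A i)|lborel. f x)"
  proof (rule set_integral_cont_up)
    show "incseq ?A"
    proof (rule incseq_SucI)
      fix n show "?A n \<subseteq> ?A (Suc n)" by (rule subset_box_imp) (auto simp: algebra_simps)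
    qed
    show "set_integrable lborel (\<Union>i. ?A i) f" using f unfolding UA by (simp add: set_integrable_def)
  qed auto
  then have tot: "integral\<^sup>L lborel f = 0"
    unfolding UA box using LIMSEQ_unique[OF _ tendsto_const] by (auto simp: set_lebesgue_integral_def)
  have si: "set_integrable lborel A f" if "A \<in> sets borel" for A
    unfolding set_integrable_def using f that by (intro integrable_mult_indicator) auto
  have Z: "(LINT x:A|lborel. f x) = 0" if "A \<in> sigma_sets UNIV ?E" for A
  proof (rule sigma_sets_induct_disjoint[OF _ _ that])
    show "Int_stable ?E" by (auto simp: Int_stable_def box_Int_box)
    show "(LINT x:A|lborel. f x) = 0" if "A \<in> ?E" for A using that box by auto
    show "(LINT x:UNIV - A|lborel. f x) = 0"
      if "A \<in> sigma_sets UNIV ?E" "(LINT x:A|lborel. f x) = 0" for A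
    proof -
      have A: "A \<in> sets borel" using that(1) by (simp add: borel_eq_box)
      have "(LINT x:A \<union> (UNIV - A)|lborel. f x) = (LINT x:A|lborel. f x) + (LINT x:UNIV - A|lborel. f x)"
        using A by (intro set_integral_Un si) auto
      then show ?thesis using that(2) tot by (simp add: set_lebesgue_integral_def)
    qed
    show "(LINT x:(\<Union>i::nat. A i)|lborel. f x) = 0"
      if "disjoint_family A" "range A \<subseteq> sigma_sets UNIV ?E" "\<And>i. (LINT x:A i|lborel. f x) = 0" for A
    proof -
      have A: "A i \<in> sets borel" for i using that(2) by (auto simp: borel_eq_box)
      have "(LINT x:(\<Union>i. A i)|lborel. f x) = (\<Sum>i. (LINT x:A i|lborel. f x))"
        using A that(1) by (intro lebesgue_integral_countable_add si) (auto simp: disjoint_family_on_def)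
      then show ?thesis using that(3) by simp
    qed
  qed (auto simp: set_lebesgue_integral_def)
  have "AE x in lborel. f x = (\<lambda>_. 0) x"
  proof (rule density_unique_real[OF f])
    fix A :: "'a set" assume "A \<in> sets lborel"
    then have "A \<in> sigma_sets UNIV ?E" by (simp add: borel_eq_box)
    then show "(LINT x:A|lborel. f x) = (LINT x:A|lborel. 0)" using Z by simp
  qed simp
  then show ?thesis by simp
qed

text \<open>The indicator of an open box is the pointwise limit of the test functions
  \<open>\<eta> j\<close>, products over the coordinates of smooth steps that become steeper with
  \<open>j\<close>. They lie between 0 and 1 and vanish off the box, so dominated convergence
  applies.\<close>

lemma box_integral_zero:
  fixes f :: "'a::euclidean_space \<Rightarrow> real"
  assumes prof: "partition_profile \<zeta>"
    and int: "set_integrable lborel (cbox a b) f" and D: "cbox a b \<subseteq> D" "D \<in> sets borel"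
    and zero: "\<And>\<eta>. \<eta> \<in> test_functions D \<Longrightarrow> (LINT x:D|lborel. f x * \<eta> x) = 0"
  shows "(LINT x:box a b|lborel. f x) = 0"
proof -
  obtain S :: "real \<Rightarrow> real" and R :: real where S: "smooth_on UNIV S" "\<And>t. 0 \<le> S t" "\<And>t. S t \<le> 1"
    "\<And>t. t \<le> 0 \<Longrightarrow> S t = 0" "\<And>t. R \<le> t \<Longrightarrow> S t = 1"
    using exists_smooth_step[OF prof] by metis
  define \<eta> where "\<eta> j x = (\<Prod>i\<in>Basis. S (real j * (x \<bullet> i - a \<bullet> i)) * S (real j * (b \<bullet> i - x \<bullet> i)))" for j :: nat and x :: 'a
  have \<eta>0: "\<eta> j x = 0" if "x \<notin> box a b" for j x
  proof -
    obtain i where i: "i \<in> Basis" "x \<bullet> i - a \<bullet> i \<le> 0 \<or> b \<bullet> i - x \<bullet> i \<le> 0"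
      using \<open>x \<notin> box a b\<close> by (auto simp: box_def not_less)
    then have "real j * (x \<bullet> i - a \<bullet> i) \<le> 0 \<or> real j * (b \<bullet> i - x \<bullet> i) \<le> 0"
      by (meson mult_nonneg_nonpos of_nat_0_le_iff)
    then show ?thesis unfolding \<eta>_def using i(1) S(4) by (intro prod_zero) (auto intro!: bexI[of _ i])
  qed
  have \<eta>01: "0 \<le> \<eta> j x" "\<eta> j x \<le> 1" for j x
    unfolding \<eta>_def using S by (auto intro!: prod_nonneg prod_le_1 mult_le_one)
  have \<eta>s: "smooth_on UNIV (\<eta> j)" for j
  proof -
    have lin: "smooth_on UNIV (\<lambda>x::'a. S (k * (x \<bullet> i) + c))" for i c k
      by (intro smooth_on_comp[OF open_UNIV S(1)] smooth_on_add smooth_on_mult smooth_on_const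
          smooth_on_inner open_UNIV)
    have "\<eta> j = (\<lambda>x. \<Prod>i\<in>Basis. S (real j * (x \<bullet> i) + (- real j * (a \<bullet> i))) *
        S (- real j * (x \<bullet> i) + real j * (b \<bullet> i)))"
      unfolding \<eta>_def by (simp add: algebra_simps)
    then show ?thesis
      by (simp only:) (intro smooth_on_prod smooth_on_mult lin open_UNIV)
  qed
  have \<eta>t: "\<eta> j \<in> test_functions D" for j
  proof -
    have s: "supp (\<eta> j) \<subseteq> cbox a b"
      unfolding supp_def using \<eta>0 box_subset_cbox by (intro closure_minimal) (auto, blast)
    moreover have "compact (supp (\<eta> j))"
      using s by (metis closed_closure compact_Int_closed compact_cbox inf.absorb_iff2 supp_def)
    ultimately show ?thesis using \<eta>s D by (auto simp: test_functions_def)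
  qed
  let ?g = "\<lambda>x. indicator (cbox a b) x *\<^sub>R f x"
  have g: "integrable lborel ?g" using int by (simp add: set_integrable_def)
  then have gm[measurable]: "?g \<in> borel_measurable borel" by auto
  have [measurable]: "\<eta> j \<in> borel_measurable borel" for j using \<eta>s by (rule smooth_borel_measurable)
  have lim: "(\<lambda>j. \<eta> j x) \<longlonglongrightarrow> indicator (box a b) x" for x
  proof (cases "x \<in> box a b")
    case False then show ?thesis using \<eta>0 by simp
  next
    case True
    have "\<forall>\<^sub>F j in sequentially. \<eta> j x = 1"
    proof -
      have "\<forall>\<^sub>F j in sequentially. \<forall>i\<in>Basis. R \<le> real j * (x \<bullet> i - a \<bullet> i) \<and> R \<le> real j * (b \<bullet> i - x \<bullet> i)"
      proof (intro eventually_ball_finite ballI eventually_conj)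
        fix i :: 'a assume "i \<in> Basis"
        then have "0 < x \<bullet> i - a \<bullet> i" "0 < b \<bullet> i - x \<bullet> i" using True by (auto simp: box_def)
        moreover have "\<forall>\<^sub>F j in sequentially. R \<le> real j * e" if "0 < e" for e
        proof -
          have "filterlim (\<lambda>j. real j * e) at_top sequentially"
            using that by (intro filterlim_at_top_mult_tendsto_pos[OF tendsto_const] filterlim_real_sequentially) 
          then show ?thesis by (simp add: filterlim_at_top)
        qed
        ultimately show "\<forall>\<^sub>F j in sequentially. R \<le> real j * (x \<bullet> i - a \<bullet> i)"
            "\<forall>\<^sub>F j in sequentially. R \<le> real j * (b \<bullet> i - x \<bullet> i)" by auto
      qed simp
      then show ?thesis by (rule eventually_mono) (auto simp: \<eta>_def S(5))
    qed
    then show ?thesis using True by (simp add: tendsto_eventually)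
  qed
  have eq: "indicator D x * (f x * \<eta> j x) = ?g x * \<eta> j x" for x j
    using \<eta>0[of x j] D(1) box_subset_cbox[of a b] by (auto simp: indicator_def)
  have "(\<lambda>j. \<integral>x. ?g x * \<eta> j x \<partial>lborel) \<longlonglongrightarrow> (\<integral>x. ?g x * indicator (box a b) x \<partial>lborel)"
  proof (rule integral_dominated_convergence[where w="\<lambda>x. norm (?g x)"])
    show "AE x in lborel. (\<lambda>j. ?g x * \<eta> j x) \<longlonglongrightarrow> ?g x * indicator (box a b) x"
      using lim by (intro AE_I2 tendsto_mult tendsto_const)
    show "AE x in lborel. norm (?g x * \<eta> j x) \<le> norm (?g x)" for j
      using \<eta>01 by (auto simp: abs_mult intro!: mult_left_le)
  qed (use g in auto)
  moreover have "(\<integral>x. ?g x * \<eta> j x \<partial>lborel) = 0" for j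
    using zero[OF \<eta>t[of j]] unfolding set_lebesgue_integral_def by (simp add: eq)
  ultimately have "(\<integral>x. ?g x * indicator (box a b) x \<partial>lborel) = 0"
    using LIMSEQ_unique[OF _ tendsto_const] by auto
  moreover have "(\<lambda>x. ?g x * indicator (box a b) x) = (\<lambda>x. indicator (box a b) x *\<^sub>R f x)"
    using box_subset_cbox[of a b] by (auto simp: indicator_def fun_eq_iff)
  ultimately show ?thesis unfolding set_lebesgue_integral_def by metis
qed

text \<open>Local integrability gives an integrable function only after cutting off by a closed box
  inside \<open>D\<close>. The box criterion is applied to each such cutoff, and countably many
  closed boxes make up \<open>D\<close>.\<close>

theorem fundamental_lemma_calculus_of_variations:
  fixes f :: "'a::euclidean_space \<Rightarrow> real"
  assumes prof: "partition_profile \<zeta>" and D: "open D"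
    and f: "locally_integrable D f"
    and zero: "\<And>\<eta>. \<eta> \<in> test_functions D \<Longrightarrow> (LINT x:D|lborel. f x * \<eta> x) = 0"
  shows "AE x in lborel. x \<in> D \<longrightarrow> f x = 0"
proof -
  have cb: "AE x in lborel. x \<in> cbox a b \<longrightarrow> f x = 0" if ab: "cbox a b \<subseteq> D" for a b
  proof -
    let ?g = "\<lambda>x. indicator (cbox a b) x * f x"
    have i: "set_integrable lborel (cbox a b) f" using f ab by (auto simp: locally_integrable_def)
    have "AE x in lborel. ?g x = 0"
    proof (rule AE_zero_if_box_integrals_zero)
      show "integrable lborel ?g" using i by (simp add: set_integrable_def)
      fix c d :: 'a
      obtain u v where uv: "box c d \<inter> box a b = box u v" by (rule that) (rule box_Int_box)
      have bd: "box u v \<subseteq> cbox a b" using uv box_subset_cbox by blast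
      have uvc: "(LINT x:box u v|lborel. f x) = 0"
      proof (cases "box u v = {}")
        case False
        then have "cbox u v = closure (box u v)" by (simp add: closure_box)
        then have c: "cbox u v \<subseteq> cbox a b" using bd closure_minimal[OF bd closed_cbox] by simp
        show ?thesis
        proof (rule box_integral_zero[OF prof _ _ _ zero])
          show "set_integrable lborel (cbox u v) f" by (rule set_integrable_subset[OF i _ c]) simp
        qed (use c ab D in auto)
      qed (simp add: set_lebesgue_integral_def)
      \<comment> \<open>The cutoff uses the closed box, whereas intersections of generators are
        computed with open boxes; the two differ by a null set.\<close>
      have nb: "AE x in lborel. x \<notin> cbox a b - box a b"
      proof (rule AE_not_in)
        have "emeasure lborel (cbox a b - box a b) = emeasure lborel (cbox a b) - emeasure lborel (box a b)"
          using emeasure_lborel_box_finite[of a b] by (intro emeasure_Diff box_subset_cbox) (simp_all add: less_top)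
        also have "\<dots> = 0"
          unfolding emeasure_lborel_cbox_eq emeasure_lborel_box_eq by simp
        finally show "cbox a b - box a b \<in> null_sets lborel" by (simp add: null_sets_def)
      qed
      have "(LINT x:box c d|lborel. ?g x) = (LINT x:box u v|lborel. f x)"
        unfolding set_lebesgue_integral_def
      proof (rule integral_cong_AE)
        have "(\<lambda>x. indicator (cbox a b) x *\<^sub>R f x) \<in> borel_measurable lborel"
          using i by (auto simp: set_integrable_def)
        then have [measurable]: "?g \<in> borel_measurable borel" by simp
        show "(\<lambda>x. indicator (box c d) x *\<^sub>R ?g x) \<in> borel_measurable lborel" by simp
        have "(\<lambda>x. indicator (box u v) x *\<^sub>R f x) = (\<lambda>x. indicator (box u v) x *\<^sub>R ?g x)"
          using bd by (auto simp: indicator_def fun_eq_iff)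
        then show "(\<lambda>x. indicator (box u v) x *\<^sub>R f x) \<in> borel_measurable lborel" by simp
        show "AE x in lborel. indicator (box c d) x *\<^sub>R ?g x = indicator (box u v) x *\<^sub>R f x"
          using nb
        proof eventually_elim
          fix x assume "x \<notin> cbox a b - box a b"
          then have "x \<in> cbox a b \<longleftrightarrow> x \<in> box a b" using box_subset_cbox by blast
          then show "indicator (box c d) x *\<^sub>R ?g x = indicator (box u v) x *\<^sub>R f x"
            unfolding uv[symmetric] by (auto simp: indicator_def)
        qed
      qed
      then show "(LINT x:box c d|lborel. ?g x) = 0" using uvc by simp
    qed
    then show ?thesis by eventually_elim (auto simp: indicator_def)
  qed
  obtain \<D> where \<D>: "countable \<D>" "\<D> \<subseteq> Pow D" "\<And>X. X \<in> \<D> \<Longrightarrow> \<exists>a b. X = cbox a b" "\<Union>\<D> = D"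
    using open_countable_Union_open_cbox[OF D] by blast
  have "AE x in lborel. \<forall>X\<in>\<D>. x \<in> X \<longrightarrow> f x = 0"
    unfolding AE_ball_countable[OF \<D>(1)]
  proof
    fix X assume X: "X \<in> \<D>"
    then obtain a b where ab: "X = cbox a b" using \<D>(3) by blast
    have "X \<subseteq> D" using X \<D>(2) by blast
    then show "AE x in lborel. x \<in> X \<longrightarrow> f x = 0" using cb unfolding ab by simp
  qed
  then show ?thesis
  proof eventually_elim
    fix x assume "\<forall>X\<in>\<D>. x \<in> X \<longrightarrow> f x = 0"
    then show "x \<in> D \<longrightarrow> f x = 0" unfolding \<D>(4)[symmetric] by auto
  qed
qed


section \<open>Finite differences\<close>

text \<open>Differences are taken of sequences, not of functions: along a line only the values at
  \<open>x + i h\<close> enter, and the product rule becomes an identity between two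
  sequences.\<close>

primrec dif :: "nat \<Rightarrow> (nat \<Rightarrow> real) \<Rightarrow> nat \<Rightarrow> real" where
  "dif 0 a i = a i"
| "dif (Suc n) a i = dif n a (Suc i) - dif n a i"

text \<open>Pascal's rule for arbitrary summands. It drives the inductions both for the closed form
  of \<open>dif\<close> and for the product rule.\<close>

lemma sum_binomial_Suc:
  fixes t :: "nat \<Rightarrow> real"
  shows "(\<Sum>j\<le>Suc n. real (Suc n choose j) * t j) = (\<Sum>j\<le>n. real (n choose j) * (t j + t (Suc j)))"
proof -
  have "(\<Sum>j\<le>Suc n. real (Suc n choose j) * t j)
      = t 0 + (\<Sum>j\<le>n. real (n choose j) * t (Suc j) + real (n choose Suc j) * t (Suc j))"
    by (subst sum.atMost_Suc_shift) (simp add: algebra_simps)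
  also have "\<dots> = (\<Sum>j\<le>n. real (n choose j) * t (Suc j)) + (t 0 + (\<Sum>j\<le>n. real (n choose Suc j) * t (Suc j)))"
    by (simp add: sum.distrib)
  also have "t 0 + (\<Sum>j\<le>n. real (n choose Suc j) * t (Suc j)) = (\<Sum>j\<le>Suc n. real (n choose j) * t j)"
    by (subst sum.atMost_Suc_shift) simp
  also have "\<dots> = (\<Sum>j\<le>n. real (n choose j) * t j)" by simp
  finally show ?thesis by (simp add: sum.distrib algebra_simps)
qed

lemma dif_eq_sum: "dif n a i = (\<Sum>j=0..n. real (n choose j) * (-1) ^ (n - j) * a (i + j))"
proof -
  \<comment> \<open>The sign is written with the exponent \<open>n + j\<close>, of the same parity
    as \<open>n - j\<close>, so that no truncated subtraction enters the induction.\<close>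
  have "dif n a i = (\<Sum>j\<le>n. real (n choose j) * ((-1) ^ (n + j) * a (i + j)))"
  proof (induction n arbitrary: i)
    case (Suc n)
    have "dif (Suc n) a i = (\<Sum>j\<le>n. real (n choose j) * ((-1) ^ (Suc n + j) * a (i + j) + (-1) ^ (Suc n + Suc j) * a (i + Suc j)))"
      by (simp add: Suc sum_subtractf[symmetric] algebra_simps)
    then show ?case
      by (subst sum_binomial_Suc) simp
  qed simp
  also have "\<dots> = (\<Sum>j\<le>n. real (n choose j) * (-1) ^ (n - j) * a (i + j))"
  proof (rule sum.cong[OF refl])
    fix j assume "j \<in> {..n}"
    then have "n + j = (n - j) + 2 * j" by simp
    then have "(-1::real) ^ (n + j) = (-1) ^ (n - j)" by (simp only: power_add power_mult) simp
    then show "real (n choose j) * ((-1) ^ (n + j) * a (i + j)) = real (n choose j) * (-1) ^ (n - j) * a (i + j)"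
      by simp
  qed
  finally show ?thesis by (simp add: atMost_atLeast0)
qed

text \<open>Leibniz rule. The first factor sits at the shifted index \<open>i + j\<close> because
  one difference of a product x y is split as (x' - x) y + x' (y' - y), with x' and y' the next
  values.\<close>

lemma dif_mult: "dif n (\<lambda>i. a i * b i) i = (\<Sum>j\<le>n. real (n choose j) * (dif (n - j) a (i + j) * dif j b i))"
proof (induction n arbitrary: i)
  case (Suc n)
  have "dif (Suc n) (\<lambda>i. a i * b i) i =
      (\<Sum>j\<le>n. real (n choose j) * (dif (n - j) a (Suc i + j) * dif j b (Suc i) - dif (n - j) a (i + j) * dif j b i))"
    by (simp add: Suc sum_subtractf[symmetric] algebra_simps)
  also have "\<dots> = (\<Sum>j\<le>n. real (n choose j) * (dif (Suc n - j) a (i + j) * dif j b i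
      + dif (Suc n - Suc j) a (i + Suc j) * dif (Suc j) b i))"
    by (intro sum.cong refl) (auto simp: Suc_diff_le algebra_simps)
  also have "\<dots> = (\<Sum>j\<le>Suc n. real (Suc n choose j) * (dif (Suc n - j) a (i + j) * dif j b i))"
    by (rule sum_binomial_Suc[symmetric])
  finally show ?case .
qed simp

lemma dif_shift: "dif n a (i + k) = dif n (\<lambda>i. a (i + k)) i"
  by (induction n arbitrary: i) (simp_all flip: add_Suc)

lemma dif_cmult: "dif n (\<lambda>i. c * a i) i = c * dif n a i"
  by (induction n arbitrary: i) (simp_all add: algebra_simps)

lemma dif_cong: "(\<And>j. i \<le> j \<Longrightarrow> j \<le> i + n \<Longrightarrow> a j = b j) \<Longrightarrow> dif n a i = dif n b i"
  by (induction n arbitrary: i) simp_all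

lemma dif_bound_sum: "\<bar>dif n a i\<bar> \<le> 2 ^ n * (\<Sum>j\<le>n. \<bar>a (i + j)\<bar>)"
proof -
  have "\<bar>dif n a i\<bar> \<le> (\<Sum>j=0..n. \<bar>real (n choose j) * (-1) ^ (n - j) * a (i + j)\<bar>)"
    unfolding dif_eq_sum by (rule sum_abs)
  also have "\<dots> \<le> (\<Sum>j=0..n. 2 ^ n * \<bar>a (i + j)\<bar>)"
  proof (rule sum_mono)
    fix j assume "j \<in> {0..n}"
    then have "n choose j \<le> 2 ^ n" using choose_row_sum[of n] member_le_sum[of j "{..n}" "\<lambda>j. n choose j"] by simp
    then have "real (n choose j) \<le> 2 ^ n" by (metis of_nat_le_iff of_nat_numeral of_nat_power)
    then show "\<bar>real (n choose j) * (-1) ^ (n - j) * a (i + j)\<bar> \<le> 2 ^ n * \<bar>a (i + j)\<bar>"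
      by (simp add: abs_mult power_abs mult_right_mono)
  qed
  finally show ?thesis by (simp add: sum_distrib_left atMost_atLeast0)
qed

text \<open>Up to order \<open>n\<close> the \<open>j\<close>-th derivative of \<open>f\<close> on \<open>I\<close> is at most \<open>C * e ^ j\<close>.\<close>

primrec bd :: "real \<Rightarrow> real set \<Rightarrow> real \<Rightarrow> nat \<Rightarrow> (real \<Rightarrow> real) \<Rightarrow> bool" where
  "bd e I C 0 f \<longleftrightarrow> (\<forall>t\<in>I. \<bar>f t\<bar> \<le> C)"
| "bd e I C (Suc n) f \<longleftrightarrow> (\<forall>t\<in>I. \<bar>f t\<bar> \<le> C) \<and>
     (\<exists>f'. (\<forall>t\<in>I. (f has_real_derivative e * f' t) (at t within I)) \<and> bd e I C n f')"

section \<open>Calculus of functions with scaled derivative bounds\<close>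

lemma bd_bound: "bd e I C n f \<Longrightarrow> t \<in> I \<Longrightarrow> \<bar>f t\<bar> \<le> C"
  by (cases n) auto

lemma bd_mono: "bd e I C n f \<Longrightarrow> C \<le> C' \<Longrightarrow> bd e I C' n f"
  by (induction n arbitrary: f) (auto intro: order_trans)

lemma bd_SucD: "bd e I C (Suc n) f \<Longrightarrow> bd e I C n f"
proof (induction n arbitrary: f)
  case (Suc n)
  then obtain f' where "\<forall>t\<in>I. (f has_real_derivative e * f' t) (at t within I)" "bd e I C (Suc n) f'"
    by auto
  then show ?case using Suc.IH[of f'] bd_bound[OF Suc.prems] by auto
qed auto

lemma bd_le: "bd e I C n f \<Longrightarrow> m \<le> n \<Longrightarrow> bd e I C m f"
proof (induction n)
  case (Suc n)
  then show ?case using bd_SucD le_Suc_eq by metis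
qed simp

lemma bd_add:
  assumes "bd e I C n f" "bd e I K n g"
  shows "bd e I (C + K) n (\<lambda>t. f t + g t)"
  using assms
proof (induction n arbitrary: f g)
  case 0
  have "\<bar>f t + g t\<bar> \<le> C + K" if "t \<in> I" for t
    using 0 that abs_triangle_ineq[of "f t" "g t"] by fastforce
  then show ?case by simp
next
  case (Suc n)
  obtain f' where f': "\<forall>t\<in>I. (f has_real_derivative e * f' t) (at t within I)" "bd e I C n f'"
    using Suc.prems by auto
  obtain g' where g': "\<forall>t\<in>I. (g has_real_derivative e * g' t) (at t within I)" "bd e I K n g'"
    using Suc.prems by auto
  have "\<bar>f t + g t\<bar> \<le> C + K" if "t \<in> I" for t
    using bd_bound[OF Suc.prems(1) that] bd_bound[OF Suc.prems(2) that] by linarith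
  moreover have "\<forall>t\<in>I. ((\<lambda>t. f t + g t) has_real_derivative e * (f' t + g' t)) (at t within I)"
  proof
    fix t assume "t \<in> I"
    from DERIV_add[OF f'(1)[rule_format, OF this] g'(1)[rule_format, OF this]]
    show "((\<lambda>t. f t + g t) has_real_derivative e * (f' t + g' t)) (at t within I)"
      by (simp add: algebra_simps)
  qed
  ultimately show ?case using Suc.IH[OF f'(2) g'(2)] by auto
qed

text \<open>Each derivative of a product doubles the number of terms, hence the factor
  \<open>2 ^ n\<close>.\<close>

lemma bd_mult:
  assumes "bd e I C n f" "bd e I K n g" "0 \<le> C" "0 \<le> K"
  shows "bd e I (2 ^ n * C * K) n (\<lambda>t. f t * g t)"
  using assms(1,2)
proof (induction n arbitrary: f g)
  case 0
  then show ?case using assms(3,4) by (auto simp: abs_mult intro!: mult_mono)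
next
  case (Suc n)
  obtain f' where f': "\<forall>t\<in>I. (f has_real_derivative e * f' t) (at t within I)" "bd e I C n f'"
    using Suc.prems by auto
  obtain g' where g': "\<forall>t\<in>I. (g has_real_derivative e * g' t) (at t within I)" "bd e I K n g'"
    using Suc.prems by auto
  have "\<bar>f t * g t\<bar> \<le> 2 ^ Suc n * C * K" if "t \<in> I" for t
  proof -
    have "\<bar>f t * g t\<bar> \<le> C * K"
      using bd_bound[OF Suc.prems(1) that] bd_bound[OF Suc.prems(2) that] assms(3,4)
      by (auto simp: abs_mult intro!: mult_mono)
    also have "\<dots> \<le> 2 ^ Suc n * (C * K)"
      using mult_right_mono[of 1 "2 ^ Suc n" "C * K"] assms(3,4) one_le_power[of "2::real" "Suc n"]
        by simp
    finally show ?thesis by (simp add: mult.assoc)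
  qed
  moreover have "\<forall>t\<in>I. ((\<lambda>t. f t * g t) has_real_derivative e * (f' t * g t + f t * g' t)) (at t within I)"
  proof
    fix t assume "t \<in> I"
    from DERIV_mult[OF f'(1)[rule_format, OF this] g'(1)[rule_format, OF this]]
    show "((\<lambda>t. f t * g t) has_real_derivative e * (f' t * g t + f t * g' t)) (at t within I)"
      by (simp add: algebra_simps)
  qed
  moreover have "bd e I (2 ^ Suc n * C * K) n (\<lambda>t. f' t * g t + f t * g' t)"
    using bd_add[OF Suc.IH[OF f'(2) bd_SucD[OF Suc.prems(2)]] Suc.IH[OF bd_SucD[OF Suc.prems(1)] g'(2)]]
    by (simp add: algebra_simps)
  ultimately show ?case by auto
qed

lemma bd_const: "\<bar>c\<bar> \<le> C \<Longrightarrow> 0 \<le> C \<Longrightarrow> bd e I C n (\<lambda>_. c)"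
proof (induction n arbitrary: c)
  case (Suc n)
  have "bd e I C n (\<lambda>_. 0)" by (rule Suc.IH) (use Suc.prems in auto)
  then show ?case using Suc.prems by (auto intro!: exI[of _ "\<lambda>_. 0"])
qed auto

lemma bd_cmult:
  assumes "bd e I C n f"
  shows "bd e I (\<bar>c\<bar> * C) n (\<lambda>t. c * f t)"
  using assms
proof (induction n arbitrary: f)
  case 0
  then show ?case by (auto simp: abs_mult mult_left_mono)
next
  case (Suc n)
  obtain f' where f': "\<forall>t\<in>I. (f has_real_derivative e * f' t) (at t within I)" "bd e I C n f'"
    using Suc.prems by auto
  have "\<forall>t\<in>I. ((\<lambda>t. c * f t) has_real_derivative e * (c * f' t)) (at t within I)"
  proof
    fix t assume "t \<in> I"
    from DERIV_cmult[OF f'(1)[rule_format, OF this], of c]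
    show "((\<lambda>t. c * f t) has_real_derivative e * (c * f' t)) (at t within I)"
      by (simp add: algebra_simps)
  qed
  moreover have "\<forall>t\<in>I. \<bar>c * f t\<bar> \<le> \<bar>c\<bar> * C"
    using bd_bound[OF Suc.prems] by (auto simp: abs_mult mult_left_mono)
  ultimately show ?case using Suc.IH[OF f'(2)] by auto
qed

lemma bd_sum:
  assumes "finite A" "\<And>b. b \<in> A \<Longrightarrow> bd e I C n (f b)" "0 \<le> C"
  shows "bd e I (real (card A) * C) n (\<lambda>t. \<Sum>b\<in>A. f b t)"
  using assms(1,2)
proof (induction A rule: finite_induct)
  case empty
  then show ?case using bd_const[of 0 0] by simp
next
  case (insert b A)
  have "bd e I (C + real (card A) * C) n (\<lambda>t. f b t + (\<Sum>b\<in>A. f b t))"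
    by (rule bd_add) (use insert in auto)
  then show ?case using insert by (simp add: algebra_simps)
qed

text \<open>Induction through (1 / f)' = - f' / f^2. The constant is chosen before \<open>e\<close>,
  \<open>I\<close> and \<open>f\<close>, and this order of quantifiers later makes the bound uniform
  over layers, points and directions.\<close>

lemma bd_inverse:
  assumes "0 < c" "0 \<le> C"
  shows "\<exists>K\<ge>0. \<forall>e I f. bd e I C n f \<longrightarrow> (\<forall>t\<in>I. c \<le> f t) \<longrightarrow> bd e I K n (\<lambda>t. inverse (f t))"
proof (induction n)
  case 0
  show ?case
    using assms by (intro exI[of _ "inverse c"]) (auto intro!: le_imp_inverse_le)
next
  case (Suc n)
  then obtain K where K: "K \<ge> 0" "\<And>e I f. bd e I C n f \<Longrightarrow> \<forall>t\<in>I. c \<le> f t \<Longrightarrow> bd e I K n (\<lambda>t. inverse (f t))"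
    by blast
  let ?L = "2 ^ n * C * (2 ^ n * K * K)"
  let ?M = "max (inverse c) ?L"
  have L: "0 \<le> ?L" using K(1) assms(2) by simp
  have "bd e I ?M (Suc n) (\<lambda>t. inverse (f t))" if f: "bd e I C (Suc n) f" and c: "\<forall>t\<in>I. c \<le> f t" for e I f
  proof -
    obtain f' where f': "\<forall>t\<in>I. (f has_real_derivative e * f' t) (at t within I)" "bd e I C n f'"
      using f by auto
    have i: "bd e I K n (\<lambda>t. inverse (f t))" by (rule K(2)[OF bd_SucD[OF f] c])
    have "bd e I ?L n (\<lambda>t. (- 1 * f' t) * (inverse (f t) * inverse (f t)))"
      by (intro bd_mult i K(1)) (use bd_cmult[OF f'(2), of "-1"] assms(2) K(1) in auto)
    then have b: "bd e I ?M n (\<lambda>t. (- 1 * f' t) * (inverse (f t) * inverse (f t)))"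
      by (rule bd_mono) simp
    have d: "\<forall>t\<in>I. ((\<lambda>t. inverse (f t)) has_real_derivative e * ((- 1 * f' t) * (inverse (f t) * inverse (f t)))) (at t within I)"
    proof
      fix t assume t: "t \<in> I"
      have "f t \<noteq> 0" using c assms(1) t by fastforce
      from DERIV_inverse_fun[OF f'(1)[rule_format, OF t] this]
      show "((\<lambda>t. inverse (f t)) has_real_derivative e * ((- 1 * f' t) * (inverse (f t) * inverse (f t)))) (at t within I)"
        by (simp add: algebra_simps)
    qed
    have "\<bar>inverse (f t)\<bar> \<le> ?M" if "t \<in> I" for t
    proof -
      have "c \<le> f t" using c that by blast
      then have "inverse (f t) \<le> inverse c" "0 < f t" using assms(1) by (auto intro!: le_imp_inverse_le)
      then show ?thesis by simp
    qed
    then show ?thesis unfolding bd.simps using d[rule_format] b by (intro conjI ballI exI)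
  qed
  moreover have "0 \<le> ?M" using L by simp
  ultimately show ?case by blast
qed

text \<open>\<open>F\<close> lists a function together with all its derivatives. The chain rule
  replaces \<open>F j\<close> by \<open>F (Suc j)\<close>, so the induction on \<open>n\<close> runs
  for all \<open>j\<close> at once; again the constant precedes \<open>e\<close>, \<open>I\<close>
  and \<open>q\<close>.\<close>

lemma bd_compose:
  fixes F :: "nat \<Rightarrow> real \<Rightarrow> real"
  assumes F: "\<And>j x. (F j has_real_derivative F (Suc j) x) (at x)" "\<And>j x. \<bar>F j x\<bar> \<le> M j" and C: "0 \<le> C"
  shows "\<exists>K\<ge>0. \<forall>e I q. bd e I C n q \<longrightarrow> bd e I K n (\<lambda>t. F j (q t))"
proof (induction n arbitrary: j)
  case 0
  have "0 \<le> M j" using F(2)[of j 0] by linarith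
  then show ?case using F(2)[of j] by (intro exI[of _ "M j"]) auto
next
  case (Suc n)
  obtain K where K: "K \<ge> 0" "\<And>e I q. bd e I C n q \<Longrightarrow> bd e I K n (\<lambda>t. F (Suc j) (q t))"
    using Suc[of "Suc j"] by blast
  let ?L = "max (M j) (2 ^ n * K * C)"
  have "bd e I ?L (Suc n) (\<lambda>t. F j (q t))" if q: "bd e I C (Suc n) q" for e I q
  proof -
    obtain q' where q': "\<forall>t\<in>I. (q has_real_derivative e * q' t) (at t within I)" "bd e I C n q'"
      using q by auto
    have "bd e I (2 ^ n * K * C) n (\<lambda>t. F (Suc j) (q t) * q' t)"
      by (rule bd_mult[OF K(2)[OF bd_SucD[OF q]] q'(2) K(1) C])
    then have b: "bd e I ?L n (\<lambda>t. F (Suc j) (q t) * q' t)" by (rule bd_mono) simp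
    have "\<forall>t\<in>I. ((\<lambda>t. F j (q t)) has_real_derivative e * (F (Suc j) (q t) * q' t)) (at t within I)"
    proof
      fix t assume t: "t \<in> I"
      from DERIV_chain2[OF F(1) q'(1)[rule_format, OF t]]
      show "((\<lambda>t. F j (q t)) has_real_derivative e * (F (Suc j) (q t) * q' t)) (at t within I)"
        by (simp add: algebra_simps)
    qed
    moreover have "\<forall>t\<in>I. \<bar>F j (q t)\<bar> \<le> ?L" using F(2) by (simp add: le_max_iff_disj)
    ultimately show ?thesis using b by auto
  qed
  moreover have "0 \<le> ?L" using K(1) C by (simp add: le_max_iff_disj)
  ultimately show ?case by blast
qed

section \<open>From derivatives along a segment to finite differences\<close>

lemma DERIV_dif:
  assumes "\<And>i. i \<le> n + k \<Longrightarrow> ((\<lambda>t. f i t) has_real_derivative f' i) (at t within J)"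
  shows "((\<lambda>t. dif n (\<lambda>i. f i t) k) has_real_derivative dif n f' k) (at t within J)"
  using assms
proof (induction n arbitrary: k)
  case (Suc n)
  have "((\<lambda>t. dif n (\<lambda>i. f i t) (Suc k)) has_real_derivative dif n f' (Suc k)) (at t within J)"
       "((\<lambda>t. dif n (\<lambda>i. f i t) k) has_real_derivative dif n f' k) (at t within J)"
    using Suc.prems by (auto intro!: Suc.IH)
  from DERIV_diff[OF this] show ?case by simp
qed simp

text \<open>By the mean value theorem a difference of order n + 1 at \<open>t\<close> is the n-th
  difference of the derivative at some point of \<open>{t..t + 1}\<close>. That point is not an
  integer in general, which is why the base point \<open>t\<close> is a real number.\<close>

lemma dif_bd:
  assumes "bd e {0..real N} C n f" "0 \<le> e" "0 \<le> t" "t + real n \<le> real N" "0 \<le> C"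
  shows "\<bar>dif n (\<lambda>i. f (t + real i)) 0\<bar> \<le> C * e ^ n"
  using assms(1,3,4)
proof (induction n arbitrary: f t)
  case 0
  then show ?case using bd_bound[of e "{0..real N}" C 0 f t] by simp
next
  case (Suc n)
  let ?I = "{0..real N}" and ?J = "{t..t + 1}"
  obtain f' where f': "\<forall>t\<in>?I. (f has_real_derivative e * f' t) (at t within ?I)" "bd e ?I C n f'"
    using Suc.prems by auto
  let ?\<phi> = "\<lambda>s. dif n (\<lambda>i. f (s + real i)) 0"
  let ?\<phi>' = "\<lambda>s. dif n (\<lambda>i. e * f' (s + real i)) 0"
  have D: "(?\<phi> has_real_derivative ?\<phi>' s) (at s within ?J)" if s: "s \<in> ?J" for s
  proof (rule DERIV_dif)
    fix i assume i: "i \<le> n + 0"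
    then have sub: "(\<lambda>s. s + real i) ` ?J \<subseteq> ?I" using Suc.prems by auto
    have "(f has_real_derivative e * f' (s + real i)) (at (s + real i) within (\<lambda>s. s + real i) ` ?J)"
      using f'(1) sub s by (intro has_field_derivative_subset[OF _ sub]) blast
    moreover have "((\<lambda>s. s + real i) has_real_derivative 1) (at s within ?J)"
      by (auto intro!: derivative_eq_intros)
    ultimately have "(f \<circ> (\<lambda>s. s + real i) has_real_derivative (e * f' (s + real i)) * 1) (at s within ?J)"
      by (rule DERIV_image_chain)
    then show "((\<lambda>s. f (s + real i)) has_real_derivative e * f' (s + real i)) (at s within ?J)"
      by (simp add: o_def)
  qed
  have "\<exists>s\<in>?J. ?\<phi> (t + 1) - ?\<phi> t = (t + 1 - t) * ?\<phi>' s"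
    using mvt_very_simple[of t "t + 1" ?\<phi> "\<lambda>s v. v * ?\<phi>' s"] D
    by (auto simp: has_field_derivative_def mult_commute_abs)
  then obtain s where s: "s \<in> ?J" "?\<phi> (t + 1) - ?\<phi> t = ?\<phi>' s" by auto
  have "dif (Suc n) (\<lambda>i. f (t + real i)) 0 = ?\<phi> (t + 1) - ?\<phi> t"
    using dif_shift[of n "\<lambda>i. f (t + real i)" 0 1] by (simp add: algebra_simps)
  also have "\<dots> = e * dif n (\<lambda>i. f' (s + real i)) 0" using s(2) by (simp add: dif_cmult)
  finally have "\<bar>dif (Suc n) (\<lambda>i. f (t + real i)) 0\<bar> = e * \<bar>dif n (\<lambda>i. f' (s + real i)) 0\<bar>"
    using assms(2) by (simp add: abs_mult)
  also have "\<dots> \<le> e * (C * e ^ n)"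
    using Suc.IH[OF f'(2), of s] s(1) Suc.prems assms(2) by (intro mult_left_mono) auto
  finally show ?case by (simp add: algebra_simps)
qed

text \<open>The normalisation \<open>l / l ^ length cs\<close> turns the hypothesis into the same
  bound \<open>B\<close> for every order, so one derivative in \<open>t\<close> costs exactly the
  factor \<open>l * norm h\<close>. The powers of the dimension come from summing over the
  coordinates of \<open>h\<close>.\<close>

lemma bd_along_line:
  fixes \<psi> :: "'a::euclidean_space \<Rightarrow> real"
  assumes sm: "smooth_on D \<psi>" and l: "0 < l" and B: "0 \<le> B"
    and I: "\<And>t. t \<in> I \<Longrightarrow> x + t *\<^sub>R h \<in> D"
    and bnd: "\<And>t cs. t \<in> I \<Longrightarrow> cs \<in> lists Basis \<Longrightarrow> length cs \<le> N \<Longrightarrow>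
                l * \<bar>iter_partial cs \<psi> (x + t *\<^sub>R h)\<bar> \<le> B * l ^ length cs"
    and cs: "cs \<in> lists Basis" "length cs + n \<le> N"
  shows "bd (l * norm h) I (real DIM('a) ^ n * B) n (\<lambda>t. l / l ^ length cs * iter_partial cs \<psi> (x + t *\<^sub>R h))"
  using cs
proof (induction n arbitrary: cs)
  case 0
  have "\<bar>l / l ^ length cs * iter_partial cs \<psi> (x + t *\<^sub>R h)\<bar> \<le> B" if "t \<in> I" for t
    using bnd[OF that 0(1)] 0(2) l by (simp add: abs_mult field_simps)
  then show ?case by simp
next
  case (Suc n)
  let ?e = "l * norm h" and ?d = "real DIM('a)"
  let ?Q = "\<lambda>cs t. l / l ^ length cs * iter_partial cs \<psi> (x + t *\<^sub>R h)"
  \<comment> \<open>The factor \<open>norm h\<close> is moved into \<open>?e\<close>, leaving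
    direction cosines of modulus at most 1. For \<open>h = 0\<close> the quotient is 0 by
    convention, and \<open>?e\<close> vanishes as well, so the derivative formula stays
    true.\<close>
  let ?f' = "\<lambda>t. \<Sum>b\<in>Basis. ((h \<bullet> b) / norm h) * ?Q (b # cs) t"
  have d1: "1 \<le> ?d" by (simp add: Suc_leI)
  have "bd ?e I (?d * (?d ^ n * B)) n ?f'"
  proof (rule bd_sum)
    fix b :: 'a assume b: "b \<in> Basis"
    have "\<bar>(h \<bullet> b) / norm h\<bar> \<le> 1"
      using Basis_le_norm[OF b, of h] by (simp add: divide_le_eq)
    then have "\<bar>(h \<bullet> b) / norm h\<bar> * (?d ^ n * B) \<le> ?d ^ n * B"
      using B by (intro mult_left_le_one_le) auto
    then show "bd ?e I (?d ^ n * B) n (\<lambda>t. ((h \<bullet> b) / norm h) * ?Q (b # cs) t)"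
      using b Suc by (intro bd_mono[OF bd_cmult[OF Suc.IH]]) auto
  qed (use B in auto)
  then have b: "bd ?e I (?d ^ Suc n * B) n ?f'" by (simp add: mult.assoc)
  have d: "(?Q cs has_real_derivative ?e * ?f' t) (at t within I)" if t: "t \<in> I" for t
  proof -
    have "iter_partial cs \<psi> differentiable (at (x + t *\<^sub>R h))"
      using sm I[OF t] Suc.prems(1) by (auto simp: smooth_on_def)
    from has_derivative_partial_deriv[OF this]
    have 1: "(iter_partial cs \<psi> has_derivative (\<lambda>v. \<Sum>b\<in>Basis. (v \<bullet> b) * iter_partial (b # cs) \<psi> (x + t *\<^sub>R h))) (at (x + t *\<^sub>R h))"
      by simp
    have 2: "((\<lambda>t. x + t *\<^sub>R h) has_derivative (\<lambda>s. s *\<^sub>R h)) (at t within I)"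
      by (auto intro!: derivative_eq_intros)
    have "((\<lambda>t. iter_partial cs \<psi> (x + t *\<^sub>R h)) has_derivative
        (\<lambda>s. \<Sum>b\<in>Basis. (s *\<^sub>R h \<bullet> b) * iter_partial (b # cs) \<psi> (x + t *\<^sub>R h))) (at t within I)"
      by (rule has_derivative_compose[OF 2 1])
    then have "((\<lambda>t. iter_partial cs \<psi> (x + t *\<^sub>R h)) has_real_derivative
        (\<Sum>b\<in>Basis. (h \<bullet> b) * iter_partial (b # cs) \<psi> (x + t *\<^sub>R h))) (at t within I)"
      unfolding has_field_derivative_def
      by (rule has_derivative_eq_rhs) (simp add: fun_eq_iff sum_distrib_left mult_ac)
    from DERIV_cmult[OF this, of "l / l ^ length cs"]
    have "(?Q cs has_real_derivative l / l ^ length cs * (\<Sum>b\<in>Basis. (h \<bullet> b) * iter_partial (b # cs) \<psi> (x + t *\<^sub>R h))) (at t within I)" .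
    moreover have "l / l ^ length cs * (\<Sum>b\<in>Basis. (h \<bullet> b) * iter_partial (b # cs) \<psi> (x + t *\<^sub>R h)) = ?e * ?f' t"
      using l by (cases "h = 0") (auto simp: sum_distrib_left field_simps intro!: sum.cong)
    ultimately show ?thesis by simp
  qed
  have "\<bar>?Q cs t\<bar> \<le> ?d ^ Suc n * B" if "t \<in> I" for t
  proof -
    have "\<bar>?Q cs t\<bar> \<le> B" using bnd[OF that Suc.prems(1)] Suc.prems(2) l by (simp add: abs_mult field_simps)
    also have "\<dots> \<le> ?d ^ Suc n * B" using B one_le_power[OF d1, of "Suc n"] by (simp only: mult_le_cancel_right1) auto
    finally show ?thesis .
  qed
  then show ?case unfolding bd.simps using d b by (intro conjI ballI exI)
qed

lemma iter_partial_real_derivatives: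
  assumes "\<zeta> \<in> test_functions (A :: real set)"
  shows "(iter_partial (replicate j 1) \<zeta> has_real_derivative iter_partial (replicate (Suc j) 1) \<zeta> x) (at x)"
    and "\<exists>M. \<forall>x. \<bar>iter_partial (replicate j 1) \<zeta> x\<bar> \<le> M"
proof -
  have r: "replicate j (1::real) \<in> lists Basis" by auto
  have "iter_partial (replicate j 1) \<zeta> differentiable (at x)"
    using test_functions_smooth[OF assms] r by (auto simp: smooth_on_def)
  from has_derivative_partial_deriv[OF this]
  show "(iter_partial (replicate j 1) \<zeta> has_real_derivative iter_partial (replicate (Suc j) 1) \<zeta> x) (at x)"
    by (simp add: has_field_derivative_def mult_commute_abs)
  show "\<exists>M. \<forall>x. \<bar>iter_partial (replicate j 1) \<zeta> x\<bar> \<le> M"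
    using test_functions_bounded[OF assms r] by (auto simp: bounded_iff)
qed

text \<open>Chains the three bounds: \<open>l * \<psi>\<close> along the line, then
  \<open>\<zeta>\<close> of it, then the reciprocal. The constant depends only on
  \<open>\<zeta>\<close>, \<open>B\<close>, \<open>c\<close>, \<open>N\<close> and the dimension,
  hence not on the layer.\<close>

lemma inverse_cutoff_differences:
  assumes \<zeta>: "\<zeta> \<in> test_functions (A :: real set)" and B: "0 \<le> B" and c: "0 < c"
  shows "\<exists>K\<ge>0. \<forall>D (\<psi> :: 'a::euclidean_space \<Rightarrow> real) l x h.
     smooth_on D \<psi> \<longrightarrow> 0 < l \<longrightarrow>
     (\<forall>t\<in>{0..real N}. x + t *\<^sub>R h \<in> D \<and> c \<le> \<zeta> (l * \<psi> (x + t *\<^sub>R h)) \<and>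
        (\<forall>cs\<in>lists Basis. length cs \<le> N \<longrightarrow> l * \<bar>iter_partial cs \<psi> (x + t *\<^sub>R h)\<bar> \<le> B * l ^ length cs)) \<longrightarrow>
     (\<forall>i j. i + j \<le> N \<longrightarrow> \<bar>dif j (\<lambda>i. inverse (\<zeta> (l * \<psi> (x + real i *\<^sub>R h)))) i\<bar> \<le> K * (l * norm h) ^ j)"
proof -
  define F where "F j = iter_partial (replicate j 1) \<zeta>" for j
  have F1: "(F j has_real_derivative F (Suc j) x) (at x)" for j x
    unfolding F_def by (rule iter_partial_real_derivatives(1)[OF \<zeta>])
  have "\<forall>j. \<exists>M. \<forall>x. \<bar>F j x\<bar> \<le> M"
    unfolding F_def using iter_partial_real_derivatives(2)[OF \<zeta>] by blast
  then obtain M where F2: "\<And>j x. \<bar>F j x\<bar> \<le> M j" by metis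
  let ?C = "real DIM('a) ^ N * B"
  have C0: "0 \<le> ?C" using B by simp
  obtain K1 where K1: "K1 \<ge> 0" "\<And>e I q. bd e I ?C N q \<Longrightarrow> bd e I K1 N (\<lambda>t. F 0 (q t))"
    using bd_compose[of F M, OF F1 F2 C0, of N 0] by blast
  obtain K where K: "K \<ge> 0" "\<And>e I f. bd e I K1 N f \<Longrightarrow> (\<forall>t\<in>I. c \<le> f t) \<Longrightarrow> bd e I K N (\<lambda>t. inverse (f t))"
    using bd_inverse[OF c K1(1), of N] by blast
  show ?thesis
  proof (intro exI[of _ K] conjI allI impI K(1))
    fix D and \<psi> :: "'a \<Rightarrow> real" and l x h i j
    assume sm: "smooth_on D \<psi>" and l: "0 < l" and ij: "i + j \<le> N"
      and H: "\<forall>t\<in>{0..real N}. x + t *\<^sub>R h \<in> D \<and> c \<le> \<zeta> (l * \<psi> (x + t *\<^sub>R h)) \<and>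
        (\<forall>cs\<in>lists Basis. length cs \<le> N \<longrightarrow> l * \<bar>iter_partial cs \<psi> (x + t *\<^sub>R h)\<bar> \<le> B * l ^ length cs)"
    let ?I = "{0..real N}" and ?e = "l * norm h"
    have "bd ?e ?I ?C N (\<lambda>t. l / l ^ length ([]::'a list) * iter_partial [] \<psi> (x + t *\<^sub>R h))"
      by (rule bd_along_line[OF sm l B, where N=N]) (use H in auto)
    then have "bd ?e ?I ?C N (\<lambda>t. l * \<psi> (x + t *\<^sub>R h))" by simp
    from K1(2)[OF this] have "bd ?e ?I K1 N (\<lambda>t. \<zeta> (l * \<psi> (x + t *\<^sub>R h)))" by (simp add: F_def)
    from K(2)[OF this] have "bd ?e ?I K N (\<lambda>t. inverse (\<zeta> (l * \<psi> (x + t *\<^sub>R h))))" using H by blast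
    then have "bd ?e ?I K j (\<lambda>t. inverse (\<zeta> (l * \<psi> (x + t *\<^sub>R h))))" by (rule bd_le) (use ij in simp)
    from dif_bd[OF this, of "real i"]
    have "\<bar>dif j (\<lambda>k. inverse (\<zeta> (l * \<psi> (x + (real i + real k) *\<^sub>R h)))) 0\<bar> \<le> K * ?e ^ j"
      using l ij K(1) by simp
    then show "\<bar>dif j (\<lambda>i. inverse (\<zeta> (l * \<psi> (x + real i *\<^sub>R h)))) i\<bar> \<le> K * ?e ^ j"
      using dif_shift[of j "\<lambda>i. inverse (\<zeta> (l * \<psi> (x + real i *\<^sub>R h)))" 0 i]
      by (simp add: add.commute)
  qed
qed


section \<open>Boundary layers of Lipschitz domains\<close>

lemma bounded_lipschitz_domain_open: "bounded_lipschitz_domain D \<Longrightarrow> open D"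
  and bounded_lipschitz_domain_bounded: "bounded_lipschitz_domain D \<Longrightarrow> bounded D"
  and bounded_lipschitz_domain_nonempty: "bounded_lipschitz_domain D \<Longrightarrow> D \<noteq> {}"
  by (auto simp: bounded_lipschitz_domain_def Defs.domain_def)

lemma frontier_nonempty:
  fixes D :: "'a::euclidean_space set"
  assumes "bounded D" "D \<noteq> {}"
  shows "frontier D \<noteq> {}"
  using frontier_eq_empty[of D] assms not_bounded_UNIV by blast

lemma measurable_bdist [measurable]: "bdist D \<in> borel_measurable borel"
  unfolding bdist_def[abs_def] by (intro borel_measurable_continuous_onI continuous_intros)

lemma emeasure_lborel_translate:
  fixes S :: "'a::euclidean_space set"
  assumes "S \<in> sets borel"
  shows "emeasure lborel {y. y - v \<in> S} = emeasure lborel S"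
proof -
  have "emeasure lborel S = emeasure (distr lborel borel ((+) (- v))) S"
    by (simp add: lborel_distr_plus)
  also have "\<dots> = emeasure lborel ((+) (- v) -` S \<inter> space lborel)"
    by (rule emeasure_distr) (use assms in auto)
  also have "(+) (- v) -` S \<inter> space lborel = {y. y - v \<in> S}" by auto
  finally show ?thesis by simp
qed

text \<open>The translates of a thin layer over a Lipschitz graph in the direction of the graph are disjoint,
  so its measure is bounded by that of a ball divided by the number of translates.\<close>

lemma measure_thin_layer:
  fixes D :: "'a::euclidean_space set" and T :: "'a \<Rightarrow> 'a" and \<mu> :: "'a \<Rightarrow> real"
  assumes D: "open D" "bounded D" "D \<noteq> {}" and r0: "0 < r0" and x0: "x0 \<in> frontier D"
    and T: "orthogonal_transformation T" and b: "b \<in> Basis"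
    and graph: "D \<inter> ball x0 r0 = {x \<in> ball x0 r0. T x \<bullet> b > \<mu> (T x - (T x \<bullet> b) *\<^sub>R b)}"
    and lip: "K-lipschitz_on {y. y \<bullet> b = 0} \<mu>"
  shows "\<exists>C\<ge>0. \<forall>r. 0 < r \<longrightarrow> r \<le> r0 / 4 \<longrightarrow>
           measure lborel {x \<in> D \<inter> ball x0 (r0 / 2). bdist D x \<le> r} \<le> C * r"
proof -
  let ?V = "measure lborel (ball x0 (r0 / 2 + 1))"
  have K: "0 \<le> K" using lip lipschitz_on_nonneg by blast
  have bb: "b \<bullet> b = 1" "norm b = 1" using b by auto
  interpret T: linear T using T orthogonal_transformation_linear by blast
  \<comment> \<open>The vertical direction of the graph, expressed in the original
    coordinates.\<close>
  obtain e where e: "T e = b" using orthogonal_transformation_surj[OF T] by (metis surjD)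
  have ne: "norm e = 1" using T e bb by (metis orthogonal_transformation_norm)
  let ?P = "\<lambda>x. T x - (T x \<bullet> b) *\<^sub>R b"
  have P: "?P x \<bullet> b = 0" for x by (simp add: inner_diff_left bb)
  have Pnorm: "norm (?P x - ?P z) \<le> norm (x - z)" for x z
  proof -
    let ?w = "T (x - z)"
    have "?P x - ?P z = ?w - (?w \<bullet> b) *\<^sub>R b" by (simp add: T.diff inner_diff_left algebra_simps)
    moreover have "(norm (?w - (?w \<bullet> b) *\<^sub>R b))\<^sup>2 \<le> (norm ?w)\<^sup>2"
      by (simp add: power2_norm_eq_inner inner_diff_left inner_diff_right bb inner_commute)
    ultimately have "norm (?P x - ?P z) \<le> norm ?w" using power2_le_imp_le[of _ "norm ?w"] by simp
    then show ?thesis using orthogonal_transformation_norm[OF T] by simp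
  qed
  have fr: "closed (frontier D)" "frontier D \<noteq> {}" using frontier_nonempty[OF D(2,3)] by auto
  have "measure lborel {x \<in> D \<inter> ball x0 (r0 / 2). bdist D x \<le> r} \<le> ?V * (K + 2) * r"
    if r: "0 < r" "r \<le> r0 / 4" for r
  proof -
    let ?S = "{x \<in> D \<inter> ball x0 (r0 / 2). bdist D x \<le> r}"
    \<comment> \<open>A point of the layer is at most \<open>(K + 1) * r\<close> above the graph:
      \<open>r\<close> for the way to a nearest boundary point and \<open>K * r\<close> for the
      change of the graph on that way. The step \<open>s\<close> exceeds this height, so vertical
      translates by multiples of \<open>s\<close> cannot meet.\<close>
    define s where "s = (K + 2) * r"
    have s: "0 < s" using K r by (simp add: s_def)
    have S[measurable]: "?S \<in> sets borel" using D(1) by measurable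
    have layer: "\<mu> (?P x) < T x \<bullet> b \<and> T x \<bullet> b \<le> \<mu> (?P x) + (K + 1) * r" if x: "x \<in> ?S" for x
    proof
      have "x \<in> D \<inter> ball x0 r0" using x r0 by auto
      then show "\<mu> (?P x) < T x \<bullet> b" using graph by blast
      obtain z where z: "z \<in> frontier D" "bdist D x = dist x z"
        using infdist_attains_inf[OF fr] unfolding bdist_def by metis
      then have xz: "dist x z \<le> r" using x by simp
      have "dist x0 z \<le> dist x0 x + dist x z" by (rule dist_triangle)
      \<comment> \<open>Here the restriction to \<open>r \<le> r0 / 4\<close> is used: the nearest
        boundary point still lies in the ball where the graph describes \<open>D\<close>.\<close>
      then have zb: "z \<in> ball x0 r0" using x xz r r0 by auto
      have "z \<notin> D" using z(1) D(1) by (simp add: frontier_def interior_open)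
      then have Tz: "T z \<bullet> b \<le> \<mu> (?P z)" using graph zb by force
      have "\<bar>T (x - z) \<bullet> b\<bar> \<le> norm (T (x - z)) * norm b" by (rule Cauchy_Schwarz_ineq2)
      then have "\<bar>T x \<bullet> b - T z \<bullet> b\<bar> \<le> r"
        using xz bb orthogonal_transformation_norm[OF T, of "x - z"]
        by (simp add: T.diff inner_diff_left dist_norm)
      moreover have "\<bar>\<mu> (?P z) - \<mu> (?P x)\<bar> \<le> K * r"
      proof -
        have "dist (\<mu> (?P z)) (\<mu> (?P x)) \<le> K * dist (?P z) (?P x)"
          by (rule lipschitz_onD[OF lip]) (use P in auto)
        also have "\<dots> \<le> K * r"
          using Pnorm[of z x] xz K by (intro mult_left_mono) (auto simp: dist_norm norm_minus_commute)
        finally show ?thesis by (simp add: dist_real_def)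
      qed
      ultimately show "T x \<bullet> b \<le> \<mu> (?P x) + (K + 1) * r" using Tz by (simp add: algebra_simps)
    qed
    define A where "A j = {y. y - (real j * s) *\<^sub>R e \<in> ?S}" for j :: nat
    have A[measurable]: "A j \<in> sets borel" for j
      unfolding A_def by (rule measurable_sets_borel[of _ borel, simplified vimage_def]) (use S in auto)
    have mA: "emeasure lborel (A j) = emeasure lborel ?S" for j
      unfolding A_def by (rule emeasure_lborel_translate[OF S])
    have disj: "A j \<inter> A k = {}" if "j < k" for j k
    proof (rule ccontr)
      assume "A j \<inter> A k \<noteq> {}"
      then obtain y where y: "y - (real j * s) *\<^sub>R e \<in> ?S" "y - (real k * s) *\<^sub>R e \<in> ?S" by (auto simp: A_def)
      have T1: "T (y - c *\<^sub>R e) \<bullet> b = T y \<bullet> b - c" for c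
        by (simp add: T.diff T.scale e inner_diff_left bb)
      have P1: "?P (y - c *\<^sub>R e) = ?P y" for c
        unfolding T1 by (simp add: T.diff T.scale e algebra_simps)
      have 1: "T y \<bullet> b - real j * s \<le> \<mu> (?P y) + (K + 1) * r" using layer[OF y(1)] unfolding P1 unfolding T1 by simp
      have 2: "\<mu> (?P y) < T y \<bullet> b - real k * s" using layer[OF y(2)] unfolding P1 unfolding T1 by simp
      have "s \<le> (real k - real j) * s" using that s by (simp add: mult_le_cancel_right1)
      then have "s < (K + 1) * r" using 1 2 by (simp add: algebra_simps)
      then show False using r by (simp add: s_def algebra_simps)
    qed
    \<comment> \<open>The indices below \<open>m\<close> are those with
      \<open>j * s \<le> 1\<close>, so all translates stay in the ball enlarged by 1; at the same
      time \<open>m\<close> is at least \<open>1 / s\<close>.\<close>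
    define m where "m = Suc (nat \<lfloor>1 / s\<rfloor>)"
    have sub: "(\<Union>j\<in>{..<m}. A j) \<subseteq> ball x0 (r0 / 2 + 1)"
    proof
      fix y assume "y \<in> (\<Union>j\<in>{..<m}. A j)"
      then obtain j where j: "j < m" "y \<in> A j" by blast
      have "real j \<le> 1 / s"
      proof -
        have "j \<le> nat \<lfloor>1 / s\<rfloor>" using j(1) by (simp add: m_def)
        then show ?thesis using s by (simp add: le_nat_floor le_nat_iff le_floor_iff)
      qed
      then have js: "real j * s \<le> 1" using s by (simp add: field_simps)
      have "dist x0 y \<le> dist x0 (y - (real j * s) *\<^sub>R e) + dist (y - (real j * s) *\<^sub>R e) y" by (rule dist_triangle)
      moreover have "dist (y - (real j * s) *\<^sub>R e) y = real j * s" using s ne by (simp add: dist_norm)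
      ultimately show "y \<in> ball x0 (r0 / 2 + 1)" using j(2) js by (simp add: A_def)
    qed
    have fin: "emeasure lborel ?S \<noteq> \<infinity>"
      using emeasure_mono[of ?S "ball x0 r0" lborel] emeasure_lborel_ball_finite[of x0 r0] r0
      by (fastforce simp: less_top[symmetric] top_unique)
    have "real m * measure lborel ?S = (\<Sum>j\<in>{..<m}. measure lborel (A j))"
      by (simp add: measure_def mA)
    also have "\<dots> = measure lborel (\<Union>j\<in>{..<m}. A j)"
    proof (rule measure_finite_Union[symmetric])
      show "disjoint_family_on A {..<m}"
        unfolding disjoint_family_on_def using disj by (metis Int_commute linorder_neqE_nat)
      show "emeasure lborel (A i) \<noteq> \<infinity>" for i using fin mA by simp
    qed auto
    also have "\<dots> \<le> ?V"
      by (rule measure_mono_fmeasurable[OF sub]) (use emeasure_lborel_ball_finite[of x0 "r0 / 2 + 1"] in \<open>auto simp: fmeasurable_def\<close>)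
    finally have mS: "real m * measure lborel ?S \<le> ?V" .
    have "1 / s \<le> real m" using s unfolding m_def by linarith
    then have "1 / s * measure lborel ?S \<le> ?V"
      using mS mult_right_mono[of "1 / s" "real m" "measure lborel ?S"] by simp
    then have "measure lborel ?S \<le> ?V * s" using s by (simp add: field_simps)
    then show ?thesis by (simp add: s_def mult.assoc)
  qed
  moreover have "0 \<le> ?V * (K + 2)" using K by simp
  ultimately show ?thesis by blast
qed

text \<open>The compact boundary is covered by finitely many balls of radius \<open>r0 / 4\<close>.
  A point at distance at most \<open>r0 / 4\<close> from the boundary then lies within
  \<open>r0 / 2\<close> of one of the centres, where the bound for thin layers over a graph
  applies.\<close>

theorem measure_boundary_layer:
  fixes D :: "'a::euclidean_space set"
  assumes "bounded_lipschitz_domain D"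
  shows "\<exists>C\<ge>0. \<forall>r>0. measure lborel {x \<in> D. bdist D x \<le> r} \<le> C * r"
proof -
  have D: "open D" "bounded D" "D \<noteq> {}"
    using assms bounded_lipschitz_domain_open bounded_lipschitz_domain_bounded bounded_lipschitz_domain_nonempty by blast+
  obtain r0 K where r0: "r0 > 0" and loc: "\<forall>x0\<in>frontier D.
        \<exists>T b (\<mu> :: 'a \<Rightarrow> real). orthogonal_transformation T \<and> b \<in> Basis \<and>
          D \<inter> ball x0 r0 = {x \<in> ball x0 r0. T x \<bullet> b > \<mu> (T x - (T x \<bullet> b) *\<^sub>R b)} \<and>
          K-lipschitz_on {y. y \<bullet> b = 0} \<mu>"
    using assms unfolding bounded_lipschitz_domain_def by blast
  let ?S = "\<lambda>x0 r. {x \<in> D \<inter> ball x0 (r0 / 2). bdist D x \<le> r}"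
  have "\<forall>x0\<in>frontier D. \<exists>C\<ge>0. \<forall>r. 0 < r \<longrightarrow> r \<le> r0 / 4 \<longrightarrow> measure lborel (?S x0 r) \<le> C * r"
  proof
    fix x0 assume x0: "x0 \<in> frontier D"
    then obtain T b and \<mu> :: "'a \<Rightarrow> real" where "orthogonal_transformation T" "b \<in> Basis"
          "D \<inter> ball x0 r0 = {x \<in> ball x0 r0. T x \<bullet> b > \<mu> (T x - (T x \<bullet> b) *\<^sub>R b)}"
          "K-lipschitz_on {y. y \<bullet> b = 0} \<mu>" using loc by meson
    then show "\<exists>C\<ge>0. \<forall>r. 0 < r \<longrightarrow> r \<le> r0 / 4 \<longrightarrow> measure lborel (?S x0 r) \<le> C * r"
      using measure_thin_layer[OF D r0 x0] by blast
  qed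
  from bchoice[OF this] obtain c where c: "\<And>x0. x0 \<in> frontier D \<Longrightarrow> c x0 \<ge> 0"
      "\<And>x0 r. x0 \<in> frontier D \<Longrightarrow> 0 < r \<Longrightarrow> r \<le> r0 / 4 \<Longrightarrow> measure lborel (?S x0 r) \<le> c x0 * r"
    by blast
  have fr: "compact (frontier D)" "closed (frontier D)" "frontier D \<noteq> {}"
    using D frontier_nonempty[OF D(2,3)] by (auto intro: compact_frontier_bounded)
  obtain X where X: "X \<subseteq> frontier D" "finite X" "frontier D \<subseteq> (\<Union>x\<in>X. ball x (r0 / 4))"
  proof (rule compactE_image[OF fr(1), of "frontier D" "\<lambda>x. ball x (r0 / 4)"])
    show "frontier D \<subseteq> (\<Union>x\<in>frontier D. ball x (r0 / 4))" using r0 by auto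
  qed (use that in auto)
  \<comment> \<open>The sum serves small \<open>r\<close>. The second term serves
    \<open>r > r0 / 4\<close>, where the measure of all of \<open>D\<close> is already at most a
    multiple of \<open>r\<close>.\<close>
  define C where "C = (\<Sum>x0\<in>X. c x0) + measure lborel D * 4 / r0"
  have C1: "0 \<le> (\<Sum>x0\<in>X. c x0)" using c(1) X(1) by (auto intro!: sum_nonneg)
  have Dm: "D \<in> fmeasurable lborel" "D \<in> sets borel"
    using D(1) emeasure_bounded_finite[OF D(2)] by (auto simp: fmeasurable_def)
  have "measure lborel {x \<in> D. bdist D x \<le> r} \<le> C * r" if r: "r > 0" for r
  proof (cases "r \<le> r0 / 4")
    case True
    have sub: "{x \<in> D. bdist D x \<le> r} \<subseteq> (\<Union>x0\<in>X. ?S x0 r)"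
    proof
      fix x assume x: "x \<in> {x \<in> D. bdist D x \<le> r}"
      obtain z where z: "z \<in> frontier D" "bdist D x = dist x z"
        using infdist_attains_inf[OF fr(2,3)] unfolding bdist_def by metis
      obtain x0 where x0: "x0 \<in> X" "z \<in> ball x0 (r0 / 4)" using X(3) z(1) by blast
      have "dist x0 x \<le> dist x0 z + dist x z" by (metis dist_commute dist_triangle)
      then have "x \<in> ?S x0 r" using x z x0 True by auto
      then show "x \<in> (\<Union>x0\<in>X. ?S x0 r)" using x0(1) by blast
    qed
    have Sm: "?S x0 r \<in> fmeasurable lborel" for x0
      by (rule fmeasurableI2[OF Dm(1)]) (use Dm(2) in auto)
    have "measure lborel {x \<in> D. bdist D x \<le> r} \<le> measure lborel (\<Union>x0\<in>X. ?S x0 r)"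
      by (rule measure_mono_fmeasurable[OF sub]) (use Dm(2) X(2) Sm in auto)
    also have "\<dots> \<le> (\<Sum>x0\<in>X. measure lborel (?S x0 r))"
      by (rule measure_UNION_le[OF X(2)]) (use Dm(2) in auto)
    also have "\<dots> \<le> (\<Sum>x0\<in>X. c x0 * r)"
      using c X(1) r True by (intro sum_mono) auto
    also have "\<dots> \<le> C * r"
    proof -
      have "0 \<le> measure lborel D * 4 / r0" using r0 by simp
      then show ?thesis
        unfolding sum_distrib_right[symmetric] C_def using r by (intro mult_right_mono) auto
    qed
    finally show ?thesis .
  next
    case False
    have "measure lborel {x \<in> D. bdist D x \<le> r} \<le> measure lborel D"
      by (rule measure_mono_fmeasurable) (use Dm in auto)
    also have "\<dots> \<le> measure lborel D * 4 / r0 * r"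
      using False r0 mult_right_mono[of r0 "r * 4" "measure lborel D"] by (simp add: field_simps)
    also have "\<dots> \<le> C * r" unfolding C_def using C1 r by (intro mult_right_mono) auto
    finally show ?thesis .
  qed
  moreover have "0 \<le> C" using C1 r0 by (simp add: C_def)
  ultimately show ?thesis by blast
qed


section \<open>Affine substitution\<close>

lemma nn_integral_lborel_affine:
  fixes f :: "'a::euclidean_space \<Rightarrow> ennreal"
  assumes [measurable]: "f \<in> borel_measurable borel" and c: "c \<noteq> 0"
  shows "(\<integral>\<^sup>+x. f x \<partial>lborel) = ennreal (\<bar>c\<bar> ^ DIM('a)) * (\<integral>\<^sup>+x. f (t + c *\<^sub>R x) \<partial>lborel)"
  by (subst lborel_affine[OF c, of t])
     (simp add: nn_integral_density nn_integral_distr nn_integral_cmult)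

lemma integrable_lborel_affine_iff:
  fixes f :: "'a::euclidean_space \<Rightarrow> 'b::{banach, second_countable_topology}"
  assumes [measurable]: "f \<in> borel_measurable borel" and c: "c \<noteq> 0"
  shows "integrable lborel (\<lambda>x. f (t + c *\<^sub>R x)) \<longleftrightarrow> integrable lborel f"
proof -
  let ?k = "\<bar>c\<bar> ^ DIM('a)" and ?F = "\<lambda>x. f (t + c *\<^sub>R x)"
  have "integrable lborel f \<longleftrightarrow> integrable lborel (\<lambda>x. ?k *\<^sub>R ?F x)"
    by (subst lborel_affine[OF c, of t]) (simp add: integrable_density integrable_distr_eq)
  also have "\<dots> \<longleftrightarrow> integrable lborel ?F"
  proof
    assume "integrable lborel (\<lambda>x. ?k *\<^sub>R ?F x)"
    then have "integrable lborel (\<lambda>x. (1 / ?k) *\<^sub>R (?k *\<^sub>R ?F x))" by (rule integrable_scaleR_right)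
    then show "integrable lborel ?F" using c by simp
  qed simp
  finally show ?thesis by simp
qed

lemma integral_lborel_affine:
  fixes f :: "'a::euclidean_space \<Rightarrow> 'b::{banach, second_countable_topology}"
  assumes [measurable]: "f \<in> borel_measurable borel" and c: "c \<noteq> 0"
  shows "(\<integral>x. f x \<partial>lborel) = \<bar>c\<bar> ^ DIM('a) *\<^sub>R (\<integral>x. f (t + c *\<^sub>R x) \<partial>lborel)"
  by (subst lborel_affine[OF c, of t])
     (simp add: integral_density integral_distr)

lemma nn_integral_lborel_translate:
  fixes f :: "'a::euclidean_space \<Rightarrow> ennreal"
  assumes "f \<in> borel_measurable borel"
  shows "(\<integral>\<^sup>+x. f (x + t) \<partial>lborel) = (\<integral>\<^sup>+x. f x \<partial>lborel)"
    and "(\<integral>\<^sup>+x. f (t - x) \<partial>lborel) = (\<integral>\<^sup>+x. f x \<partial>lborel)"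
  using nn_integral_lborel_affine[OF assms, of 1 t] nn_integral_lborel_affine[OF assms, of "-1" t]
  by (simp_all add: add.commute)

lemma integral_lborel_translate:
  fixes f :: "'a::euclidean_space \<Rightarrow> 'b::{banach, second_countable_topology}"
  assumes "f \<in> borel_measurable borel"
  shows "(\<integral>x. f (x + t) \<partial>lborel) = (\<integral>x. f x \<partial>lborel)"
    and "(\<integral>x. f (t - x) \<partial>lborel) = (\<integral>x. f x \<partial>lborel)"
  using integral_lborel_affine[OF assms, of 1 t] integral_lborel_affine[OF assms, of "-1" t]
  by (simp_all add: add.commute)

lemma integrable_lborel_translate:
  fixes f :: "'a::euclidean_space \<Rightarrow> 'b::{banach, second_countable_topology}"
  assumes "integrable lborel f"
  shows "integrable lborel (\<lambda>x. f (x + t))" and "integrable lborel (\<lambda>x. f (t - x))"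
  using integrable_lborel_affine_iff[of f 1 t] integrable_lborel_affine_iff[of f "-1" t] assms
  by (simp_all add: add.commute)

lemma AE_lborel_affine:
  fixes P :: "'a::euclidean_space \<Rightarrow> bool"
  assumes "AE x in lborel. P x" and c: "c \<noteq> 0"
  shows "AE x in lborel. P (t + c *\<^sub>R x)"
proof -
  obtain N where N': "{x \<in> space lborel. \<not> P x} \<subseteq> N" "emeasure lborel N = 0" "N \<in> sets lborel"
    using AE_E[OF assms(1)] by blast
  have N: "N \<in> sets borel" "emeasure lborel N = 0" "\<And>x. x \<notin> N \<Longrightarrow> P x" using N' by auto
  have m[measurable]: "(\<lambda>x. t + c *\<^sub>R x) \<in> borel_measurable borel" by simp
  have "(\<integral>\<^sup>+x. indicator N (t + c *\<^sub>R x) \<partial>lborel) = 0"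
    using nn_integral_lborel_affine[of "indicator N :: 'a \<Rightarrow> ennreal" c t] N(1,2) c by simp
  then have "AE x in lborel. indicator N (t + c *\<^sub>R x) = (0 :: ennreal)"
    using N(1) by (subst (asm) nn_integral_0_iff_AE) simp_all
  then show ?thesis
    by eventually_elim (use N(3) in \<open>auto simp: indicator_def split: if_splits\<close>)
qed

lemma AE_lborel_translate:
  fixes P :: "'a::euclidean_space \<Rightarrow> bool"
  assumes "AE x in lborel. P x"
  shows "AE x in lborel. P (x + t)"
  using AE_lborel_affine[OF assms, of 1 t] by (simp add: add.commute)


section \<open>Convolution on Lebesgue spaces\<close>

text \<open>Convexity of the power in the form of its tangent at \<open>a\<close>. Division by
  \<open>a powr p\<close> leaves 1 + p (r - 1) \<le> r powr p, which is Young's inequality for r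
  powr p and 1 with weights 1 / p and 1 - 1 / p.\<close>

lemma powr_tangent:
  fixes x a p :: real
  assumes "0 \<le> x" "0 \<le> a" "1 \<le> p"
  shows "a powr p + p * a powr (p - 1) * (x - a) \<le> x powr p"
proof (cases "a = 0 \<or> x = 0")
  case True
  have "a powr p = a powr (p - 1) * a" if "a > 0"
    using that by (simp add: powr_diff)
  moreover have "0 \<le> (p - 1) * (a powr (p - 1) * a)" using assms by simp
  moreover have "a > 0 \<or> a = 0" using assms(2) by linarith
  ultimately show ?thesis using True assms by (elim disjE) (simp_all add: algebra_simps)
next
  case False
  then have pos: "0 < x" "0 < a" using assms by auto
  define r where "r = x / a"
  have r: "0 < r" using pos by (simp add: r_def)
  have "(r powr p) powr (1 / p) * 1 powr (1 - 1 / p) \<le> (1 / p) * (r powr p) + (1 - 1 / p) * 1"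
    using assms(3) r by (intro Youngs_inequality_0) auto
  then have "r \<le> (1 / p) * (r powr p) + (1 - 1 / p)"
    using assms(3) r by (simp add: powr_powr)
  then have "p * r \<le> p * ((1 / p) * (r powr p) + (1 - 1 / p))"
    using assms(3) by (intro mult_left_mono) auto
  also have "\<dots> = r powr p + (p - 1)" using assms(3) by (simp add: distrib_left right_diff_distrib)
  finally have "1 + p * (r - 1) \<le> r powr p" by (simp add: algebra_simps)
  then have "a powr p * (1 + p * (r - 1)) \<le> a powr p * r powr p"
    by (intro mult_left_mono) auto
  moreover have "a powr p * r powr p = x powr p"
    using pos by (simp add: r_def powr_divide)
  moreover have "a powr p * (1 + p * (r - 1)) = a powr p + p * a powr (p - 1) * (x - a)"
    using pos by (simp add: r_def powr_diff field_simps)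
  ultimately show ?thesis by simp
qed

text \<open>Jensen's inequality for a weight of arbitrary mass: the tangent at the weighted mean is
  integrated, and its linear term drops out. The power p - 1 of the mass compensates for the missing
  normalisation.\<close>

lemma jensen_powr:
  fixes w f :: "'a \<Rightarrow> real"
  assumes w: "integrable M w" "\<And>x. 0 \<le> w x" and f: "\<And>x. 0 \<le> f x"
    and wf: "integrable M (\<lambda>x. w x * f x)" and wfp: "integrable M (\<lambda>x. w x * f x powr p)" and p: "1 \<le> p"
  shows "(\<integral>x. w x * f x \<partial>M) powr p \<le> (\<integral>x. w x \<partial>M) powr (p - 1) * (\<integral>x. w x * f x powr p \<partial>M)"
proof -
  define m where "m = (\<integral>x. w x \<partial>M)"
  define A where "A = (\<integral>x. w x * f x \<partial>M)"
  have m0: "0 \<le> m" using w by (simp add: m_def)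
  have A0: "0 \<le> A" using w f by (simp add: A_def)
  show ?thesis
  proof (cases "m = 0")
    case True
    then have "AE x in M. w x = 0"
      using integral_nonneg_eq_0_iff_AE[OF w(1)] w(2) by (simp add: m_def)
    then have "A = 0" unfolding A_def by (intro integral_eq_zero_AE) auto
    then show ?thesis using w f by (simp add: A_def[symmetric])
  next
    case False
    then have m: "0 < m" using m0 by simp
    define a where "a = A / m"
    have a: "0 \<le> a" using A0 m by (simp add: a_def)
    have "a powr p * m = a powr p * m + p * a powr (p - 1) * (A - a * m)"
      using m by (simp add: a_def)
    also have "\<dots> = (\<integral>x. w x * a powr p + (p * a powr (p - 1)) * (w x * f x - a * w x) \<partial>M)"
      using w wf by (simp add: m_def A_def mult.commute)
    also have "\<dots> \<le> (\<integral>x. w x * f x powr p \<partial>M)"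
    proof (rule integral_mono)
      fix x
      have "w x * (a powr p + p * a powr (p - 1) * (f x - a)) \<le> w x * f x powr p"
        by (intro mult_left_mono powr_tangent w f a p)
      then show "w x * a powr p + (p * a powr (p - 1)) * (w x * f x - a * w x) \<le> w x * f x powr p"
        by (simp add: algebra_simps)
    qed (use w wf wfp in auto)
    finally have "m powr (p - 1) * (a powr p * m) \<le> m powr (p - 1) * (\<integral>x. w x * f x powr p \<partial>M)"
      by (intro mult_left_mono) auto
    moreover have "m powr (p - 1) * (a powr p * m) = A powr p"
      using m A0 by (simp add: a_def powr_divide powr_diff field_simps)
    ultimately show ?thesis by (simp add: A_def m_def)
  qed
qed

definition conv :: "('a::euclidean_space \<Rightarrow> real) \<Rightarrow> ('a \<Rightarrow> real) \<Rightarrow> 'a \<Rightarrow> real" where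
  "conv K g x = (\<integral>y. K y * g (x - y) \<partial>lborel)"

text \<open>The p-th power of the L_p norm over the whole space; leaving out the root keeps it
  additive in the domain and directly accessible to Tonelli.\<close>

definition Lp_pow :: "real \<Rightarrow> ('a::euclidean_space \<Rightarrow> real) \<Rightarrow> ennreal" where
  "Lp_pow p g = (\<integral>\<^sup>+x. ennreal (\<bar>g x\<bar> powr p) \<partial>lborel)"

lemma measurable_conv [measurable]:
  assumes [measurable]: "K \<in> borel_measurable borel" "g \<in> borel_measurable borel"
  shows "conv K g \<in> borel_measurable borel"
  unfolding conv_def[abs_def] by measurable

lemma Lp_pow_cong_AE: "AE x in lborel. f x = g x \<Longrightarrow> Lp_pow p f = Lp_pow p g"
  unfolding Lp_pow_def by (intro nn_integral_cong_AE) auto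

text \<open>Tonelli gives the double integral, hence finiteness of the inner integral almost
  everywhere. Integrability of the convolution integrand itself follows from |g| \<le> 1 + |g| powr
  p.\<close>

lemma conv_Lp_finite:
  fixes K g :: "'a::euclidean_space \<Rightarrow> real"
  assumes K: "integrable lborel K" and g[measurable]: "g \<in> borel_measurable borel"
    and p: "1 \<le> p" and fin: "Lp_pow p g < \<infinity>"
  shows "(\<integral>\<^sup>+x. (\<integral>\<^sup>+y. ennreal (\<bar>K y\<bar> * \<bar>g (x - y)\<bar> powr p) \<partial>lborel) \<partial>lborel)
           = ennreal (\<integral>y. \<bar>K y\<bar> \<partial>lborel) * Lp_pow p g" (is "?L = _")
    and "AE x in lborel. integrable lborel (\<lambda>y. \<bar>K y\<bar> * \<bar>g (x - y)\<bar> powr p)"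
    and "AE x in lborel. integrable lborel (\<lambda>y. K y * g (x - y))"
proof -
  have Km[measurable]: "K \<in> borel_measurable borel" using K by auto
  have "?L = (\<integral>\<^sup>+y. (\<integral>\<^sup>+x. ennreal (\<bar>K y\<bar> * \<bar>g (x - y)\<bar> powr p) \<partial>lborel) \<partial>lborel)"
    by (rule lborel_pair.Fubini') measurable
  also have "\<dots> = (\<integral>\<^sup>+y. ennreal \<bar>K y\<bar> * Lp_pow p g \<partial>lborel)"
  proof (rule nn_integral_cong)
    fix y
    have "(\<integral>\<^sup>+x. ennreal (\<bar>K y\<bar> * \<bar>g (x - y)\<bar> powr p) \<partial>lborel)
        = ennreal \<bar>K y\<bar> * (\<integral>\<^sup>+x. ennreal (\<bar>g (x + (- y))\<bar> powr p) \<partial>lborel)"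
      by (simp add: ennreal_mult nn_integral_cmult)
    also have "(\<integral>\<^sup>+x. ennreal (\<bar>g (x + (- y))\<bar> powr p) \<partial>lborel) = Lp_pow p g"
      unfolding Lp_pow_def by (rule nn_integral_lborel_translate(1)[where f="\<lambda>x. ennreal (\<bar>g x\<bar> powr p)"]) simp
    finally show "(\<integral>\<^sup>+x. ennreal (\<bar>K y\<bar> * \<bar>g (x - y)\<bar> powr p) \<partial>lborel) = ennreal \<bar>K y\<bar> * Lp_pow p g" .
  qed
  also have "\<dots> = (\<integral>\<^sup>+y. ennreal \<bar>K y\<bar> \<partial>lborel) * Lp_pow p g"
    by (rule nn_integral_multc) simp
  also have "(\<integral>\<^sup>+y. ennreal \<bar>K y\<bar> \<partial>lborel) = ennreal (\<integral>y. \<bar>K y\<bar> \<partial>lborel)"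
    by (rule nn_integral_eq_integral) (use K in auto)
  finally show L: "?L = ennreal (\<integral>y. \<bar>K y\<bar> \<partial>lborel) * Lp_pow p g" .
  have "?L \<noteq> \<infinity>" unfolding L using fin by (simp add: ennreal_mult_eq_top_iff)
  then have "AE x in lborel. (\<integral>\<^sup>+y. ennreal (\<bar>K y\<bar> * \<bar>g (x - y)\<bar> powr p) \<partial>lborel) \<noteq> \<infinity>"
    by (intro nn_integral_PInf_AE) measurable
  then show A: "AE x in lborel. integrable lborel (\<lambda>y. \<bar>K y\<bar> * \<bar>g (x - y)\<bar> powr p)"
  proof eventually_elim
    fix x assume "(\<integral>\<^sup>+y. ennreal (\<bar>K y\<bar> * \<bar>g (x - y)\<bar> powr p) \<partial>lborel) \<noteq> \<infinity>"
    then show "integrable lborel (\<lambda>y. \<bar>K y\<bar> * \<bar>g (x - y)\<bar> powr p)"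
      by (intro integrableI_bounded) (auto simp: less_top abs_mult)
  qed
  then show "AE x in lborel. integrable lborel (\<lambda>y. K y * g (x - y))"
  proof eventually_elim
    fix x assume i: "integrable lborel (\<lambda>y. \<bar>K y\<bar> * \<bar>g (x - y)\<bar> powr p)"
    show "integrable lborel (\<lambda>y. K y * g (x - y))"
    proof (rule Bochner_Integration.integrable_bound)
      show "integrable lborel (\<lambda>y. \<bar>K y\<bar> + \<bar>K y\<bar> * \<bar>g (x - y)\<bar> powr p)" using i K by auto
      have "\<bar>g z\<bar> \<le> 1 + \<bar>g z\<bar> powr p" for z
      proof (cases "\<bar>g z\<bar> \<le> 1")
        case False
        then have "\<bar>g z\<bar> powr 1 \<le> \<bar>g z\<bar> powr p" using p by (intro powr_mono) auto
        then show ?thesis using False by simp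
      qed (simp add: add_increasing2)
      then have "\<bar>K y\<bar> * \<bar>g (x - y)\<bar> \<le> \<bar>K y\<bar> * (1 + \<bar>g (x - y)\<bar> powr p)" for y
        by (intro mult_left_mono) auto
      then show "AE y in lborel. norm (K y * g (x - y)) \<le> norm (\<bar>K y\<bar> + \<bar>K y\<bar> * \<bar>g (x - y)\<bar> powr p)"
        by (auto simp: abs_mult algebra_simps)
    qed measurable
  qed
qed

text \<open>Young's convolution inequality for an integrable kernel: Jensen with the weight |K|
  inside, Tonelli outside.\<close>

lemma conv_Lp_bound:
  fixes K g :: "'a::euclidean_space \<Rightarrow> real"
  assumes K: "integrable lborel K" and g[measurable]: "g \<in> borel_measurable borel"
    and p: "1 \<le> p" and fin: "Lp_pow p g < \<infinity>"
  shows "Lp_pow p (conv K g) \<le> ennreal ((\<integral>y. \<bar>K y\<bar> \<partial>lborel) powr p) * Lp_pow p g"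
proof -
  let ?m = "\<integral>y. \<bar>K y\<bar> \<partial>lborel"
  have Km[measurable]: "K \<in> borel_measurable borel" using K by auto
  have m0: "0 \<le> ?m" by simp
  have "Lp_pow p (conv K g) \<le> (\<integral>\<^sup>+x. ennreal (?m powr (p - 1)) * (\<integral>\<^sup>+y. ennreal (\<bar>K y\<bar> * \<bar>g (x - y)\<bar> powr p) \<partial>lborel) \<partial>lborel)"
    unfolding Lp_pow_def
  proof (rule nn_integral_mono_AE)
    show "AE x in lborel. ennreal (\<bar>conv K g x\<bar> powr p) \<le> ennreal (?m powr (p - 1)) * (\<integral>\<^sup>+y. ennreal (\<bar>K y\<bar> * \<bar>g (x - y)\<bar> powr p) \<partial>lborel)"
      using conv_Lp_finite(2)[OF K g p fin] conv_Lp_finite(3)[OF K g p fin]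
    proof eventually_elim
      fix x
      assume i: "integrable lborel (\<lambda>y. \<bar>K y\<bar> * \<bar>g (x - y)\<bar> powr p)" "integrable lborel (\<lambda>y. K y * g (x - y))"
      have i2: "integrable lborel (\<lambda>y. \<bar>K y\<bar> * \<bar>g (x - y)\<bar>)"
        using integrable_abs[OF i(2)] by (simp add: abs_mult)
      have "\<bar>conv K g x\<bar> \<le> (\<integral>y. \<bar>K y\<bar> * \<bar>g (x - y)\<bar> \<partial>lborel)"
        unfolding conv_def using integral_abs_bound[of lborel "\<lambda>y. K y * g (x - y)"] by (simp add: abs_mult)
      then have "\<bar>conv K g x\<bar> powr p \<le> (\<integral>y. \<bar>K y\<bar> * \<bar>g (x - y)\<bar> \<partial>lborel) powr p"
        using p by (intro powr_mono2) auto
      also have "\<dots> \<le> ?m powr (p - 1) * (\<integral>y. \<bar>K y\<bar> * \<bar>g (x - y)\<bar> powr p \<partial>lborel)"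
        by (rule jensen_powr) (use K i i2 p in auto)
      finally have "ennreal (\<bar>conv K g x\<bar> powr p) \<le> ennreal (?m powr (p - 1)) * ennreal (\<integral>y. \<bar>K y\<bar> * \<bar>g (x - y)\<bar> powr p \<partial>lborel)"
        by (simp add: ennreal_mult[symmetric])
      also have "ennreal (\<integral>y. \<bar>K y\<bar> * \<bar>g (x - y)\<bar> powr p \<partial>lborel) = (\<integral>\<^sup>+y. ennreal (\<bar>K y\<bar> * \<bar>g (x - y)\<bar> powr p) \<partial>lborel)"
        by (rule nn_integral_eq_integral[symmetric]) (use i in auto)
      finally show "ennreal (\<bar>conv K g x\<bar> powr p) \<le> ennreal (?m powr (p - 1)) * (\<integral>\<^sup>+y. ennreal (\<bar>K y\<bar> * \<bar>g (x - y)\<bar> powr p) \<partial>lborel)" .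
    qed
  qed
  also have "\<dots> = ennreal (?m powr (p - 1)) * (ennreal ?m * Lp_pow p g)"
    by (subst nn_integral_cmult) (simp_all add: conv_Lp_finite(1)[OF K g p fin])
  also have "\<dots> = ennreal (?m powr p) * Lp_pow p g"
  proof -
    have "?m powr (p - 1) * ?m = ?m powr p"
    proof (cases "?m = 0")
      case False
      then have "?m > 0" using m0 by linarith
      then show ?thesis by (simp add: powr_diff)
    qed simp
    then show ?thesis by (metis ennreal_mult m0 mult.assoc powr_ge_zero)
  qed
  finally show ?thesis .
qed


section \<open>Differences of iterated convolutions\<close>

definition Dif :: "'a::euclidean_space \<Rightarrow> ('a \<Rightarrow> real) \<Rightarrow> 'a \<Rightarrow> real" where
  "Dif h f x = f (x + h) - f x"

lemma measurable_Dif [measurable]: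
  assumes [measurable]: "f \<in> borel_measurable borel"
  shows "Dif h f \<in> borel_measurable borel"
  unfolding Dif_def[abs_def] by simp

lemma measurable_Dif_pow [measurable]: "f \<in> borel_measurable borel \<Longrightarrow> (Dif h ^^ i) f \<in> borel_measurable borel"
  by (induction i) auto

lemma Lp_pow_translate:
  assumes "f \<in> borel_measurable borel"
  shows "Lp_pow p (\<lambda>x. f (x + h)) = Lp_pow p f"
  unfolding Lp_pow_def
  by (rule nn_integral_lborel_translate(1)[where f="\<lambda>x. ennreal (\<bar>f x\<bar> powr p)"]) (use assms in measurable)

lemma powr_add_le:
  fixes a b p :: real
  assumes "0 \<le> p"
  shows "\<bar>a + b\<bar> powr p \<le> 2 powr p * (\<bar>a\<bar> powr p + \<bar>b\<bar> powr p)"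
proof -
  have "\<bar>a + b\<bar> powr p \<le> (2 * max \<bar>a\<bar> \<bar>b\<bar>) powr p"
    using assms by (intro powr_mono2) auto
  also have "\<dots> = 2 powr p * max \<bar>a\<bar> \<bar>b\<bar> powr p" by (simp add: powr_mult)
  also have "max \<bar>a\<bar> \<bar>b\<bar> powr p \<le> \<bar>a\<bar> powr p + \<bar>b\<bar> powr p" by (simp add: max_def)
  finally show ?thesis by (simp add: mult_left_mono)
qed

lemma Lp_pow_add:
  assumes [measurable]: "f \<in> borel_measurable borel" "g \<in> borel_measurable borel" and "0 \<le> p"
  shows "Lp_pow p (\<lambda>x. f x + g x) \<le> ennreal (2 powr p) * (Lp_pow p f + Lp_pow p g)"
proof -
  have "Lp_pow p (\<lambda>x. f x + g x) \<le> (\<integral>\<^sup>+x. ennreal (2 powr p) * (ennreal (\<bar>f x\<bar> powr p) + ennreal (\<bar>g x\<bar> powr p)) \<partial>lborel)"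
    unfolding Lp_pow_def
    by (intro nn_integral_mono) (simp add: ennreal_mult[symmetric] ennreal_plus[symmetric] powr_add_le assms(3) del: ennreal_plus)
  also have "\<dots> = ennreal (2 powr p) * (Lp_pow p f + Lp_pow p g)"
    unfolding Lp_pow_def by (simp add: nn_integral_cmult nn_integral_add)
  finally show ?thesis .
qed

lemma Lp_pow_Dif_finite:
  assumes [measurable]: "f \<in> borel_measurable borel" and "0 \<le> p" "Lp_pow p f < \<infinity>"
  shows "Lp_pow p (Dif h f) < \<infinity>"
proof -
  have "Lp_pow p (Dif h f) \<le> ennreal (2 powr p) * (Lp_pow p (\<lambda>x. f (x + h)) + Lp_pow p (\<lambda>x. - f x))"
    using Lp_pow_add[of "\<lambda>x. f (x + h)" "\<lambda>x. - f x" p] assms by (simp add: Dif_def[abs_def])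
  also have "\<dots> = ennreal (2 powr p) * (Lp_pow p f + Lp_pow p f)"
    by (simp add: Lp_pow_translate) (simp add: Lp_pow_def)
  also have "\<dots> < \<infinity>" using assms(3) by (simp add: ennreal_mult_less_top)
  finally show ?thesis .
qed

lemma Lp_pow_Dif_pow_finite:
  assumes "f \<in> borel_measurable borel" "0 \<le> p" "Lp_pow p f < \<infinity>"
  shows "Lp_pow p ((Dif h ^^ i) f) < \<infinity>"
proof (induction i)
  case (Suc i)
  then show ?case using Lp_pow_Dif_finite[OF measurable_Dif_pow[OF assms(1)] assms(2)] by simp
qed (use assms in simp)

lemma conv_translate:
  assumes [measurable]: "K \<in> borel_measurable borel" "g \<in> borel_measurable borel"
  shows "conv K g (x + h) = conv (\<lambda>y. K (y + h)) g x"
proof -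
  have "(\<integral>y. K (y + h) * g (x + h - (y + h)) \<partial>lborel) = (\<integral>y. K y * g (x + h - y) \<partial>lborel)"
    by (rule integral_lborel_translate(1)[where f="\<lambda>y. K y * g (x + h - y)"]) simp
  then show ?thesis unfolding conv_def by simp
qed

text \<open>A difference may be moved to either factor. Both identities hold only almost everywhere,
  since at exceptional points a convolution integral may diverge and then takes the default value
  0.\<close>

lemma Dif_conv:
  fixes K g :: "'a::euclidean_space \<Rightarrow> real"
  assumes K: "integrable lborel K" and g[measurable]: "g \<in> borel_measurable borel"
    and p: "1 \<le> p" and fin: "Lp_pow p g < \<infinity>"
  shows "AE x in lborel. Dif h (conv K g) x = conv (Dif h K) g x"
    and "AE x in lborel. Dif h (conv K g) x = conv K (Dif h g) x"
proof -
  have Km[measurable]: "K \<in> borel_measurable borel" using K by auto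
  have K': "integrable lborel (\<lambda>y. K (y + h))" by (rule integrable_lborel_translate(1)[OF K])
  note A = conv_Lp_finite(3)[OF K g p fin]
  show "AE x in lborel. Dif h (conv K g) x = conv (Dif h K) g x"
    using A conv_Lp_finite(3)[OF K' g p fin]
  proof eventually_elim
    fix x assume i: "integrable lborel (\<lambda>y. K y * g (x - y))" "integrable lborel (\<lambda>y. K (y + h) * g (x - y))"
    have "Dif h (conv K g) x = conv (\<lambda>y. K (y + h)) g x - conv K g x"
      by (simp only: Dif_def conv_translate[OF Km g])
    also have "\<dots> = conv (Dif h K) g x"
      unfolding conv_def Dif_def
      by (subst Bochner_Integration.integral_diff[symmetric]) (use i in \<open>simp_all add: left_diff_distrib\<close>)
    finally show "Dif h (conv K g) x = conv (Dif h K) g x" .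
  qed
  show "AE x in lborel. Dif h (conv K g) x = conv K (Dif h g) x"
    using A AE_lborel_translate[OF A, of h]
  proof eventually_elim
    fix x assume i: "integrable lborel (\<lambda>y. K y * g (x - y))" "integrable lborel (\<lambda>y. K y * g (x + h - y))"
    show "Dif h (conv K g) x = conv K (Dif h g) x"
      unfolding Dif_def conv_def
      by (subst Bochner_Integration.integral_diff[symmetric]) (use i in \<open>simp_all add: right_diff_distrib algebra_simps\<close>)
  qed
qed

lemma Dif_cong_AE:
  assumes "AE x in lborel. f x = g x"
  shows "AE x in lborel. Dif h f x = Dif h g x"
  using assms AE_lborel_translate[OF assms, of h] by eventually_elim (simp add: Dif_def)

lemma Dif_pow_conv:
  fixes K g :: "'a::euclidean_space \<Rightarrow> real"
  assumes K: "integrable lborel K" and g: "g \<in> borel_measurable borel"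
    and p: "1 \<le> p" and fin: "Lp_pow p g < \<infinity>"
  shows "AE x in lborel. (Dif h ^^ i) (conv K g) x = conv K ((Dif h ^^ i) g) x"
proof (induction i)
  case (Suc i)
  have "AE x in lborel. Dif h (conv K ((Dif h ^^ i) g)) x = conv K (Dif h ((Dif h ^^ i) g)) x"
    using g p fin by (intro Dif_conv(2)[OF K _ p] Lp_pow_Dif_pow_finite measurable_Dif_pow) auto
  with Dif_cong_AE[OF Suc.IH, of h] show ?case by eventually_elim simp
qed simp

lemma conv_pow_Lp:
  fixes K g :: "'a::euclidean_space \<Rightarrow> real"
  assumes K: "integrable lborel K" "(\<integral>y. \<bar>K y\<bar> \<partial>lborel) \<le> 1" and g: "g \<in> borel_measurable borel"
    and p: "1 \<le> p" and fin: "Lp_pow p g < \<infinity>"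
  shows "(conv K ^^ m) g \<in> borel_measurable borel" "Lp_pow p ((conv K ^^ m) g) \<le> Lp_pow p g"
proof (induction m)
  case (Suc m)
  have Km: "K \<in> borel_measurable borel" using K by auto
  case 1 show ?case using Suc(1) Km by simp
  case 2
  have "(\<integral>y. \<bar>K y\<bar> \<partial>lborel) powr p \<le> 1" using K(2) p by (intro powr_le1) auto
  then have "ennreal ((\<integral>y. \<bar>K y\<bar> \<partial>lborel) powr p) * Lp_pow p ((conv K ^^ m) g) \<le> 1 * Lp_pow p g"
    by (intro mult_mono Suc(2)) auto
  moreover have "Lp_pow p ((conv K ^^ m) g) < \<infinity>" using Suc(2) fin by (rule le_less_trans)
  note conv_Lp_bound[OF K(1) Suc(1) p this]
  ultimately show ?case by simp
qed (use g in auto)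

text \<open>Each of the \<open>i\<close> differences is placed on a kernel of its own and costs
  \<open>\<kappa>\<close> in L_1; each remaining kernel has L_1 norm at most 1. This is why
  \<open>i\<close> may not exceed the number of kernels.\<close>

lemma Dif_pow_conv_pow_bound:
  fixes K g :: "'a::euclidean_space \<Rightarrow> real"
  assumes K: "integrable lborel K" "(\<integral>y. \<bar>K y\<bar> \<partial>lborel) \<le> 1"
    and D: "(\<integral>y. \<bar>Dif h K y\<bar> \<partial>lborel) \<le> \<kappa>"
    and g: "g \<in> borel_measurable borel" and p: "1 \<le> p" and fin: "Lp_pow p g < \<infinity>" and "i \<le> m"
  shows "Lp_pow p ((Dif h ^^ i) ((conv K ^^ m) g)) \<le> ennreal ((\<kappa> ^ i) powr p) * Lp_pow p g"
  using \<open>i \<le> m\<close>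
proof (induction m arbitrary: i)
  case 0
  then show ?case by simp
next
  case (Suc m)
  show ?case
  proof (cases i)
    case 0
    then show ?thesis using conv_pow_Lp(2)[OF K g p fin, of "Suc m"] by simp
  next
    case (Suc j)
    let ?f = "(conv K ^^ m) g" and ?F = "(Dif h ^^ j) ((conv K ^^ m) g)"
    have f: "?f \<in> borel_measurable borel" "Lp_pow p ?f < \<infinity>"
      using conv_pow_Lp[OF K g p fin, of m] fin by (auto intro: order.strict_trans1)
    have F: "?F \<in> borel_measurable borel" "Lp_pow p ?F < \<infinity>"
      using measurable_Dif_pow[OF f(1)] Lp_pow_Dif_pow_finite[OF f(1) _ f(2)] p by simp_all
    have "0 \<le> (\<integral>y. \<bar>Dif h K y\<bar> \<partial>lborel)" by simp
    then have \<kappa>: "0 \<le> \<kappa>" using D by linarith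
    have DK: "integrable lborel (Dif h K)"
      unfolding Dif_def[abs_def] using K(1) integrable_lborel_translate(1)[OF K(1)] by auto
    have "AE x in lborel. (Dif h ^^ i) (conv K ?f) x = conv (Dif h K) ?F x"
      using Dif_cong_AE[OF Dif_pow_conv[OF K(1) f(1) p f(2), of j h], of h]
        Dif_conv(1)[OF K(1) F(1) p F(2), of h]
      unfolding \<open>i = Suc j\<close> by eventually_elim simp
    then have "Lp_pow p ((Dif h ^^ i) (conv K ?f)) = Lp_pow p (conv (Dif h K) ?F)"
      by (rule Lp_pow_cong_AE)
    also have "\<dots> \<le> ennreal ((\<integral>y. \<bar>Dif h K y\<bar> \<partial>lborel) powr p) * Lp_pow p ?F"
      by (rule conv_Lp_bound[OF DK F(1) p F(2)])
    also have "\<dots> \<le> ennreal (\<kappa> powr p) * (ennreal ((\<kappa> ^ j) powr p) * Lp_pow p g)"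
      using Suc.IH[of j] Suc.prems \<open>i = Suc j\<close> D p
      by (intro mult_mono ennreal_leI powr_mono2) auto
    also have "\<dots> = ennreal ((\<kappa> ^ i) powr p) * Lp_pow p g"
      using \<kappa> by (simp add: \<open>i = Suc j\<close> powr_mult ennreal_mult mult.assoc)
    finally show ?thesis by simp
  qed
qed


section \<open>Gaussian densities\<close>

text \<open>Lebesgue measure is the image of the product measure over \<open>Basis\<close>, so
  integrals of products over the coordinates factor.\<close>

lemma integral_lborel_prod_Basis:
  fixes f :: "'a::euclidean_space \<Rightarrow> real \<Rightarrow> 'c::{real_normed_field, banach, second_countable_topology}"
  assumes f: "\<And>b. b \<in> Basis \<Longrightarrow> integrable lborel (f b)"
  shows "integrable lborel (\<lambda>x::'a. \<Prod>b\<in>Basis. f b (x \<bullet> b))"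
    and "(\<integral>(x::'a). (\<Prod>b\<in>Basis. f b (x \<bullet> b)) \<partial>lborel) = (\<Prod>b\<in>Basis. \<integral>t. f b t \<partial>lborel)"
proof -
  interpret product_sigma_finite "\<lambda>_::'a. lborel :: real measure" ..
  have [measurable]: "\<And>b. b \<in> Basis \<Longrightarrow> f b \<in> borel_measurable borel" using f by auto
  have m: "(\<lambda>x::'a. \<Prod>b\<in>Basis. f b (x \<bullet> b)) \<in> borel_measurable borel" by measurable
  have e: "(\<Prod>b\<in>Basis. f b ((\<Sum>b\<in>Basis. g b *\<^sub>R b) \<bullet> b)) = (\<Prod>b\<in>Basis. f b (g b))" for g
    by (intro prod.cong refl) (simp add: inner_sum_left_Basis)
  show "integrable lborel (\<lambda>x::'a. \<Prod>b\<in>Basis. f b (x \<bullet> b))"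
    by (subst lborel_eq, subst integrable_distr_eq)
       (use m product_integrable_prod[of Basis f] f in \<open>auto simp: e\<close>)
  show "(\<integral>(x::'a). (\<Prod>b\<in>Basis. f b (x \<bullet> b)) \<partial>lborel) = (\<Prod>b\<in>Basis. \<integral>t. f b t \<partial>lborel)"
    by (subst lborel_eq, subst integral_distr)
       (use m product_integral_prod[of Basis f] f in \<open>auto simp: e\<close>)
qed

definition gauss :: "'a::euclidean_space \<Rightarrow> real" where
  "gauss z = (\<Prod>b\<in>Basis. std_normal_density (z \<bullet> b))"

lemma gauss_eq: "gauss (z::'a::euclidean_space) = (1 / sqrt (2 * pi)) ^ DIM('a) * exp (- (norm z)\<^sup>2 / 2)"
proof -
  have "(norm z)\<^sup>2 = (\<Sum>b\<in>Basis. (z \<bullet> b)\<^sup>2)"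
    unfolding power2_norm_eq_inner by (subst euclidean_inner) (simp add: power2_eq_square)
  then have "exp (- (norm z)\<^sup>2 / 2) = (\<Prod>b\<in>Basis. exp (- (z \<bullet> b)\<^sup>2 / 2))"
    by (simp add: exp_sum[symmetric] sum_negf sum_divide_distrib)
  then show ?thesis
    unfolding gauss_def std_normal_density_def by (simp add: prod_dividef power_divide)
qed

lemma gauss_nonneg: "0 \<le> gauss z"
  by (simp add: gauss_eq)

lemma measurable_gauss [measurable]: "gauss \<in> borel_measurable borel"
  unfolding gauss_def[abs_def] by measurable

lemma gauss_minus: "gauss (- z) = gauss z"
  by (simp add: gauss_eq)

lemma gauss_integrable: "integrable lborel (gauss :: 'a::euclidean_space \<Rightarrow> real)"
  and gauss_integral: "(\<integral>(z::'a::euclidean_space). gauss z \<partial>lborel) = 1"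
proof -
  have "integrable lborel std_normal_density" by simp
  from integral_lborel_prod_Basis[where 'a='a and f="\<lambda>_. std_normal_density", OF this]
  show "integrable lborel (gauss :: 'a \<Rightarrow> real)" "(\<integral>(z::'a). gauss z \<partial>lborel) = 1"
    by (simp_all add: gauss_def[abs_def] integral_normal_density)
qed

lemma std_normal_fourier: "(\<integral>x. iexp (t * x) * of_real (std_normal_density x) \<partial>lborel) = of_real (exp (- t\<^sup>2 / 2))"
    and std_normal_fourier_integrable: "integrable lborel (\<lambda>x. iexp (t * x) * of_real (std_normal_density x))"
proof -
  have "(\<integral>x. iexp (t * x) * of_real (std_normal_density x) \<partial>lborel) = char std_normal_distribution t"
    unfolding char_def by (subst integral_density) (simp_all add: scaleR_conv_of_real mult.commute)
  then show "(\<integral>x. iexp (t * x) * of_real (std_normal_density x) \<partial>lborel) = of_real (exp (- t\<^sup>2 / 2))"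
    by (simp add: char_std_normal_distribution)
  show "integrable lborel (\<lambda>x. iexp (t * x) * of_real (std_normal_density x))"
    by (rule Bochner_Integration.integrable_bound[of _ std_normal_density]) (auto simp: norm_mult)
qed

lemma cis_inner_prod: "cis (z \<bullet> \<xi>) = (\<Prod>b\<in>Basis. iexp ((\<xi> \<bullet> b) * (z \<bullet> b)))"
proof -
  have "cis (z \<bullet> \<xi>) = exp (\<Sum>b\<in>Basis. \<i> * complex_of_real ((\<xi> \<bullet> b) * (z \<bullet> b)))"
    unfolding cis_conv_exp by (subst euclidean_inner) (simp add: sum_distrib_left mult_ac)
  then show ?thesis by (simp add: exp_sum)
qed

lemma gauss_fourier:
  fixes \<xi> :: "'a::euclidean_space"
  shows "(\<integral>z. cis (z \<bullet> \<xi>) * of_real (gauss z) \<partial>lborel) = of_real (exp (- (norm \<xi>)\<^sup>2 / 2))"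
    and "integrable lborel (\<lambda>z. cis (z \<bullet> \<xi>) * of_real (gauss z))"
proof -
  let ?f = "\<lambda>b x. iexp ((\<xi> \<bullet> b) * x) * of_real (std_normal_density x)"
  have e: "cis (z \<bullet> \<xi>) * of_real (gauss z) = (\<Prod>b\<in>Basis. ?f b (z \<bullet> b))" for z
    by (simp add: cis_inner_prod gauss_def prod.distrib)
  have "(\<integral>z. cis (z \<bullet> \<xi>) * of_real (gauss z) \<partial>lborel) = (\<Prod>b\<in>Basis. of_real (exp (- (\<xi> \<bullet> b)\<^sup>2 / 2)))"
    unfolding e integral_lborel_prod_Basis(2)[of ?f, OF std_normal_fourier_integrable] std_normal_fourier ..
  moreover have "(norm \<xi>)\<^sup>2 = (\<Sum>b\<in>Basis. (\<xi> \<bullet> b)\<^sup>2)"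
    unfolding power2_norm_eq_inner by (subst euclidean_inner) (simp add: power2_eq_square)
  ultimately show "(\<integral>z. cis (z \<bullet> \<xi>) * of_real (gauss z) \<partial>lborel) = of_real (exp (- (norm \<xi>)\<^sup>2 / 2))"
    by (simp add: exp_sum[symmetric] sum_negf sum_divide_distrib flip: of_real_prod)
  show "integrable lborel (\<lambda>z. cis (z \<bullet> \<xi>) * of_real (gauss z))"
    unfolding e by (rule integral_lborel_prod_Basis(1)[of ?f, OF std_normal_fourier_integrable])
qed

lemma power_le_fact_exp:
  fixes r :: real
  assumes "0 \<le> r"
  shows "r ^ k \<le> fact k * exp r"
proof -
  have "(\<Sum>n\<in>{k}. r ^ n / fact n) \<le> (\<Sum>n. r ^ n / fact n)"
    using summable_exp_generic[of r] assms by (intro sum_le_suminf) (auto simp: field_simps)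
  then have "r ^ k / fact k \<le> exp r" by (simp add: exp_def field_simps)
  then show ?thesis by (simp add: field_simps)
qed

text \<open>The power is absorbed by an exponential and this by the Gaussian, which leaves a
  multiple of a wider Gaussian as integrable majorant.\<close>

lemma gauss_moment: "integrable lborel (\<lambda>z::'a::euclidean_space. norm z ^ k * gauss z)"
proof (rule Bochner_Integration.integrable_bound)
  let ?C = "fact k * exp 1 :: real"
  have "integrable lborel (\<lambda>z::'a. gauss (0 + (1 / sqrt 2) *\<^sub>R z))"
    using integrable_lborel_affine_iff[of "gauss :: 'a \<Rightarrow> real" "1 / sqrt 2" 0] gauss_integrable by simp
  then show "integrable lborel (\<lambda>z::'a. ?C * gauss ((1 / sqrt 2) *\<^sub>R z))" by simp
  show "AE z::'a in lborel. norm (norm z ^ k * gauss z) \<le> norm (?C * gauss ((1 / sqrt 2) *\<^sub>R z))"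
  proof (rule AE_I2)
    fix z :: 'a
    let ?r = "norm z" and ?c = "(1 / sqrt (2 * pi)) ^ DIM('a)"
    \<comment> \<open>Completing the square: r - r^2 / 2 \<le> 1 - r^2 / 4, so the exponential of r
      costs half of the Gaussian exponent and a factor exp 1.\<close>
    have "0 \<le> (?r / 2 - 1)\<^sup>2" by simp
    then have "?r + - ?r\<^sup>2 / 2 \<le> 1 + - (?r\<^sup>2 / 2) / 2" by (simp add: power2_eq_square algebra_simps)
    then have "exp ?r * exp (- ?r\<^sup>2 / 2) \<le> exp 1 * exp (- (?r\<^sup>2 / 2) / 2)"
      unfolding exp_add[symmetric] exp_le_cancel_iff .
    then have *: "fact k * (exp ?r * exp (- ?r\<^sup>2 / 2)) \<le> fact k * (exp 1 * exp (- (?r\<^sup>2 / 2) / 2))"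
      by (rule mult_left_mono) simp
    have "?r ^ k * exp (- ?r\<^sup>2 / 2) \<le> (fact k * exp ?r) * exp (- ?r\<^sup>2 / 2)"
      by (intro mult_right_mono power_le_fact_exp) auto
    also have "\<dots> \<le> ?C * exp (- (?r\<^sup>2 / 2) / 2)" using * by (simp only: mult.assoc)
    finally have "?r ^ k * exp (- ?r\<^sup>2 / 2) \<le> ?C * exp (- (?r\<^sup>2 / 2) / 2)" .
    then have "?c * (?r ^ k * exp (- ?r\<^sup>2 / 2)) \<le> ?c * (?C * exp (- (?r\<^sup>2 / 2) / 2))"
      by (intro mult_left_mono) auto
    moreover have "(norm ((1 / sqrt 2) *\<^sub>R z))\<^sup>2 = ?r\<^sup>2 / 2" by (simp add: power_divide)
    ultimately have "?r ^ k * gauss z \<le> ?C * gauss ((1 / sqrt 2) *\<^sub>R z)"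
      unfolding gauss_eq by (simp only: mult_ac)
    then show "norm (?r ^ k * gauss z) \<le> norm (?C * gauss ((1 / sqrt 2) *\<^sub>R z))"
      using gauss_nonneg[of z] gauss_nonneg[of "(1 / sqrt 2) *\<^sub>R z"] by (simp add: abs_mult)
  qed
qed measurable

lemma abs_exp_diff_le:
  fixes a b :: real
  shows "\<bar>exp (- a) - exp (- b)\<bar> \<le> \<bar>a - b\<bar> * exp (- min a b)"
proof -
  have *: "\<bar>exp (- a) - exp (- b)\<bar> \<le> \<bar>a - b\<bar> * exp (- min a b)" if "a \<le> b" for a b :: real
  proof -
    have "1 - exp (a - b) \<le> b - a" using exp_ge_add_one_self[of "a - b"] by linarith
    then have "exp (- a) * (1 - exp (a - b)) \<le> exp (- a) * (b - a)" by (intro mult_left_mono) auto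
    moreover have "exp (- a) * (1 - exp (a - b)) = exp (- a) - exp (- b)"
      by (simp add: right_diff_distrib exp_add[symmetric])
    moreover have "exp (- b) \<le> exp (- a)" using that by simp
    ultimately show ?thesis using that by (simp add: mult.commute)
  qed
  show ?thesis
  proof (cases "a \<le> b")
    case False
    then show ?thesis using *[of b a] by (simp add: abs_minus_commute min.commute)
  qed (rule *)
qed

text \<open>For \<open>norm w \<le> 1\<close> the two radii differ by at most 1, so the linear
  factor can be expressed by the radius at which the larger Gaussian is taken. The bound is one
  integrable function plus its translate, hence its integral does not depend on \<open>w\<close>
  apart from the factor \<open>norm w\<close>.\<close>

lemma gauss_diff_pointwise:
  fixes z w :: "'a::euclidean_space"
  assumes w: "norm w \<le> 1"
  shows "\<bar>gauss (z + w) - gauss z\<bar> \<le> norm w * ((2 * norm (z + w) + 1) * gauss (z + w) + (2 * norm z + 1) * gauss z)"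
proof -
  let ?a = "(norm (z + w))\<^sup>2 / 2" and ?b = "(norm z)\<^sup>2 / 2" and ?c = "(1 / sqrt (2 * pi)) ^ DIM('a)"
  have nw: "\<bar>norm (z + w) - norm z\<bar> \<le> norm w" using norm_triangle_ineq3[of "z + w" z] by simp
  have "?a - ?b = (norm (z + w) - norm z) * ((norm (z + w) + norm z) / 2)"
    by (simp add: power2_eq_square algebra_simps)
  then have "\<bar>?a - ?b\<bar> = \<bar>(norm (z + w) - norm z) * ((norm (z + w) + norm z) / 2)\<bar>" by (simp only:)
  also have "\<dots> = \<bar>norm (z + w) - norm z\<bar> * ((norm (z + w) + norm z) / 2)" by (simp add: abs_mult)
  also have "\<dots> \<le> norm w * (norm (z + w) + norm z)"
    using nw by (intro mult_mono) auto
  finally have ab: "\<bar>?a - ?b\<bar> \<le> norm w * (norm (z + w) + norm z)" .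
  have m: "(norm (z + w) + norm z) * exp (- min ?a ?b) \<le> (2 * norm (z + w) + 1) * exp (- ?a) + (2 * norm z + 1) * exp (- ?b)"
  proof (cases "?a \<le> ?b")
    case True
    have "(norm (z + w) + norm z) * exp (- ?a) \<le> (2 * norm (z + w) + 1) * exp (- ?a)"
      using nw w by (intro mult_right_mono) auto
    then show ?thesis using True by (simp add: add_increasing2)
  next
    case False
    have "(norm (z + w) + norm z) * exp (- ?b) \<le> (2 * norm z + 1) * exp (- ?b)"
      using nw w by (intro mult_right_mono) auto
    then show ?thesis using False by (simp add: add_increasing)
  qed
  have "\<bar>exp (- ?a) - exp (- ?b)\<bar> \<le> (norm w * (norm (z + w) + norm z)) * exp (- min ?a ?b)"
    by (rule order_trans[OF abs_exp_diff_le]) (intro mult_right_mono ab, simp)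
  also have "\<dots> \<le> norm w * ((2 * norm (z + w) + 1) * exp (- ?a) + (2 * norm z + 1) * exp (- ?b))"
    using m by (simp add: mult.assoc mult_left_mono)
  finally have "?c * \<bar>exp (- ?a) - exp (- ?b)\<bar> \<le> ?c * (norm w * ((2 * norm (z + w) + 1) * exp (- ?a) + (2 * norm z + 1) * exp (- ?b)))"
    by (intro mult_left_mono) auto
  moreover have "?c * \<bar>exp (- ?a) - exp (- ?b)\<bar> = \<bar>gauss (z + w) - gauss z\<bar>"
  proof -
    have "gauss (z + w) - gauss z = ?c * (exp (- ?a) - exp (- ?b))" by (simp add: gauss_eq right_diff_distrib)
    then show ?thesis by (simp add: abs_mult)
  qed
  ultimately show ?thesis by (simp add: gauss_eq algebra_simps)
qed

text \<open>Short translations have an L_1 error linear in \<open>norm w\<close>, long ones an error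
  of at most 2. Together they give every exponent \<open>s\<close> in [0,1] with one
  constant.\<close>

lemma gauss_diff_L1:
  obtains C :: real where "0 \<le> C"
    "\<forall>(w::'a::euclidean_space) s. 0 \<le> s \<longrightarrow> s \<le> 1 \<longrightarrow>
       (\<integral>\<^sup>+z. ennreal \<bar>gauss (z + w) - gauss z\<bar> \<partial>lborel) \<le> ennreal (C * norm w powr s)"
proof -
  define A where "A = (\<integral>(z::'a). (2 * norm z + 1) * gauss z \<partial>lborel)"
  have i: "integrable lborel (\<lambda>z::'a. (2 * norm z + 1) * gauss z)"
  proof -
    have "integrable lborel (\<lambda>z::'a. 2 * (norm z ^ 1 * gauss z) + gauss z)"
      by (intro Bochner_Integration.integrable_add Bochner_Integration.integrable_mult_right gauss_moment gauss_integrable)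
    then show ?thesis by (simp add: distrib_right mult.assoc)
  qed
  have A0: "0 \<le> A" unfolding A_def by (intro Bochner_Integration.integral_nonneg mult_nonneg_nonneg gauss_nonneg) auto
  have A: "(\<integral>\<^sup>+(z::'a). ennreal ((2 * norm z + 1) * gauss z) \<partial>lborel) = ennreal A"
    unfolding A_def by (rule nn_integral_eq_integral[OF i]) (simp add: gauss_nonneg)
  have At: "(\<integral>\<^sup>+(z::'a). ennreal ((2 * norm (z + w) + 1) * gauss (z + w)) \<partial>lborel) = ennreal A" for w
    using nn_integral_lborel_translate(1)[of "\<lambda>z::'a. ennreal ((2 * norm z + 1) * gauss z)" w] A by simp
  have g1: "(\<integral>\<^sup>+(z::'a). ennreal (gauss z) \<partial>lborel) = 1"
    using nn_integral_eq_integral[OF gauss_integrable[where 'a='a]] by (simp add: gauss_nonneg gauss_integral)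
  have g1t: "(\<integral>\<^sup>+(z::'a). ennreal (gauss (z + w)) \<partial>lborel) = 1" for w
    using nn_integral_lborel_translate(1)[of "\<lambda>z::'a. ennreal (gauss z)" w] g1 by simp
  have two: "(\<integral>\<^sup>+(z::'a). ennreal \<bar>gauss (z + w) - gauss z\<bar> \<partial>lborel) \<le> 2" for w
  proof -
    have "(\<integral>\<^sup>+(z::'a). ennreal \<bar>gauss (z + w) - gauss z\<bar> \<partial>lborel) \<le> (\<integral>\<^sup>+(z::'a). ennreal (gauss (z + w)) + ennreal (gauss z) \<partial>lborel)"
    proof (rule nn_integral_mono)
      fix z :: 'a
      show "ennreal \<bar>gauss (z + w) - gauss z\<bar> \<le> ennreal (gauss (z + w)) + ennreal (gauss z)"
        using gauss_nonneg[of z] gauss_nonneg[of "z + w"]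
        by (subst ennreal_plus[symmetric]) (auto simp del: ennreal_plus intro!: ennreal_leI)
    qed
    also have "\<dots> = 2" by (subst nn_integral_add) (simp_all add: g1 g1t)
    finally show ?thesis .
  qed
  have small: "(\<integral>\<^sup>+(z::'a). ennreal \<bar>gauss (z + w) - gauss z\<bar> \<partial>lborel) \<le> ennreal (2 * A * norm w)" if "norm w \<le> 1" for w
  proof -
    have "(\<integral>\<^sup>+(z::'a). ennreal \<bar>gauss (z + w) - gauss z\<bar> \<partial>lborel)
      \<le> (\<integral>\<^sup>+(z::'a). ennreal (norm w) * (ennreal ((2 * norm (z + w) + 1) * gauss (z + w)) + ennreal ((2 * norm z + 1) * gauss z)) \<partial>lborel)"
    proof (rule nn_integral_mono)
      fix z :: 'a
      show "ennreal \<bar>gauss (z + w) - gauss z\<bar> \<le> ennreal (norm w) * (ennreal ((2 * norm (z + w) + 1) * gauss (z + w)) + ennreal ((2 * norm z + 1) * gauss z))"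
        using gauss_diff_pointwise[OF that, of z] gauss_nonneg[of z] gauss_nonneg[of "z + w"]
        by (subst ennreal_plus[symmetric]) (auto simp: ennreal_mult[symmetric] simp del: ennreal_plus intro!: ennreal_leI)
    qed
    also have "\<dots> = ennreal (norm w) * (ennreal A + ennreal A)"
      by (subst nn_integral_cmult, simp, subst nn_integral_add) (simp_all add: A At)
    also have "\<dots> = ennreal (2 * A * norm w)"
      using A0 by (simp add: ennreal_plus[symmetric] ennreal_mult[symmetric] mult_ac del: ennreal_plus)
    finally show ?thesis .
  qed
  show ?thesis
  \<comment> \<open>The 2 covers \<open>norm w > 1\<close>, where \<open>norm w powr s\<close> is at
    least 1; the \<open>2 * A\<close> covers \<open>norm w \<le> 1\<close>, where
    \<open>norm w \<le> norm w powr s\<close>.\<close>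
  proof (rule that[of "2 + 2 * A"])
    show "\<forall>(w::'a) s. 0 \<le> s \<longrightarrow> s \<le> 1 \<longrightarrow>
       (\<integral>\<^sup>+z. ennreal \<bar>gauss (z + w) - gauss z\<bar> \<partial>lborel) \<le> ennreal ((2 + 2 * A) * norm w powr s)"
    proof (intro allI impI)
      fix w :: 'a and s :: real assume s: "0 \<le> s" "s \<le> 1"
      show "(\<integral>\<^sup>+z. ennreal \<bar>gauss (z + w) - gauss z\<bar> \<partial>lborel) \<le> ennreal ((2 + 2 * A) * norm w powr s)"
      proof (cases "w = 0 \<or> norm w > 1")
        case False
        then have w: "0 < norm w" "norm w \<le> 1" by auto
        have "norm w = norm w powr 1" using w by simp
        also have "\<dots> \<le> norm w powr s" using w s by (intro powr_mono') auto
        finally have "2 * A * norm w \<le> (2 + 2 * A) * norm w powr s"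
          using A0 by (intro mult_mono) auto
        then show ?thesis using small[OF w(2)] by (meson ennreal_leI order_trans)
      next
        case True
        then show ?thesis
        proof
          assume w: "norm w > 1"
          then have "1 \<le> norm w powr s" using s by (simp add: ge_one_powr_ge_zero)
          then have "2 * 1 \<le> (2 + 2 * A) * norm w powr s" using A0 by (intro mult_mono) auto
          then have "ennreal 2 \<le> ennreal ((2 + 2 * A) * norm w powr s)" by (intro ennreal_leI) simp
          then show ?thesis using two[of w] by (simp add: order_trans)
        qed simp
      qed
    qed
  qed (use A0 in simp)
qed


section \<open>The Bessel kernel\<close>

lemma Gamma_nn_integral_scaled:
  assumes "0 < b" "0 < q"
  shows "(\<integral>\<^sup>+t. ennreal (indicator {0<..} t * t powr (b - 1) * exp (- (q * t))) \<partial>lborel) = ennreal (Gamma b / q powr b)"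
proof -
  have "ennreal (Gamma b) = (\<integral>\<^sup>+t. ennreal (indicator {0..} t * t powr (b - 1) / exp t) \<partial>lborel)"
    by (rule Gamma_conv_nn_integral_real[OF assms(1)])
  also have "\<dots> = (\<integral>\<^sup>+t. ennreal (indicator {0<..} t * t powr (b - 1) * exp (- t)) \<partial>lborel)"
    by (intro nn_integral_cong) (auto simp: indicator_def exp_minus field_simps)
  also have "\<dots> = ennreal q * (\<integral>\<^sup>+t. ennreal (indicator {0<..} (q * t) * (q * t) powr (b - 1) * exp (- (q * t))) \<partial>lborel)"
    using nn_integral_lborel_affine[of "\<lambda>t. ennreal (indicator {0<..} t * t powr (b - 1) * exp (- t))" q 0] assms by simp
  also have "\<dots> = (\<integral>\<^sup>+t. ennreal q * ennreal (indicator {0<..} (q * t) * (q * t) powr (b - 1) * exp (- (q * t))) \<partial>lborel)"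
    by (subst nn_integral_cmult) simp_all
  also have "\<dots> = (\<integral>\<^sup>+t. ennreal (q powr b) * ennreal (indicator {0<..} t * t powr (b - 1) * exp (- (q * t))) \<partial>lborel)"
  proof (rule nn_integral_cong)
    fix t :: real
    show "ennreal q * ennreal (indicator {0<..} (q * t) * (q * t) powr (b - 1) * exp (- (q * t)))
        = ennreal (q powr b) * ennreal (indicator {0<..} t * t powr (b - 1) * exp (- (q * t)))"
    proof (cases "0 < t")
      case True
      have "q * (q * t) powr (b - 1) = q powr b * t powr (b - 1)"
        using True assms by (simp add: powr_mult powr_diff)
      then show ?thesis using True assms by (simp add: ennreal_mult[symmetric] indicator_def mult.assoc[symmetric])
    next
      case False
      then have "\<not> 0 < q * t" using assms by (simp add: zero_less_mult_iff)
      then show ?thesis using False by (simp add: indicator_def)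
    qed
  qed
  also have "\<dots> = ennreal (q powr b) * (\<integral>\<^sup>+t. ennreal (indicator {0<..} t * t powr (b - 1) * exp (- (q * t))) \<partial>lborel)"
    by (rule nn_integral_cmult) simp
  finally have e: "ennreal (Gamma b) = ennreal (q powr b) * (\<integral>\<^sup>+t. ennreal (indicator {0<..} t * t powr (b - 1) * exp (- (q * t))) \<partial>lborel)" (is "_ = _ * ?I") .
  have q: "0 < q powr b" using assms by simp
  have "?I = ennreal (1 / q powr b) * (ennreal (q powr b) * ?I)"
    using q by (simp add: mult.assoc[symmetric] ennreal_mult[symmetric])
  also have "\<dots> = ennreal (1 / q powr b) * ennreal (Gamma b)" by (simp only: e)
  also have "\<dots> = ennreal (Gamma b / q powr b)"
    using q assms by (simp add: ennreal_mult[symmetric] Gamma_real_pos less_imp_le)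
  finally show ?thesis .
qed

text \<open>The density of the Gamma distribution with shape a / 2 and rate 1. Its Laplace transform
  (1 + q) powr (- a / 2) is the Bessel multiplier at q = |\<xi>|^2.\<close>

definition mixing :: "real \<Rightarrow> real \<Rightarrow> real" where
  "mixing a t = indicator {0<..} t * t powr (a / 2 - 1) * exp (- t) / Gamma (a / 2)"

lemma measurable_mixing [measurable]: "mixing a \<in> borel_measurable borel"
  unfolding mixing_def[abs_def] by measurable

lemma mixing_nonneg: "0 < a \<Longrightarrow> 0 \<le> mixing a t"
  by (simp add: mixing_def Gamma_real_pos less_imp_le indicator_def)

lemma mixing_nonpos: "t \<le> 0 \<Longrightarrow> mixing a t = 0"
  by (simp add: mixing_def indicator_def)

text \<open>One formula for three uses: total mass, Laplace transform, and fractional moments,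
  including the negative ones down to - a / 2.\<close>

lemma mixing_nn_integral:
  assumes "0 < a" "0 \<le> q" "0 < a / 2 + r"
  shows "(\<integral>\<^sup>+t. ennreal (mixing a t * t powr r * exp (- (q * t))) \<partial>lborel)
           = ennreal (Gamma (a / 2 + r) / Gamma (a / 2) / (1 + q) powr (a / 2 + r))"
proof -
  have G: "0 < Gamma (a / 2)" "0 < Gamma (a / 2 + r)" using assms by (auto intro: Gamma_real_pos)
  have "(\<integral>\<^sup>+t. ennreal (mixing a t * t powr r * exp (- (q * t))) \<partial>lborel)
      = (\<integral>\<^sup>+t. ennreal (1 / Gamma (a / 2)) * ennreal (indicator {0<..} t * t powr ((a / 2 + r) - 1) * exp (- ((1 + q) * t))) \<partial>lborel)"
  proof (rule nn_integral_cong)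
    fix t :: real
    have "t powr (a / 2 - 1) * t powr r = t powr ((a / 2 + r) - 1)"
      by (simp add: powr_add[symmetric] algebra_simps)
    moreover have "exp (- t) * exp (- (q * t)) = exp (- ((1 + q) * t))"
      by (simp add: exp_add[symmetric] algebra_simps)
    ultimately show "ennreal (mixing a t * t powr r * exp (- (q * t)))
      = ennreal (1 / Gamma (a / 2)) * ennreal (indicator {0<..} t * t powr ((a / 2 + r) - 1) * exp (- ((1 + q) * t)))"
      using G by (simp add: mixing_def ennreal_mult[symmetric] indicator_def)
                 (metis (no_types, opaque_lifting) mult.assoc mult.left_commute)
  qed
  also have "\<dots> = ennreal (1 / Gamma (a / 2)) * ennreal (Gamma (a / 2 + r) / (1 + q) powr (a / 2 + r))"
    by (subst nn_integral_cmult) (use assms in \<open>simp_all add: Gamma_nn_integral_scaled\<close>)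
  also have "\<dots> = ennreal (Gamma (a / 2 + r) / Gamma (a / 2) / (1 + q) powr (a / 2 + r))"
    using G by (simp add: ennreal_mult[symmetric] less_imp_le mult.commute)
  finally show ?thesis .
qed

lemma mixing_integrable: "0 < a \<Longrightarrow> integrable lborel (mixing a)"
  and mixing_nn_integral_1: "0 < a \<Longrightarrow> (\<integral>\<^sup>+t. ennreal (mixing a t) \<partial>lborel) = 1"
proof -
  assume a: "0 < a"
  have "0 < Gamma (a / 2)" using a by (intro Gamma_real_pos) simp
  then have G: "Gamma (a / 2) \<noteq> 0" by simp
  \<comment> \<open>In HOL \<open>0 powr 0\<close> is 0, not 1; the identity survives because
    \<open>mixing\<close> vanishes at 0.\<close>
  have *: "mixing a t * t powr 0 = mixing a t" for t by (simp add: mixing_nonpos)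
  show m: "(\<integral>\<^sup>+t. ennreal (mixing a t) \<partial>lborel) = 1"
    using mixing_nn_integral[OF a, of 0 0] G a unfolding * by simp
  show "integrable lborel (mixing a)"
    by (rule integrableI_nonneg) (use m a in \<open>auto simp: mixing_nonneg\<close>)
qed

lemma mixing_laplace:
  assumes "0 < a" "0 \<le> q"
  shows "(\<integral>t. mixing a t * exp (- (q * t)) \<partial>lborel) = (1 + q) powr (- (a / 2))"
proof -
  have "0 < Gamma (a / 2)" using assms by (intro Gamma_real_pos) simp
  then have G: "Gamma (a / 2) \<noteq> 0" by simp
  have *: "mixing a t * t powr 0 = mixing a t" for t by (simp add: mixing_nonpos)
  have "(\<integral>\<^sup>+t. ennreal (mixing a t * exp (- (q * t))) \<partial>lborel) = ennreal ((1 + q) powr (- (a / 2)))"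
    using mixing_nn_integral[OF assms, of 0] G assms unfolding * by (simp add: powr_minus_divide)
  then show ?thesis
    by (intro integral_eq_nn_integral[THEN trans]) (use assms in \<open>auto simp: mixing_nonneg\<close>)
qed

text \<open>The Gaussian density with standard deviation \<open>\<sigma>\<close> in every
  coordinate.\<close>

definition dgauss :: "real \<Rightarrow> 'a::euclidean_space \<Rightarrow> real" where
  "dgauss \<sigma> x = gauss (x /\<^sub>R \<sigma>) / \<sigma> ^ DIM('a)"

lemma measurable_dgauss [measurable]: "(\<lambda>p. dgauss (fst p) (snd p)) \<in> borel_measurable (borel \<Otimes>\<^sub>M borel)"
  unfolding dgauss_def by measurable

lemma dgauss_nonneg: "0 \<le> \<sigma> \<Longrightarrow> 0 \<le> dgauss \<sigma> x"
  by (simp add: dgauss_def gauss_nonneg)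

lemma dgauss_nn_integral:
  fixes F :: "'a::euclidean_space \<Rightarrow> ennreal"
  assumes [measurable]: "F \<in> borel_measurable borel" and s: "0 < \<sigma>"
  shows "(\<integral>\<^sup>+x. F x * ennreal (dgauss \<sigma> x) \<partial>lborel) = (\<integral>\<^sup>+z. F (\<sigma> *\<^sub>R z) * ennreal (gauss z) \<partial>lborel)"
proof -
  have [measurable]: "dgauss \<sigma> \<in> borel_measurable (borel :: 'a measure)" unfolding dgauss_def[abs_def] by measurable
  have "(\<integral>\<^sup>+x. F x * ennreal (dgauss \<sigma> x) \<partial>lborel) = ennreal (\<sigma> ^ DIM('a)) * (\<integral>\<^sup>+z. F (\<sigma> *\<^sub>R z) * ennreal (dgauss \<sigma> (\<sigma> *\<^sub>R z)) \<partial>lborel)"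
    using nn_integral_lborel_affine[of "\<lambda>x. F x * ennreal (dgauss \<sigma> x)" \<sigma> 0] s by simp
  also have "\<dots> = (\<integral>\<^sup>+z. ennreal (\<sigma> ^ DIM('a)) * (F (\<sigma> *\<^sub>R z) * ennreal (dgauss \<sigma> (\<sigma> *\<^sub>R z))) \<partial>lborel)"
    by (rule nn_integral_cmult[symmetric]) measurable
  also have "\<dots> = (\<integral>\<^sup>+z. F (\<sigma> *\<^sub>R z) * ennreal (gauss z) \<partial>lborel)"
  proof (rule nn_integral_cong)
    fix z :: 'a
    have "ennreal (\<sigma> ^ DIM('a)) * ennreal (dgauss \<sigma> (\<sigma> *\<^sub>R z)) = ennreal (gauss z)"
      using s by (simp add: dgauss_def ennreal_mult[symmetric] gauss_nonneg)
    then show "ennreal (\<sigma> ^ DIM('a)) * (F (\<sigma> *\<^sub>R z) * ennreal (dgauss \<sigma> (\<sigma> *\<^sub>R z))) = F (\<sigma> *\<^sub>R z) * ennreal (gauss z)"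
      by (metis mult.left_commute)
  qed
  finally show ?thesis .
qed

lemma dgauss_integral:
  fixes F :: "'a::euclidean_space \<Rightarrow> complex"
  assumes [measurable]: "F \<in> borel_measurable borel" and s: "0 < \<sigma>"
  shows "(\<integral>x. F x * of_real (dgauss \<sigma> x) \<partial>lborel) = (\<integral>z. F (\<sigma> *\<^sub>R z) * of_real (gauss z) \<partial>lborel)"
proof -
  have [measurable]: "dgauss \<sigma> \<in> borel_measurable (borel :: 'a measure)" unfolding dgauss_def[abs_def] by measurable
  have "(\<integral>x. F x * of_real (dgauss \<sigma> x) \<partial>lborel) = \<sigma> ^ DIM('a) *\<^sub>R (\<integral>z. F (\<sigma> *\<^sub>R z) * of_real (dgauss \<sigma> (\<sigma> *\<^sub>R z)) \<partial>lborel)"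
    using integral_lborel_affine[of "\<lambda>x. F x * of_real (dgauss \<sigma> x)" \<sigma> 0] s by simp
  also have "\<dots> = (\<integral>z. \<sigma> ^ DIM('a) *\<^sub>R (F (\<sigma> *\<^sub>R z) * of_real (dgauss \<sigma> (\<sigma> *\<^sub>R z))) \<partial>lborel)"
    by (rule integral_scaleR_right[symmetric])
  also have "(\<lambda>z. \<sigma> ^ DIM('a) *\<^sub>R (F (\<sigma> *\<^sub>R z) * of_real (dgauss \<sigma> (\<sigma> *\<^sub>R z)))) = (\<lambda>z. F (\<sigma> *\<^sub>R z) * of_real (gauss z))"
    using s by (simp add: dgauss_def scaleR_conv_of_real fun_eq_iff)
  finally show ?thesis .
qed

text \<open>Subordination: the Gaussian of variance 2 t has Fourier transform exp (- t |\<xi>|^2),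
  and averaging it over the Gamma density in t gives (1 + |\<xi>|^2) powr (- a / 2), the multiplier
  of (1 - \<Delta>) to the power - a / 2.\<close>

definition bessel_kernel :: "real \<Rightarrow> 'a::euclidean_space \<Rightarrow> real" where
  "bessel_kernel a x = (\<integral>t. mixing a t * dgauss (sqrt (2 * t)) x \<partial>lborel)"

lemma measurable_bessel_integrand [measurable]:
  "(\<lambda>p. mixing a (fst p) * dgauss (sqrt (2 * fst p)) (snd p :: 'a::euclidean_space)) \<in> borel_measurable (borel \<Otimes>\<^sub>M borel)"
  "(\<lambda>p. mixing a (snd p) * dgauss (sqrt (2 * snd p)) (fst p :: 'a::euclidean_space)) \<in> borel_measurable (borel \<Otimes>\<^sub>M borel)"
  unfolding dgauss_def by measurable

lemma measurable_dgauss_single [measurable]: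
  "(\<lambda>t. mixing a t * dgauss (sqrt (2 * t)) (x :: 'a::euclidean_space)) \<in> borel_measurable borel"
  "(\<lambda>x :: 'a::euclidean_space. dgauss \<sigma> x) \<in> borel_measurable borel"
  unfolding dgauss_def by measurable

lemma measurable_bessel_kernel [measurable]: "bessel_kernel a \<in> borel_measurable borel"
  unfolding bessel_kernel_def[abs_def] using measurable_bessel_integrand(2)
  by (intro lborel.borel_measurable_lebesgue_integral) (simp add: case_prod_beta')

lemma bessel_integrand_nonneg: "0 < a \<Longrightarrow> 0 \<le> mixing a t * dgauss (sqrt (2 * t)) x"
  by (cases "t \<le> 0") (simp_all add: mixing_nonpos mixing_nonneg dgauss_nonneg)

lemma bessel_kernel_nonneg: "0 < a \<Longrightarrow> 0 \<le> bessel_kernel a x"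
  unfolding bessel_kernel_def by (intro Bochner_Integration.integral_nonneg) (simp add: bessel_integrand_nonneg)

lemma bessel_kernel_minus: "bessel_kernel a (- x) = bessel_kernel a x"
  unfolding bessel_kernel_def dgauss_def by (simp add: gauss_minus scaleR_minus_right)

lemma bessel_double_integral:
  fixes F :: "'a::euclidean_space \<Rightarrow> ennreal"
  assumes a: "0 < a" and [measurable]: "F \<in> borel_measurable borel"
  shows "(\<integral>\<^sup>+x. F x * (\<integral>\<^sup>+t. ennreal (mixing a t * dgauss (sqrt (2 * t)) x) \<partial>lborel) \<partial>lborel)
       = (\<integral>\<^sup>+t. ennreal (mixing a t) * (\<integral>\<^sup>+z. F (sqrt (2 * t) *\<^sub>R z) * ennreal (gauss z) \<partial>lborel) \<partial>lborel)"
proof -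
  have "(\<integral>\<^sup>+x. F x * (\<integral>\<^sup>+t. ennreal (mixing a t * dgauss (sqrt (2 * t)) x) \<partial>lborel) \<partial>lborel)
      = (\<integral>\<^sup>+x. (\<integral>\<^sup>+t. F x * ennreal (mixing a t * dgauss (sqrt (2 * t)) x) \<partial>lborel) \<partial>lborel)"
    by (intro nn_integral_cong nn_integral_cmult[symmetric]) simp
  also have "\<dots> = (\<integral>\<^sup>+t. (\<integral>\<^sup>+x. F x * ennreal (mixing a t * dgauss (sqrt (2 * t)) x) \<partial>lborel) \<partial>lborel)"
    using measurable_bessel_integrand(2)[of a, where 'a='a]
    by (intro lborel_pair.Fubini'[symmetric]) (simp add: case_prod_beta')
  also have "\<dots> = (\<integral>\<^sup>+t. ennreal (mixing a t) * (\<integral>\<^sup>+z. F (sqrt (2 * t) *\<^sub>R z) * ennreal (gauss z) \<partial>lborel) \<partial>lborel)"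
  proof (rule nn_integral_cong)
    fix t :: real
    show "(\<integral>\<^sup>+x. F x * ennreal (mixing a t * dgauss (sqrt (2 * t)) x) \<partial>lborel)
        = ennreal (mixing a t) * (\<integral>\<^sup>+z. F (sqrt (2 * t) *\<^sub>R z) * ennreal (gauss z) \<partial>lborel)"
    proof (cases "t \<le> 0")
      case False
      have "F x * ennreal (mixing a t * dgauss (sqrt (2 * t)) x) = ennreal (mixing a t) * (F x * ennreal (dgauss (sqrt (2 * t)) x))" for x
        using mixing_nonneg[OF a, of t] False by (simp add: ennreal_mult' dgauss_nonneg mult.left_commute)
      then have "(\<integral>\<^sup>+x. F x * ennreal (mixing a t * dgauss (sqrt (2 * t)) x) \<partial>lborel)
          = ennreal (mixing a t) * (\<integral>\<^sup>+x. F x * ennreal (dgauss (sqrt (2 * t)) x) \<partial>lborel)"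
        by (simp add: nn_integral_cmult)
      then show ?thesis using False by (simp add: dgauss_nn_integral)
    qed (simp add: mixing_nonpos)
  qed
  finally show ?thesis .
qed

lemma gauss_nn_integral_1: "(\<integral>\<^sup>+(z::'a::euclidean_space). ennreal (gauss z) \<partial>lborel) = 1"
  using nn_integral_eq_integral[OF gauss_integrable[where 'a='a]] by (simp add: gauss_nonneg gauss_integral)

text \<open>The kernel may be infinite at the origin, where the Bochner integral then has the
  default value 0. Its agreement with the Lebesgue integral is therefore stated almost
  everywhere.\<close>

lemma bessel_kernel_AE:
  assumes a: "0 < a"
  shows "AE x::'a::euclidean_space in lborel. integrable lborel (\<lambda>t. mixing a t * dgauss (sqrt (2 * t)) x)"
    and "AE x::'a::euclidean_space in lborel. ennreal (bessel_kernel a x) = (\<integral>\<^sup>+t. ennreal (mixing a t * dgauss (sqrt (2 * t)) x) \<partial>lborel)"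
proof -
  have "(\<integral>\<^sup>+(x::'a). 1 * (\<integral>\<^sup>+t. ennreal (mixing a t * dgauss (sqrt (2 * t)) x) \<partial>lborel) \<partial>lborel) = 1"
    by (subst bessel_double_integral[OF a]) (simp_all add: gauss_nn_integral_1 mixing_nn_integral_1[OF a])
  then have "(\<integral>\<^sup>+(x::'a). (\<integral>\<^sup>+t. ennreal (mixing a t * dgauss (sqrt (2 * t)) x) \<partial>lborel) \<partial>lborel) \<noteq> \<infinity>" by simp
  then have "AE x::'a in lborel. (\<integral>\<^sup>+t. ennreal (mixing a t * dgauss (sqrt (2 * t)) x) \<partial>lborel) \<noteq> \<infinity>"
    using measurable_bessel_integrand(2)[of a, where 'a='a]
    by (intro nn_integral_PInf_AE lborel.borel_measurable_nn_integral) (simp_all add: case_prod_beta')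
  then show A: "AE x::'a in lborel. integrable lborel (\<lambda>t. mixing a t * dgauss (sqrt (2 * t)) x)"
  proof eventually_elim
    fix x :: 'a assume f: "(\<integral>\<^sup>+t. ennreal (mixing a t * dgauss (sqrt (2 * t)) x) \<partial>lborel) \<noteq> \<infinity>"
    show "integrable lborel (\<lambda>t. mixing a t * dgauss (sqrt (2 * t)) x)"
      by (rule integrableI_nonneg) (use f a in \<open>auto simp: bessel_integrand_nonneg less_top\<close>)
  qed
  then show "AE x::'a in lborel. ennreal (bessel_kernel a x) = (\<integral>\<^sup>+t. ennreal (mixing a t * dgauss (sqrt (2 * t)) x) \<partial>lborel)"
    by eventually_elim (simp add: bessel_kernel_def nn_integral_eq_integral bessel_integrand_nonneg a)
qed

lemma bessel_kernel_nn_integral: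
  fixes F :: "'a::euclidean_space \<Rightarrow> ennreal"
  assumes a: "0 < a" and F[measurable]: "F \<in> borel_measurable borel"
  shows "(\<integral>\<^sup>+x. F x * ennreal (bessel_kernel a x) \<partial>lborel)
       = (\<integral>\<^sup>+t. ennreal (mixing a t) * (\<integral>\<^sup>+z. F (sqrt (2 * t) *\<^sub>R z) * ennreal (gauss z) \<partial>lborel) \<partial>lborel)"
  unfolding bessel_double_integral[OF a F, symmetric]
  by (intro nn_integral_cong_AE) (use bessel_kernel_AE(2)[OF a, where 'a='a] in \<open>eventually_elim, simp\<close>)

text \<open>The k-th moment of the Gaussian at time t is a multiple of t powr (k / 2), and the Gamma
  density has all positive moments. Finite moments of all orders let convolution with the kernel
  preserve Schwartz functions.\<close>

lemma bessel_kernel_moment: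
  assumes a: "0 < a"
  shows "integrable lborel (\<lambda>x::'a::euclidean_space. norm x ^ k * bessel_kernel a x)"
proof (rule integrableI_nonneg)
  define M where "M = (\<integral>(z::'a). norm z ^ k * gauss z \<partial>lborel)"
  have M: "(\<integral>\<^sup>+(z::'a). ennreal (norm z ^ k * gauss z) \<partial>lborel) = ennreal M"
    unfolding M_def by (rule nn_integral_eq_integral[OF gauss_moment]) (simp add: gauss_nonneg)
  have M0: "0 \<le> M" unfolding M_def by (intro Bochner_Integration.integral_nonneg) (simp add: gauss_nonneg)
  have "(\<integral>\<^sup>+(x::'a). ennreal (norm x ^ k * bessel_kernel a x) \<partial>lborel) = (\<integral>\<^sup>+(x::'a). ennreal (norm x ^ k) * ennreal (bessel_kernel a x) \<partial>lborel)"
    by (simp add: ennreal_mult bessel_kernel_nonneg a)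
  also have "\<dots> = (\<integral>\<^sup>+t. ennreal (mixing a t) * (\<integral>\<^sup>+(z::'a). ennreal (norm (sqrt (2 * t) *\<^sub>R z) ^ k) * ennreal (gauss z) \<partial>lborel) \<partial>lborel)"
    by (rule bessel_kernel_nn_integral[OF a]) simp
  also have "\<dots> = (\<integral>\<^sup>+t. ennreal (2 powr (k / 2) * M) * ennreal (mixing a t * t powr (k / 2) * exp (- (0 * t))) \<partial>lborel)"
  proof (rule nn_integral_cong)
    fix t :: real
    show "ennreal (mixing a t) * (\<integral>\<^sup>+(z::'a). ennreal (norm (sqrt (2 * t) *\<^sub>R z) ^ k) * ennreal (gauss z) \<partial>lborel)
        = ennreal (2 powr (k / 2) * M) * ennreal (mixing a t * t powr (k / 2) * exp (- (0 * t)))"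
    proof (cases "t \<le> 0")
      case False
      have "(\<integral>\<^sup>+(z::'a). ennreal (norm (sqrt (2 * t) *\<^sub>R z) ^ k) * ennreal (gauss z) \<partial>lborel)
          = (\<integral>\<^sup>+(z::'a). ennreal (sqrt (2 * t) ^ k) * ennreal (norm z ^ k * gauss z) \<partial>lborel)"
        using False by (intro nn_integral_cong) (simp add: ennreal_mult[symmetric] gauss_nonneg power_mult_distrib mult.assoc)
      also have "\<dots> = ennreal (sqrt (2 * t) ^ k) * ennreal M"
        by (subst nn_integral_cmult) (simp_all add: M)
      also have "sqrt (2 * t) ^ k = 2 powr (k / 2) * t powr (k / 2)"
      proof -
        have "sqrt (2 * t) ^ k = ((2 * t) powr (1 / 2)) powr real k"
          using False by (simp add: powr_half_sqrt powr_realpow)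
        also have "\<dots> = (2 * t) powr (k / 2)" by (simp add: powr_powr)
        finally show ?thesis using False by (simp add: powr_mult)
      qed
      finally show ?thesis using False M0 mixing_nonneg[OF a, of t]
        by (simp add: ennreal_mult[symmetric] mult_ac)
    qed (simp add: mixing_nonpos)
  qed
  also have "\<dots> = ennreal (2 powr (k / 2) * M) * (\<integral>\<^sup>+t. ennreal (mixing a t * t powr (k / 2) * exp (- (0 * t))) \<partial>lborel)"
    by (rule nn_integral_cmult) simp
  also have "\<dots> < \<infinity>"
    by (subst mixing_nn_integral) (use a in \<open>auto simp: ennreal_mult_less_top\<close>)
  finally show "(\<integral>\<^sup>+(x::'a). ennreal (norm x ^ k * bessel_kernel a x) \<partial>lborel) < \<infinity>" .
qed (auto simp: bessel_kernel_nonneg a)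

lemma bessel_kernel_integrable:
  "0 < a \<Longrightarrow> integrable lborel (bessel_kernel a :: 'a::euclidean_space \<Rightarrow> real)"
  using bessel_kernel_moment[of a 0, where 'a='a] by simp

lemma bessel_kernel_integral:
  assumes a: "0 < a"
  shows "(\<integral>(x::'a::euclidean_space). bessel_kernel a x \<partial>lborel) = 1"
proof -
  have "(\<integral>\<^sup>+(x::'a). ennreal (bessel_kernel a x) \<partial>lborel) = 1"
    using bessel_kernel_nn_integral[OF a, of "\<lambda>_::'a. 1"] by (simp add: gauss_nn_integral_1 mixing_nn_integral_1[OF a])
  then show ?thesis
    by (intro integral_eq_nn_integral[THEN trans]) (auto simp: bessel_kernel_nonneg a)
qed

lemma bessel_kernel_fourier:
  fixes \<xi> :: "'a::euclidean_space"
  assumes a: "0 < a"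
  shows "(\<integral>x. cis (- (x \<bullet> \<xi>)) * of_real (bessel_kernel a x) \<partial>lborel) = of_real ((1 + (norm \<xi>)\<^sup>2) powr (- (a / 2)))"
proof -
  let ?H = "\<lambda>t x. cis (- (x \<bullet> \<xi>)) * of_real (mixing a t * dgauss (sqrt (2 * t)) x)"
  have [measurable]: "(\<lambda>x::'a. cis (- (x \<bullet> \<xi>))) \<in> borel_measurable borel"
    by (intro borel_measurable_continuous_onI) (auto simp: cis_conv_exp intro!: continuous_intros)
  have Hm: "(\<lambda>(t, x). ?H t x) \<in> borel_measurable (lborel \<Otimes>\<^sub>M lborel)"
  proof -
    have "(\<lambda>p. cis (- ((snd p :: 'a) \<bullet> \<xi>))) \<in> borel_measurable (lborel \<Otimes>\<^sub>M lborel)"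
      by (rule measurable_compose[OF measurable_snd]) simp
    moreover have "(\<lambda>p. complex_of_real (mixing a (fst p) * dgauss (sqrt (2 * fst p)) (snd p :: 'a))) \<in> borel_measurable (lborel \<Otimes>\<^sub>M lborel)"
      by (rule measurable_compose[where N=borel])
         (use measurable_bessel_integrand(1)[of a, where 'a='a] in
           \<open>auto intro!: borel_measurable_continuous_onI continuous_intros\<close>)
    ultimately show ?thesis unfolding case_prod_beta' by (rule borel_measurable_times)
  qed
  have nrm: "(\<integral>x. norm (?H t x) \<partial>lborel) = mixing a t" for t
  proof (cases "t \<le> 0")
    case False
    have "(\<integral>\<^sup>+x. 1 * ennreal (dgauss (sqrt (2 * t)) (x::'a)) \<partial>lborel) = 1"
      using False by (subst dgauss_nn_integral) (simp_all add: gauss_nn_integral_1)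
    then have "(\<integral>x. dgauss (sqrt (2 * t)) (x::'a) \<partial>lborel) = 1"
      using False by (intro integral_eq_nn_integral[THEN trans]) (auto simp: dgauss_nonneg)
    then show ?thesis using mixing_nonneg[OF a, of t] False by (simp add: norm_mult abs_mult dgauss_nonneg)
  qed (simp add: mixing_nonpos)
  have int: "integrable lborel (\<lambda>x. ?H t x)" for t
  proof (cases "t \<le> 0")
    case False
    have "(\<integral>\<^sup>+x. 1 * ennreal (dgauss (sqrt (2 * t)) (x::'a)) \<partial>lborel) = 1"
      using False by (subst dgauss_nn_integral) (simp_all add: gauss_nn_integral_1)
    then have "integrable lborel (dgauss (sqrt (2 * t)) :: 'a \<Rightarrow> real)"
      using False by (intro integrableI_nonneg) (auto simp: dgauss_nonneg)
    then have "integrable lborel (\<lambda>x::'a. mixing a t * dgauss (sqrt (2 * t)) x)" by simp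
    then show ?thesis
      by (rule Bochner_Integration.integrable_bound) (auto simp: norm_mult)
  qed (simp add: mixing_nonpos)
  have I: "integrable (lborel \<Otimes>\<^sub>M lborel) (\<lambda>(t, x). ?H t x)"
    using Hm mixing_integrable[OF a] int nrm by (intro lborel_pair.Fubini_integrable) simp_all
  have "(\<integral>x. cis (- (x \<bullet> \<xi>)) * of_real (bessel_kernel a x) \<partial>lborel) = (\<integral>x. (\<integral>t. ?H t x \<partial>lborel) \<partial>lborel)"
    by (simp only: bessel_kernel_def integral_mult_right_zero integral_complex_of_real)
  also have "\<dots> = (\<integral>t. (\<integral>x. ?H t x \<partial>lborel) \<partial>lborel)"
    by (rule lborel_pair.Fubini_integral[OF I])
  also have "\<dots> = (\<integral>t. of_real (mixing a t * exp (- ((norm \<xi>)\<^sup>2 * t))) \<partial>lborel)"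
  proof (rule Bochner_Integration.integral_cong[OF refl])
    fix t :: real
    show "(\<integral>x. ?H t x \<partial>lborel) = of_real (mixing a t * exp (- ((norm \<xi>)\<^sup>2 * t)))"
    proof (cases "t \<le> 0")
      case False
      have "(\<integral>x. ?H t x \<partial>lborel) = of_real (mixing a t) * (\<integral>x. cis (- (x \<bullet> \<xi>)) * of_real (dgauss (sqrt (2 * t)) x) \<partial>lborel)"
        by (simp add: mult.left_commute)
      also have "(\<integral>x. cis (- (x \<bullet> \<xi>)) * of_real (dgauss (sqrt (2 * t)) x) \<partial>lborel)
          = (\<integral>z. cis (- ((sqrt (2 * t) *\<^sub>R z) \<bullet> \<xi>)) * of_real (gauss z) \<partial>lborel)"
        using False by (intro dgauss_integral) auto
      also have "\<dots> = (\<integral>z. cis (z \<bullet> (- sqrt (2 * t) *\<^sub>R \<xi>)) * of_real (gauss z) \<partial>lborel)" by simp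
      also have "\<dots> = of_real (exp (- ((norm \<xi>)\<^sup>2 * t)))"
        unfolding gauss_fourier(1) using False by (simp add: power_mult_distrib mult.commute)
      finally show ?thesis by simp
    qed (simp add: mixing_nonpos)
  qed
  also have "\<dots> = of_real ((1 + (norm \<xi>)\<^sup>2) powr (- (a / 2)))"
    unfolding integral_complex_of_real by (simp add: mixing_laplace[OF a])
  finally show ?thesis .
qed

text \<open>By scaling, the Gaussian at time t has an L_1 modulus of order
  \<open>norm h powr s\<close> times t powr (- s / 2). This negative moment is finite under the
  Gamma density because s < a.\<close>

lemma bessel_kernel_L1_modulus:
  assumes a: "0 < a" and s: "0 \<le> s" "s \<le> 1" "s < a"
  obtains C :: real where "0 \<le> C"
    "\<forall>h::'a::euclidean_space. (\<integral>y. \<bar>Dif h (bessel_kernel a) y\<bar> \<partial>lborel) \<le> C * norm h powr s"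
proof -
  obtain C0 where C0: "0 \<le> C0" and C0': "\<forall>(w::'a::euclidean_space) s. 0 \<le> s \<longrightarrow> s \<le> 1 \<longrightarrow>
       (\<integral>\<^sup>+z. ennreal \<bar>gauss (z + w) - gauss z\<bar> \<partial>lborel) \<le> ennreal (C0 * norm w powr s)"
    by (rule gauss_diff_L1)
  define L where "L = C0 * 2 powr (- (s / 2)) * (Gamma (a / 2 + - (s / 2)) / Gamma (a / 2))"
  have pos: "0 < a / 2 + - (s / 2)" using s by simp
  have L0: "0 \<le> L" using C0 Gamma_real_pos[OF pos] Gamma_real_pos[of "a / 2"] a by (simp add: L_def)
  have "(\<integral>y. \<bar>Dif h (bessel_kernel a) y\<bar> \<partial>lborel) \<le> L * norm h powr s" for h :: 'a
  proof -
    let ?H = "\<lambda>t x. mixing a t * (dgauss (sqrt (2 * t)) (x + h) - dgauss (sqrt (2 * t)) x)"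
    have Hm: "(\<lambda>(x, t). ?H t x) \<in> borel_measurable (lborel \<Otimes>\<^sub>M lborel)"
      unfolding dgauss_def by measurable
    have "(\<integral>\<^sup>+x. ennreal \<bar>Dif h (bessel_kernel a) x\<bar> \<partial>lborel) \<le> (\<integral>\<^sup>+x. (\<integral>\<^sup>+t. ennreal \<bar>?H t x\<bar> \<partial>lborel) \<partial>lborel)"
    proof (rule nn_integral_mono_AE)
      show "AE x in lborel. ennreal \<bar>Dif h (bessel_kernel a) x\<bar> \<le> (\<integral>\<^sup>+t. ennreal \<bar>?H t x\<bar> \<partial>lborel)"
        using bessel_kernel_AE(1)[OF a, where 'a='a] AE_lborel_translate[OF bessel_kernel_AE(1)[OF a, where 'a='a], of h]
      proof eventually_elim
        fix x assume i: "integrable lborel (\<lambda>t. mixing a t * dgauss (sqrt (2 * t)) x)"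
          "integrable lborel (\<lambda>t. mixing a t * dgauss (sqrt (2 * t)) (x + h))"
        have "Dif h (bessel_kernel a) x = (\<integral>t. ?H t x \<partial>lborel)"
          unfolding Dif_def bessel_kernel_def using i by (simp add: right_diff_distrib)
        also have "ennreal \<bar>\<dots>\<bar> \<le> (\<integral>\<^sup>+t. ennreal \<bar>?H t x\<bar> \<partial>lborel)"
          using integral_norm_bound_ennreal[of lborel "\<lambda>t. ?H t x"] i by (simp add: right_diff_distrib)
        finally show "ennreal \<bar>Dif h (bessel_kernel a) x\<bar> \<le> (\<integral>\<^sup>+t. ennreal \<bar>?H t x\<bar> \<partial>lborel)" .
      qed
    qed
    also have "\<dots> = (\<integral>\<^sup>+t. (\<integral>\<^sup>+x. ennreal \<bar>?H t x\<bar> \<partial>lborel) \<partial>lborel)"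
      using Hm by (intro lborel_pair.Fubini'[symmetric]) (simp add: case_prod_beta')
    also have "\<dots> \<le> (\<integral>\<^sup>+t. ennreal (C0 * 2 powr (- (s / 2)) * norm h powr s) * ennreal (mixing a t * t powr (- (s / 2)) * exp (- (0 * t))) \<partial>lborel)"
    proof (rule nn_integral_mono)
      fix t :: real
      show "(\<integral>\<^sup>+x. ennreal \<bar>?H t x\<bar> \<partial>lborel) \<le> ennreal (C0 * 2 powr (- (s / 2)) * norm h powr s) * ennreal (mixing a t * t powr (- (s / 2)) * exp (- (0 * t)))"
      proof (cases "t \<le> 0")
        case False
        let ?s = "sqrt (2 * t)"
        have sp: "0 < ?s" using False by simp
        have "(\<integral>\<^sup>+x. ennreal \<bar>?H t x\<bar> \<partial>lborel) = ennreal (mixing a t) * (\<integral>\<^sup>+x. ennreal \<bar>dgauss ?s (x + h) - dgauss ?s x\<bar> \<partial>lborel)"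
          using mixing_nonneg[OF a, of t] by (subst nn_integral_cmult[symmetric]) (simp_all add: abs_mult ennreal_mult)
        also have "(\<integral>\<^sup>+x. ennreal \<bar>dgauss ?s (x + h) - dgauss ?s x\<bar> \<partial>lborel)
            = ennreal (?s ^ DIM('a)) * (\<integral>\<^sup>+z. ennreal \<bar>dgauss ?s (?s *\<^sub>R z + h) - dgauss ?s (?s *\<^sub>R z)\<bar> \<partial>lborel)"
          using nn_integral_lborel_affine[of "\<lambda>x. ennreal \<bar>dgauss ?s (x + h) - dgauss ?s x\<bar>" ?s 0] sp by simp
        also have "\<dots> = (\<integral>\<^sup>+z. ennreal (?s ^ DIM('a)) * ennreal \<bar>dgauss ?s (?s *\<^sub>R z + h) - dgauss ?s (?s *\<^sub>R z)\<bar> \<partial>lborel)"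
          by (rule nn_integral_cmult[symmetric]) measurable
        also have "\<dots> = (\<integral>\<^sup>+z. ennreal \<bar>gauss (z + h /\<^sub>R ?s) - gauss z\<bar> \<partial>lborel)"
        proof (rule nn_integral_cong)
          fix z :: 'a
          have 1: "(?s *\<^sub>R z + h) /\<^sub>R ?s = z + h /\<^sub>R ?s" "(?s *\<^sub>R z) /\<^sub>R ?s = z" using sp by (simp_all add: scaleR_right_distrib)
          have "?s ^ DIM('a) * \<bar>dgauss ?s (?s *\<^sub>R z + h) - dgauss ?s (?s *\<^sub>R z)\<bar> = \<bar>gauss (z + h /\<^sub>R ?s) - gauss z\<bar>"
            unfolding dgauss_def 1 using sp by (simp add: diff_divide_distrib[symmetric] abs_divide)
          then show "ennreal (?s ^ DIM('a)) * ennreal \<bar>dgauss ?s (?s *\<^sub>R z + h) - dgauss ?s (?s *\<^sub>R z)\<bar> = ennreal \<bar>gauss (z + h /\<^sub>R ?s) - gauss z\<bar>"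
            using sp by (simp add: ennreal_mult[symmetric])
        qed
        also have "\<dots> \<le> ennreal (C0 * norm (h /\<^sub>R ?s) powr s)" using C0' s by blast
        also have "norm (h /\<^sub>R ?s) powr s = norm h powr s * (2 powr (- (s / 2)) * t powr (- (s / 2)))"
        proof -
          have "norm (h /\<^sub>R ?s) powr s = (norm h / ?s) powr s" using sp by (simp add: divide_inverse mult.commute)
          also have "\<dots> = norm h powr s / ?s powr s" using sp by (simp add: powr_divide)
          also have "?s powr s = (2 * t) powr (s / 2)" using False by (simp add: powr_half_sqrt[symmetric] powr_powr)
          also have "norm h powr s / (2 * t) powr (s / 2) = norm h powr s * (2 powr (- (s / 2)) * t powr (- (s / 2)))"
            using False by (simp add: powr_mult powr_minus field_simps)
          finally show ?thesis .
        qed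
        finally have "(\<integral>\<^sup>+x. ennreal \<bar>?H t x\<bar> \<partial>lborel) \<le> ennreal (mixing a t) * ennreal (C0 * (norm h powr s * (2 powr (- (s / 2)) * t powr (- (s / 2)))))"
          by (simp add: mult_left_mono)
        also have "\<dots> = ennreal (C0 * 2 powr (- (s / 2)) * norm h powr s) * ennreal (mixing a t * t powr (- (s / 2)) * exp (- (0 * t)))"
          using C0 mixing_nonneg[OF a, of t] by (simp add: ennreal_mult[symmetric] mult_ac)
        finally show ?thesis .
      qed (simp add: mixing_nonpos)
    qed
    also have "\<dots> = ennreal (C0 * 2 powr (- (s / 2)) * norm h powr s) * ennreal (Gamma (a / 2 + - (s / 2)) / Gamma (a / 2) / (1 + 0) powr (a / 2 + - (s / 2)))"
      by (subst nn_integral_cmult) (use mixing_nn_integral[OF a, of 0 "- (s / 2)"] pos in simp_all)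
    also have "\<dots> = ennreal (L * norm h powr s)"
      using C0 Gamma_real_pos[OF pos] Gamma_real_pos[of "a / 2"] a
      by (simp add: L_def ennreal_mult[symmetric] mult_ac less_imp_le)
    finally have le: "(\<integral>\<^sup>+x. ennreal \<bar>Dif h (bessel_kernel a) x\<bar> \<partial>lborel) \<le> ennreal (L * norm h powr s)" .
    have "(\<integral>y. \<bar>Dif h (bessel_kernel a) y\<bar> \<partial>lborel) = enn2real (\<integral>\<^sup>+x. ennreal \<bar>Dif h (bessel_kernel a) x\<bar> \<partial>lborel)"
      by (rule integral_eq_nn_integral) auto
    also have "\<dots> \<le> L * norm h powr s"
      using le L0 by (simp add: enn2real_leI)
    finally show ?thesis .
  qed
  then show ?thesis using that[of L] L0 by blast
qed


section \<open>Convolutions of Schwartz functions\<close>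

lemma mean_value_segment:
  fixes f :: "'a::euclidean_space \<Rightarrow> real"
  assumes "\<And>t. t \<in> {0..1} \<Longrightarrow> f differentiable (at (z + t *\<^sub>R v))"
  shows "\<exists>\<theta>\<in>{0..1}. f (z + v) - f z = (\<Sum>b\<in>Basis. (v \<bullet> b) * partial_deriv b f (z + \<theta> *\<^sub>R v))"
proof -
  let ?D = "\<lambda>t. \<Sum>b\<in>Basis. (v \<bullet> b) * partial_deriv b f (z + t *\<^sub>R v)"
  have d: "((\<lambda>t. f (z + t *\<^sub>R v)) has_derivative (\<lambda>s. s * ?D t)) (at t within {0..1})" if "t \<in> {0..1}" for t
  proof -
    have 2: "((\<lambda>t. z + t *\<^sub>R v) has_derivative (\<lambda>s. s *\<^sub>R v)) (at t within {0..1})"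
      by (auto intro!: derivative_eq_intros)
    show ?thesis
      using has_derivative_compose[OF 2 has_derivative_partial_deriv[OF assms[OF that]]]
      by (simp add: sum_distrib_left mult.assoc)
  qed
  have "\<exists>t\<in>{0..1}. f (z + 1 *\<^sub>R v) - f (z + 0 *\<^sub>R v) = (1 - 0) * ?D t"
    by (rule mvt_very_simple) (use d in auto)
  then show ?thesis by simp
qed

lemma smooth_bounded_lipschitz:
  fixes f :: "'a::euclidean_space \<Rightarrow> real"
  assumes f: "\<And>x. f differentiable (at x)" and B: "\<And>b. b \<in> Basis \<Longrightarrow> bounded (range (partial_deriv b f))"
  shows "\<exists>L\<ge>0. \<forall>z v. \<bar>f (z + v) - f z\<bar> \<le> L * norm v"
proof -
  have "\<forall>b\<in>Basis. \<exists>M. \<forall>x. \<bar>partial_deriv b f x\<bar> \<le> M"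
    using B by (auto simp: bounded_iff)
  from bchoice[OF this] obtain M where M: "\<And>b x. b \<in> Basis \<Longrightarrow> \<bar>partial_deriv b f x\<bar> \<le> M b" by blast
  have M0: "0 \<le> M b" if "b \<in> Basis" for b using M[OF that, of 0] by linarith
  show ?thesis
  proof (intro exI[of _ "\<Sum>b\<in>Basis. M b"] conjI allI)
    fix z v
    obtain t where t: "f (z + v) - f z = (\<Sum>b\<in>Basis. (v \<bullet> b) * partial_deriv b f (z + t *\<^sub>R v))"
      using mean_value_segment[where f=f and z=z and v=v, OF f] by blast
    have "\<bar>f (z + v) - f z\<bar> \<le> (\<Sum>b\<in>Basis. \<bar>(v \<bullet> b) * partial_deriv b f (z + t *\<^sub>R v)\<bar>)"
      unfolding t by (rule sum_abs)
    also have "\<dots> \<le> (\<Sum>b\<in>Basis. norm v * M b)"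
      using M Basis_le_norm by (intro sum_mono) (auto simp: abs_mult intro!: mult_mono)
    finally show "\<bar>f (z + v) - f z\<bar> \<le> (\<Sum>b\<in>Basis. M b) * norm v"
      by (simp add: sum_distrib_left mult.commute)
  qed (use M0 in \<open>auto intro: sum_nonneg\<close>)
qed

text \<open>Bounded derivatives of every order are what allows differentiation under a convolution
  with a merely integrable kernel.\<close>

definition smooth_bounded :: "('a::euclidean_space \<Rightarrow> real) \<Rightarrow> bool" where
  "smooth_bounded \<phi> \<longleftrightarrow> smooth_on UNIV \<phi> \<and> (\<forall>bs\<in>lists Basis. bounded (range (iter_partial bs \<phi>)))"

lemma smooth_bounded_iter_partial:
  fixes \<phi> :: "'a::euclidean_space \<Rightarrow> real"
  assumes "smooth_bounded \<phi>" "bs \<in> lists Basis"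
  shows "smooth_bounded (iter_partial bs \<phi>)"
  unfolding smooth_bounded_def
proof (intro conjI ballI)
  show "smooth_on UNIV (iter_partial bs \<phi>)"
    using assms smooth_on_iter_partial unfolding smooth_bounded_def by blast
  fix as assume "as \<in> lists (Basis :: 'a set)"
  then have "as @ bs \<in> lists Basis" using assms(2) by simp
  then show "bounded (range (iter_partial as (iter_partial bs \<phi>)))"
    using assms(1) unfolding smooth_bounded_def iter_partial_append[symmetric] by blast
qed

lemma smooth_bounded_partial_deriv: "smooth_bounded \<phi> \<Longrightarrow> b \<in> Basis \<Longrightarrow> smooth_bounded (partial_deriv b \<phi>)"
  using smooth_bounded_iter_partial[of \<phi> "[b]"] by simp

lemma smooth_bounded_bound:
  assumes "smooth_bounded \<phi>"
  obtains B where "0 \<le> B" "\<forall>x. \<bar>\<phi> x\<bar> \<le> B"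
proof -
  have "bounded (range (iter_partial [] \<phi>))" using assms unfolding smooth_bounded_def by blast
  then obtain B where "\<forall>x. \<bar>\<phi> x\<bar> \<le> B" by (auto simp: bounded_iff)
  moreover from this have "0 \<le> B" by (meson abs_ge_zero order_trans)
  ultimately show ?thesis using that by blast
qed

lemma smooth_bounded_differentiable: "smooth_bounded \<phi> \<Longrightarrow> \<phi> differentiable (at x)"
  unfolding smooth_bounded_def by (intro smooth_on_differentiable[of UNIV]) simp_all

lemma smooth_bounded_measurable: "smooth_bounded \<phi> \<Longrightarrow> \<phi> \<in> borel_measurable borel"
  unfolding smooth_bounded_def by (intro smooth_borel_measurable) simp

text \<open>The remainder is uniform in the base point, since the first derivatives are globally
  Lipschitz; this uniformity is what can be integrated against a kernel.\<close>

lemma smooth_bounded_taylor: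
  fixes \<phi> :: "'a::euclidean_space \<Rightarrow> real"
  assumes "smooth_bounded \<phi>"
  shows "\<exists>M\<ge>0. \<forall>z v. \<bar>\<phi> (z + v) - \<phi> z - (\<Sum>b\<in>Basis. (v \<bullet> b) * partial_deriv b \<phi> z)\<bar> \<le> M * (norm v)\<^sup>2"
proof -
  have "\<forall>b\<in>Basis. \<exists>L\<ge>0. \<forall>z v. \<bar>partial_deriv b \<phi> (z + v) - partial_deriv b \<phi> z\<bar> \<le> L * norm v"
  proof
    fix b :: 'a assume b: "b \<in> Basis"
    note sb = smooth_bounded_partial_deriv[OF assms b]
    show "\<exists>L\<ge>0. \<forall>z v. \<bar>partial_deriv b \<phi> (z + v) - partial_deriv b \<phi> z\<bar> \<le> L * norm v"
    proof (rule smooth_bounded_lipschitz)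
      fix c :: 'a assume "c \<in> Basis"
      then have "[c] \<in> lists Basis" by simp
      then have "bounded (range (iter_partial [c] (partial_deriv b \<phi>)))"
        using sb unfolding smooth_bounded_def by (simp del: iter_partial.simps)
      then show "bounded (range (partial_deriv c (partial_deriv b \<phi>)))" by simp
    qed (rule smooth_bounded_differentiable[OF sb])
  qed
  from bchoice[OF this] obtain L where L: "\<And>b. b \<in> Basis \<Longrightarrow> 0 \<le> L b"
    "\<And>b z v. b \<in> Basis \<Longrightarrow> \<bar>partial_deriv b \<phi> (z + v) - partial_deriv b \<phi> z\<bar> \<le> L b * norm v" by blast
  show ?thesis
  proof (intro exI[of _ "\<Sum>b\<in>Basis. L b"] conjI allI)
    fix z v
    obtain t where t01: "t \<in> {0..1}" and t: "\<phi> (z + v) - \<phi> z = (\<Sum>b\<in>Basis. (v \<bullet> b) * partial_deriv b \<phi> (z + t *\<^sub>R v))"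
      using mean_value_segment[where f=\<phi> and z=z and v=v, OF smooth_bounded_differentiable[OF assms]] by blast
    have "\<bar>\<phi> (z + v) - \<phi> z - (\<Sum>b\<in>Basis. (v \<bullet> b) * partial_deriv b \<phi> z)\<bar>
        = \<bar>\<Sum>b\<in>Basis. (v \<bullet> b) * (partial_deriv b \<phi> (z + t *\<^sub>R v) - partial_deriv b \<phi> z)\<bar>"
      unfolding t by (simp add: sum_subtractf right_diff_distrib)
    also have "\<dots> \<le> (\<Sum>b\<in>Basis. \<bar>(v \<bullet> b) * (partial_deriv b \<phi> (z + t *\<^sub>R v) - partial_deriv b \<phi> z)\<bar>)"
      by (rule sum_abs)
    also have "\<dots> \<le> (\<Sum>b\<in>Basis. norm v * (L b * norm v))"
    proof (rule sum_mono)
      fix b :: 'a assume b: "b \<in> Basis"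
      have "\<bar>partial_deriv b \<phi> (z + t *\<^sub>R v) - partial_deriv b \<phi> z\<bar> \<le> L b * norm (t *\<^sub>R v)" by (rule L(2)[OF b])
      also have "\<dots> \<le> L b * norm v"
        using L(1)[OF b] t01 by (intro mult_left_mono) (auto intro!: mult_left_le_one_le)
      finally show "\<bar>(v \<bullet> b) * (partial_deriv b \<phi> (z + t *\<^sub>R v) - partial_deriv b \<phi> z)\<bar> \<le> norm v * (L b * norm v)"
        unfolding abs_mult using Basis_le_norm[OF b, of v] by (intro mult_mono) auto
    qed
    also have "\<dots> = (\<Sum>b\<in>Basis. L b) * (norm v)\<^sup>2"
      unfolding sum_distrib_right by (intro sum.cong refl) (simp add: power2_eq_square)
    finally show "\<bar>\<phi> (z + v) - \<phi> z - (\<Sum>b\<in>Basis. (v \<bullet> b) * partial_deriv b \<phi> z)\<bar> \<le> (\<Sum>b\<in>Basis. L b) * (norm v)\<^sup>2" .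
  qed (use L in \<open>auto intro: sum_nonneg\<close>)
qed

lemma conv_integrable_bounded:
  fixes K \<phi> :: "'a::euclidean_space \<Rightarrow> real"
  assumes K: "integrable lborel K" and m[measurable]: "\<phi> \<in> borel_measurable borel" and B: "\<forall>x. \<bar>\<phi> x\<bar> \<le> B"
  shows "integrable lborel (\<lambda>y. K y * \<phi> (x - y))"
proof (rule Bochner_Integration.integrable_bound)
  show "integrable lborel (\<lambda>y. B * \<bar>K y\<bar>)" using K by auto
  show "(\<lambda>y. K y * \<phi> (x - y)) \<in> borel_measurable lborel" using K by auto
  have "0 \<le> B" using B by (meson abs_ge_zero order_trans)
  then show "AE y in lborel. norm (K y * \<phi> (x - y)) \<le> norm (B * \<bar>K y\<bar>)"
    using B by (auto simp: abs_mult mult.commute[of B] intro!: mult_left_mono)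
qed

text \<open>Integrating the uniform Taylor remainder against |K| leaves an error quadratic in
  \<open>v\<close>; no limit is exchanged with an integral.\<close>

lemma has_derivative_conv:
  fixes \<phi> :: "'a::euclidean_space \<Rightarrow> real"
  assumes K: "integrable lborel K" and sb: "smooth_bounded \<phi>"
  shows "(conv K \<phi> has_derivative (\<lambda>v. \<Sum>b\<in>Basis. (v \<bullet> b) * conv K (partial_deriv b \<phi>) x)) (at x)"
proof -
  obtain M where M: "0 \<le> M" "\<And>z v. \<bar>\<phi> (z + v) - \<phi> z - (\<Sum>b\<in>Basis. (v \<bullet> b) * partial_deriv b \<phi> z)\<bar> \<le> M * (norm v)\<^sup>2"
    using smooth_bounded_taylor[OF sb] by blast
  have I: "integrable lborel (\<lambda>y. K y * f (x - y))" if f: "smooth_bounded f" for f :: "'a \<Rightarrow> real" and x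
  proof -
    obtain B where "\<forall>x. \<bar>f x\<bar> \<le> B" by (rule smooth_bounded_bound[OF f])
    then show ?thesis by (rule conv_integrable_bounded[OF K smooth_bounded_measurable[OF f]])
  qed
  let ?A = "\<integral>y. \<bar>K y\<bar> \<partial>lborel"
  let ?f' = "\<lambda>v. \<Sum>b\<in>Basis. (v \<bullet> b) * conv K (partial_deriv b \<phi>) x"
  have est: "\<bar>conv K \<phi> (x + v) - conv K \<phi> x - ?f' v\<bar> \<le> ?A * M * (norm v)\<^sup>2" for v
  proof -
    let ?R = "\<lambda>y. \<phi> (x + v - y) - \<phi> (x - y) - (\<Sum>b\<in>Basis. (v \<bullet> b) * partial_deriv b \<phi> (x - y))"
    let ?S = "\<lambda>y. \<Sum>b\<in>Basis. (v \<bullet> b) * (K y * partial_deriv b \<phi> (x - y))"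
    have e: "K y * ?R y = K y * \<phi> (x + v - y) - K y * \<phi> (x - y) - ?S y" for y
      by (simp add: right_diff_distrib sum_distrib_left mult.left_commute)
    have Ib: "integrable lborel (\<lambda>y. (v \<bullet> b) * (K y * partial_deriv b \<phi> (x - y)))" if "b \<in> Basis" for b
      using I[OF smooth_bounded_partial_deriv[OF sb that]] by simp
    have IS: "integrable lborel ?S" by (intro Bochner_Integration.integrable_sum Ib)
    have ID: "integrable lborel (\<lambda>y. K y * \<phi> (x + v - y) - K y * \<phi> (x - y))"
      by (intro Bochner_Integration.integrable_diff I[OF sb])
    have int: "integrable lborel (\<lambda>y. K y * ?R y)"
      unfolding e by (rule Bochner_Integration.integrable_diff[OF ID IS])
    have "(\<integral>y. K y * ?R y \<partial>lborel) = (\<integral>y. K y * \<phi> (x + v - y) - K y * \<phi> (x - y) \<partial>lborel) - (\<integral>y. ?S y \<partial>lborel)"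
      unfolding e by (rule Bochner_Integration.integral_diff[OF ID IS])
    moreover have "(\<integral>y. K y * \<phi> (x + v - y) - K y * \<phi> (x - y) \<partial>lborel) = conv K \<phi> (x + v) - conv K \<phi> x"
      unfolding conv_def by (rule Bochner_Integration.integral_diff[OF I[OF sb] I[OF sb]])
    moreover have "(\<integral>y. ?S y \<partial>lborel) = ?f' v"
      unfolding conv_def integral_mult_right_zero[symmetric]
      by (rule Bochner_Integration.integral_sum) (rule Ib)
    ultimately have "\<bar>conv K \<phi> (x + v) - conv K \<phi> x - ?f' v\<bar> = \<bar>\<integral>y. K y * ?R y \<partial>lborel\<bar>" by simp
    also have "\<dots> \<le> (\<integral>y. \<bar>K y * ?R y\<bar> \<partial>lborel)" by (rule integral_abs_bound)
    also have "\<dots> \<le> (\<integral>y. \<bar>K y\<bar> * (M * (norm v)\<^sup>2) \<partial>lborel)"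
    proof (rule integral_mono[OF integrable_abs[OF int]])
      show "integrable lborel (\<lambda>y. \<bar>K y\<bar> * (M * (norm v)\<^sup>2))"
        by (intro Bochner_Integration.integrable_mult_left integrable_abs K)
      fix y
      have *: "x + v - y = x - y + v" by simp
      have "\<bar>?R y\<bar> \<le> M * (norm v)\<^sup>2" unfolding * by (rule M(2))
      then show "\<bar>K y * ?R y\<bar> \<le> \<bar>K y\<bar> * (M * (norm v)\<^sup>2)"
        unfolding abs_mult by (rule mult_left_mono) simp
    qed
    also have "\<dots> = ?A * M * (norm v)\<^sup>2" by (simp add: mult.assoc)
    finally show ?thesis .
  qed
  show ?thesis
  proof (rule has_derivativeI_sandwich[of 1])
    show "bounded_linear ?f'"
      by (intro bounded_linear_sum bounded_linear_compose[OF bounded_linear_mult_left bounded_linear_inner_left])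
    show "norm (conv K \<phi> y - conv K \<phi> x - ?f' (y - x)) / norm (y - x) \<le> ?A * M * norm (y - x)"
      if "y \<noteq> x" for y
    proof -
      have "0 < norm (y - x)" using that by simp
      then show ?thesis
        using est[of "y - x"] by (simp add: divide_le_eq power2_eq_square mult.assoc)
    qed
    have "((\<lambda>y. ?A * M * norm (y - x)) \<longlongrightarrow> ?A * M * norm (x - x)) (at x)"
      by (intro tendsto_intros)
    then show "((\<lambda>y. ?A * M * norm (y - x)) \<longlongrightarrow> 0) (at x)" by simp
  qed auto
qed

lemma iter_partial_conv:
  fixes \<phi> :: "'a::euclidean_space \<Rightarrow> real"
  assumes K: "integrable lborel K" and sb: "smooth_bounded \<phi>" and "bs \<in> lists Basis"
  shows "iter_partial bs (conv K \<phi>) = conv K (iter_partial bs \<phi>)"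
  using assms(3)
proof (induction bs)
  case (Cons b bs)
  note d = has_derivative_conv[OF K smooth_bounded_iter_partial[OF sb Cons.hyps(2)]]
  show ?case
  proof
    fix x
    have "iter_partial (b # bs) (conv K \<phi>) x = partial_deriv b (conv K (iter_partial bs \<phi>)) x"
      using Cons by simp
    also have "\<dots> = (\<Sum>c\<in>Basis. (b \<bullet> c) * conv K (partial_deriv c (iter_partial bs \<phi>)) x)"
      by (rule partial_deriv_eqI[OF d])
    also have "\<dots> = (\<Sum>c\<in>Basis. if c = b then conv K (partial_deriv c (iter_partial bs \<phi>)) x else 0)"
      using Cons.hyps(1) by (intro sum.cong refl) (auto simp: inner_Basis)
    also have "\<dots> = conv K (iter_partial (b # bs) \<phi>) x"
      using Cons.hyps(1) by simp
    finally show "iter_partial (b # bs) (conv K \<phi>) x = conv K (iter_partial (b # bs) \<phi>) x" .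
  qed
qed simp

lemma smooth_conv:
  fixes \<phi> :: "'a::euclidean_space \<Rightarrow> real"
  assumes K: "integrable lborel K" and sb: "smooth_bounded \<phi>"
  shows "smooth_on UNIV (conv K \<phi>)"
  unfolding smooth_on_def
proof (intro ballI)
  fix bs x assume bs: "bs \<in> lists (Basis :: 'a set)"
  show "iter_partial bs (conv K \<phi>) differentiable at x"
    unfolding iter_partial_conv[OF K sb bs]
    by (rule differentiableI[OF has_derivative_conv[OF K smooth_bounded_iter_partial[OF sb bs]]])
qed

lemma schwartz_smooth_bounded:
  fixes \<phi> :: "'a::euclidean_space \<Rightarrow> real"
  assumes "\<phi> \<in> schwartz"
  shows "smooth_bounded \<phi>"
  unfolding smooth_bounded_def
proof (intro conjI ballI)
  show "smooth_on UNIV \<phi>" using assms by (simp add: schwartz_def)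
  fix bs :: "'a list" assume "bs \<in> lists Basis"
  then have "bounded (range (\<lambda>x. norm x ^ 0 * iter_partial bs \<phi> x))"
    using assms unfolding schwartz_def by blast
  then show "bounded (range (iter_partial bs \<phi>))" by simp
qed

lemma power_add_le:
  fixes a b :: real
  assumes "0 \<le> a" "0 \<le> b"
  shows "(a + b) ^ k \<le> 2 ^ k * (a ^ k + b ^ k)"
proof -
  have "(a + b) ^ k \<le> (2 * max a b) ^ k" using assms by (intro power_mono) auto
  also have "\<dots> = 2 ^ k * max a b ^ k" by (simp add: power_mult_distrib)
  also have "max a b ^ k \<le> a ^ k + b ^ k" using assms by (simp add: max_def)
  finally show ?thesis by (simp add: mult_left_mono)
qed

text \<open>Since |x| \<le> |x - y| + |y|, a power of |x| is paid either by the decay of the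
  derivative of \<open>\<phi>\<close> at x - y or by a moment of \<open>K\<close>.\<close>

lemma schwartz_conv:
  fixes \<phi> :: "'a::euclidean_space \<Rightarrow> real"
  assumes K: "\<And>k. integrable lborel (\<lambda>x. norm x ^ k * K x)" and \<phi>: "\<phi> \<in> schwartz"
  shows "conv K \<phi> \<in> schwartz"
proof -
  have K0: "integrable lborel K" using K[of 0] by simp
  note sb = schwartz_smooth_bounded[OF \<phi>]
  have "bounded (range (\<lambda>x. norm x ^ k * iter_partial bs (conv K \<phi>) x))" if bs: "bs \<in> lists Basis" for k bs
  proof -
    let ?g = "iter_partial bs \<phi>"
    have g: "smooth_bounded ?g" by (rule smooth_bounded_iter_partial[OF sb bs])
    obtain B where B: "0 \<le> B" "\<forall>x. \<bar>?g x\<bar> \<le> B" by (rule smooth_bounded_bound[OF g])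
    have "bounded (range (\<lambda>x. norm x ^ k * ?g x))" using \<phi> bs unfolding schwartz_def by blast
    then obtain A where A: "\<And>x. \<bar>norm x ^ k * ?g x\<bar> \<le> A" by (auto simp: bounded_iff)
    let ?W = "\<lambda>y. 2 ^ k * (A * \<bar>K y\<bar> + B * \<bar>norm y ^ k * K y\<bar>)"
    have W: "integrable lborel ?W" using K0 K[of k] by auto
    have I: "integrable lborel (\<lambda>y. norm x ^ k * (K y * ?g (x - y)))" for x
      using conv_integrable_bounded[OF K0 smooth_bounded_measurable[OF g] B(2)] by simp
    have "\<bar>norm x ^ k * conv K ?g x\<bar> \<le> (\<integral>y. ?W y \<partial>lborel)" for x
    proof -
      have "\<bar>norm x ^ k * conv K ?g x\<bar> = \<bar>\<integral>y. norm x ^ k * (K y * ?g (x - y)) \<partial>lborel\<bar>"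
        unfolding conv_def by simp
      also have "\<dots> \<le> (\<integral>y. \<bar>norm x ^ k * (K y * ?g (x - y))\<bar> \<partial>lborel)" by (rule integral_abs_bound)
      also have "\<dots> \<le> (\<integral>y. ?W y \<partial>lborel)"
      proof (rule integral_mono[OF integrable_abs[OF I] W])
        fix y
        have "norm x ^ k \<le> (norm (x - y) + norm y) ^ k"
          using norm_triangle_ineq[of "x - y" y] by (intro power_mono) auto
        also have "\<dots> \<le> 2 ^ k * (norm (x - y) ^ k + norm y ^ k)" by (rule power_add_le) auto
        finally have "norm x ^ k * (\<bar>K y\<bar> * \<bar>?g (x - y)\<bar>) \<le> (2 ^ k * (norm (x - y) ^ k + norm y ^ k)) * (\<bar>K y\<bar> * \<bar>?g (x - y)\<bar>)"
          by (intro mult_right_mono) auto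
        also have "\<dots> = 2 ^ k * (\<bar>norm (x - y) ^ k * ?g (x - y)\<bar> * \<bar>K y\<bar> + \<bar>?g (x - y)\<bar> * \<bar>norm y ^ k * K y\<bar>)"
          by (simp add: abs_mult power_abs algebra_simps)
        also have "\<dots> \<le> ?W y"
          using A B(2) by (intro mult_left_mono add_mono mult_right_mono) auto
        finally show "\<bar>norm x ^ k * (K y * ?g (x - y))\<bar> \<le> ?W y" by (simp add: abs_mult power_abs)
      qed
      finally show ?thesis .
    qed
    then show ?thesis unfolding iter_partial_conv[OF K0 sb bs] by (auto simp: bounded_iff)
  qed
  then show ?thesis using smooth_conv[OF K0 sb] by (auto simp: schwartz_def)
qed

lemma test_functions_schwartz:
  assumes "\<phi> \<in> test_functions (D :: 'a::euclidean_space set)"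
  shows "\<phi> \<in> schwartz"
proof -
  obtain R where R: "\<And>x. x \<in> supp \<phi> \<Longrightarrow> norm x \<le> R"
    using compact_imp_bounded[OF test_functions_compact[OF assms]] by (auto simp: bounded_iff)
  have "bounded (range (\<lambda>x. norm x ^ k * iter_partial bs \<phi> x))" if bs: "bs \<in> lists Basis" for k bs
  proof -
    obtain B where B: "\<And>x. \<bar>iter_partial bs \<phi> x\<bar> \<le> B"
      using test_functions_bounded[OF assms bs] by (auto simp: bounded_iff)
    have "\<bar>norm x ^ k * iter_partial bs \<phi> x\<bar> \<le> \<bar>R\<bar> ^ k * \<bar>B\<bar>" for x
    proof (cases "x \<in> supp \<phi>")
      case True
      have "norm x \<le> \<bar>R\<bar>" "\<bar>iter_partial bs \<phi> x\<bar> \<le> \<bar>B\<bar>" using R[OF True] B[of x] by linarith+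
      then show ?thesis by (auto simp: abs_mult power_abs intro!: mult_mono power_mono)
    qed (simp add: iter_partial_not_in_supp)
    then show ?thesis by (auto simp: bounded_iff)
  qed
  then show ?thesis using test_functions_smooth[OF assms] by (auto simp: schwartz_def)
qed


section \<open>Fourier inversion\<close>

lemma measurable_cis_inner [measurable]:
  fixes f g :: "'b \<Rightarrow> 'a::euclidean_space"
  assumes "f \<in> borel_measurable M" "g \<in> borel_measurable M"
  shows "(\<lambda>x. cis (f x \<bullet> g x)) \<in> borel_measurable M" "(\<lambda>x. cis (- (f x \<bullet> g x))) \<in> borel_measurable M"
proof -
  have c: "cis \<in> borel_measurable borel"
    by (intro borel_measurable_continuous_onI) (auto simp: cis_conv_exp[abs_def] intro!: continuous_intros)
  show "(\<lambda>x. cis (f x \<bullet> g x)) \<in> borel_measurable M" "(\<lambda>x. cis (- (f x \<bullet> g x))) \<in> borel_measurable M"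
    by (rule measurable_compose[OF _ c]; use assms in simp)+
qed

lemma integrable_cis_mult:
  fixes \<phi> :: "'a::euclidean_space \<Rightarrow> real"
  assumes "integrable lborel \<phi>"
  shows "integrable lborel (\<lambda>x. cis (- (x \<bullet> \<xi>)) * of_real (\<phi> x))"
proof (rule Bochner_Integration.integrable_bound[OF assms])
  have [measurable]: "\<phi> \<in> borel_measurable borel" using assms by auto
  show "(\<lambda>x. cis (- (x \<bullet> \<xi>)) * of_real (\<phi> x)) \<in> borel_measurable lborel" by measurable
qed (simp add: norm_mult)

lemma fourier_norm_le:
  assumes "integrable lborel \<phi>"
  shows "norm (fourier \<phi> \<xi>) \<le> (\<integral>x. \<bar>\<phi> x\<bar> \<partial>lborel)"
proof -
  have "norm (fourier \<phi> \<xi>) \<le> (\<integral>x. norm (cis (- (x \<bullet> \<xi>)) * of_real (\<phi> x)) \<partial>lborel)"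
    unfolding fourier_def by (rule integral_norm_bound)
  then show ?thesis by (simp add: norm_mult)
qed

lemma measurable_fourier [measurable]:
  assumes [measurable]: "\<phi> \<in> borel_measurable borel"
  shows "fourier \<phi> \<in> borel_measurable borel"
  unfolding fourier_def[abs_def]
proof (rule lborel.borel_measurable_lebesgue_integral)
  show "(\<lambda>(\<xi>, x). cis (- (x \<bullet> \<xi>)) * complex_of_real (\<phi> x)) \<in> borel_measurable (borel \<Otimes>\<^sub>M lborel)"
    unfolding case_prod_beta' by measurable
qed

lemma conv_integrable:
  assumes K: "integrable lborel K" and \<phi>: "integrable lborel \<phi>"
  shows "integrable lborel (conv K \<phi>)"
proof -
  have m: "K \<in> borel_measurable borel" "\<phi> \<in> borel_measurable borel" using K \<phi> by auto
  have e: "Lp_pow 1 f = (\<integral>\<^sup>+x. ennreal (norm (f x)) \<partial>lborel)" for f :: "'a \<Rightarrow> real"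
    by (simp add: Lp_pow_def)
  have fin: "Lp_pow 1 \<phi> < \<infinity>" using \<phi> by (simp add: e integrable_iff_bounded)
  have "Lp_pow 1 (conv K \<phi>) \<le> ennreal ((\<integral>y. \<bar>K y\<bar> \<partial>lborel) powr 1) * Lp_pow 1 \<phi>"
    by (rule conv_Lp_bound[OF K m(2) _ fin]) simp
  also have "\<dots> < \<infinity>" using fin by (simp add: ennreal_mult_less_top)
  finally show ?thesis using m by (simp add: e integrable_iff_bounded)
qed

lemma fourier_conv:
  fixes K \<phi> :: "'a::euclidean_space \<Rightarrow> real"
  assumes K: "integrable lborel K" and \<phi>: "integrable lborel \<phi>"
  shows "fourier (conv K \<phi>) \<xi> = fourier K \<xi> * fourier \<phi> \<xi>"
proof -
  have m[measurable]: "K \<in> borel_measurable borel" "\<phi> \<in> borel_measurable borel" using K \<phi> by auto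
  let ?H = "\<lambda>y x. cis (- (x \<bullet> \<xi>)) * of_real (K y * \<phi> (x - y))"
  have sh: "integrable lborel (\<lambda>x. \<phi> (x - y))" for y
    using integrable_lborel_translate(1)[OF \<phi>, of "- y"] by simp
  have shi: "(\<integral>x. \<bar>\<phi> (x - y)\<bar> \<partial>lborel) = (\<integral>x. \<bar>\<phi> x\<bar> \<partial>lborel)" for y
    using integral_lborel_translate(1)[of "\<lambda>x. \<bar>\<phi> x\<bar>" "- y"] by simp
  have Hm: "(\<lambda>(y, x). ?H y x) \<in> borel_measurable (lborel \<Otimes>\<^sub>M lborel)"
    unfolding case_prod_beta' by measurable
  have I: "integrable (lborel \<Otimes>\<^sub>M lborel) (\<lambda>(y, x). ?H y x)"
  proof (rule lborel_pair.Fubini_integrable[OF Hm])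
    have "(\<integral>x. norm (?H y x) \<partial>lborel) = \<bar>K y\<bar> * (\<integral>x. \<bar>\<phi> x\<bar> \<partial>lborel)" for y
      by (simp add: norm_mult abs_mult shi)
    then show "integrable lborel (\<lambda>y. \<integral>x. norm (case (y, x) of (y, x) \<Rightarrow> ?H y x) \<partial>lborel)"
      using K by simp
    show "AE y in lborel. integrable lborel (\<lambda>x. case (y, x) of (y, x) \<Rightarrow> ?H y x)"
      using integrable_cis_mult[OF integrable_mult_right[OF sh]] by simp
  qed
  have "fourier (conv K \<phi>) \<xi> = (\<integral>x. (\<integral>y. ?H y x \<partial>lborel) \<partial>lborel)"
    by (simp only: fourier_def conv_def integral_mult_right_zero integral_complex_of_real)
  also have "\<dots> = (\<integral>y. (\<integral>x. ?H y x \<partial>lborel) \<partial>lborel)"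
    by (rule lborel_pair.Fubini_integral[OF I])
  also have "\<dots> = (\<integral>y. (cis (- (y \<bullet> \<xi>)) * of_real (K y)) * fourier \<phi> \<xi> \<partial>lborel)"
  proof (rule Bochner_Integration.integral_cong[OF refl])
    fix y
    have "(\<integral>x. ?H y x \<partial>lborel) = (\<integral>x. ?H y (x + y) \<partial>lborel)"
      by (rule integral_lborel_translate(1)[symmetric]) measurable
    also have "\<dots> = (\<integral>x. (cis (- (y \<bullet> \<xi>)) * of_real (K y)) * (cis (- (x \<bullet> \<xi>)) * of_real (\<phi> x)) \<partial>lborel)"
    proof (intro Bochner_Integration.integral_cong refl)
      fix x
      have "cis (- ((x + y) \<bullet> \<xi>)) = cis (- (x \<bullet> \<xi>)) * cis (- (y \<bullet> \<xi>))"
        by (simp add: cis_mult inner_add_left)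
      then show "?H y (x + y) = (cis (- (y \<bullet> \<xi>)) * of_real (K y)) * (cis (- (x \<bullet> \<xi>)) * of_real (\<phi> x))"
        by (simp add: mult_ac)
    qed
    also have "\<dots> = (cis (- (y \<bullet> \<xi>)) * of_real (K y)) * fourier \<phi> \<xi>"
      unfolding fourier_def by (rule integral_mult_right_zero)
    finally show "(\<integral>x. ?H y x \<partial>lborel) = (cis (- (y \<bullet> \<xi>)) * of_real (K y)) * fourier \<phi> \<xi>" .
  qed
  also have "\<dots> = fourier K \<xi> * fourier \<phi> \<xi>"
    unfolding fourier_def[of K] by (rule integral_mult_left_zero)
  finally show ?thesis .
qed

text \<open>Difference quotients in direction \<open>b\<close> replace integration by parts. A
  translation becomes multiplication by \<open>cis\<close>, and the quotients are dominated because
  \<open>\<phi>\<close> is Lipschitz with bounded support.\<close>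

lemma fourier_partial_deriv:
  fixes \<phi> :: "'a::euclidean_space \<Rightarrow> real"
  assumes \<phi>: "\<phi> \<in> test_functions UNIV" and b: "b \<in> Basis"
  shows "fourier (partial_deriv b \<phi>) \<xi> = \<i> * of_real (\<xi> \<bullet> b) * fourier \<phi> \<xi>"
proof -
  define r where "r j = 1 / real (Suc j)" for j
  have r0: "r \<longlonglongrightarrow> 0" unfolding r_def by (rule LIMSEQ_inverse_real_of_nat[unfolded inverse_eq_divide])
  have rpos: "0 < r j" "r j \<le> 1" for j by (simp_all add: r_def)
  note sb = schwartz_smooth_bounded[OF test_functions_schwartz[OF \<phi>]]
  note [measurable] = smooth_bounded_measurable[OF sb] smooth_bounded_measurable[OF smooth_bounded_partial_deriv[OF sb b]]
  obtain L where L: "0 \<le> L" "\<And>z v. \<bar>\<phi> (z + v) - \<phi> z\<bar> \<le> L * norm v"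
  proof -
    have "\<exists>L\<ge>0. \<forall>z v. \<bar>\<phi> (z + v) - \<phi> z\<bar> \<le> L * norm v"
    proof (rule smooth_bounded_lipschitz)
      fix c :: 'a assume "c \<in> Basis"
      then have "[c] \<in> lists Basis" by simp
      from test_functions_bounded[OF \<phi> this] show "bounded (range (partial_deriv c \<phi>))" by simp
    qed (rule smooth_bounded_differentiable[OF sb])
    then show ?thesis using that by blast
  qed
  obtain R where R: "\<And>x. x \<in> supp \<phi> \<Longrightarrow> norm x \<le> R"
    using compact_imp_bounded[OF test_functions_compact[OF \<phi>]] by (auto simp: bounded_iff)
  have z: "\<phi> x = 0" if "norm x > R" for x using R[of x] that not_in_supp[of x \<phi>] by force
  let ?q = "\<lambda>j x. (\<phi> (x + r j *\<^sub>R b) - \<phi> x) / r j"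
  let ?w = "\<lambda>x::'a. indicator (cball 0 (R + 1)) x * L :: real"
  have qb: "\<bar>?q j x\<bar> \<le> ?w x" for j x
  proof (cases "norm x \<le> R + 1")
    case True
    have "\<bar>\<phi> (x + r j *\<^sub>R b) - \<phi> x\<bar> \<le> L * r j" using L(2)[of x "r j *\<^sub>R b"] b rpos[of j] by simp
    then show ?thesis using True rpos[of j] by (simp add: field_simps)
  next
    case False
    have "norm (r j *\<^sub>R b) \<le> 1" using b rpos[of j] by simp
    then have "norm (x + r j *\<^sub>R b) > R" using False norm_diff_ineq[of x "r j *\<^sub>R b"] by linarith
    then show ?thesis using z False by simp
  qed
  have lim: "(\<lambda>j. ?q j x) \<longlonglongrightarrow> partial_deriv b \<phi> x" for x
  proof -
    have 1: "((\<lambda>t. x + t *\<^sub>R b) has_derivative (\<lambda>s. s *\<^sub>R b)) (at 0)"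
      by (auto intro!: derivative_eq_intros)
    have 2: "(\<phi> has_derivative frechet_derivative \<phi> (at x)) (at (x + 0 *\<^sub>R b))"
      using smooth_bounded_differentiable[OF sb, of x] by (simp add: frechet_derivative_works)
    have "((\<lambda>t. \<phi> (x + t *\<^sub>R b)) has_derivative (\<lambda>s. frechet_derivative \<phi> (at x) (s *\<^sub>R b))) (at 0)"
      by (rule has_derivative_compose[OF 1 2])
    moreover have "(\<lambda>s. frechet_derivative \<phi> (at x) (s *\<^sub>R b)) = (*) (partial_deriv b \<phi> x)"
      using has_derivative_linear[OF 2] by (auto simp: linear_scale partial_deriv_def fun_eq_iff)
    ultimately have "DERIV (\<lambda>t. \<phi> (x + t *\<^sub>R b)) 0 :> partial_deriv b \<phi> x"
      by (simp add: has_field_derivative_def)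
    then have "(\<lambda>t. (\<phi> (x + t *\<^sub>R b) - \<phi> x) / t) \<midarrow>0\<rightarrow> partial_deriv b \<phi> x"
      by (simp add: DERIV_def)
    moreover have "filterlim r (at 0) sequentially"
      using r0 rpos by (auto simp: filterlim_at less_imp_neq intro!: always_eventually) (metis less_irrefl rpos(1))
    ultimately show ?thesis by (rule filterlim_compose)
  qed
  have \<phi>i: "integrable lborel \<phi>" by (rule test_functions_integrable[OF \<phi>])
  have sh: "fourier (\<lambda>x. \<phi> (x + v)) \<xi> = cis (v \<bullet> \<xi>) * fourier \<phi> \<xi>" for v
  proof -
    have "fourier (\<lambda>x. \<phi> (x + v)) \<xi> = (\<integral>x. cis (v \<bullet> \<xi>) * (cis (- ((x + v) \<bullet> \<xi>)) * of_real (\<phi> (x + v))) \<partial>lborel)"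
      unfolding fourier_def
      by (intro Bochner_Integration.integral_cong refl) (simp add: inner_add_left cis_mult mult.assoc[symmetric])
    also have "\<dots> = cis (v \<bullet> \<xi>) * (\<integral>x. cis (- ((x + v) \<bullet> \<xi>)) * of_real (\<phi> (x + v)) \<partial>lborel)"
      by (rule integral_mult_right_zero)
    also have "(\<integral>x. cis (- ((x + v) \<bullet> \<xi>)) * of_real (\<phi> (x + v)) \<partial>lborel) = fourier \<phi> \<xi>"
      unfolding fourier_def
      by (rule integral_lborel_translate(1)[where f="\<lambda>x. cis (- (x \<bullet> \<xi>)) * of_real (\<phi> x)"]) measurable
    finally show ?thesis .
  qed
  have q: "(\<integral>x. cis (- (x \<bullet> \<xi>)) * of_real (?q j x) \<partial>lborel) = (cis (r j * (\<xi> \<bullet> b)) - 1) / of_real (r j) * fourier \<phi> \<xi>" for j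
  proof -
    have "(\<integral>x. cis (- (x \<bullet> \<xi>)) * of_real (?q j x) \<partial>lborel)
        = (\<integral>x. (cis (- (x \<bullet> \<xi>)) * of_real (\<phi> (x + r j *\<^sub>R b)) - cis (- (x \<bullet> \<xi>)) * of_real (\<phi> x)) / of_real (r j) \<partial>lborel)"
      by (intro Bochner_Integration.integral_cong refl) (simp add: right_diff_distrib)
    also have "\<dots> = (fourier (\<lambda>x. \<phi> (x + r j *\<^sub>R b)) \<xi> - fourier \<phi> \<xi>) / of_real (r j)"
      unfolding fourier_def integral_divide_zero
      by (subst Bochner_Integration.integral_diff)
         (use integrable_cis_mult[OF \<phi>i] integrable_cis_mult[OF integrable_lborel_translate(1)[OF \<phi>i]] in auto)
    also have "\<dots> = (cis (r j * (\<xi> \<bullet> b)) - 1) / of_real (r j) * fourier \<phi> \<xi>"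
      unfolding sh by (simp add: inner_commute left_diff_distrib)
    finally show ?thesis .
  qed
  have "(\<lambda>j. \<integral>x. cis (- (x \<bullet> \<xi>)) * of_real (?q j x) \<partial>lborel) \<longlonglongrightarrow> (\<integral>x. cis (- (x \<bullet> \<xi>)) * of_real (partial_deriv b \<phi> x) \<partial>lborel)"
  proof (rule integral_dominated_convergence[where w="?w"])
    show "integrable lborel ?w"
      using emeasure_lborel_cball_finite[of "0::'a" "R + 1"]
      by (intro integrable_mult_left integrable_real_indicator) auto
    show "AE x in lborel. (\<lambda>j. cis (- (x \<bullet> \<xi>)) * of_real (?q j x)) \<longlonglongrightarrow> cis (- (x \<bullet> \<xi>)) * of_real (partial_deriv b \<phi> x)"
      by (intro AE_I2 tendsto_mult tendsto_const tendsto_of_real lim)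
    show "AE x in lborel. norm (cis (- (x \<bullet> \<xi>)) * of_real (?q j x)) \<le> ?w x" for j
      using qb by (auto simp: norm_mult simp del: of_real_divide of_real_diff)
  qed measurable
  moreover have "(\<lambda>j. (cis (r j * (\<xi> \<bullet> b)) - 1) / of_real (r j) * fourier \<phi> \<xi>) \<longlonglongrightarrow> (\<i> * of_real (\<xi> \<bullet> b)) * fourier \<phi> \<xi>"
  proof (intro tendsto_mult tendsto_const)
    have "((\<lambda>t. exp (\<i> * of_real (\<xi> \<bullet> b) * t)) has_field_derivative (\<i> * of_real (\<xi> \<bullet> b)) * exp (\<i> * of_real (\<xi> \<bullet> b) * 0)) (at 0)"
      by (auto intro!: derivative_eq_intros)
    then have "(\<lambda>t. (exp (\<i> * of_real (\<xi> \<bullet> b) * t) - 1) / t) \<midarrow>0\<rightarrow> \<i> * of_real (\<xi> \<bullet> b)"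
      by (simp add: DERIV_def)
    moreover have "filterlim (\<lambda>j. complex_of_real (r j)) (at 0) sequentially"
    proof -
      have "(\<lambda>j. complex_of_real (r j)) \<longlonglongrightarrow> 0" using tendsto_of_real[OF r0] by simp
      moreover have "complex_of_real (r j) \<noteq> 0" for j using rpos(1)[of j] by simp
      ultimately show ?thesis by (simp add: filterlim_at)
    qed
    ultimately have "(\<lambda>j. (exp (\<i> * of_real (\<xi> \<bullet> b) * complex_of_real (r j)) - 1) / complex_of_real (r j)) \<longlonglongrightarrow> \<i> * of_real (\<xi> \<bullet> b)"
      by (rule filterlim_compose)
    then show "(\<lambda>j. (cis (r j * (\<xi> \<bullet> b)) - 1) / complex_of_real (r j)) \<longlonglongrightarrow> \<i> * of_real (\<xi> \<bullet> b)"
      by (simp add: cis_conv_exp mult_ac)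
  qed
  ultimately show ?thesis
    unfolding q using LIMSEQ_unique by (auto simp: fourier_def)
qed

lemma test_functions_diff:
  assumes "f \<in> test_functions UNIV" "g \<in> test_functions (UNIV :: 'a::euclidean_space set)"
  shows "(\<lambda>x. f x - g x) \<in> test_functions UNIV"
proof -
  have "(\<lambda>x. if x \<in> UNIV then f x + (-1) * g x else 0) \<in> test_functions UNIV"
  proof (rule test_functionsI[where K="supp f \<union> supp g"])
    show "smooth_on UNIV (\<lambda>x. f x + (-1) * g x)"
      using assms test_functions_smooth by (intro smooth_on_add smooth_on_mult smooth_on_const open_UNIV) blast+
  qed (use assms test_functions_compact in \<open>auto simp: not_in_supp\<close>)
  then show ?thesis by simp
qed

text \<open>Applying 1 minus the second derivative in each coordinate gives a test function whose
  transform is that of \<open>\<phi>\<close> times the product of the factors 1 + (\<xi> \<bullet>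
  b)^2. This transform is bounded, and the reciprocal of the product is integrable because it
  factors over the coordinates.\<close>

lemma fourier_test_function_integrable:
  fixes \<phi> :: "'a::euclidean_space \<Rightarrow> real"
  assumes \<phi>: "\<phi> \<in> test_functions UNIV"
  shows "integrable lborel (fourier \<phi>)"
proof -
  obtain bs :: "'a list" where bs: "set bs = Basis" "distinct bs"
    using finite_distinct_list[OF finite_Basis] by blast
  have "\<exists>f\<in>test_functions UNIV. \<forall>\<xi>. fourier f \<xi> = (\<Prod>b\<leftarrow>cs. of_real (1 + (\<xi> \<bullet> b)\<^sup>2)) * fourier \<phi> \<xi>"
    if "set cs \<subseteq> Basis" for cs
    using that
  proof (induction cs)
    case Nil
    then show ?case using \<phi> by auto
  next
    case (Cons b cs)
    then obtain f where f: "f \<in> test_functions UNIV" "\<And>\<xi>. fourier f \<xi> = (\<Prod>b\<leftarrow>cs. of_real (1 + (\<xi> \<bullet> b)\<^sup>2)) * fourier \<phi> \<xi>"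
      by auto
    have b: "b \<in> Basis" using Cons.prems by simp
    let ?f1 = "partial_deriv b f" and ?f2 = "partial_deriv b (partial_deriv b f)"
    have t: "?f1 \<in> test_functions UNIV" "?f2 \<in> test_functions UNIV"
      using test_functions_partial_deriv[OF _ b] f(1) by blast+
    have "fourier (\<lambda>x. f x - ?f2 x) \<xi> = fourier f \<xi> - fourier ?f2 \<xi>" for \<xi>
      unfolding fourier_def
      by (subst Bochner_Integration.integral_diff[symmetric])
         (use integrable_cis_mult test_functions_integrable f(1) t in \<open>auto simp: right_diff_distrib\<close>)
    moreover have "fourier ?f2 \<xi> = - of_real ((\<xi> \<bullet> b)\<^sup>2) * fourier f \<xi>" for \<xi>
    proof -
      have "fourier ?f2 \<xi> = (\<i> * \<i>) * (of_real (\<xi> \<bullet> b) * of_real (\<xi> \<bullet> b)) * fourier f \<xi>"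
        unfolding fourier_partial_deriv[OF t(1) b] fourier_partial_deriv[OF f(1) b] by (simp only: mult_ac)
      then show ?thesis by (simp add: power2_eq_square)
    qed
    ultimately have "fourier (\<lambda>x. f x - ?f2 x) \<xi> = of_real (1 + (\<xi> \<bullet> b)\<^sup>2) * fourier f \<xi>" for \<xi>
      by (simp add: distrib_right)
    then have "\<forall>\<xi>. fourier (\<lambda>x. f x - ?f2 x) \<xi> = (\<Prod>b\<leftarrow>b # cs. of_real (1 + (\<xi> \<bullet> b)\<^sup>2)) * fourier \<phi> \<xi>"
      by (simp add: f(2) mult.assoc)
    then show ?case using test_functions_diff[OF f(1) t(2)] by blast
  qed
  from this[of bs] bs obtain f where f: "f \<in> test_functions UNIV"
    "\<And>\<xi>. fourier f \<xi> = (\<Prod>b\<leftarrow>bs. of_real (1 + (\<xi> \<bullet> b)\<^sup>2)) * fourier \<phi> \<xi>" by auto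
  have p: "(\<Prod>b\<leftarrow>bs. of_real (1 + (\<xi> \<bullet> b)\<^sup>2)) = complex_of_real (\<Prod>b\<in>Basis. 1 + (\<xi> \<bullet> b)\<^sup>2)" for \<xi> :: 'a
  proof -
    have "(\<Prod>b\<leftarrow>cs. of_real (1 + (\<xi> \<bullet> b)\<^sup>2)) = complex_of_real (\<Prod>b\<leftarrow>cs. 1 + (\<xi> \<bullet> b)\<^sup>2)" for cs
      by (induction cs) simp_all
    then show ?thesis
      unfolding bs(1)[symmetric] by (simp only: prod.distinct_set_conv_list[OF bs(2)])
  qed
  have ppos: "0 < (\<Prod>b\<in>Basis. 1 + (\<xi> \<bullet> b)\<^sup>2)" for \<xi> :: 'a
    by (intro prod_pos) (simp add: add_pos_nonneg)
  let ?A = "\<integral>x. \<bar>f x\<bar> \<partial>lborel"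
  have "integrable lborel (\<lambda>x::real. inverse (1 + x\<^sup>2))"
    using integrable_inverse_1_plus_square by (simp add: set_integrable_def)
  from integral_lborel_prod_Basis(1)[where f="\<lambda>_::'a. \<lambda>x. inverse (1 + x\<^sup>2)", OF this]
  have i: "integrable lborel (\<lambda>\<xi>::'a. ?A * (\<Prod>b\<in>Basis. inverse (1 + (\<xi> \<bullet> b)\<^sup>2)))" by simp
  show ?thesis
  proof (rule Bochner_Integration.integrable_bound[OF i])
    show "fourier \<phi> \<in> borel_measurable lborel"
      using measurable_fourier[OF smooth_borel_measurable[OF test_functions_smooth[OF \<phi>]]] by simp
    show "AE \<xi> in lborel. norm (fourier \<phi> \<xi>) \<le> norm (?A * (\<Prod>b\<in>Basis. inverse (1 + (\<xi> \<bullet> b)\<^sup>2)))"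
    proof (rule AE_I2)
      fix \<xi> :: 'a
      let ?P = "\<Prod>b\<in>Basis. 1 + (\<xi> \<bullet> b)\<^sup>2"
      have "norm (fourier f \<xi>) = ?P * norm (fourier \<phi> \<xi>)"
        unfolding f(2) p norm_mult norm_of_real using ppos[of \<xi>] by simp
      then have "?P * norm (fourier \<phi> \<xi>) \<le> ?A"
        using fourier_norm_le[OF test_functions_integrable[OF f(1)], of \<xi>] by simp
      then have "norm (fourier \<phi> \<xi>) \<le> ?A * inverse ?P"
        using ppos[of \<xi>] by (simp add: field_simps)
      moreover have "inverse ?P = (\<Prod>b\<in>Basis. inverse (1 + (\<xi> \<bullet> b)\<^sup>2))" by (simp add: prod_inversef[symmetric] o_def)
      ultimately show "norm (fourier \<phi> \<xi>) \<le> norm (?A * (\<Prod>b\<in>Basis. inverse (1 + (\<xi> \<bullet> b)\<^sup>2)))" by simp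
    qed
  qed
qed

text \<open>Gaussian regularisation: with the factor \<open>gauss (\<epsilon> \<xi>)\<close> the
  double integral is absolutely convergent, Fubini turns it into an average of \<open>\<phi>\<close>
  near x, and both sides converge as \<epsilon> tends to 0.\<close>

lemma fourier_inversion:
  fixes \<phi> :: "'a::euclidean_space \<Rightarrow> real"
  assumes \<phi>: "\<phi> \<in> test_functions UNIV"
  shows "(\<integral>\<xi>. cis (x \<bullet> \<xi>) * fourier \<phi> \<xi> \<partial>lborel) = of_real ((2 * pi) ^ DIM('a) * \<phi> x)"
proof -
  define \<epsilon> where "\<epsilon> j = 1 / real (Suc j)" for j
  have e0: "\<epsilon> \<longlonglongrightarrow> 0" unfolding \<epsilon>_def by (rule LIMSEQ_inverse_real_of_nat[unfolded inverse_eq_divide])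
  have epos: "0 < \<epsilon> j" for j by (simp add: \<epsilon>_def)
  \<comment> \<open>The value of \<open>gauss\<close> at 0, which is the limit of the regularising
    factor. It enters twice, through this limit and through the transform of the Gaussian, and
    \<open>c * c\<close> is the reciprocal of (2 pi) to the dimension.\<close>
  define c where "c = (1 / sqrt (2 * pi)) ^ DIM('a)"
  have c: "0 < c" by (simp add: c_def)
  have g: "gauss z = c * exp (- (norm z)\<^sup>2 / 2)" for z :: 'a by (simp add: gauss_eq c_def)
  have \<phi>i: "integrable lborel \<phi>" by (rule test_functions_integrable[OF \<phi>])
  have [measurable]: "\<phi> \<in> borel_measurable borel" using \<phi>i by auto
  have fi: "integrable lborel (fourier \<phi>)" by (rule fourier_test_function_integrable[OF \<phi>])
  obtain B where B: "0 \<le> B" "\<forall>x. \<bar>\<phi> x\<bar> \<le> B"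
    by (rule smooth_bounded_bound[OF schwartz_smooth_bounded[OF test_functions_schwartz[OF \<phi>]]])
  have gi: "integrable lborel (\<lambda>\<xi>::'a. gauss (\<epsilon> j *\<^sub>R \<xi>))" for j
    using integrable_lborel_affine_iff[of "gauss :: 'a \<Rightarrow> real" "\<epsilon> j" 0] epos[of j] gauss_integrable by simp
  have inner: "(\<integral>\<xi>. cis (w \<bullet> \<xi>) * of_real (gauss (\<epsilon> j *\<^sub>R \<xi>)) \<partial>lborel) = of_real (dgauss (\<epsilon> j) w / c)" for w :: 'a and j
  proof -
    let ?e = "\<epsilon> j"
    have "(\<integral>z. cis (z \<bullet> (w /\<^sub>R ?e)) * of_real (gauss z) \<partial>lborel)
       = \<bar>?e\<bar> ^ DIM('a) *\<^sub>R (\<integral>\<xi>. cis ((0 + ?e *\<^sub>R \<xi>) \<bullet> (w /\<^sub>R ?e)) * of_real (gauss (0 + ?e *\<^sub>R \<xi>)) \<partial>lborel)"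
      using epos[of j] by (intro integral_lborel_affine) measurable
    moreover have "(0 + ?e *\<^sub>R \<xi>) \<bullet> (w /\<^sub>R ?e) = w \<bullet> \<xi>" for \<xi> using epos[of j] by (simp add: inner_commute)
    ultimately have "of_real (exp (- (norm (w /\<^sub>R ?e))\<^sup>2 / 2)) = of_real (?e ^ DIM('a)) * (\<integral>\<xi>. cis (w \<bullet> \<xi>) * of_real (gauss (?e *\<^sub>R \<xi>)) \<partial>lborel)"
      unfolding gauss_fourier(1) using epos[of j] by (simp add: scaleR_conv_of_real)
    moreover have "exp (- (norm (w /\<^sub>R ?e))\<^sup>2 / 2) = gauss (w /\<^sub>R ?e) / c" using c by (simp add: g)
    ultimately have "of_real (gauss (w /\<^sub>R ?e) / c) = of_real (?e ^ DIM('a)) * (\<integral>\<xi>. cis (w \<bullet> \<xi>) * of_real (gauss (?e *\<^sub>R \<xi>)) \<partial>lborel)"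
      by simp
    then show ?thesis using epos[of j] c by (simp add: dgauss_def field_simps)
  qed
  have key: "(\<integral>\<xi>. (cis (x \<bullet> \<xi>) * fourier \<phi> \<xi>) * of_real (gauss (\<epsilon> j *\<^sub>R \<xi>)) \<partial>lborel) = of_real (1 / c * (\<integral>z. \<phi> (x - \<epsilon> j *\<^sub>R z) * gauss z \<partial>lborel))" for j
  proof -
    let ?H = "\<lambda>\<xi> y. (cis ((x - y) \<bullet> \<xi>) * of_real (gauss (\<epsilon> j *\<^sub>R \<xi>))) * of_real (\<phi> y)"
    have Hm: "(\<lambda>(\<xi>, y). ?H \<xi> y) \<in> borel_measurable (lborel \<Otimes>\<^sub>M lborel)"
      unfolding case_prod_beta' by measurable
    have I: "integrable (lborel \<Otimes>\<^sub>M lborel) (\<lambda>(\<xi>, y). ?H \<xi> y)"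
    proof (rule lborel_pair.Fubini_integrable[OF Hm])
      show "integrable lborel (\<lambda>\<xi>::'a. \<integral>y. norm (case (\<xi>, y) of (\<xi>, y) \<Rightarrow> ?H \<xi> y) \<partial>lborel)"
        using gi[of j] by (simp add: norm_mult)
      show "AE \<xi>::'a in lborel. integrable lborel (\<lambda>y. case (\<xi>, y) of (\<xi>, y) \<Rightarrow> ?H \<xi> y)"
      proof (rule AE_I2)
        fix \<xi> :: 'a
        have "integrable lborel (\<lambda>y. gauss (\<epsilon> j *\<^sub>R \<xi>) * \<phi> y)" using \<phi>i by simp
        then show "integrable lborel (\<lambda>y. case (\<xi>, y) of (\<xi>, y) \<Rightarrow> ?H \<xi> y)"
          unfolding prod.case by (rule Bochner_Integration.integrable_bound) (auto simp: norm_mult abs_mult)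
      qed
    qed
    have "(\<integral>\<xi>. (cis (x \<bullet> \<xi>) * fourier \<phi> \<xi>) * of_real (gauss (\<epsilon> j *\<^sub>R \<xi>)) \<partial>lborel) = (\<integral>\<xi>. (\<integral>y. ?H \<xi> y \<partial>lborel) \<partial>lborel)"
    proof (rule Bochner_Integration.integral_cong[OF refl])
      fix \<xi>
      have "(cis (x \<bullet> \<xi>) * of_real (gauss (\<epsilon> j *\<^sub>R \<xi>))) * fourier \<phi> \<xi> = (\<integral>y. (cis (x \<bullet> \<xi>) * of_real (gauss (\<epsilon> j *\<^sub>R \<xi>))) * (cis (- (y \<bullet> \<xi>)) * of_real (\<phi> y)) \<partial>lborel)"
        unfolding fourier_def by (rule integral_mult_right_zero[symmetric])
      also have "\<dots> = (\<integral>y. ?H \<xi> y \<partial>lborel)"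
        by (intro Bochner_Integration.integral_cong refl) (simp add: inner_diff_left cis_divide[symmetric] cis_cnj[symmetric] cis_inverse[symmetric] divide_inverse mult_ac)
      finally show "(cis (x \<bullet> \<xi>) * fourier \<phi> \<xi>) * of_real (gauss (\<epsilon> j *\<^sub>R \<xi>)) = (\<integral>y. ?H \<xi> y \<partial>lborel)"
        by (simp add: mult_ac)
    qed
    also have "\<dots> = (\<integral>y. (\<integral>\<xi>. ?H \<xi> y \<partial>lborel) \<partial>lborel)"
      by (rule lborel_pair.Fubini_integral[OF I, symmetric])
    also have "\<dots> = (\<integral>y. of_real (dgauss (\<epsilon> j) (x - y) / c * \<phi> y) \<partial>lborel)"
      by (simp only: integral_mult_left_zero inner of_real_mult)
    also have "\<dots> = of_real (\<integral>y. dgauss (\<epsilon> j) (x - y) / c * \<phi> y \<partial>lborel)"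
      by (rule integral_complex_of_real)
    also have "(\<integral>y. dgauss (\<epsilon> j) (x - y) / c * \<phi> y \<partial>lborel) = (\<integral>y. dgauss (\<epsilon> j) (x - (x - y)) / c * \<phi> (x - y) \<partial>lborel)"
      by (rule integral_lborel_translate(2)[symmetric]) measurable
    also have "\<dots> = \<bar>\<epsilon> j\<bar> ^ DIM('a) *\<^sub>R (\<integral>z. dgauss (\<epsilon> j) (x - (x - (0 + \<epsilon> j *\<^sub>R z))) / c * \<phi> (x - (0 + \<epsilon> j *\<^sub>R z)) \<partial>lborel)"
      using epos[of j] by (intro integral_lborel_affine) auto
    also have "\<dots> = (\<integral>z. 1 / c * (\<phi> (x - \<epsilon> j *\<^sub>R z) * gauss z) \<partial>lborel)"
      using epos[of j] unfolding integral_scaleR_right[symmetric]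
      by (intro Bochner_Integration.integral_cong refl) (simp add: dgauss_def field_simps)
    also have "\<dots> = 1 / c * (\<integral>z. \<phi> (x - \<epsilon> j *\<^sub>R z) * gauss z \<partial>lborel)"
      by (rule integral_mult_right_zero)
    finally show ?thesis .
  qed
  have cont: "isCont \<phi> y" for y
    using smooth_on_continuous_on[OF test_functions_smooth[OF \<phi>]] by (simp add: continuous_on_eq_continuous_at)
  have L1: "(\<lambda>j. \<integral>\<xi>. (cis (x \<bullet> \<xi>) * fourier \<phi> \<xi>) * of_real (gauss (\<epsilon> j *\<^sub>R \<xi>)) \<partial>lborel) \<longlonglongrightarrow> (\<integral>\<xi>. (cis (x \<bullet> \<xi>) * fourier \<phi> \<xi>) * of_real c \<partial>lborel)"
  proof (rule integral_dominated_convergence[where w="\<lambda>\<xi>. c * norm (fourier \<phi> \<xi>)"])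
    show "AE \<xi> in lborel. (\<lambda>j. (cis (x \<bullet> \<xi>) * fourier \<phi> \<xi>) * of_real (gauss (\<epsilon> j *\<^sub>R \<xi>))) \<longlonglongrightarrow> (cis (x \<bullet> \<xi>) * fourier \<phi> \<xi>) * of_real c"
    proof (intro AE_I2 tendsto_mult tendsto_const tendsto_of_real)
      fix \<xi> :: 'a
      have "(\<lambda>j. c * exp (- (norm (\<epsilon> j *\<^sub>R \<xi>))\<^sup>2 / 2)) \<longlonglongrightarrow> c * exp (- (norm (0 *\<^sub>R \<xi>))\<^sup>2 / 2)"
        by (intro tendsto_intros e0) simp
      then show "(\<lambda>j. gauss (\<epsilon> j *\<^sub>R \<xi>)) \<longlonglongrightarrow> c" unfolding g by simp
    qed
    show "AE \<xi> in lborel. norm ((cis (x \<bullet> \<xi>) * fourier \<phi> \<xi>) * of_real (gauss (\<epsilon> j *\<^sub>R \<xi>))) \<le> c * norm (fourier \<phi> \<xi>)" for j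
    proof (rule AE_I2)
      fix \<xi> :: 'a
      have "gauss (\<epsilon> j *\<^sub>R \<xi>) \<le> c" using c unfolding g by simp
      then show "norm ((cis (x \<bullet> \<xi>) * fourier \<phi> \<xi>) * of_real (gauss (\<epsilon> j *\<^sub>R \<xi>))) \<le> c * norm (fourier \<phi> \<xi>)"
        using mult_right_mono[of "gauss (\<epsilon> j *\<^sub>R \<xi>)" c "norm (fourier \<phi> \<xi>)"]
        by (simp add: norm_mult gauss_nonneg mult.commute)
    qed
  qed (use fi in auto)
  have L2: "(\<lambda>j. \<integral>z. \<phi> (x - \<epsilon> j *\<^sub>R z) * gauss z \<partial>lborel) \<longlonglongrightarrow> (\<integral>(z::'a). \<phi> x * gauss z \<partial>lborel)"
  proof (rule integral_dominated_convergence[where w="\<lambda>z::'a. B * gauss z"])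
    show "AE z in lborel. (\<lambda>j. \<phi> (x - \<epsilon> j *\<^sub>R z) * gauss z) \<longlonglongrightarrow> \<phi> x * gauss z"
    proof (intro AE_I2 tendsto_mult tendsto_const)
      fix z :: 'a
      have "(\<lambda>j. x - \<epsilon> j *\<^sub>R z) \<longlonglongrightarrow> x - 0 *\<^sub>R z" by (intro tendsto_intros e0)
      then have "(\<lambda>j. x - \<epsilon> j *\<^sub>R z) \<longlonglongrightarrow> x" by simp
      then show "(\<lambda>j. \<phi> (x - \<epsilon> j *\<^sub>R z)) \<longlonglongrightarrow> \<phi> x" by (rule isCont_tendsto_compose[OF cont])
    qed
    show "integrable lborel (\<lambda>z::'a. B * gauss z)" by (intro Bochner_Integration.integrable_mult_right gauss_integrable)
    show "AE z::'a in lborel. norm (\<phi> (x - \<epsilon> j *\<^sub>R z) * gauss z) \<le> B * gauss z" for j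
    proof (rule AE_I2)
      fix z :: 'a
      have "\<bar>\<phi> (x - \<epsilon> j *\<^sub>R z)\<bar> * gauss z \<le> B * gauss z"
        using B(2) gauss_nonneg by (intro mult_right_mono) auto
      then show "norm (\<phi> (x - \<epsilon> j *\<^sub>R z) * gauss z) \<le> B * gauss z"
        by (simp add: abs_mult gauss_nonneg)
    qed
  qed measurable
  have "(\<lambda>j. complex_of_real (1 / c * (\<integral>z. \<phi> (x - \<epsilon> j *\<^sub>R z) * gauss z \<partial>lborel))) \<longlonglongrightarrow> of_real (1 / c * (\<integral>(z::'a). \<phi> x * gauss z \<partial>lborel))"
    by (intro tendsto_of_real tendsto_mult tendsto_const L2)
  then have "(\<integral>\<xi>. (cis (x \<bullet> \<xi>) * fourier \<phi> \<xi>) * of_real c \<partial>lborel) = of_real (1 / c * (\<integral>(z::'a). \<phi> x * gauss z \<partial>lborel))"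
    using L1 unfolding key by (rule LIMSEQ_unique[rotated])
  then have "(\<integral>\<xi>. cis (x \<bullet> \<xi>) * fourier \<phi> \<xi> \<partial>lborel) * of_real c = of_real (1 / c * \<phi> x)"
    by (simp add: gauss_integral)
  then have "(\<integral>\<xi>. cis (x \<bullet> \<xi>) * fourier \<phi> \<xi> \<partial>lborel) = of_real (1 / c * \<phi> x) / of_real c"
    by (rule eq_divide_imp[rotated]) (use c in simp)
  also have "\<dots> = of_real (1 / (c * c) * \<phi> x)" using c by (simp add: field_simps)
  also have "1 / (c * c) = (2 * pi) ^ DIM('a)"
  proof -
    have "sqrt (2 * pi) * sqrt (2 * pi) = 2 * pi" by simp
    then have "1 / sqrt (2 * pi) * (1 / sqrt (2 * pi)) = 1 / (2 * pi)" by simp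
    moreover have "c * c = (1 / sqrt (2 * pi) * (1 / sqrt (2 * pi))) ^ DIM('a)"
      by (simp only: c_def power_mult_distrib)
    ultimately have "c * c = (1 / (2 * pi)) ^ DIM('a)" by (simp only:)
    then show ?thesis by (simp add: power_divide)
  qed
  finally show ?thesis .
qed


section \<open>Representation of Bessel potentials\<close>

text \<open>The bound \<open>A\<close>, uniform in \<open>y\<close>, together with integrability of
  \<open>K\<close> is what Fubini requires here.\<close>

lemma conv_double_integral:
  fixes K u w :: "'a::euclidean_space \<Rightarrow> real"
  assumes K: "integrable lborel K" and [measurable]: "u \<in> borel_measurable borel" "w \<in> borel_measurable borel"
    and i: "\<And>y. integrable lborel (\<lambda>x. u (x - y) * w x)" and A: "\<And>y. (\<integral>x. \<bar>u (x - y) * w x\<bar> \<partial>lborel) \<le> A"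
  shows "(\<integral>x. conv K u x * w x \<partial>lborel) = (\<integral>y. K y * (\<integral>x. u (x - y) * w x \<partial>lborel) \<partial>lborel)"
proof -
  have [measurable]: "K \<in> borel_measurable borel" using K by auto
  let ?H = "\<lambda>y x. K y * (u (x - y) * w x)"
  have Hm: "(\<lambda>(y, x). ?H y x) \<in> borel_measurable (lborel \<Otimes>\<^sub>M lborel)"
    unfolding case_prod_beta' by measurable
  have I: "integrable (lborel \<Otimes>\<^sub>M lborel) (\<lambda>(y, x). ?H y x)"
  proof (rule lborel_pair.Fubini_integrable[OF Hm])
    show "AE y in lborel. integrable lborel (\<lambda>x. case (y, x) of (y, x) \<Rightarrow> ?H y x)"
      using i by simp
    have e: "(\<integral>x. norm (?H y x) \<partial>lborel) = \<bar>K y\<bar> * (\<integral>x. \<bar>u (x - y) * w x\<bar> \<partial>lborel)" for y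
      by (simp add: abs_mult)
    show "integrable lborel (\<lambda>y. \<integral>x. norm (case (y, x) of (y, x) \<Rightarrow> ?H y x) \<partial>lborel)"
      unfolding prod.case e
    proof (rule Bochner_Integration.integrable_bound)
      show "integrable lborel (\<lambda>y. \<bar>K y\<bar> * A)" by (intro Bochner_Integration.integrable_mult_left integrable_abs K)
      show "(\<lambda>y. \<bar>K y\<bar> * (\<integral>x. \<bar>u (x - y) * w x\<bar> \<partial>lborel)) \<in> borel_measurable lborel" by measurable
      show "AE y in lborel. norm (\<bar>K y\<bar> * (\<integral>x. \<bar>u (x - y) * w x\<bar> \<partial>lborel)) \<le> norm (\<bar>K y\<bar> * A)"
      proof (rule AE_I2)
        fix y
        have "0 \<le> (\<integral>x. \<bar>u (x - y) * w x\<bar> \<partial>lborel)" by simp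
        then have "\<bar>\<integral>x. \<bar>u (x - y) * w x\<bar> \<partial>lborel\<bar> \<le> \<bar>A\<bar>" using A[of y] by linarith
        then show "norm (\<bar>K y\<bar> * (\<integral>x. \<bar>u (x - y) * w x\<bar> \<partial>lborel)) \<le> norm (\<bar>K y\<bar> * A)"
          unfolding real_norm_def abs_mult by (intro mult_left_mono) auto
      qed
    qed
  qed
  have "(\<integral>x. conv K u x * w x \<partial>lborel) = (\<integral>x. (\<integral>y. ?H y x \<partial>lborel) \<partial>lborel)"
    unfolding conv_def integral_mult_left_zero[symmetric] by (simp only: mult.assoc)
  also have "\<dots> = (\<integral>y. (\<integral>x. ?H y x \<partial>lborel) \<partial>lborel)"
    by (rule lborel_pair.Fubini_integral[OF I])
  also have "\<dots> = (\<integral>y. K y * (\<integral>x. u (x - y) * w x \<partial>lborel) \<partial>lborel)"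
    by (simp only: integral_mult_right_zero)
  finally show ?thesis .
qed

lemma bounded_times_Lp:
  fixes \<phi> g :: "'a::euclidean_space \<Rightarrow> real"
  assumes \<phi>: "integrable lborel \<phi>" "\<forall>x. \<bar>\<phi> x\<bar> \<le> B" and g[measurable]: "g \<in> borel_measurable borel"
    and p: "1 \<le> p" and fin: "Lp_pow p g < \<infinity>"
  shows "integrable lborel (\<lambda>x. \<phi> (x - y) * g x)"
    and "(\<integral>x. \<bar>\<phi> (x - y) * g x\<bar> \<partial>lborel) \<le> (\<integral>x. \<bar>\<phi> x\<bar> \<partial>lborel) + B * (\<integral>x. \<bar>g x\<bar> powr p \<partial>lborel)"
proof -
  have \<phi>m[measurable]: "\<phi> \<in> borel_measurable borel" using \<phi> by auto
  have B: "0 \<le> B" using \<phi>(2) by (meson abs_ge_zero order_trans)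
  have gp: "integrable lborel (\<lambda>x. \<bar>g x\<bar> powr p)"
    by (rule integrableI_nonneg) (use fin in \<open>auto simp: Lp_pow_def\<close>)
  have sh: "integrable lborel (\<lambda>x. \<phi> (x - y))"
    using integrable_lborel_translate(1)[OF \<phi>(1), of "- y"] by simp
  have shi: "(\<integral>x. \<bar>\<phi> (x - y)\<bar> \<partial>lborel) = (\<integral>x. \<bar>\<phi> x\<bar> \<partial>lborel)"
    using integral_lborel_translate(1)[of "\<lambda>x. \<bar>\<phi> x\<bar>" "- y"] by simp
  let ?W = "\<lambda>x. \<bar>\<phi> (x - y)\<bar> + B * \<bar>g x\<bar> powr p"
  have W: "integrable lborel ?W"
    by (intro Bochner_Integration.integrable_add integrable_abs sh Bochner_Integration.integrable_mult_right gp)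
  have le: "\<bar>\<phi> (x - y) * g x\<bar> \<le> ?W x" for x
  proof -
    have "\<bar>g x\<bar> \<le> 1 + \<bar>g x\<bar> powr p"
    proof (cases "\<bar>g x\<bar> \<le> 1")
      case False
      then have "\<bar>g x\<bar> powr 1 \<le> \<bar>g x\<bar> powr p" using p by (intro powr_mono) auto
      then show ?thesis using False by simp
    qed (simp add: add_increasing2)
    then have "\<bar>\<phi> (x - y)\<bar> * \<bar>g x\<bar> \<le> \<bar>\<phi> (x - y)\<bar> * (1 + \<bar>g x\<bar> powr p)" by (intro mult_left_mono) auto
    also have "\<dots> = \<bar>\<phi> (x - y)\<bar> + \<bar>\<phi> (x - y)\<bar> * \<bar>g x\<bar> powr p" by (simp add: distrib_left)
    also have "\<dots> \<le> ?W x" using \<phi>(2) by (intro add_left_mono mult_right_mono) auto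
    finally show ?thesis by (simp add: abs_mult)
  qed
  show i: "integrable lborel (\<lambda>x. \<phi> (x - y) * g x)"
    by (rule Bochner_Integration.integrable_bound[OF W]) (use le B in \<open>auto simp del: abs_mult intro: order_trans[OF le]\<close>)
  have "(\<integral>x. \<bar>\<phi> (x - y) * g x\<bar> \<partial>lborel) \<le> (\<integral>x. ?W x \<partial>lborel)"
    by (rule integral_mono[OF integrable_abs[OF i] W le])
  also have "\<dots> = (\<integral>x. \<bar>\<phi> (x - y)\<bar> \<partial>lborel) + (\<integral>x. B * \<bar>g x\<bar> powr p \<partial>lborel)"
    by (rule Bochner_Integration.integral_add[OF integrable_abs[OF sh] Bochner_Integration.integrable_mult_right[OF gp]])
  also have "\<dots> = (\<integral>x. \<bar>\<phi> x\<bar> \<partial>lborel) + B * (\<integral>x. \<bar>g x\<bar> powr p \<partial>lborel)"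
    unfolding shi by simp
  finally show "(\<integral>x. \<bar>\<phi> (x - y) * g x\<bar> \<partial>lborel) \<le> (\<integral>x. \<bar>\<phi> x\<bar> \<partial>lborel) + B * (\<integral>x. \<bar>g x\<bar> powr p \<partial>lborel)" .
qed

text \<open>Convolution with an even kernel is symmetric under the integral pairing: after Fubini
  the substitution of - y for y exchanges the two sides.\<close>

lemma conv_adjoint:
  fixes K g \<phi> :: "'a::euclidean_space \<Rightarrow> real"
  assumes K: "integrable lborel K" "\<And>y. K (- y) = K y" and g[measurable]: "g \<in> borel_measurable borel"
    and p: "1 \<le> p" and fin: "Lp_pow p g < \<infinity>" and \<phi>: "integrable lborel \<phi>" "\<forall>x. \<bar>\<phi> x\<bar> \<le> B"
  shows "(\<integral>x. g x * conv K \<phi> x \<partial>lborel) = (\<integral>x. conv K g x * \<phi> x \<partial>lborel)"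
proof -
  have [measurable]: "K \<in> borel_measurable borel" "\<phi> \<in> borel_measurable borel" using K \<phi> by auto
  note b = bounded_times_Lp[OF \<phi> g p fin]
  have tr: "(\<integral>x. f (x + y) \<partial>lborel) = (\<integral>x. f x \<partial>lborel)" if "f \<in> borel_measurable borel" for f :: "'a \<Rightarrow> real" and y
    using integral_lborel_translate(1)[OF that] .
  have gs: "(\<integral>x. g (x - y) * \<phi> x \<partial>lborel) = (\<integral>x. \<phi> (x - (- y)) * g x \<partial>lborel)" for y
    using tr[of "\<lambda>x. g (x - y) * \<phi> x" y] by (simp add: mult.commute)
  have gsa: "(\<integral>x. \<bar>g (x - y) * \<phi> x\<bar> \<partial>lborel) = (\<integral>x. \<bar>\<phi> (x - (- y)) * g x\<bar> \<partial>lborel)" for y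
    using tr[of "\<lambda>x. \<bar>g (x - y) * \<phi> x\<bar>" y] by (simp add: mult.commute)
  have gi: "integrable lborel (\<lambda>x. g (x - y) * \<phi> x)" for y
    using integrable_lborel_translate(1)[OF b(1)[of "- y"], of "- y"] by (simp add: mult.commute)
  have "(\<integral>x. g x * conv K \<phi> x \<partial>lborel) = (\<integral>x. conv K \<phi> x * g x \<partial>lborel)" by (simp only: mult.commute)
  also have "\<dots> = (\<integral>y. K y * (\<integral>x. \<phi> (x - y) * g x \<partial>lborel) \<partial>lborel)"
    by (rule conv_double_integral[OF K(1) _ _ b(1) b(2)]) simp_all
  also have "\<dots> = (\<integral>y. K (0 - y) * (\<integral>x. \<phi> (x - (0 - y)) * g x \<partial>lborel) \<partial>lborel)"
    by (rule integral_lborel_translate(2)[symmetric]) measurable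
  also have "\<dots> = (\<integral>y. K y * (\<integral>x. g (x - y) * \<phi> x \<partial>lborel) \<partial>lborel)"
    unfolding gs by (simp add: K(2))
  also have "\<dots> = (\<integral>x. conv K g x * \<phi> x \<partial>lborel)"
    by (rule conv_double_integral[symmetric, OF K(1) _ _ gi])
       (use b(2) in \<open>auto simp only: gsa g, simp\<close>)
  finally show ?thesis .
qed

lemma test_function_conv_pow:
  fixes \<phi> :: "'a::euclidean_space \<Rightarrow> real"
  assumes a: "0 < a" and \<phi>: "\<phi> \<in> test_functions UNIV"
  shows "(conv (bessel_kernel a) ^^ n) \<phi> \<in> schwartz"
    and "integrable lborel ((conv (bessel_kernel a) ^^ n) \<phi>)"
    and "fourier ((conv (bessel_kernel a) ^^ n) \<phi>) \<xi> = of_real ((1 + (norm \<xi>)\<^sup>2) powr (- (a * real n / 2))) * fourier \<phi> \<xi>"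
proof -
  note K = bessel_kernel_integrable[OF a, where 'a='a]
  have S: "(conv (bessel_kernel a) ^^ n) \<phi> \<in> schwartz \<and> integrable lborel ((conv (bessel_kernel a) ^^ n) \<phi>) \<and>
    (\<forall>\<xi>. fourier ((conv (bessel_kernel a) ^^ n) \<phi>) \<xi> = of_real ((1 + (norm \<xi>)\<^sup>2) powr (- (a * real n / 2))) * fourier \<phi> \<xi>)"
  proof (induction n)
    case 0
    have "1 + (norm \<xi>)\<^sup>2 \<noteq> 0" for \<xi> :: 'a by (metis add_nonneg_eq_0_iff zero_le_one zero_le_power2 zero_neq_one)
    then show ?case using test_functions_schwartz[OF \<phi>] test_functions_integrable[OF \<phi>] by simp
  next
    case (Suc n)
    let ?f = "(conv (bessel_kernel a) ^^ n) \<phi>"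
    have f: "?f \<in> schwartz" "integrable lborel ?f" using Suc by blast+
    have "conv (bessel_kernel a) ?f \<in> schwartz"
      by (rule schwartz_conv[OF bessel_kernel_moment[OF a] f(1)])
    moreover have "integrable lborel (conv (bessel_kernel a) ?f)" by (rule conv_integrable[OF K f(2)])
    moreover have "fourier (conv (bessel_kernel a) ?f) \<xi> = of_real ((1 + (norm \<xi>)\<^sup>2) powr (- (a * real (Suc n) / 2))) * fourier \<phi> \<xi>" for \<xi>
    proof -
      have k: "fourier (bessel_kernel a) \<xi> = of_real ((1 + (norm \<xi>)\<^sup>2) powr (- (a / 2)))"
        unfolding fourier_def by (rule bessel_kernel_fourier[OF a])
      have e: "(1 + (norm \<xi>)\<^sup>2) powr (- (a / 2)) * (1 + (norm \<xi>)\<^sup>2) powr (- (a * real n / 2)) = (1 + (norm \<xi>)\<^sup>2) powr (- (a * real (Suc n) / 2))"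
      proof -
        have "- (a / 2) + - (a * real n / 2) = - (a * real (Suc n) / 2)"
          by (simp add: algebra_simps add_divide_distrib)
        then show ?thesis by (simp only: powr_add[symmetric])
      qed
      have IH: "fourier ?f \<xi> = of_real ((1 + (norm \<xi>)\<^sup>2) powr (- (a * real n / 2))) * fourier \<phi> \<xi>"
        using Suc by blast
      show ?thesis
        unfolding fourier_conv[OF K f(2)] k IH e[symmetric] of_real_mult by (simp only: mult.assoc)
    qed
    ultimately show ?case by simp
  qed
  then show "(conv (bessel_kernel a) ^^ n) \<phi> \<in> schwartz" "integrable lborel ((conv (bessel_kernel a) ^^ n) \<phi>)"
    "fourier ((conv (bessel_kernel a) ^^ n) \<phi>) \<xi> = of_real ((1 + (norm \<xi>)\<^sup>2) powr (- (a * real n / 2))) * fourier \<phi> \<xi>"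
    by blast+
qed

text \<open>The multipliers of the kernels and of \<open>bessel_op\<close> cancel, and Fourier
  inversion does the rest. Every test function is thereby \<open>bessel_op\<close> of a Schwartz
  function, so the identity in the definition of \<open>bessel_norm\<close> determines a
  distribution on test functions.\<close>

lemma bessel_op_conv_pow:
  fixes \<phi> :: "'a::euclidean_space \<Rightarrow> real"
  assumes a: "0 < a" and \<phi>: "\<phi> \<in> test_functions UNIV"
  shows "bessel_op (a * real n) ((conv (bessel_kernel a) ^^ n) \<phi>) = \<phi>"
proof
  fix x
  have "(1 + (norm \<xi>)\<^sup>2) powr (a * real n / 2) * (1 + (norm \<xi>)\<^sup>2) powr (- (a * real n / 2)) = 1" for \<xi> :: 'a
  proof -
    have "1 + (norm \<xi>)\<^sup>2 > 0" by (simp add: add_pos_nonneg)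
    then show ?thesis by (simp add: powr_add[symmetric])
  qed
  then have "complex_of_real ((1 + (norm \<xi>)\<^sup>2) powr (a * real n / 2)) * (of_real ((1 + (norm \<xi>)\<^sup>2) powr (- (a * real n / 2)))) = 1" for \<xi> :: 'a
    by (metis of_real_1 of_real_mult)
  then have H: "cis (x \<bullet> \<xi>) * of_real ((1 + (norm \<xi>)\<^sup>2) powr (a * real n / 2)) * fourier ((conv (bessel_kernel a) ^^ n) \<phi>) \<xi>
      = cis (x \<bullet> \<xi>) * fourier \<phi> \<xi>" for \<xi>
    unfolding test_function_conv_pow(3)[OF a \<phi>] by (simp add: mult.assoc[symmetric])
  have "bessel_op (a * real n) ((conv (bessel_kernel a) ^^ n) \<phi>) x
      = Re (of_real (1 / (2 * pi) ^ DIM('a)) * of_real ((2 * pi) ^ DIM('a) * \<phi> x))"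
    by (simp only: bessel_op_def H fourier_inversion[OF \<phi>])
  also have "\<dots> = \<phi> x" by (simp only: of_real_mult[symmetric] Re_complex_of_real) simp
  finally show "bessel_op (a * real n) ((conv (bessel_kernel a) ^^ n) \<phi>) x = \<phi> x" .
qed

lemma conv_pow_adjoint:
  fixes K g \<phi> :: "'a::euclidean_space \<Rightarrow> real"
  assumes K: "integrable lborel K" "\<And>y. K (- y) = K y" "(\<integral>y. \<bar>K y\<bar> \<partial>lborel) \<le> 1"
    and g: "g \<in> borel_measurable borel" and p: "1 \<le> p" and fin: "Lp_pow p g < \<infinity>"
    and \<phi>: "\<And>m. integrable lborel ((conv K ^^ m) \<phi>)" "\<And>m. \<exists>B. \<forall>x. \<bar>(conv K ^^ m) \<phi> x\<bar> \<le> B"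
  shows "(\<integral>x. g x * (conv K ^^ n) \<phi> x \<partial>lborel) = (\<integral>x. (conv K ^^ n) g x * \<phi> x \<partial>lborel)"
proof -
  \<comment> \<open>The kernels are moved from \<open>\<phi>\<close> to \<open>g\<close> one at a
    time.\<close>
  have "(\<integral>x. (conv K ^^ m) g x * (conv K ^^ (n - m)) \<phi> x \<partial>lborel) = (\<integral>x. g x * (conv K ^^ n) \<phi> x \<partial>lborel)" if "m \<le> n" for m
    using that
  proof (induction m)
    case (Suc m)
    have gm: "(conv K ^^ m) g \<in> borel_measurable borel" "Lp_pow p ((conv K ^^ m) g) < \<infinity>"
      using conv_pow_Lp[OF K(1,3) g p fin, of m] fin by (auto intro: order.strict_trans1)
    obtain B where B: "\<forall>x. \<bar>(conv K ^^ (n - Suc m)) \<phi> x\<bar> \<le> B" using \<phi>(2) by blast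
    have "n - m = Suc (n - Suc m)" using Suc.prems by simp
    then have "(conv K ^^ (n - m)) \<phi> = conv K ((conv K ^^ (n - Suc m)) \<phi>)" by simp
    then show ?case
      using conv_adjoint[OF K(1,2) gm(1) p gm(2) \<phi>(1) B] Suc by simp
  qed simp
  from this[of n] show ?thesis by simp
qed

text \<open>\<open>w\<close> is \<open>g\<close> convolved with \<open>n\<close> kernels of order
  \<gamma> / n. Each kernel contributes the exponent s / n, so that s / n \<le> 1 and s / n <
  \<gamma> / n are required. The constant does not depend on \<open>v\<close> or \<open>g\<close>;
  for i = 0 the bound says that the power integral of \<open>w\<close> is at most that of
  \<open>g\<close>.\<close>

theorem bessel_potential_representation:
  fixes \<gamma> p s :: real and n :: nat
  assumes \<gamma>: "0 < \<gamma>" and p: "1 \<le> p" and n: "1 \<le> n" and s: "0 \<le> s" "s < \<gamma>" "s \<le> real n"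
  shows "\<exists>C\<ge>0. \<forall>(v :: ('a::euclidean_space \<Rightarrow> real) \<Rightarrow> real) g. g \<in> Lp_space p UNIV \<longrightarrow>
    (\<forall>\<phi>\<in>schwartz. v (bessel_op \<gamma> \<phi>) = (LINT x|lborel. g x * \<phi> x)) \<longrightarrow>
    (\<exists>w. w \<in> borel_measurable borel \<and> Lp_pow p w < \<infinity> \<and>
       (\<forall>\<phi>\<in>test_functions UNIV. v \<phi> = (LINT x|lborel. w x * \<phi> x)) \<and>
       (\<forall>h. \<forall>i\<le>n. Lp_pow p ((Dif h ^^ i) w) \<le> ennreal (((C * norm h powr (s / real n)) ^ i) powr p) * Lp_pow p g))"
proof -
  define a where "a = \<gamma> / real n"
  have a: "0 < a" "a * real n = \<gamma>" using \<gamma> n by (simp_all add: a_def)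
  have s': "0 \<le> s / real n" "s / real n \<le> 1" "s / real n < a"
    using s n by (simp_all add: a_def divide_strict_right_mono)
  let ?K = "bessel_kernel a :: 'a \<Rightarrow> real"
  obtain C where C: "0 \<le> C" "\<And>h::'a. (\<integral>y. \<bar>Dif h ?K y\<bar> \<partial>lborel) \<le> C * norm h powr (s / real n)"
    using bessel_kernel_L1_modulus[OF a(1) s', where 'a='a] by blast
  have K: "integrable lborel ?K" "(\<integral>y. \<bar>?K y\<bar> \<partial>lborel) \<le> 1"
    by (simp_all add: bessel_kernel_integrable[OF a(1)] bessel_kernel_integral[OF a(1)] bessel_kernel_nonneg[OF a(1)])
  show ?thesis
  proof (intro exI[of _ C] conjI C(1) allI impI)
    fix v :: "('a \<Rightarrow> real) \<Rightarrow> real" and g :: "'a \<Rightarrow> real"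
    assume gL: "g \<in> Lp_space p UNIV" and v: "\<forall>\<phi>\<in>schwartz. v (bessel_op \<gamma> \<phi>) = (LINT x|lborel. g x * \<phi> x)"
    have g: "g \<in> borel_measurable borel"
      using gL by (simp add: Lp_space_def set_borel_measurable_def)
    have fin: "Lp_pow p g < \<infinity>"
      using gL p by (auto simp: Lp_space_def Lp_norm_def Lp_pow_def ennreal_powr_def less_top split: if_splits)
    let ?w = "(conv ?K ^^ n) g"
    have "v \<phi> = (LINT x|lborel. ?w x * \<phi> x)" if \<phi>: "\<phi> \<in> test_functions UNIV" for \<phi>
    proof -
      have "v \<phi> = v (bessel_op \<gamma> ((conv ?K ^^ n) \<phi>))"
        using bessel_op_conv_pow[OF a(1) \<phi>, of n] a(2) by simp
      also have "\<dots> = (LINT x|lborel. g x * (conv ?K ^^ n) \<phi> x)"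
        using v test_function_conv_pow(1)[OF a(1) \<phi>] by blast
      also have "\<dots> = (LINT x|lborel. ?w x * \<phi> x)"
      proof (rule conv_pow_adjoint[OF K(1) bessel_kernel_minus K(2) g p fin test_function_conv_pow(2)[OF a(1) \<phi>]])
        fix m
        show "\<exists>B. \<forall>x. \<bar>(conv ?K ^^ m) \<phi> x\<bar> \<le> B"
          using smooth_bounded_bound[OF schwartz_smooth_bounded[OF test_function_conv_pow(1)[OF a(1) \<phi>]]] by blast
      qed
      finally show ?thesis .
    qed
    moreover have "?w \<in> borel_measurable borel" "Lp_pow p ?w < \<infinity>"
      using conv_pow_Lp[OF K g p fin, of n] fin by (auto intro: order.strict_trans1)
    moreover have "Lp_pow p ((Dif h ^^ i) ?w) \<le> ennreal (((C * norm h powr (s / real n)) ^ i) powr p) * Lp_pow p g"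
      if "i \<le> n" for h i
      by (rule Dif_pow_conv_pow_bound[OF K C(2) g p fin that])
    ultimately show "\<exists>w. w \<in> borel_measurable borel \<and> Lp_pow p w < \<infinity> \<and>
       (\<forall>\<phi>\<in>test_functions UNIV. v \<phi> = (LINT x|lborel. w x * \<phi> x)) \<and>
       (\<forall>h. \<forall>i\<le>n. Lp_pow p ((Dif h ^^ i) w) \<le> ennreal (((C * norm h powr (s / real n)) ^ i) powr p) * Lp_pow p g)"
      by blast
  qed
qed


section \<open>Layers parallel to the boundary\<close>

text \<open>The layer \<open>A j\<close> is at distance comparable to \<open>1 / l j\<close> from the boundary; it corresponds to the
  index \<open>m0 - j\<close> of the weighted Sobolev norm, and layers with an index above \<open>m0\<close> do not meet \<open>D\<close>.\<close>

locale layers =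
  fixes D :: "'a::euclidean_space set" and \<psi> :: "'a \<Rightarrow> real" and \<zeta> :: "real \<Rightarrow> real"
    and a b c1 N0 N1 :: real and Nd :: "nat \<Rightarrow> real" and m0 :: int
  assumes lipschitz: "bounded_lipschitz_domain D"
    and smooth_psi: "smooth_on D \<psi>"
    and profile: "partition_profile \<zeta>"
    and ab: "0 < a" "a < b" "\<And>t. t \<notin> {a..b} \<Longrightarrow> \<zeta> t = 0"
    and N_pos: "0 < N0" "0 < N1" "\<And>m. 0 \<le> Nd m"
    and psi_le: "\<And>y. y \<in> D \<Longrightarrow> \<psi> y \<le> N0 * bdist D y"
    and le_psi: "\<And>y. y \<in> D \<Longrightarrow> bdist D y \<le> N1 * \<psi> y"
    and psi_deriv: "\<And>y cs. y \<in> D \<Longrightarrow> cs \<in> lists Basis \<Longrightarrow>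
          bdist D y powr (real (length cs) - 1) * \<bar>iter_partial cs \<psi> y\<bar> \<le> Nd (length cs)"
    and c1_pos: "0 < c1" and c1_cover: "\<And>y. y \<in> D \<Longrightarrow> \<exists>m. c1 \<le> \<zeta> (exp (- of_int m) * \<psi> y)"
    and m0_max: "\<And>y m. y \<in> D \<Longrightarrow> \<zeta> (exp (- of_int m) * \<psi> y) \<noteq> 0 \<Longrightarrow> m \<le> m0"
begin

definition l :: "nat \<Rightarrow> real" where "l j = exp (- of_int (m0 - int j))"
definition cut :: "nat \<Rightarrow> 'a \<Rightarrow> real" where "cut j y = \<zeta> (l j * \<psi> y)"
text \<open>On this set the cutoff is bounded below and can be divided by. The sets cover
  \<open>D\<close> but may overlap.\<close>

definition A :: "nat \<Rightarrow> 'a set" where "A j = {y \<in> D. c1 \<le> cut j y}"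

lemma open_D: "open D" and bounded_D: "bounded D" and nonempty_D: "D \<noteq> {}"
  using lipschitz bounded_lipschitz_domain_open bounded_lipschitz_domain_bounded bounded_lipschitz_domain_nonempty
  by blast+

lemma borel_D [measurable]: "D \<in> sets borel"
  using open_D by simp

lemma l_pos: "0 < l j"
  by (simp add: l_def)

lemma l_eq: "l j = exp (real j - of_int m0)"
  by (simp add: l_def)

lemma zeta_test: "\<zeta> \<in> test_functions {0<..}" and zeta_nonneg: "0 \<le> \<zeta> t"
  using profile by (auto simp: partition_profile_def)

lemma bdist_pos:
  assumes "y \<in> D"
  shows "0 < bdist D y"
proof -
  have "y \<notin> frontier D" using assms open_D by (simp add: frontier_def interior_open)
  then show ?thesis
    unfolding bdist_def using frontier_nonempty[OF bounded_D nonempty_D]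
    by (simp add: infdist_pos_not_in_closed frontier_closed)
qed

lemma bdist_triangle: "bdist D x \<le> bdist D y + dist x y"
  unfolding bdist_def by (rule infdist_triangle)

text \<open>A ball is connected, so if it met both \<open>D\<close> and the complement it would
  contain a boundary point closer to \<open>y\<close> than the distance allows.\<close>

lemma near_in_D:
  assumes y: "y \<in> D" and z: "dist y z < bdist D y"
  shows "z \<in> D"
proof (rule ccontr)
  assume "z \<notin> D"
  let ?B = "ball y (bdist D y)"
  have "z \<in> ?B" "y \<in> ?B" using z bdist_pos[OF y] by auto
  then have "?B \<inter> D \<noteq> {}" "?B - D \<noteq> {}" using y \<open>z \<notin> D\<close> by blast+
  then have "?B \<inter> frontier D \<noteq> {}" by (intro connected_Int_frontier) auto
  then obtain w where w: "w \<in> frontier D" "dist y w < bdist D y" by auto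
  then show False using infdist_le[OF w(1), of y] by (simp add: bdist_def)
qed

lemma cut_nonzero_bounds:
  assumes "y \<in> D" "cut j y \<noteq> 0"
  shows "a / N0 \<le> l j * bdist D y" and "l j * bdist D y \<le> N1 * b"
proof -
  have s: "a \<le> l j * \<psi> y" "l j * \<psi> y \<le> b"
    using ab(3)[of "l j * \<psi> y"] assms(2) by (auto simp: cut_def)
  have "a \<le> l j * (N0 * bdist D y)"
    using s(1) psi_le[OF assms(1)] l_pos[of j] by (meson less_imp_le mult_left_mono order_trans)
  then show "a / N0 \<le> l j * bdist D y" using N_pos by (simp add: field_simps)
  have "l j * bdist D y \<le> l j * (N1 * \<psi> y)"
    using le_psi[OF assms(1)] l_pos[of j] by (intro mult_left_mono) auto
  also have "\<dots> = N1 * (l j * \<psi> y)" by simp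
  also have "\<dots> \<le> N1 * b" using s(2) N_pos by (intro mult_left_mono) auto
  finally show "l j * bdist D y \<le> N1 * b" .
qed

lemma A_D: "y \<in> A j \<Longrightarrow> y \<in> D" and A_cut: "y \<in> A j \<Longrightarrow> cut j y \<noteq> 0"
  using c1_pos by (auto simp: A_def)

lemma A_cover:
  assumes "y \<in> D"
  shows "\<exists>j. y \<in> A j"
proof -
  obtain m where m: "c1 \<le> \<zeta> (exp (- of_int m) * \<psi> y)" using c1_cover[OF assms] by blast
  then have "m \<le> m0" using m0_max[OF assms, of m] c1_pos by force
  then have "m = m0 - int (nat (m0 - m))" by simp
  then have "y \<in> A (nat (m0 - m))" using m assms unfolding A_def cut_def l_def by simp
  then show ?thesis by blast
qed

lemma smooth_cut: "smooth_on D (cut j)"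
proof -
  have "smooth_on D (\<lambda>y. l j * \<psi> y)"
    by (rule smooth_on_mult[OF open_D smooth_on_const[OF open_D] smooth_psi])
  then show ?thesis
    unfolding cut_def[abs_def] by (rule smooth_on_comp[OF open_D test_functions_smooth[OF zeta_test]])
qed

lemma cut_bounded: "\<exists>M\<ge>0. \<forall>j y. \<bar>cut j y\<bar> \<le> M"
proof -
  obtain M where "0 \<le> M" "\<forall>x. \<bar>\<zeta> x\<bar> \<le> M"
    by (rule smooth_bounded_bound[OF schwartz_smooth_bounded[OF test_functions_schwartz[OF zeta_test]]])
  then show ?thesis by (auto simp: cut_def)
qed

lemma measurable_cut [measurable]: "(\<lambda>y. if y \<in> D then cut j y else 0) \<in> borel_measurable borel"
  by (rule borel_measurable_continuous_on_if) (auto intro: smooth_on_continuous_on smooth_cut)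

lemma borel_A [measurable]: "A j \<in> sets borel"
proof -
  have "A j = {y \<in> space borel. c1 \<le> (if y \<in> D then cut j y else 0)}"
    using c1_pos by (auto simp: A_def)
  also have "\<dots> \<in> sets borel" by measurable
  finally show ?thesis .
qed

text \<open>For steps that are small relative to the width of the layer, the whole segment keeps a
  distance to the boundary comparable to 1 / l j and the cutoff keeps half of its lower bound. Then
  the uniform bounds for reciprocals of cutoffs apply with constants that do not depend on
  \<open>j\<close>.\<close>

lemma cut_inverse_differences:
  obtains \<delta> K where "0 < \<delta>" "\<delta> \<le> 1" "0 \<le> K"
    "\<forall>j x h. x \<in> A j \<longrightarrow> l j * norm h \<le> \<delta> \<longrightarrow>
       (\<forall>i\<le>n. x + real i *\<^sub>R h \<in> D \<and> cut j (x + real i *\<^sub>R h) \<noteq> 0) \<and>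
       (\<forall>i k. i + k \<le> n \<longrightarrow> \<bar>dif k (\<lambda>i. inverse (cut j (x + real i *\<^sub>R h))) i\<bar> \<le> K * (l j * norm h) ^ k)"
proof -
  let ?d = "real DIM('a)"
  \<comment> \<open>Half of the lower bound \<open>a / N0\<close> for \<open>l j * bdist D x\<close>
    on the layer; the segment may use up the other half.\<close>
  define q where "q = a / (2 * N0)"
  have q: "0 < q" using ab N_pos by (simp add: q_def)
  \<comment> \<open>The first term bounds \<open>l j * \<psi>\<close> itself, the sum the
    derivatives of order m \<ge> 1, through \<open>l j * bdist \<ge> q\<close>. The summand for m =
    0 has truncated exponent 0 and only adds something nonnegative.\<close>
  define B where "B = N0 * (N1 * b + q) + (\<Sum>m\<le>n. Nd m / q ^ (m - 1))"
  have B1: "0 \<le> N0 * (N1 * b + q)" using N_pos ab q by simp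
  have B2: "0 \<le> Nd m / q ^ (m - 1)" for m using N_pos q by simp
  then have B3: "0 \<le> (\<Sum>m\<le>n. Nd m / q ^ (m - 1))" by (intro sum_nonneg) auto
  have B: "0 \<le> B" using B1 B3 by (simp add: B_def)
  obtain L where L: "0 \<le> L" "\<And>s t. \<bar>\<zeta> (s + t) - \<zeta> s\<bar> \<le> L * \<bar>t\<bar>"
  proof -
    note sb = schwartz_smooth_bounded[OF test_functions_schwartz[OF zeta_test]]
    have "\<exists>L\<ge>0. \<forall>z v. \<bar>\<zeta> (z + v) - \<zeta> z\<bar> \<le> L * norm v"
    proof (rule smooth_bounded_lipschitz)
      fix c :: real assume "c \<in> Basis"
      then have "[c] \<in> lists Basis" by simp
      from test_functions_bounded[OF zeta_test this] show "bounded (range (partial_deriv c \<zeta>))" by simp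
    qed (rule smooth_bounded_differentiable[OF sb])
    then show ?thesis using that by auto
  qed
  \<comment> \<open>The second entry keeps the segment within \<open>q / l j\<close> of its start;
    the third limits the change of the cutoff to \<open>c1 / 2\<close>, by the Lipschitz constants
    of \<open>\<zeta>\<close> and \<open>\<psi>\<close>. The added ones exclude division by
    0.\<close>
  define \<delta> where "\<delta> = min 1 (min (q / (real n + 1)) (c1 / (2 * (L * (?d * Nd 1) + 1) * (real n + 1))))"
  have LN: "0 \<le> L * (?d * Nd 1)" using L N_pos by simp
  have \<delta>: "0 < \<delta>" "\<delta> \<le> 1" using q c1_pos LN by (simp_all add: \<delta>_def)
  have \<delta>q: "real n * \<delta> \<le> q"
  proof -
    have "\<delta> \<le> q / (real n + 1)" by (simp add: \<delta>_def)
    then have "\<delta> * (real n + 1) \<le> q" by (simp add: field_simps)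
    then show ?thesis using \<delta>(1) by (simp add: algebra_simps)
  qed
  have \<delta>c: "L * (?d * Nd 1) * (real n * \<delta>) \<le> c1 / 2"
  proof -
    have "\<delta> \<le> c1 / (2 * (L * (?d * Nd 1) + 1) * (real n + 1))" by (simp add: \<delta>_def)
    moreover have "0 < 2 * (L * (?d * Nd 1) + 1) * (real n + 1)"
      using LN by (intro mult_pos_pos) auto
    ultimately have "\<delta> * (2 * (L * (?d * Nd 1) + 1) * (real n + 1)) \<le> c1"
      by (simp only: pos_le_divide_eq)
    then have "\<delta> * ((L * (?d * Nd 1) + 1) * (real n + 1)) \<le> c1 / 2"
      by (simp only: mult.assoc mult.left_commute[of _ 2])
    moreover have "L * (?d * Nd 1) * (real n * \<delta>) \<le> \<delta> * ((L * (?d * Nd 1) + 1) * (real n + 1))"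
    proof -
      have "(L * (?d * Nd 1)) * real n \<le> (L * (?d * Nd 1) + 1) * (real n + 1)"
        using LN by (intro mult_mono) auto
      from mult_left_mono[OF this, of \<delta>] show ?thesis using \<delta>(1) by (simp add: mult_ac)
    qed
    ultimately show ?thesis by linarith
  qed
  have near: "x + t *\<^sub>R h \<in> D \<and> c1 / 2 \<le> \<zeta> (l j * \<psi> (x + t *\<^sub>R h)) \<and>
      (\<forall>cs\<in>lists Basis. length cs \<le> n \<longrightarrow> l j * \<bar>iter_partial cs \<psi> (x + t *\<^sub>R h)\<bar> \<le> B * l j ^ length cs)"
    if x: "x \<in> A j" and h: "l j * norm h \<le> \<delta>" and t: "t \<in> {0..real n}" for j x h t
  proof -
    let ?l = "l j"
    have lp: "0 < ?l" by (rule l_pos)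
    have xD: "x \<in> D" using x by (rule A_D)
    note xb = cut_nonzero_bounds[OF xD A_cut[OF x]]
    have step: "?l * (s * norm h) \<le> real n * \<delta>" if "s \<in> {0..real n}" for s
    proof -
      have "s * (?l * norm h) \<le> real n * \<delta>" using that h \<delta>(1) lp by (intro mult_mono) auto
      then show ?thesis by (simp add: mult_ac)
    qed
    have inD: "x + s *\<^sub>R h \<in> D" and lo: "q \<le> ?l * bdist D (x + s *\<^sub>R h)"
      and hi: "?l * bdist D (x + s *\<^sub>R h) \<le> N1 * b + q" if s: "s \<in> {0..real n}" for s
    proof -
      have ls: "?l * dist x (x + s *\<^sub>R h) \<le> q" using step[OF s] \<delta>q s by (simp add: dist_norm)
      have q2: "q + q = a / N0" using N_pos by (simp add: q_def)
      then have "?l * dist x (x + s *\<^sub>R h) < ?l * bdist D x" using ls xb(1) q by linarith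
      then show "x + s *\<^sub>R h \<in> D" using near_in_D[OF xD] lp by simp
      have "?l * bdist D x \<le> ?l * (bdist D (x + s *\<^sub>R h) + dist x (x + s *\<^sub>R h))"
        using lp bdist_triangle by (intro mult_left_mono) auto
      then show "q \<le> ?l * bdist D (x + s *\<^sub>R h)" using ls xb(1) q2 by (simp add: distrib_left)
      have "?l * bdist D (x + s *\<^sub>R h) \<le> ?l * (bdist D x + dist (x + s *\<^sub>R h) x)"
        using lp bdist_triangle by (intro mult_left_mono) auto
      then show "?l * bdist D (x + s *\<^sub>R h) \<le> N1 * b + q" using ls xb(2) by (simp add: distrib_left dist_commute)
    qed
    have d1: "\<bar>partial_deriv c \<psi> z\<bar> \<le> Nd 1" if "z \<in> D" "c \<in> Basis" for c z
      using psi_deriv[OF that(1), of "[c]"] that bdist_pos[OF that(1)] by simp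
    have "\<bar>\<psi> (x + t *\<^sub>R h) - \<psi> x\<bar> \<le> norm (t *\<^sub>R h) * (?d * Nd 1)"
    proof -
      have "\<exists>\<theta>\<in>{0..1}. \<psi> (x + t *\<^sub>R h) - \<psi> x = (\<Sum>c\<in>Basis. (t *\<^sub>R h \<bullet> c) * partial_deriv c \<psi> (x + \<theta> *\<^sub>R t *\<^sub>R h))"
      proof (rule mean_value_segment)
        fix \<theta> :: real assume "\<theta> \<in> {0..1}"
        then have "\<theta> * t \<in> {0..real n}" using t by (auto intro: order_trans[OF mult_left_le_one_le])
        then show "\<psi> differentiable at (x + \<theta> *\<^sub>R t *\<^sub>R h)"
          using inD[of "\<theta> * t"] smooth_on_differentiable[OF smooth_psi] by simp
      qed
      then obtain \<theta> where \<theta>: "\<theta> \<in> {0..1}"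
        "\<psi> (x + t *\<^sub>R h) - \<psi> x = (\<Sum>c\<in>Basis. (t *\<^sub>R h \<bullet> c) * partial_deriv c \<psi> (x + \<theta> *\<^sub>R t *\<^sub>R h))" by blast
      have "\<theta> * t \<in> {0..real n}" using t \<theta>(1) by (auto intro: order_trans[OF mult_left_le_one_le])
      then have z: "x + \<theta> *\<^sub>R t *\<^sub>R h \<in> D" using inD[of "\<theta> * t"] by simp
      have "\<bar>\<psi> (x + t *\<^sub>R h) - \<psi> x\<bar> \<le> (\<Sum>c\<in>Basis. \<bar>(t *\<^sub>R h \<bullet> c) * partial_deriv c \<psi> (x + \<theta> *\<^sub>R t *\<^sub>R h)\<bar>)"
        unfolding \<theta>(2) by (rule sum_abs)
      also have "\<dots> \<le> (\<Sum>c\<in>(Basis::'a set). norm (t *\<^sub>R h) * Nd 1)"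
        unfolding abs_mult using d1[OF z] Basis_le_norm[of _ "t *\<^sub>R h"] by (intro sum_mono mult_mono) auto
      finally show ?thesis by (simp add: mult_ac)
    qed
    then have "?l * \<bar>\<psi> (x + t *\<^sub>R h) - \<psi> x\<bar> \<le> ?l * (norm (t *\<^sub>R h) * (?d * Nd 1))"
      using lp by (intro mult_left_mono) auto
    also have "\<dots> = (?l * (t * norm h)) * (?d * Nd 1)" using t by simp
    also have "\<dots> \<le> (real n * \<delta>) * (?d * Nd 1)"
      using step[OF t] N_pos by (intro mult_right_mono) auto
    finally have "L * (?l * \<bar>\<psi> (x + t *\<^sub>R h) - \<psi> x\<bar>) \<le> L * ((real n * \<delta>) * (?d * Nd 1))"
      using L by (intro mult_left_mono) auto
    also have "\<dots> \<le> c1 / 2" using \<delta>c by (simp add: mult_ac)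
    finally have "L * \<bar>?l * \<psi> (x + t *\<^sub>R h) - ?l * \<psi> x\<bar> \<le> c1 / 2"
      using lp by (simp add: abs_mult right_diff_distrib[symmetric])
    then have "\<bar>\<zeta> (?l * \<psi> (x + t *\<^sub>R h)) - \<zeta> (?l * \<psi> x)\<bar> \<le> c1 / 2"
      using L(2)[of "?l * \<psi> x" "?l * \<psi> (x + t *\<^sub>R h) - ?l * \<psi> x"] by simp
    moreover have "c1 \<le> \<zeta> (?l * \<psi> x)" using x by (simp add: A_def cut_def)
    ultimately have z2: "c1 / 2 \<le> \<zeta> (?l * \<psi> (x + t *\<^sub>R h))" by linarith
    have "?l * \<bar>iter_partial cs \<psi> (x + t *\<^sub>R h)\<bar> \<le> B * ?l ^ length cs"
      if cs: "cs \<in> lists Basis" "length cs \<le> n" for cs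
    proof (cases "length cs")
      case 0
      let ?y = "x + t *\<^sub>R h"
      have "0 \<le> \<psi> ?y" using le_psi[OF inD[OF t]] bdist_pos[OF inD[OF t]] N_pos(2)
        by (metis less_le_trans less_imp_le zero_less_mult_pos)
      then have "?l * \<bar>\<psi> ?y\<bar> \<le> ?l * (N0 * bdist D ?y)"
        using psi_le[OF inD[OF t]] lp by (intro mult_left_mono) auto
      also have "\<dots> = N0 * (?l * bdist D ?y)" by simp
      also have "\<dots> \<le> N0 * (N1 * b + q)" using hi[OF t] N_pos by (intro mult_left_mono) auto
      also have "\<dots> \<le> B" using B3 by (simp add: B_def)
      finally show ?thesis using 0 by simp
    next
      case (Suc m)
      let ?y = "x + t *\<^sub>R h" and ?I = "\<bar>iter_partial cs \<psi> (x + t *\<^sub>R h)\<bar>"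
      have \<rho>: "q / ?l \<le> bdist D ?y" using lo[OF t] lp by (simp add: field_simps)
      have "(q / ?l) ^ m * ?I \<le> bdist D ?y ^ m * ?I"
        using \<rho> q lp by (intro mult_right_mono power_mono) auto
      also have "\<dots> = bdist D ?y powr (real (length cs) - 1) * ?I"
        using bdist_pos[OF inD[OF t]] by (simp add: Suc powr_realpow)
      also have "\<dots> \<le> Nd (Suc m)" using psi_deriv[OF inD[OF t] cs(1)] by (simp add: Suc)
      finally have "?I \<le> Nd (Suc m) / q ^ m * ?l ^ m" using q lp by (simp add: field_simps)
      then have "?l * ?I \<le> ?l * (Nd (Suc m) / q ^ m * ?l ^ m)" using lp by (intro mult_left_mono) auto
      also have "\<dots> = Nd (Suc m) / q ^ m * ?l ^ Suc m" by simp
      also have "\<dots> \<le> B * ?l ^ Suc m"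
      proof (rule mult_right_mono)
        have "Nd (Suc m) / q ^ (Suc m - 1) \<le> (\<Sum>m\<le>n. Nd m / q ^ (m - 1))"
          by (rule member_le_sum) (use cs Suc B2 in auto)
        then show "Nd (Suc m) / q ^ m \<le> B" using B1 by (simp add: B_def)
      qed (use lp in auto)
      finally show ?thesis by (simp add: Suc)
    qed
    then show ?thesis using inD[OF t] z2 by blast
  qed
  have c2: "0 < c1 / 2" using c1_pos by simp
  obtain K where K: "0 \<le> K" "\<forall>D (\<psi> :: 'a \<Rightarrow> real) l x h.
     smooth_on D \<psi> \<longrightarrow> 0 < l \<longrightarrow>
     (\<forall>t\<in>{0..real n}. x + t *\<^sub>R h \<in> D \<and> c1 / 2 \<le> \<zeta> (l * \<psi> (x + t *\<^sub>R h)) \<and>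
        (\<forall>cs\<in>lists Basis. length cs \<le> n \<longrightarrow> l * \<bar>iter_partial cs \<psi> (x + t *\<^sub>R h)\<bar> \<le> B * l ^ length cs)) \<longrightarrow>
     (\<forall>i j. i + j \<le> n \<longrightarrow> \<bar>dif j (\<lambda>i. inverse (\<zeta> (l * \<psi> (x + real i *\<^sub>R h)))) i\<bar> \<le> K * (l * norm h) ^ j)"
    using inverse_cutoff_differences[OF zeta_test B c2, of n] by blast
  show ?thesis
  proof (rule that[OF \<delta> K(1)], intro allI impI conjI)
    fix j i and x h :: 'a assume x: "x \<in> A j" and h: "l j * norm h \<le> \<delta>" and i: "i \<le> n"
    have "real i \<in> {0..real n}" using i by simp
    from near[OF x h this] c2 show "x + real i *\<^sub>R h \<in> D" "cut j (x + real i *\<^sub>R h) \<noteq> 0"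
      by (auto simp: cut_def)
  next
    fix j i k and x h :: 'a assume x: "x \<in> A j" and h: "l j * norm h \<le> \<delta>" and ik: "i + k \<le> n"
    show "\<bar>dif k (\<lambda>i. inverse (cut j (x + real i *\<^sub>R h))) i\<bar> \<le> K * (l j * norm h) ^ k"
      unfolding cut_def using K(2)[rule_format, OF smooth_psi l_pos near[OF x h] ik] .
  qed
qed

text \<open>On the segment \<open>f\<close> is \<open>w\<close> divided by the cutoff. In the
  Leibniz rule the \<open>n - i\<close> differences that fall on the reciprocal cutoff give the
  power \<open>n - i\<close> of \<open>l j * norm h\<close>, and the remaining \<open>i\<close> fall
  on \<open>w\<close>.\<close>

lemma near_layer_differences:
  obtains \<delta> K where "0 < \<delta>" "\<delta> \<le> 1" "0 \<le> K"
    "\<forall>j x h (f :: 'a \<Rightarrow> real) w. x \<in> A j \<longrightarrow> l j * norm h \<le> \<delta> \<longrightarrow>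
       (\<forall>i\<le>n. x + real i *\<^sub>R h \<in> D \<longrightarrow> cut j (x + real i *\<^sub>R h) * f (x + real i *\<^sub>R h) = w (x + real i *\<^sub>R h)) \<longrightarrow>
       \<bar>dif n (\<lambda>i. f (x + real i *\<^sub>R h)) 0\<bar>
         \<le> K * (\<Sum>i\<le>n. (l j * norm h) ^ (n - i) * \<bar>dif i (\<lambda>k. w (x + real k *\<^sub>R h)) 0\<bar>)"
proof -
  obtain \<delta> K where \<delta>: "0 < \<delta>" "\<delta> \<le> 1" and K: "0 \<le> K" and H:
    "\<forall>j x h. x \<in> A j \<longrightarrow> l j * norm h \<le> \<delta> \<longrightarrow>
       (\<forall>i\<le>n. x + real i *\<^sub>R h \<in> D \<and> cut j (x + real i *\<^sub>R h) \<noteq> 0) \<and>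
       (\<forall>i k. i + k \<le> n \<longrightarrow> \<bar>dif k (\<lambda>i. inverse (cut j (x + real i *\<^sub>R h))) i\<bar> \<le> K * (l j * norm h) ^ k)"
    by (rule cut_inverse_differences)
  show ?thesis
  proof (rule that[OF \<delta>, of "2 ^ n * K"], simp add: K, intro allI impI)
    fix j and x h :: 'a and f w :: "'a \<Rightarrow> real"
    assume x: "x \<in> A j" and h: "l j * norm h \<le> \<delta>"
      and fw: "\<forall>i\<le>n. x + real i *\<^sub>R h \<in> D \<longrightarrow> cut j (x + real i *\<^sub>R h) * f (x + real i *\<^sub>R h) = w (x + real i *\<^sub>R h)"
    let ?e = "l j * norm h" and ?r = "\<lambda>i. inverse (cut j (x + real i *\<^sub>R h))" and ?w = "\<lambda>k. w (x + real k *\<^sub>R h)"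
    have H1: "x + real i *\<^sub>R h \<in> D" "cut j (x + real i *\<^sub>R h) \<noteq> 0" if "i \<le> n" for i using H x h that by blast+
    have H2: "\<bar>dif k ?r i\<bar> \<le> K * ?e ^ k" if "i + k \<le> n" for i k using H x h that by blast
    have e0: "0 \<le> ?e" using l_pos[of j] by simp
    have "dif n (\<lambda>i. f (x + real i *\<^sub>R h)) 0 = dif n (\<lambda>i. ?r i * ?w i) 0"
    proof (rule dif_cong)
      fix i assume "i \<le> 0 + n"
      then have i: "i \<le> n" by simp
      have "?w i = cut j (x + real i *\<^sub>R h) * f (x + real i *\<^sub>R h)" using fw H1(1)[OF i] i by simp
      then show "f (x + real i *\<^sub>R h) = ?r i * ?w i" using H1(2)[OF i] by simp
    qed
    also have "\<dots> = (\<Sum>i\<le>n. real (n choose i) * (dif (n - i) ?r (0 + i) * dif i ?w 0))" by (rule dif_mult)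
    finally have "\<bar>dif n (\<lambda>i. f (x + real i *\<^sub>R h)) 0\<bar> \<le> (\<Sum>i\<le>n. \<bar>real (n choose i) * (dif (n - i) ?r (0 + i) * dif i ?w 0)\<bar>)"
      by (simp only: sum_abs)
    also have "\<dots> \<le> (\<Sum>i\<le>n. 2 ^ n * (K * ?e ^ (n - i) * \<bar>dif i ?w 0\<bar>))"
    proof (rule sum_mono)
      fix i assume "i \<in> {..n}"
      then have i: "i \<le> n" by simp
      have "n choose i \<le> 2 ^ n" using choose_row_sum[of n] member_le_sum[of i "{..n}" "\<lambda>j. n choose j"] i by simp
      then have "real (n choose i) \<le> 2 ^ n" by (metis of_nat_le_iff of_nat_numeral of_nat_power)
      moreover have "\<bar>dif (n - i) ?r (0 + i)\<bar> \<le> K * ?e ^ (n - i)" using H2[of i "n - i"] i by simp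
      ultimately show "\<bar>real (n choose i) * (dif (n - i) ?r (0 + i) * dif i ?w 0)\<bar> \<le> 2 ^ n * (K * ?e ^ (n - i) * \<bar>dif i ?w 0\<bar>)"
        unfolding abs_mult using K e0 by (intro mult_mono) auto
    qed
    also have "\<dots> = 2 ^ n * K * (\<Sum>i\<le>n. ?e ^ (n - i) * \<bar>dif i ?w 0\<bar>)"
      by (simp add: sum_distrib_left mult.assoc)
    finally show "\<bar>dif n (\<lambda>i. f (x + real i *\<^sub>R h)) 0\<bar> \<le> 2 ^ n * K * (\<Sum>i\<le>n. ?e ^ (n - i) * \<bar>dif i ?w 0\<bar>)" .
  qed
qed

end

text \<open>The lower bound on the sum over all scales becomes a lower bound for a single cutoff
  because, for a given point, only boundedly many scales hit the support of
  \<open>\<zeta>\<close>.\<close>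

lemma layers_exist:
  assumes lip: "bounded_lipschitz_domain D" and reg: "regularized_distance D \<psi>" and prof: "partition_profile \<zeta>"
  shows "\<exists>a b c1 N0 N1 Nd m0. layers D \<psi> \<zeta> a b c1 N0 N1 Nd m0"
proof -
  note D = bounded_lipschitz_domain_open[OF lip] bounded_lipschitz_domain_bounded[OF lip] bounded_lipschitz_domain_nonempty[OF lip]
  have \<zeta>: "\<zeta> \<in> test_functions {0<..}" using prof by (simp add: partition_profile_def)
  obtain a b where ab: "0 < a" "a < b" "\<forall>t. t \<notin> {a..b} \<longrightarrow> \<zeta> t = 0"
    by (rule test_functions_supp_real[OF \<zeta>])
  obtain N1 where N1: "0 < N1" "\<And>y. y \<in> D \<Longrightarrow> bdist D y \<le> N1 * \<psi> y"
    using reg unfolding regularized_distance_def by blast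
  have "\<forall>m. \<exists>N. \<forall>x\<in>D. \<forall>bs\<in>lists Basis. length bs = m \<longrightarrow> bdist D x powr (real m - 1) * \<bar>iter_partial bs \<psi> x\<bar> \<le> N"
    using reg unfolding regularized_distance_def by blast
  from choice[OF this] obtain N where N: "\<And>m x bs. x \<in> D \<Longrightarrow> bs \<in> lists Basis \<Longrightarrow> length bs = m \<Longrightarrow>
      bdist D x powr (real m - 1) * \<bar>iter_partial bs \<psi> x\<bar> \<le> N m" by blast
  have fr: "closed (frontier D)" "frontier D \<noteq> {}" using frontier_nonempty[OF D(2,3)] by auto
  have rho: "0 < bdist D y" if "y \<in> D" for y
  proof -
    have "y \<notin> frontier D" using that D(1) by (simp add: frontier_def interior_open)
    then show ?thesis unfolding bdist_def using fr by (simp add: infdist_pos_not_in_closed)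
  qed
  have psi: "0 < \<psi> y" if "y \<in> D" for y
    using N1(2)[OF that] rho[OF that] N1(1) by (metis less_le_trans zero_less_mult_pos)
  \<comment> \<open>The upper comparison of \<open>\<psi>\<close> with the distance is the
    derivative bound of order 0, whose weight is the distance to the power -1.\<close>
  define N0 where "N0 = max 1 (N 0)"
  have N0: "\<psi> y \<le> N0 * bdist D y" if "y \<in> D" for y
  proof -
    have "bdist D y powr (real 0 - 1) * \<bar>iter_partial [] \<psi> y\<bar> \<le> N 0" by (rule N[OF that]) auto
    then have "\<psi> y / bdist D y \<le> N 0" using rho[OF that] psi[OF that] by (simp add: powr_minus divide_inverse mult.commute)
    also have "N 0 \<le> N0" by (simp add: N0_def)
    finally show ?thesis using rho[OF that] by (simp add: field_simps)
  qed
  obtain z0 where z0: "z0 \<in> frontier D" using fr by blast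
  obtain R where R: "0 < R" "\<And>y. y \<in> D \<Longrightarrow> dist y z0 \<le> R"
    using D(2) bounded_any_center[of D z0] by (metis dist_commute zero_less_one less_max_iff_disj max.coboundedI1 max.cobounded2 order_trans)
  have rhoR: "bdist D y \<le> R" if "y \<in> D" for y
    using infdist_le[OF z0, of y] R(2)[OF that] by (simp add: bdist_def)
  \<comment> \<open>A nonzero cutoff at scale m forces \<open>a \<le> exp (- m) * \<psi> y\<close>,
    and \<open>\<psi>\<close> is at most \<open>N0 * R\<close> on the bounded domain.\<close>
  define m0 where "m0 = \<lceil>ln (N0 * R / a)\<rceil>"
  have m0: "m \<le> m0" if y: "y \<in> D" and "\<zeta> (exp (- of_int m) * \<psi> y) \<noteq> 0" for y m
  proof -
    have "a \<le> exp (- of_int m) * \<psi> y" using ab(3) that(2) by force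
    also have "\<dots> \<le> exp (- of_int m) * (N0 * R)"
    proof (rule mult_left_mono)
      have "N0 * bdist D y \<le> N0 * R" using rhoR[OF y] by (intro mult_left_mono) (auto simp: N0_def)
      then show "\<psi> y \<le> N0 * R" using N0[OF y] by linarith
    qed simp
    finally have "exp (of_int m) \<le> N0 * R / a" using ab(1) by (simp add: exp_minus field_simps)
    then have "of_int m \<le> ln (N0 * R / a)" by (metis exp_gt_zero ln_exp ln_le_cancel_iff order_less_le_trans)
    then show ?thesis unfolding m0_def by linarith
  qed
  obtain c where c: "c > 0" "\<And>t. (\<Sum>\<^sub>\<infinity>n::int. \<zeta> (exp (of_int n + t))) > c" and nn: "\<And>t. \<zeta> t \<ge> 0"
    using prof by (auto simp: partition_profile_def)
  \<comment> \<open>An upper bound for the number of integers n with ln a \<le> n + t \<le> ln b. If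
    all the corresponding terms were below \<open>c / M\<close>, their sum could not exceed
    \<open>c\<close>.\<close>
  define M where "M = ln b - ln a + 1"
  have M: "0 < M" using ab by (simp add: M_def add_pos_pos)
  have cover: "\<exists>m. c / M \<le> \<zeta> (exp (- of_int m) * \<psi> y)" if y: "y \<in> D" for y
  proof (rule ccontr)
    assume "\<not> ?thesis"
    then have lt: "\<zeta> (exp (- of_int m) * \<psi> y) < c / M" for m by (meson not_le)
    define t where "t = ln (\<psi> y)"
    have et: "exp (of_int n + t) = exp (- of_int (- n)) * \<psi> y" for n :: int
      using psi[OF y] by (simp add: t_def exp_add)
    define S where "S = {\<lceil>ln a - t\<rceil>..\<lfloor>ln b - t\<rfloor>}"
    have out: "\<zeta> (exp (of_int n + t)) = 0" if "n \<notin> S" for n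
    proof (rule ccontr)
      assume "\<zeta> (exp (of_int n + t)) \<noteq> 0"
      then have "a \<le> exp (of_int n + t)" "exp (of_int n + t) \<le> b" using ab(3) by force+
      then have "ln a \<le> of_int n + t" "of_int n + t \<le> ln b"
        using ab by (metis exp_gt_zero ln_exp ln_le_cancel_iff order_less_trans)+
      then have "n \<in> S" unfolding S_def by (simp add: ceiling_le_iff le_floor_iff)
      then show False using that by blast
    qed
    have "(\<Sum>\<^sub>\<infinity>n::int. \<zeta> (exp (of_int n + t))) = (\<Sum>\<^sub>\<infinity>n\<in>S. \<zeta> (exp (of_int n + t)))"
      by (rule infsum_cong_neutral) (use out in auto)
    also have "\<dots> = (\<Sum>n\<in>S. \<zeta> (exp (of_int n + t)))" by (rule infsum_finite) (simp add: S_def)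
    also have "\<dots> \<le> (\<Sum>n\<in>S. c / M)" unfolding et by (intro sum_mono) (rule less_imp_le[OF lt])
    also have "\<dots> = real (card S) * (c / M)" by simp
    also have "\<dots> \<le> M * (c / M)"
    proof (rule mult_right_mono)
      have "real_of_int (\<lfloor>ln b - t\<rfloor> - \<lceil>ln a - t\<rceil> + 1) \<le> M"
        unfolding M_def using of_int_floor_le[of "ln b - t"] le_of_int_ceiling[of "ln a - t"] by linarith
      then show "real (card S) \<le> M" using M by (simp add: S_def)
    qed (use c(1) M in auto)
    also have "\<dots> = c" using M by simp
    finally show False using c(2)[of t] by simp
  qed
  have "layers D \<psi> \<zeta> a b (c / M) N0 N1 (\<lambda>m. max 0 (N m)) m0"
  proof
    show "bdist D y powr (real (length cs) - 1) * \<bar>iter_partial cs \<psi> y\<bar> \<le> max 0 (N (length cs))"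
      if "y \<in> D" "cs \<in> lists Basis" for y cs using N[OF that refl] by simp
    show "smooth_on D \<psi>" using reg by (simp add: regularized_distance_def)
  qed (use lip prof ab N1 N0 cover m0 c M in \<open>auto simp: N0_def\<close>)
  then show ?thesis by blast
qed


section \<open>Representation by a function\<close>

lemma test_functions_dilate:
  fixes \<eta> :: "'a::euclidean_space \<Rightarrow> real"
  assumes \<eta>: "\<eta> \<in> test_functions UNIV" and c: "c \<noteq> 0"
  shows "(\<lambda>x. k * \<eta> (c *\<^sub>R x)) \<in> test_functions UNIV"
proof -
  have "(\<lambda>x. if x \<in> UNIV then k * \<eta> (c *\<^sub>R x) else 0) \<in> test_functions UNIV"
  proof (rule test_functionsI[where K="(\<lambda>x. (1 / c) *\<^sub>R x) ` supp \<eta>"])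
    show "compact ((\<lambda>x. (1 / c) *\<^sub>R x) ` supp \<eta>)"
      by (rule compact_scaling[OF test_functions_compact[OF \<eta>]])
    have "smooth_on UNIV (\<lambda>x. \<eta> (c *\<^sub>R x + 0))" by (rule smooth_on_affine_comp[OF test_functions_smooth[OF \<eta>]])
    then show "smooth_on UNIV (\<lambda>x. k * \<eta> (c *\<^sub>R x))"
      by (intro smooth_on_mult smooth_on_const open_UNIV) simp
    fix x assume x: "x \<in> UNIV - (\<lambda>x. (1 / c) *\<^sub>R x) ` supp \<eta>"
    have "c *\<^sub>R x \<notin> supp \<eta>"
    proof
      assume "c *\<^sub>R x \<in> supp \<eta>"
      then have "(1 / c) *\<^sub>R (c *\<^sub>R x) \<in> (\<lambda>x. (1 / c) *\<^sub>R x) ` supp \<eta>" by (rule imageI)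
      then show False using x c by simp
    qed
    then show "k * \<eta> (c *\<^sub>R x) = 0" by (simp add: not_in_supp)
  qed auto
  then show ?thesis by simp
qed

lemma set_integrable_Lp_dilate:
  fixes w :: "'a::euclidean_space \<Rightarrow> real"
  assumes w[measurable]: "w \<in> borel_measurable borel" and p: "1 \<le> p" and fin: "Lp_pow p w < \<infinity>"
    and c: "c \<noteq> 0" and K: "compact K"
  shows "set_integrable lborel K (\<lambda>y. w (c *\<^sub>R y))"
  unfolding set_integrable_def
proof (rule Bochner_Integration.integrable_bound)
  have Kb[measurable]: "K \<in> sets borel" using K by (simp add: borel_compact)
  have wp: "integrable lborel (\<lambda>x. \<bar>w x\<bar> powr p)"
    by (rule integrableI_nonneg) (use fin in \<open>auto simp: Lp_pow_def\<close>)
  have "integrable lborel (\<lambda>y. \<bar>w (0 + c *\<^sub>R y)\<bar> powr p)"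
    using integrable_lborel_affine_iff[of "\<lambda>x. \<bar>w x\<bar> powr p" c 0] c wp by simp
  moreover have "integrable lborel (indicator K :: 'a \<Rightarrow> real)"
    using emeasure_bounded_finite[OF compact_imp_bounded[OF K]] by (intro integrable_real_indicator) auto
  ultimately show "integrable lborel (\<lambda>y. indicator K y + \<bar>w (c *\<^sub>R y)\<bar> powr p)"
    by (intro Bochner_Integration.integrable_add) simp_all
  have le: "\<bar>w x\<bar> \<le> 1 + \<bar>w x\<bar> powr p" for x
  proof (cases "\<bar>w x\<bar> \<le> 1")
    case False
    then have "\<bar>w x\<bar> powr 1 \<le> \<bar>w x\<bar> powr p" using p by (intro powr_mono) auto
    then show ?thesis using False by simp
  qed (simp add: add_increasing2)
  show "AE y in lborel. norm (indicator K y *\<^sub>R w (c *\<^sub>R y)) \<le> norm (indicator K y + \<bar>w (c *\<^sub>R y)\<bar> powr p)"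
    using le by (intro AE_I2) (simp add: indicator_def)
  show "(\<lambda>y. indicator K y *\<^sub>R w (c *\<^sub>R y)) \<in> borel_measurable lborel" by measurable
qed

lemma locally_integrable_test_function:
  fixes f :: "'a::euclidean_space \<Rightarrow> real"
  assumes f: "locally_integrable D f" and \<eta>: "\<eta> \<in> test_functions D"
  shows "set_integrable lborel D (\<lambda>x. f x * \<eta> x)"
proof -
  let ?K = "supp \<eta>"
  have K: "compact ?K" "?K \<subseteq> D" using \<eta> by (auto simp: test_functions_def)
  have i: "integrable lborel (\<lambda>x. indicator ?K x *\<^sub>R f x)"
    using f K by (simp add: locally_integrable_def set_integrable_def)
  obtain B where B: "0 \<le> B" "\<forall>x. \<bar>\<eta> x\<bar> \<le> B"
    by (rule smooth_bounded_bound[OF schwartz_smooth_bounded[OF test_functions_schwartz[OF \<eta>]]])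
  have m: "\<eta> \<in> borel_measurable borel" by (rule smooth_borel_measurable[OF test_functions_smooth[OF \<eta>]])
  have "integrable lborel (\<lambda>x. (indicator ?K x *\<^sub>R f x) * \<eta> x)"
  proof (rule Bochner_Integration.integrable_bound)
    show "integrable lborel (\<lambda>x. B * (indicator ?K x *\<^sub>R f x))" using i by (rule Bochner_Integration.integrable_mult_right)
    show "(\<lambda>x. (indicator ?K x *\<^sub>R f x) * \<eta> x) \<in> borel_measurable lborel"
      using i m by (intro borel_measurable_times) auto
    show "AE x in lborel. norm ((indicator ?K x *\<^sub>R f x) * \<eta> x) \<le> norm (B * (indicator ?K x *\<^sub>R f x))"
    proof (rule AE_I2)
      fix x
      have "\<bar>indicator ?K x *\<^sub>R f x\<bar> * \<bar>\<eta> x\<bar> \<le> \<bar>indicator ?K x *\<^sub>R f x\<bar> * B"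
        using B by (intro mult_left_mono) auto
      then show "norm ((indicator ?K x *\<^sub>R f x) * \<eta> x) \<le> norm (B * (indicator ?K x *\<^sub>R f x))"
        using B(1) unfolding real_norm_def abs_mult by (simp only: abs_of_nonneg mult.commute)
    qed
  qed
  moreover have "(\<lambda>x. (indicator ?K x *\<^sub>R f x) * \<eta> x) = (\<lambda>x. indicator D x *\<^sub>R (f x * \<eta> x))"
    using K(2) not_in_supp[of _ \<eta>] by (auto simp: fun_eq_iff indicator_def)
  ultimately show ?thesis by (simp add: set_integrable_def)
qed

lemma locally_integrable_diff:
  "locally_integrable D f \<Longrightarrow> locally_integrable D g \<Longrightarrow> locally_integrable D (\<lambda>x. f x - g x)"
  by (auto simp: locally_integrable_def intro: set_integral_diff)

lemma distributions_linear:
  assumes "u \<in> distributions D" "\<phi> \<in> test_functions D" "\<eta> \<in> test_functions D"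
  shows "u (\<lambda>x. a * \<phi> x + b * \<eta> x) = a * u \<phi> + b * u \<eta>"
  using assms unfolding distributions_def by blast

lemma zero_test_function: "(\<lambda>_. 0) \<in> test_functions D"
  by (simp add: test_functions_def smooth_on_const supp_def)

lemma distributions_sum:
  fixes \<phi> :: "'i \<Rightarrow> 'a::euclidean_space \<Rightarrow> real"
  assumes u: "u \<in> distributions D" and D: "open D" and I: "finite I" "\<And>i. i \<in> I \<Longrightarrow> \<phi> i \<in> test_functions D"
  shows "u (\<lambda>x. \<Sum>i\<in>I. \<phi> i x) = (\<Sum>i\<in>I. u (\<phi> i)) \<and> (\<lambda>x. \<Sum>i\<in>I. \<phi> i x) \<in> test_functions D"
  using I
proof (induction I rule: finite_induct)
  case empty
  have "u (\<lambda>x. 0 * 0 + 0 * 0) = 0 * u (\<lambda>_. 0) + 0 * u (\<lambda>_. 0)"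
    by (rule distributions_linear[OF u zero_test_function zero_test_function])
  then show ?case by (simp add: zero_test_function)
next
  case (insert i I)
  let ?s = "\<lambda>x. \<Sum>i\<in>I. \<phi> i x"
  have s: "?s \<in> test_functions D" "u ?s = (\<Sum>i\<in>I. u (\<phi> i))" using insert by auto
  have i: "\<phi> i \<in> test_functions D" using insert by simp
  have "u (\<lambda>x. 1 * \<phi> i x + 1 * ?s x) = 1 * u (\<phi> i) + 1 * u ?s" by (rule distributions_linear[OF u i s(1)])
  moreover have "(\<lambda>x. if x \<in> D then \<phi> i x + ?s x else 0) \<in> test_functions D"
  proof (rule test_functionsI[OF D, where K="supp (\<phi> i) \<union> supp ?s"])
    show "smooth_on D (\<lambda>x. \<phi> i x + ?s x)"
      using test_functions_smooth[OF i] test_functions_smooth[OF s(1)] smooth_on_subset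
      by (intro smooth_on_add[OF D]) blast+
    show "compact (supp (\<phi> i) \<union> supp ?s)" "supp (\<phi> i) \<union> supp ?s \<subseteq> D"
      using i s(1) by (auto simp: test_functions_def)
    fix x assume "x \<in> D - (supp (\<phi> i) \<union> supp ?s)"
    then show "\<phi> i x + ?s x = 0" using not_in_supp[of x "\<phi> i"] not_in_supp[of x ?s] by simp
  qed
  moreover have "(\<lambda>x. if x \<in> D then \<phi> i x + ?s x else 0) = (\<lambda>x. \<phi> i x + ?s x)"
  proof
    fix x
    have "x \<notin> D \<Longrightarrow> x \<notin> supp (\<phi> i) \<and> x \<notin> supp ?s" using i s(1) by (auto simp: test_functions_def)
    then show "(if x \<in> D then \<phi> i x + ?s x else 0) = \<phi> i x + ?s x"
      using not_in_supp[of x "\<phi> i"] not_in_supp[of x ?s] by auto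
  qed
  ultimately show ?case using insert s(2) by simp
qed

section \<open>Gluing the potentials on the layers into one function\<close>

context layers
begin

definition localize :: "nat \<Rightarrow> ('a \<Rightarrow> real) \<Rightarrow> 'a \<Rightarrow> real" where
  "localize j \<eta> = (\<lambda>y. if y \<in> D then cut j y * \<eta> y else 0)"

lemma localize_test: "\<eta> \<in> test_functions D \<Longrightarrow> localize j \<eta> \<in> test_functions D"
  unfolding localize_def by (rule test_functions_mult[OF open_D _ smooth_cut])

text \<open>With the dilation undone: as a distribution on \<open>D\<close>, the product of
  \<open>u\<close> with the j-th cutoff is the function \<open>w (l j y)\<close>.\<close>

definition represents :: "(('a \<Rightarrow> real) \<Rightarrow> real) \<Rightarrow> nat \<Rightarrow> ('a \<Rightarrow> real) \<Rightarrow> bool" where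
  "represents u j w \<longleftrightarrow> (\<forall>\<eta>\<in>test_functions D. u (localize j \<eta>) = (\<integral>y. w (l j *\<^sub>R y) * \<eta> y \<partial>lborel))"

lemma representsI:
  assumes [measurable]: "w \<in> borel_measurable borel"
    and w: "\<And>\<phi>. \<phi> \<in> test_functions UNIV \<Longrightarrow> localized_dilation D \<psi> \<zeta> (m0 - int j) u \<phi> = (LINT x|lborel. w x * \<phi> x)"
  shows "represents u j w"
  unfolding represents_def
proof
  fix \<eta> assume \<eta>: "\<eta> \<in> test_functions D"
  let ?l = "l j" and ?d = "DIM('a)"
  \<comment> \<open>Chosen so that the dilation in \<open>localized_dilation\<close> and its factor
    \<open>l ^ d\<close> cancel, leaving the cutoff times \<open>\<eta>\<close>.\<close>
  define \<phi> where "\<phi> = (\<lambda>x. (1 / ?l ^ ?d) * \<eta> ((1 / ?l) *\<^sub>R x))"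
  have \<eta>U: "\<eta> \<in> test_functions UNIV" using \<eta> test_functions_mono by blast
  have [measurable]: "\<eta> \<in> borel_measurable borel" by (rule smooth_borel_measurable[OF test_functions_smooth[OF \<eta>]])
  have lp: "0 < ?l" by (rule l_pos)
  have \<phi>: "\<phi> \<in> test_functions UNIV" unfolding \<phi>_def using lp by (intro test_functions_dilate[OF \<eta>U]) simp
  have \<phi>l: "\<phi> (?l *\<^sub>R y) = \<eta> y / ?l ^ ?d" for y using lp by (simp add: \<phi>_def)
  have e: "exp (- of_int (m0 - int j) * real ?d) = ?l ^ ?d"
    unfolding l_def by (rule exp_of_nat2_mult)
  have "localized_dilation D \<psi> \<zeta> (m0 - int j) u \<phi> = u (localize j \<eta>)"
    unfolding localized_dilation_def localize_def e
    unfolding l_def[symmetric] \<phi>l cut_def using lp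
    by (intro arg_cong[of _ _ u] ext) simp
  moreover have "(LINT x|lborel. w x * \<phi> x) = \<bar>?l\<bar> ^ ?d *\<^sub>R (\<integral>y. w (0 + ?l *\<^sub>R y) * \<phi> (0 + ?l *\<^sub>R y) \<partial>lborel)"
    using lp by (intro integral_lborel_affine) (auto simp: \<phi>_def)
  moreover have "\<dots> = (\<integral>y. w (?l *\<^sub>R y) * \<eta> y \<partial>lborel)"
    unfolding integral_scaleR_right[symmetric] using lp
    by (intro Bochner_Integration.integral_cong refl) (simp add: \<phi>l)
  ultimately show "u (localize j \<eta>) = (\<integral>y. w (?l *\<^sub>R y) * \<eta> y \<partial>lborel)" using w[OF \<phi>] by simp
qed

lemma locally_integrable_cut:
  assumes f: "locally_integrable D f"
  shows "locally_integrable D (\<lambda>y. cut j y * f y)"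
  unfolding locally_integrable_def
proof (intro allI impI)
  fix K assume K: "compact K \<and> K \<subseteq> D"
  obtain M where M: "0 \<le> M" "\<forall>j y. \<bar>cut j y\<bar> \<le> M" using cut_bounded by blast
  have i: "integrable lborel (\<lambda>x. indicator K x *\<^sub>R f x)" using f K by (simp add: locally_integrable_def set_integrable_def)
  have "integrable lborel (\<lambda>x. (if x \<in> D then cut j x else 0) * (indicator K x *\<^sub>R f x))"
  proof (rule Bochner_Integration.integrable_bound)
    show "integrable lborel (\<lambda>x. M * (indicator K x *\<^sub>R f x))" using i by (rule Bochner_Integration.integrable_mult_right)
    show "(\<lambda>x. (if x \<in> D then cut j x else 0) * (indicator K x *\<^sub>R f x)) \<in> borel_measurable lborel"
      using i measurable_cut[of j] by (intro borel_measurable_times) auto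
    show "AE x in lborel. norm ((if x \<in> D then cut j x else 0) * (indicator K x *\<^sub>R f x)) \<le> norm (M * (indicator K x *\<^sub>R f x))"
    proof (rule AE_I2)
      fix x
      have "\<bar>if x \<in> D then cut j x else 0\<bar> \<le> \<bar>M\<bar>" using M by auto
      then show "norm ((if x \<in> D then cut j x else 0) * (indicator K x *\<^sub>R f x)) \<le> norm (M * (indicator K x *\<^sub>R f x))"
        unfolding real_norm_def abs_mult by (rule mult_right_mono) simp
    qed
  qed
  moreover have "(\<lambda>x. (if x \<in> D then cut j x else 0) * (indicator K x *\<^sub>R f x)) = (\<lambda>x. indicator K x *\<^sub>R (cut j x * f x))"
    using K by (auto simp: fun_eq_iff indicator_def)
  ultimately show "set_integrable lborel K (\<lambda>y. cut j y * f y)" by (simp add: set_integrable_def)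
qed

lemma locally_integrable_layer:
  assumes "w \<in> borel_measurable borel" "1 \<le> p" "Lp_pow p w < \<infinity>"
  shows "locally_integrable D (\<lambda>y. w (l j *\<^sub>R y))"
  unfolding locally_integrable_def using set_integrable_Lp_dilate[OF assms] l_pos[of j] by auto

lemma integral_localize:
  "(\<integral>y. g y * localize j \<eta> y \<partial>lborel) = (LINT y:D|lborel. (cut j y * g y) * \<eta> y)"
  unfolding set_lebesgue_integral_def localize_def
  by (intro Bochner_Integration.integral_cong refl) (simp add: indicator_def)

lemma integral_test_D:
  assumes "\<eta> \<in> test_functions D"
  shows "(\<integral>y. g y * \<eta> y \<partial>lborel) = (LINT y:D|lborel. g y * \<eta> y)"
proof -
  have "g y * \<eta> y = indicator D y *\<^sub>R (g y * \<eta> y)" for y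
    using assms not_in_supp[of y \<eta>] by (auto simp: test_functions_def indicator_def)
  then show ?thesis unfolding set_lebesgue_integral_def by (intro Bochner_Integration.integral_cong refl)
qed

text \<open>Two functions for the product of \<open>u\<close> with a cutoff agree almost everywhere,
  by the fundamental lemma. This ties one fixed representing function to the potential of any
  admissible \<open>g\<close>, so that \<open>g\<close> may be varied in the estimates.\<close>

lemma represents_unique:
  assumes f: "locally_integrable D f" and u: "u = regular_distribution D f"
    and w: "w \<in> borel_measurable borel" "1 \<le> p" "Lp_pow p w < \<infinity>" and rep: "represents u j w"
  shows "AE y in lborel. y \<in> D \<longrightarrow> cut j y * f y = w (l j *\<^sub>R y)"
proof -
  note li = locally_integrable_cut[OF f, of j] locally_integrable_layer[OF w, of j]
  have "AE y in lborel. y \<in> D \<longrightarrow> cut j y * f y - w (l j *\<^sub>R y) = 0"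
  proof (rule fundamental_lemma_calculus_of_variations[OF profile open_D locally_integrable_diff[OF li]])
    fix \<eta> assume \<eta>: "\<eta> \<in> test_functions D"
    have "(LINT y:D|lborel. (cut j y * f y - w (l j *\<^sub>R y)) * \<eta> y)
        = (LINT y:D|lborel. (cut j y * f y) * \<eta> y) - (LINT y:D|lborel. w (l j *\<^sub>R y) * \<eta> y)"
      unfolding left_diff_distrib
      by (intro set_integral_diff locally_integrable_test_function[OF _ \<eta>] li)
    also have "(LINT y:D|lborel. w (l j *\<^sub>R y) * \<eta> y) = u (localize j \<eta>)"
      using rep \<eta> integral_test_D[OF \<eta>, of "\<lambda>y. w (l j *\<^sub>R y)"] by (simp add: represents_def)
    also have "u (localize j \<eta>) = (LINT y:D|lborel. f y * localize j \<eta> y)"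
      using localize_test[OF \<eta>, of j] by (simp add: u regular_distribution_def)
    also have "\<dots> = (LINT y:D|lborel. (cut j y * f y) * \<eta> y)"
      using integral_test_D[OF localize_test[OF \<eta>], of f j] integral_localize[of f j \<eta>] by simp
    finally show "(LINT y:D|lborel. (cut j y * f y - w (l j *\<^sub>R y)) * \<eta> y) = 0" by simp
  qed
  then show ?thesis by eventually_elim simp
qed

text \<open>Both sides represent \<open>u\<close> multiplied by both cutoffs, and the two
  localisations commute.\<close>

lemma represents_consistent:
  assumes wi: "wi \<in> borel_measurable borel" "1 \<le> p" "Lp_pow p wi < \<infinity>" "represents u i wi"
    and wj: "wj \<in> borel_measurable borel" "1 \<le> p" "Lp_pow p wj < \<infinity>" "represents u j wj"
  shows "AE y in lborel. y \<in> D \<longrightarrow> cut i y * wj (l j *\<^sub>R y) = cut j y * wi (l i *\<^sub>R y)"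
proof -
  note li = locally_integrable_cut[OF locally_integrable_layer[OF wj(1-3), of j], of i]
    locally_integrable_cut[OF locally_integrable_layer[OF wi(1-3), of i], of j]
  have "AE y in lborel. y \<in> D \<longrightarrow> cut i y * wj (l j *\<^sub>R y) - cut j y * wi (l i *\<^sub>R y) = 0"
  proof (rule fundamental_lemma_calculus_of_variations[OF profile open_D locally_integrable_diff[OF li]])
    fix \<eta> assume \<eta>: "\<eta> \<in> test_functions D"
    have "(LINT y:D|lborel. (cut i y * wj (l j *\<^sub>R y) - cut j y * wi (l i *\<^sub>R y)) * \<eta> y)
        = (LINT y:D|lborel. (cut i y * wj (l j *\<^sub>R y)) * \<eta> y) - (LINT y:D|lborel. (cut j y * wi (l i *\<^sub>R y)) * \<eta> y)"
      unfolding left_diff_distrib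
      by (intro set_integral_diff locally_integrable_test_function[OF _ \<eta>] li)
    also have "(LINT y:D|lborel. (cut i y * wj (l j *\<^sub>R y)) * \<eta> y) = u (localize j (localize i \<eta>))"
      using wj(4) localize_test[OF \<eta>, of i] integral_localize[of "\<lambda>y. wj (l j *\<^sub>R y)" i \<eta>] by (simp add: represents_def)
    also have "(LINT y:D|lborel. (cut j y * wi (l i *\<^sub>R y)) * \<eta> y) = u (localize i (localize j \<eta>))"
      using wi(4) localize_test[OF \<eta>, of j] integral_localize[of "\<lambda>y. wi (l i *\<^sub>R y)" j \<eta>] by (simp add: represents_def)
    also have "localize i (localize j \<eta>) = localize j (localize i \<eta>)"
      by (auto simp: localize_def fun_eq_iff)
    finally show "(LINT y:D|lborel. (cut i y * wj (l j *\<^sub>R y) - cut j y * wi (l i *\<^sub>R y)) * \<eta> y) = 0" by simp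
  qed
  then show ?thesis by eventually_elim simp
qed

lemma compact_finitely_many_layers:
  assumes K: "compact K" "K \<subseteq> D"
  shows "\<exists>J. \<forall>y\<in>K. \<forall>j. cut j y \<noteq> 0 \<longrightarrow> j \<le> J"
proof (cases "K = {}")
  case False
  have "continuous_on K (bdist D)" unfolding bdist_def[abs_def] by (intro continuous_intros)
  then obtain y0 where y0: "y0 \<in> K" "\<forall>y\<in>K. bdist D y0 \<le> bdist D y"
    using continuous_attains_inf[OF K(1) False] by blast
  let ?r = "bdist D y0"
  have r: "0 < ?r" using y0(1) K(2) bdist_pos by blast
  have "j \<le> nat \<lceil>ln (N1 * b / ?r) + of_int m0\<rceil>" if y: "y \<in> K" and c: "cut j y \<noteq> 0" for y j
  proof -
    have yD: "y \<in> D" using y K(2) by blast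
    have "l j * ?r \<le> l j * bdist D y" using y0(2) y l_pos[of j] by (intro mult_left_mono) auto
    also have "\<dots> \<le> N1 * b" by (rule cut_nonzero_bounds(2)[OF yD c])
    finally have "exp (real j - of_int m0) \<le> N1 * b / ?r" using r by (simp add: l_eq field_simps)
    then have "real j - of_int m0 \<le> ln (N1 * b / ?r)"
      by (metis exp_gt_zero ln_exp ln_le_cancel_iff order_less_le_trans)
    then show ?thesis by linarith
  qed
  then show ?thesis by blast
qed simp

text \<open>The quotients \<open>w j (l j y) / cut j y\<close> agree almost everywhere where two
  layers overlap, so any measurable selection of a layer defines \<open>f\<close>. To recover
  \<open>u\<close>, a test function is split into finitely many localised pieces.\<close>

lemma distribution_representation:
  fixes w :: "nat \<Rightarrow> 'a \<Rightarrow> real"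
  assumes u: "u \<in> distributions D" and p: "1 \<le> p"
    and w: "\<And>j. w j \<in> borel_measurable borel" "\<And>j. Lp_pow p (w j) < \<infinity>" "\<And>j. represents u j (w j)"
  shows "\<exists>f. f \<in> borel_measurable borel \<and> locally_integrable D f \<and> u = regular_distribution D f"
proof -
  \<comment> \<open>Selecting the first layer that contains the point makes the choice
    measurable.\<close>
  define \<kappa> where "\<kappa> y = (LEAST j. y \<in> A j)" for y
  define q where "q j y = (if y \<in> D then w j (l j *\<^sub>R y) / cut j y else 0)" for j y
  define f where "f y = q (\<kappa> y) y" for y
  note [measurable] = w(1)
  have \<kappa>A: "y \<in> A (\<kappa> y)" if "y \<in> D" for y
    unfolding \<kappa>_def using A_cover[OF that] by (rule LeastI_ex)
  have "q j = (\<lambda>y. if y \<in> D then w j (l j *\<^sub>R y) / (if y \<in> D then cut j y else 0) else 0)" for j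
    by (auto simp: q_def)
  moreover have "(\<lambda>y. if y \<in> D then w j (l j *\<^sub>R y) / (if y \<in> D then cut j y else 0) else 0) \<in> borel_measurable borel" for j
    by measurable
  ultimately have qm: "q j \<in> borel_measurable borel" for j by simp
  have \<kappa>m: "\<kappa> \<in> measurable borel (count_space UNIV)"
    unfolding \<kappa>_def[abs_def] by (rule measurable_Least) simp
  have fm[measurable]: "f \<in> borel_measurable borel"
    unfolding f_def[abs_def] by (rule measurable_compose_countable[OF qm \<kappa>m])
  have "AE y in lborel. \<forall>i j. y \<in> D \<longrightarrow> cut i y * w j (l j *\<^sub>R y) = cut j y * w i (l i *\<^sub>R y)"
    unfolding AE_all_countable using represents_consistent[OF w(1) p w(2,3) w(1) p w(2,3)] by blast
  then have fw: "AE y in lborel. \<forall>j. y \<in> D \<longrightarrow> cut j y * f y = w j (l j *\<^sub>R y)"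
  proof eventually_elim
    fix y assume c: "\<forall>i j. y \<in> D \<longrightarrow> cut i y * w j (l j *\<^sub>R y) = cut j y * w i (l i *\<^sub>R y)"
    show "\<forall>j. y \<in> D \<longrightarrow> cut j y * f y = w j (l j *\<^sub>R y)"
    proof (intro allI impI)
      fix j assume y: "y \<in> D"
      have "cut (\<kappa> y) y \<noteq> 0" by (rule A_cut[OF \<kappa>A[OF y]])
      moreover have "cut j y * w (\<kappa> y) (l (\<kappa> y) *\<^sub>R y) = cut (\<kappa> y) y * w j (l j *\<^sub>R y)" using c y by blast
      ultimately show "cut j y * f y = w j (l j *\<^sub>R y)" using y by (simp add: f_def q_def field_simps)
    qed
  qed
  have li: "locally_integrable D f"
    unfolding locally_integrable_def
  proof (intro allI impI)
    fix K assume K: "compact K \<and> K \<subseteq> D"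
    obtain J where J: "\<forall>y\<in>K. \<forall>j. cut j y \<noteq> 0 \<longrightarrow> j \<le> J" using compact_finitely_many_layers K by blast
    have Kb: "K \<in> sets borel" using K by (simp add: borel_compact)
    show "set_integrable lborel K f"
      unfolding set_integrable_def
    proof (rule Bochner_Integration.integrable_bound)
      have "integrable lborel (\<lambda>y. \<bar>indicator K y *\<^sub>R w j (l j *\<^sub>R y)\<bar> / c1)" for j
        using locally_integrable_layer[OF w(1) p w(2), of j] K
        by (simp add: locally_integrable_def set_integrable_def)
      then show "integrable lborel (\<lambda>y. \<Sum>j\<le>J. \<bar>indicator K y *\<^sub>R w j (l j *\<^sub>R y)\<bar> / c1)"
        by (intro Bochner_Integration.integrable_sum)
      show "(\<lambda>y. indicator K y *\<^sub>R f y) \<in> borel_measurable lborel" using Kb by simp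
      show "AE y in lborel. norm (indicator K y *\<^sub>R f y) \<le> norm (\<Sum>j\<le>J. \<bar>indicator K y *\<^sub>R w j (l j *\<^sub>R y)\<bar> / c1)"
      proof (rule AE_I2)
        fix y
        have nn: "0 \<le> (\<Sum>j\<le>J. \<bar>indicator K y *\<^sub>R w j (l j *\<^sub>R y)\<bar> / c1)" using c1_pos by (intro sum_nonneg) auto
        show "norm (indicator K y *\<^sub>R f y) \<le> norm (\<Sum>j\<le>J. \<bar>indicator K y *\<^sub>R w j (l j *\<^sub>R y)\<bar> / c1)"
        proof (cases "y \<in> K")
          case True
          then have yD: "y \<in> D" using K by blast
          let ?k = "\<kappa> y"
          have c: "c1 \<le> cut ?k y" using \<kappa>A[OF yD] by (simp add: A_def)
          have kJ: "?k \<le> J" using J True A_cut[OF \<kappa>A[OF yD]] by blast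
          have "\<bar>f y\<bar> = \<bar>w ?k (l ?k *\<^sub>R y)\<bar> / cut ?k y" using yD c c1_pos by (simp add: f_def q_def abs_divide)
          also have "\<dots> \<le> \<bar>w ?k (l ?k *\<^sub>R y)\<bar> / c1" using c c1_pos by (intro divide_left_mono) auto
          also have "\<dots> = \<bar>indicator K y *\<^sub>R w ?k (l ?k *\<^sub>R y)\<bar> / c1" using True by simp
          also have "\<dots> \<le> (\<Sum>j\<le>J. \<bar>indicator K y *\<^sub>R w j (l j *\<^sub>R y)\<bar> / c1)"
            using kJ c1_pos by (intro member_le_sum[where f="\<lambda>j. \<bar>indicator K y *\<^sub>R w j (l j *\<^sub>R y)\<bar> / c1"]) auto
          finally show ?thesis using nn True by simp
        qed simp
      qed
    qed
  qed
  have "u \<eta> = regular_distribution D f \<eta>" for \<eta>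
  proof (cases "\<eta> \<in> test_functions D")
    case False
    then show ?thesis using u by (simp add: distributions_def regular_distribution_def)
  next
    case True
    let ?K = "supp \<eta>"
    have K: "compact ?K" "?K \<subseteq> D" using True by (auto simp: test_functions_def)
    obtain J where J: "\<forall>y\<in>?K. \<forall>j. cut j y \<noteq> 0 \<longrightarrow> j \<le> J" using compact_finitely_many_layers K by blast
    define Z where "Z y = (\<Sum>j\<le>J. cut j y)" for y
    have Zs: "smooth_on D Z" unfolding Z_def[abs_def] by (rule smooth_on_sum[OF open_D smooth_cut])
    \<comment> \<open>Finitely many cutoffs have a positive sum near the support of
      \<open>\<eta>\<close>, though perhaps not on all of \<open>D\<close>; the division by
      \<open>Z\<close> is therefore done on this open neighbourhood.\<close>
    define V where "V = {y \<in> D. 0 < Z y}"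
    have V: "open V"
    proof -
      have "V = D \<inter> Z -` {0<..}" by (auto simp: V_def)
      then show ?thesis
        using continuous_open_preimage[OF smooth_on_continuous_on[OF Zs] open_D open_greaterThan] by simp
    qed
    have VD: "V \<subseteq> D" by (auto simp: V_def)
    have KV: "?K \<subseteq> V"
    proof
      fix y assume y: "y \<in> ?K"
      then have yD: "y \<in> D" using K by blast
      obtain j where j: "y \<in> A j" using A_cover[OF yD] by blast
      have "j \<le> J" using J y A_cut[OF j] by blast
      then have "cut j y \<le> Z y" unfolding Z_def by (intro member_le_sum) (auto simp: cut_def zeta_nonneg)
      moreover have "c1 \<le> cut j y" using j by (simp add: A_def)
      ultimately show "y \<in> V" using yD c1_pos by (simp add: V_def)
    qed
    have \<eta>V: "\<eta> \<in> test_functions V" using True KV by (simp add: test_functions_def)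
    \<comment> \<open>The quotient \<open>\<eta> / Z\<close> replaces a partition of unity: its
      localisations to the layers up to \<open>J\<close> add up to \<open>\<eta>\<close>.\<close>
    define \<theta> where "\<theta> = (\<lambda>y. if y \<in> V then inverse (Z y) * \<eta> y else 0)"
    have "\<theta> \<in> test_functions V"
      unfolding \<theta>_def
      by (rule test_functions_mult[OF V \<eta>V smooth_on_inverse[OF V smooth_on_subset[OF Zs VD]]]) (auto simp: V_def)
    then have \<theta>: "\<theta> \<in> test_functions D" using test_functions_mono[OF VD] by blast
    have pu: "(\<Sum>j\<le>J. localize j \<theta> y) = \<eta> y" for y
    proof (cases "y \<in> V")
      case True
      then have "(\<Sum>j\<le>J. localize j \<theta> y) = Z y * \<theta> y" using VD by (auto simp: localize_def Z_def sum_distrib_right)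
      then show ?thesis using True by (simp add: \<theta>_def V_def)
    next
      case False
      then have "\<eta> y = 0" using KV not_in_supp[of y \<eta>] by blast
      moreover have "localize j \<theta> y = 0" for j using False by (simp add: localize_def \<theta>_def)
      ultimately show ?thesis by simp
    qed
    have "u \<eta> = u (\<lambda>y. \<Sum>j\<le>J. localize j \<theta> y)" by (simp add: pu)
    also have "\<dots> = (\<Sum>j\<le>J. u (localize j \<theta>))"
      using distributions_sum[OF u open_D, of "{..J}" "\<lambda>j. localize j \<theta>"] localize_test[OF \<theta>] by simp
    also have "\<dots> = (\<Sum>j\<le>J. LINT y:D|lborel. f y * localize j \<theta> y)"
    proof (rule sum.cong[OF refl])
      fix j
      have "u (localize j \<theta>) = (\<integral>y. w j (l j *\<^sub>R y) * \<theta> y \<partial>lborel)" using w(3)[of j] \<theta> by (simp add: represents_def)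
      also have "\<dots> = (LINT y:D|lborel. w j (l j *\<^sub>R y) * \<theta> y)" by (rule integral_test_D[OF \<theta>])
      also have "\<dots> = (LINT y:D|lborel. f y * localize j \<theta> y)"
      proof (rule set_lebesgue_integral_cong_AE)
        have [measurable]: "\<theta> \<in> borel_measurable borel" "localize j \<theta> \<in> borel_measurable borel"
          using \<theta> localize_test[OF \<theta>] test_functions_smooth smooth_borel_measurable by blast+
        show "(\<lambda>y. w j (l j *\<^sub>R y) * \<theta> y) \<in> borel_measurable lborel" "(\<lambda>y. f y * localize j \<theta> y) \<in> borel_measurable lborel"
          by measurable
        show "AE y\<in>D in lborel. w j (l j *\<^sub>R y) * \<theta> y = f y * localize j \<theta> y"
          using fw
        proof eventually_elim
          fix y assume "\<forall>j. y \<in> D \<longrightarrow> cut j y * f y = w j (l j *\<^sub>R y)"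
          then have "y \<in> D \<longrightarrow> w j (l j *\<^sub>R y) = cut j y * f y" by simp
          then show "y \<in> D \<longrightarrow> w j (l j *\<^sub>R y) * \<theta> y = f y * localize j \<theta> y"
            by (simp add: localize_def mult_ac)
        qed
      qed simp
      finally show "u (localize j \<theta>) = (LINT y:D|lborel. f y * localize j \<theta> y)" .
    qed
    also have "\<dots> = (LINT y:D|lborel. (\<Sum>j\<le>J. f y * localize j \<theta> y))"
      unfolding set_lebesgue_integral_def scaleR_sum_right
      by (rule Bochner_Integration.integral_sum[symmetric])
         (use locally_integrable_test_function[OF li localize_test[OF \<theta>]] in \<open>simp add: set_integrable_def\<close>)
    also have "\<dots> = regular_distribution D f \<eta>"
      using True by (simp add: regular_distribution_def sum_distrib_left[symmetric] pu)
    finally show ?thesis .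
  qed
  then show ?thesis using fm li by blast
qed

end


section \<open>Estimates on the layers\<close>

text \<open>Comparison with the largest summand, which works for exponents below 1 as well as
  above.\<close>

lemma sum_powr_le:
  fixes f :: "nat \<Rightarrow> real"
  assumes f: "\<And>i. 0 \<le> f i" and t: "0 \<le> t"
  shows "(\<Sum>i\<le>n. f i) powr t \<le> (real n + 1) powr t * (\<Sum>i\<le>n. f i powr t)"
proof -
  have "Max (f ` {..n}) \<in> f ` {..n}" by (intro Max_in) auto
  then obtain k where "k \<le> n" "Max (f ` {..n}) = f k" by (metis atMost_iff imageE)
  then have k: "k \<le> n" "\<And>i. i \<le> n \<Longrightarrow> f i \<le> f k" using Max_ge[of "f ` {..n}"] by auto
  have "(\<Sum>i\<le>n. f i) \<le> (\<Sum>i\<le>n. f k)" using k(2) by (intro sum_mono) auto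
  then have "(\<Sum>i\<le>n. f i) \<le> (real n + 1) * f k" by (simp add: add.commute)
  then have "(\<Sum>i\<le>n. f i) powr t \<le> ((real n + 1) * f k) powr t"
    using f t by (intro powr_mono2) (auto intro: sum_nonneg)
  also have "\<dots> = (real n + 1) powr t * f k powr t" using f by (simp add: powr_mult)
  also have "\<dots> \<le> (real n + 1) powr t * (\<Sum>i\<le>n. f i powr t)"
    using k(1) by (intro mult_left_mono member_le_sum[of k "{..n}" "\<lambda>i. f i powr t"]) auto
  finally show ?thesis .
qed

text \<open>For \<open>e \<le> 1\<close> a larger exponent makes the power smaller, and n - i + s i
  / n \<ge> s because s \<le> n. The case e = 0 is separate because the powers are combined through
  \<open>powr\<close> with a positive base.\<close>

lemma interpolation_power_le:
  fixes e s :: real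
  assumes e: "0 \<le> e" "e \<le> 1" and i: "i \<le> n" and n: "1 \<le> n" and s: "0 < s" "s \<le> real n"
  shows "e ^ (n - i) * (e powr (s / real n)) ^ i \<le> e powr s"
proof (cases "e = 0")
  case True
  show ?thesis
  proof (cases "i = n")
    case True
    then show ?thesis using \<open>e = 0\<close> n by (simp add: power_0_left)
  next
    case False
    then have "n - i \<noteq> 0" using i by simp
    then show ?thesis using True by (simp add: power_0_left)
  qed
next
  case False
  then have e0: "0 < e" using e by simp
  have "e ^ (n - i) * (e powr (s / real n)) ^ i = e powr (real (n - i)) * e powr (s / real n * real i)"
    using e0 by (simp add: powr_realpow powr_power mult.commute)
  also have "\<dots> = e powr (real (n - i) + s / real n * real i)" by (simp add: powr_add)
  also have "\<dots> \<le> e powr s"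
  proof (rule powr_mono')
    have "s = s / real n * real (n - i) + s / real n * real i"
      using n i by (simp add: of_nat_diff field_simps)
    moreover have "s / real n * real (n - i) \<le> 1 * real (n - i)"
      using s n by (intro mult_right_mono) auto
    ultimately show "s \<le> real (n - i) + s / real n * real i" by linarith
  qed (use e e0 in auto)
  finally show ?thesis .
qed

text \<open>Hoelder's inequality up to a factor 2, by splitting at the level \<open>k\<close>: below
  it F powr t is at most k powr t, above it at most k powr (t - p) times F powr p. The exponent
  \<open>t\<close> may be less than 1.\<close>

lemma nn_integral_powr_holder:
  fixes F :: "'a::euclidean_space \<Rightarrow> real"
  assumes F[measurable]: "F \<in> borel_measurable borel" "\<And>x. 0 \<le> F x" and S[measurable]: "S \<in> sets borel"
    and M: "emeasure lborel S \<le> ennreal M" "0 < M" and t: "0 < t" "t \<le> p"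
    and X: "(\<integral>\<^sup>+x\<in>S. ennreal (F x powr p) \<partial>lborel) \<le> ennreal X" "0 \<le> X"
  shows "(\<integral>\<^sup>+x\<in>S. ennreal (F x powr t) \<partial>lborel) \<le> ennreal (2 * M powr (1 - t / p) * X powr (t / p))"
proof (cases "X = 0")
  case True
  then have "(\<integral>\<^sup>+x. ennreal (F x powr p) * indicator S x \<partial>lborel) = 0" using X by simp
  then have "AE x in lborel. ennreal (F x powr p) * indicator S x = 0"
    by (subst (asm) nn_integral_0_iff_AE) simp_all
  then have "AE x in lborel. ennreal (F x powr t) * indicator S x = 0"
    by eventually_elim (auto simp: indicator_def split: if_splits)
  then have "(\<integral>\<^sup>+x. ennreal (F x powr t) * indicator S x \<partial>lborel) = 0"
    by (subst nn_integral_0_iff_AE) simp_all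
  then show ?thesis by simp
next
  case False
  then have X0: "0 < X" using X by simp
  have p: "0 < p" using t by simp
  \<comment> \<open>This level makes the two contributions equal; hence the 2.\<close>
  define k where "k = (X / M) powr (1 / p)"
  have k: "0 < k" using X0 M by (simp add: k_def)
  have pw: "F x powr t \<le> k powr t + k powr (t - p) * F x powr p" for x
  proof (cases "F x \<le> k")
    case True
    then have "F x powr t \<le> k powr t" using F(2) t by (intro powr_mono2) auto
    then show ?thesis by (simp add: add_increasing2)
  next
    case False
    then have "F x powr (t - p) \<le> k powr (t - p)" using k t by (intro powr_mono2') auto
    then have "F x powr (t - p) * F x powr p \<le> k powr (t - p) * F x powr p" by (intro mult_right_mono) auto
    moreover have "F x powr (t - p) * F x powr p = F x powr t" by (simp add: powr_add[symmetric])
    ultimately show ?thesis by (simp add: add_increasing)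
  qed
  have "(\<integral>\<^sup>+x\<in>S. ennreal (F x powr t) \<partial>lborel)
      \<le> (\<integral>\<^sup>+x. ennreal (k powr t) * indicator S x + ennreal (k powr (t - p)) * (ennreal (F x powr p) * indicator S x) \<partial>lborel)"
  proof (rule nn_integral_mono)
    fix x
    have "ennreal (F x powr t) \<le> ennreal (k powr t) + ennreal (k powr (t - p)) * ennreal (F x powr p)"
      using pw[of x] by (simp add: ennreal_mult[symmetric] ennreal_plus[symmetric] ennreal_leI del: ennreal_plus)
    then show "ennreal (F x powr t) * indicator S x \<le> ennreal (k powr t) * indicator S x + ennreal (k powr (t - p)) * (ennreal (F x powr p) * indicator S x)"
      by (simp add: indicator_def)
  qed
  also have "\<dots> = ennreal (k powr t) * emeasure lborel S + ennreal (k powr (t - p)) * (\<integral>\<^sup>+x\<in>S. ennreal (F x powr p) \<partial>lborel)"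
    by (simp add: nn_integral_add nn_integral_cmult)
  also have "\<dots> \<le> ennreal (k powr t) * ennreal M + ennreal (k powr (t - p)) * ennreal X"
    by (intro add_mono mult_left_mono M X) auto
  also have "\<dots> = ennreal (k powr t * M + k powr (t - p) * X)"
    using M X0 by (simp add: ennreal_mult[symmetric] ennreal_plus[symmetric] del: ennreal_plus)
  also have "k powr t * M + k powr (t - p) * X = 2 * M powr (1 - t / p) * X powr (t / p)"
  proof -
    have 1: "k powr t = X powr (t / p) / M powr (t / p)" using X0 M by (simp add: k_def powr_powr powr_divide)
    have 2: "k powr (t - p) = k powr t * (M / X)"
    proof -
      have "k powr p = X / M" using X0 M p by (simp add: k_def powr_powr)
      then show ?thesis using X0 M by (simp add: powr_diff)
    qed
    have 3: "M powr (1 - t / p) = M / M powr (t / p)" using M by (simp add: powr_diff)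
    show ?thesis unfolding 2 1 3 using X0 by (simp add: field_simps)
  qed
  finally show ?thesis .
qed

text \<open>Here \<open>s\<close> is the smoothness actually proved for the differences, strictly
  above \<alpha>. As s approaches \<alpha>, its last bound turns into \<alpha> * (1 - 1 / d) <
  \<nu>, the critical relation of the embedding.\<close>

locale embedding = layers D \<psi> \<zeta> a b c1 N0 N1 Nd m0
  for D :: "'a::euclidean_space set" and \<psi> \<zeta> a b c1 N0 N1 Nd m0 +
  fixes \<gamma> p \<nu> \<alpha> \<tau> s d :: real and n :: nat
  assumes d: "d = real DIM('a)" and p: "1 \<le> p" and n: "1 \<le> n" and \<gamma>: "0 < \<gamma>" and \<alpha>: "0 < \<alpha>"
    and s: "\<alpha> < s" "s < \<gamma>" "s \<le> real n" "s < \<nu> + \<alpha> / d"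
    and \<tau>: "1 / \<tau> = \<alpha> / d + 1 / p"
begin

definition "\<theta> = d - \<nu> * p"
text \<open>The decay exponent of the layers: what remains of the power of \<open>l j\<close> after
  \<open>norm h powr (s * \<tau>)\<close> has been extracted.\<close>

definition "\<kappa> = \<tau> * (\<nu> + \<alpha> / d - s)"

lemma d_pos: "0 < d"
  by (simp add: d)

lemma \<tau>_pos: "0 < \<tau>"
proof -
  have "0 < \<alpha> / d + 1 / p" using \<alpha> p d_pos by (intro add_pos_pos) auto
  then show ?thesis using \<tau> by (metis zero_less_divide_1_iff)
qed

lemma \<tau>_le: "\<tau> \<le> p"
proof -
  have "1 / p \<le> 1 / \<tau>" unfolding \<tau> using \<alpha> d_pos by simp
  then show ?thesis using \<tau>_pos p by (simp add: field_simps)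
qed

lemma \<tau>_eq: "1 - \<tau> / p = \<tau> * \<alpha> / d"
proof -
  have "1 = \<tau> * (\<alpha> / d + 1 / p)" using \<tau>_pos unfolding \<tau>[symmetric] by simp
  then show ?thesis by (simp add: distrib_left)
qed

lemma \<kappa>_pos: "0 < \<kappa>"
  unfolding \<kappa>_def using \<tau>_pos s by simp

lemma s_pos: "0 < s"
  using \<alpha> s by simp

text \<open>The competitors in the infimum that defines \<open>bessel_norm\<close> on layer
  \<open>j\<close>.\<close>

definition admissible :: "(('a \<Rightarrow> real) \<Rightarrow> real) \<Rightarrow> nat \<Rightarrow> ('a \<Rightarrow> real) set" where
  "admissible u j = {g \<in> Lp_space p UNIV. \<forall>\<phi>\<in>schwartz.
     localized_dilation D \<psi> \<zeta> (m0 - int j) u (bessel_op \<gamma> \<phi>) = (LINT x|lborel. g x * \<phi> x)}"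

definition wnorm :: "(('a \<Rightarrow> real) \<Rightarrow> real) \<Rightarrow> ennreal" where
  "wnorm u = weighted_sobolev_norm D \<psi> \<zeta> \<gamma> p \<theta> u"

text \<open>One term of the series is at most the whole sum, and the weight
  \<open>exp (m * \<theta>)\<close> at m = m0 - j equals
  \<open>l j powr (- \<theta>)\<close>.\<close>

lemma bessel_norm_le:
  assumes U: "wnorm u = ennreal U" "0 \<le> U"
  shows "bessel_norm \<gamma> p (localized_dilation D \<psi> \<zeta> (m0 - int j) u) \<le> ennreal (U * l j powr (\<theta> / p))"
proof -
  let ?\<beta> = "\<lambda>m. bessel_norm \<gamma> p (localized_dilation D \<psi> \<zeta> m u)"
  let ?T = "\<lambda>m::int. ennreal (exp (of_int m * \<theta>)) * ennreal_powr (?\<beta> m) p"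
  let ?m = "m0 - int j"
  let ?S = "\<Sum>\<^sub>\<infinity>m. ?T m"
  have "ennreal_powr ?S (1 / p) = ennreal U" using U by (simp add: wnorm_def weighted_sobolev_norm_def)
  then have Sf: "?S \<noteq> \<infinity>" and "enn2real ?S powr (1 / p) = U"
    using U(2) by (auto simp: ennreal_powr_def split: if_splits)
  then have "enn2real ?S = U powr p" using p by (auto simp: powr_powr)
  then have S: "?S = ennreal (U powr p)" using Sf by (metis ennreal_enn2real_if infinity_ennreal_def)
  have "?T ?m = (\<Sum>\<^sub>\<infinity>m\<in>{?m}. ?T m)" by simp
  also have "\<dots> \<le> ?S" by (rule infsum_mono_neutral) (auto intro: nonneg_summable_on_complete)
  finally have T: "ennreal (exp (of_int ?m * \<theta>)) * ennreal_powr (?\<beta> ?m) p \<le> ennreal (U powr p)" unfolding S .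
  have fin: "?\<beta> ?m \<noteq> \<infinity>"
  proof
    assume "?\<beta> ?m = \<infinity>"
    then have "ennreal (exp (of_int ?m * \<theta>)) * \<infinity> \<le> ennreal (U powr p)" using T by (simp add: ennreal_powr_def)
    then show False by (simp add: ennreal_mult_top top_unique)
  qed
  let ?B = "enn2real (?\<beta> ?m)"
  have l: "exp (of_int ?m * \<theta>) = l j powr (- \<theta>)" by (simp add: l_def powr_def algebra_simps)
  have "ennreal (l j powr (- \<theta>) * ?B powr p) \<le> ennreal (U powr p)"
    using T fin unfolding l by (simp add: ennreal_powr_def ennreal_mult)
  then have "l j powr (- \<theta>) * ?B powr p \<le> U powr p" by simp
  then have "?B powr p \<le> U powr p * l j powr \<theta>"
    using l_pos[of j] by (simp add: powr_minus field_simps)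
  then have "(?B powr p) powr (1 / p) \<le> (U powr p * l j powr \<theta>) powr (1 / p)"
    using p by (intro powr_mono2) auto
  moreover have "(?B powr p) powr (1 / p) = ?B" using p by (simp add: powr_powr)
  moreover have "(U powr p * l j powr \<theta>) powr (1 / p) = U * l j powr (\<theta> / p)"
    using p U(2) by (simp add: powr_mult powr_powr)
  ultimately have "?B \<le> U * l j powr (\<theta> / p)" by simp
  then have "ennreal ?B \<le> ennreal (U * l j powr (\<theta> / p))" by (rule ennreal_leI)
  then show ?thesis using fin by (simp add: ennreal_enn2real_if)
qed

text \<open>The Bessel norm is an infimum, so the bound is applied to a competitor whose norm
  exceeds it by less than \<open>e\<close>, and then \<open>e\<close> tends to 0.\<close>

lemma admissible_infimum:
  assumes U: "wnorm u = ennreal U" "0 \<le> U" and K: "0 \<le> K"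
    and X: "\<And>g. g \<in> admissible u j \<Longrightarrow> X \<le> ennreal K * Lp_pow p g"
  shows "X \<le> ennreal (K * (U powr p * l j powr \<theta>))"
proof -
  define B where "B = U * l j powr (\<theta> / p)"
  have B0: "0 \<le> B" using U by (simp add: B_def)
  have Xe: "X \<le> ennreal (K * (B + e) powr p)" if e: "0 < e" for e
  proof -
    have "bessel_norm \<gamma> p (localized_dilation D \<psi> \<zeta> (m0 - int j) u) < ennreal (B + e)"
      using bessel_norm_le[OF U, of j] B0 e by (auto simp: B_def[symmetric] ennreal_less_iff intro: le_less_trans)
    then obtain g where g: "g \<in> admissible u j" "Lp_norm p UNIV g < ennreal (B + e)"
      unfolding bessel_norm_def INF_less_iff admissible_def by blast
    have fin: "Lp_pow p g \<noteq> \<infinity>" and "enn2real (Lp_pow p g) powr (1 / p) < B + e"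
      using g(2) B0 e by (auto simp: Lp_norm_def Lp_pow_def[symmetric] ennreal_powr_def ennreal_less_iff split: if_splits simp del: ennreal_plus)
    then have "(enn2real (Lp_pow p g) powr (1 / p)) powr p \<le> (B + e) powr p"
      using p by (intro powr_mono2) auto
    then have "enn2real (Lp_pow p g) \<le> (B + e) powr p" using p by (simp add: powr_powr)
    then have "Lp_pow p g \<le> ennreal ((B + e) powr p)"
      using fin by (metis ennreal_enn2real_if ennreal_leI infinity_ennreal_def)
    then have "ennreal K * Lp_pow p g \<le> ennreal K * ennreal ((B + e) powr p)" by (rule mult_left_mono) simp
    then show ?thesis using X[OF g(1)] K by (simp add: ennreal_mult)
  qed
  have "(\<lambda>k. B + 1 / real (Suc k)) \<longlonglongrightarrow> B + 0"
    by (intro tendsto_add tendsto_const LIMSEQ_inverse_real_of_nat[unfolded inverse_eq_divide])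
  then have "(\<lambda>k. (B + 1 / real (Suc k)) powr p) \<longlonglongrightarrow> (B + 0) powr p"
    using p B0 by (intro tendsto_powr2[OF _ tendsto_const]) (auto intro!: always_eventually)
  then have "(\<lambda>k. ennreal (K * (B + 1 / real (Suc k)) powr p)) \<longlonglongrightarrow> ennreal (K * B powr p)"
    by (intro tendsto_ennrealI tendsto_mult tendsto_const) simp
  then have "X \<le> ennreal (K * B powr p)"
    by (rule LIMSEQ_le_const) (use Xe in \<open>auto intro!: exI[of _ 0]\<close>)
  moreover have "B powr p = U powr p * l j powr \<theta>"
    using p U by (simp add: B_def powr_mult powr_powr)
  ultimately show ?thesis by simp
qed

lemma admissible_nonempty:
  assumes U: "wnorm u = ennreal U" "0 \<le> U"
  shows "admissible u j \<noteq> {}"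
proof
  assume "admissible u j = {}"
  then have "bessel_norm \<gamma> p (localized_dilation D \<psi> \<zeta> (m0 - int j) u) = \<infinity>"
    unfolding bessel_norm_def by (subst admissible_def[symmetric]) simp
  then show False using bessel_norm_le[OF U, of j] by (simp add: top_unique)
qed

lemma layer_functions:
  obtains C where "0 \<le> C"
    "\<forall>u j. \<forall>g\<in>admissible u j. \<exists>w. w \<in> borel_measurable borel \<and> Lp_pow p w < \<infinity> \<and> represents u j w \<and>
       (\<forall>h. \<forall>i\<le>n. Lp_pow p ((Dif h ^^ i) w) \<le> ennreal (((C * norm h powr (s / real n)) ^ i) powr p) * Lp_pow p g)"
proof -
  have "0 \<le> s" using s_pos by simp
  from bessel_potential_representation[OF \<gamma> p n this s(2,3), where 'a='a]
  obtain C where C: "0 \<le> C" "\<And>(v :: ('a \<Rightarrow> real) \<Rightarrow> real) g. g \<in> Lp_space p UNIV \<Longrightarrow>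
    (\<forall>\<phi>\<in>schwartz. v (bessel_op \<gamma> \<phi>) = (LINT x|lborel. g x * \<phi> x)) \<Longrightarrow>
    (\<exists>w. w \<in> borel_measurable borel \<and> Lp_pow p w < \<infinity> \<and>
       (\<forall>\<phi>\<in>test_functions UNIV. v \<phi> = (LINT x|lborel. w x * \<phi> x)) \<and>
       (\<forall>h. \<forall>i\<le>n. Lp_pow p ((Dif h ^^ i) w) \<le> ennreal (((C * norm h powr (s / real n)) ^ i) powr p) * Lp_pow p g))"
    by blast
  show ?thesis
  proof (rule that[OF C(1)], intro allI ballI)
    fix u :: "('a \<Rightarrow> real) \<Rightarrow> real" and j g assume "g \<in> admissible u j"
    then have g: "g \<in> Lp_space p UNIV" "\<forall>\<phi>\<in>schwartz.
      localized_dilation D \<psi> \<zeta> (m0 - int j) u (bessel_op \<gamma> \<phi>) = (LINT x|lborel. g x * \<phi> x)"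
      by (auto simp: admissible_def)
    from C(2)[where v="localized_dilation D \<psi> \<zeta> (m0 - int j) u", OF g] obtain w where w: "w \<in> borel_measurable borel" "Lp_pow p w < \<infinity>"
       "\<forall>\<phi>\<in>test_functions UNIV. localized_dilation D \<psi> \<zeta> (m0 - int j) u \<phi> = (LINT x|lborel. w x * \<phi> x)"
       "\<forall>h. \<forall>i\<le>n. Lp_pow p ((Dif h ^^ i) w) \<le> ennreal (((C * norm h powr (s / real n)) ^ i) powr p) * Lp_pow p g"
      by blast
    moreover have "represents u j w" by (rule representsI[OF w(1)]) (use w(3) in blast)
    ultimately show "\<exists>w. w \<in> borel_measurable borel \<and> Lp_pow p w < \<infinity> \<and> represents u j w \<and>
       (\<forall>h. \<forall>i\<le>n. Lp_pow p ((Dif h ^^ i) w) \<le> ennreal (((C * norm h powr (s / real n)) ^ i) powr p) * Lp_pow p g)"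
      by blast
  qed
qed

text \<open>A layer lies within distance \<open>N1 * b / l j\<close> of the boundary, so the linear
  bound for boundary layers applies.\<close>

lemma emeasure_A:
  obtains M where "0 < M" "\<forall>j. emeasure lborel (A j) \<le> ennreal (M / l j)"
proof -
  obtain C where C: "0 \<le> C" "\<And>r. 0 < r \<Longrightarrow> measure lborel {x \<in> D. bdist D x \<le> r} \<le> C * r"
    using measure_boundary_layer[OF lipschitz] by blast
  have N1b: "0 < N1 * b" using N_pos ab by simp
  show ?thesis
  \<comment> \<open>\<open>C\<close> may be 0; \<open>C + 1\<close> keeps the constant positive, as
    the Hoelder estimate wants it.\<close>
  proof (rule that[of "(C + 1) * (N1 * b)"])
    show "0 < (C + 1) * (N1 * b)" using C N1b by (intro mult_pos_pos[OF _ N1b]) auto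
    show "\<forall>j. emeasure lborel (A j) \<le> ennreal ((C + 1) * (N1 * b) / l j)"
    proof
    fix j
    let ?r = "N1 * b / l j" and ?S = "{x \<in> D. bdist D x \<le> N1 * b / l j}"
    have r: "0 < ?r" using N1b l_pos by simp
    have sub: "A j \<subseteq> ?S"
    proof
      fix y assume y: "y \<in> A j"
      have "l j * bdist D y \<le> N1 * b" by (rule cut_nonzero_bounds(2)[OF A_D[OF y] A_cut[OF y]])
      then show "y \<in> ?S" using A_D[OF y] l_pos[of j] by (simp add: field_simps)
    qed
    have "emeasure lborel (A j) \<le> emeasure lborel ?S" by (rule emeasure_mono[OF sub]) simp
    also have "emeasure lborel ?S = ennreal (measure lborel ?S)"
      using emeasure_bounded_finite[of ?S] bounded_subset[OF bounded_D, of ?S]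
      by (intro emeasure_eq_ennreal_measure) auto
    also have "\<dots> \<le> ennreal ((C + 1) * (N1 * b) / l j)"
    proof (rule ennreal_leI)
      have "measure lborel ?S \<le> C * ?r" by (rule C(2)[OF r])
      also have "\<dots> \<le> (C + 1) * ?r" using r by (intro mult_right_mono) auto
      finally show "measure lborel ?S \<le> (C + 1) * (N1 * b) / l j" by simp
    qed
    finally show "emeasure lborel (A j) \<le> ennreal ((C + 1) * (N1 * b) / l j)" .
    qed
  qed
qed

text \<open>Where the exponents come from: the dilation gives l powr (- d) and the weighted norm l
  powr \<theta>, together l powr (- \<nu> p), whose power \<tau> / p is l powr (- \<nu> \<tau>). The
  measure of the layer to the power 1 - \<tau> / p adds l powr (- \<tau> \<alpha> / d).\<close>

lemma layer_holder:
  obtains H where "0 \<le> H"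
    "\<forall>u U j k (F :: 'a \<Rightarrow> real). wnorm u = ennreal U \<longrightarrow> 0 \<le> U \<longrightarrow> 0 \<le> k \<longrightarrow> F \<in> borel_measurable borel \<longrightarrow> (\<forall>x. 0 \<le> F x) \<longrightarrow>
       (\<forall>g\<in>admissible u j. (\<integral>\<^sup>+x\<in>A j. ennreal (F x powr p) \<partial>lborel) \<le> ennreal (k * l j powr (- d)) * Lp_pow p g) \<longrightarrow>
       (\<integral>\<^sup>+x\<in>A j. ennreal (F x powr \<tau>) \<partial>lborel) \<le> ennreal (H * k powr (\<tau> / p) * U powr \<tau> * l j powr (- (\<tau> * (\<nu> + \<alpha> / d))))"
proof -
  obtain M where M: "0 < M" "\<forall>j. emeasure lborel (A j) \<le> ennreal (M / l j)" by (rule emeasure_A)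
  show ?thesis
  proof (rule that[of "2 * M powr (1 - \<tau> / p)"], simp, intro allI impI)
    fix u :: "('a \<Rightarrow> real) \<Rightarrow> real" and U j k and F :: "'a \<Rightarrow> real"
    assume U: "wnorm u = ennreal U" "0 \<le> U" and k: "0 \<le> k" and F: "F \<in> borel_measurable borel" "\<forall>x. 0 \<le> F x"
      and adm: "\<forall>g\<in>admissible u j. (\<integral>\<^sup>+x\<in>A j. ennreal (F x powr p) \<partial>lborel) \<le> ennreal (k * l j powr (- d)) * Lp_pow p g"
    let ?l = "l j"
    have lp: "0 < ?l" by (rule l_pos)
    let ?X = "k * ?l powr (- d) * (U powr p * ?l powr \<theta>)"
    have X: "(\<integral>\<^sup>+x\<in>A j. ennreal (F x powr p) \<partial>lborel) \<le> ennreal ?X"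
      by (rule admissible_infimum[OF U _ adm[rule_format]]) (use k in simp)
    have "(\<integral>\<^sup>+x\<in>A j. ennreal (F x powr \<tau>) \<partial>lborel) \<le> ennreal (2 * (M / ?l) powr (1 - \<tau> / p) * ?X powr (\<tau> / p))"
      by (rule nn_integral_powr_holder[OF F(1) F(2)[rule_format] borel_A M(2)[rule_format] _ \<tau>_pos \<tau>_le X]) (use M lp k in auto)
    also have "2 * (M / ?l) powr (1 - \<tau> / p) * ?X powr (\<tau> / p) = 2 * M powr (1 - \<tau> / p) * k powr (\<tau> / p) * U powr \<tau> * ?l powr (- (\<tau> * (\<nu> + \<alpha> / d)))"
    proof -
      have e1: "?X = k * U powr p * ?l powr (- (\<nu> * p))"
      proof -
        have "?l powr (- d) * ?l powr \<theta> = ?l powr (- (\<nu> * p))" by (simp add: powr_add[symmetric] \<theta>_def)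
        then show ?thesis by (simp add: mult_ac)
      qed
      have "?X powr (\<tau> / p) = k powr (\<tau> / p) * (U powr p) powr (\<tau> / p) * (?l powr (- (\<nu> * p))) powr (\<tau> / p)"
        unfolding e1 using k by (simp add: powr_mult)
      also have "(U powr p) powr (\<tau> / p) = U powr \<tau>" using p by (simp add: powr_powr)
      also have "(?l powr (- (\<nu> * p))) powr (\<tau> / p) = ?l powr (- (\<nu> * \<tau>))" using p by (simp add: powr_powr)
      finally have e2: "?X powr (\<tau> / p) = k powr (\<tau> / p) * U powr \<tau> * ?l powr (- (\<nu> * \<tau>))" .
      have e3: "(M / ?l) powr (1 - \<tau> / p) = M powr (1 - \<tau> / p) * ?l powr (- (\<tau> * \<alpha> / d))"
        unfolding \<tau>_eq using M(1) lp by (simp add: powr_divide powr_minus divide_inverse powr_mult inverse_powr)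
      have e4: "?l powr (- (\<tau> * \<alpha> / d)) * ?l powr (- (\<nu> * \<tau>)) = ?l powr (- (\<tau> * (\<nu> + \<alpha> / d)))"
        by (simp add: powr_add[symmetric] distrib_left mult.commute)
      show ?thesis unfolding e2 e3 e4[symmetric] by (simp add: mult_ac)
    qed
    finally show "(\<integral>\<^sup>+x\<in>A j. ennreal (F x powr \<tau>) \<partial>lborel) \<le> ennreal (2 * M powr (1 - \<tau> / p) * k powr (\<tau> / p) * U powr \<tau> * ?l powr (- (\<tau> * (\<nu> + \<alpha> / d))))" .
  qed
qed

lemma nn_integral_dilate:
  fixes w :: "'a \<Rightarrow> real"
  assumes [measurable]: "w \<in> borel_measurable borel"
  shows "(\<integral>\<^sup>+x. ennreal (\<bar>w (0 + l j *\<^sub>R x)\<bar> powr p) \<partial>lborel) = ennreal (l j powr (- d)) * Lp_pow p w"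
proof -
  have lp: "0 < l j" by (rule l_pos)
  have e: "l j powr (- d) * \<bar>l j\<bar> ^ DIM('a) = 1" using lp by (simp add: d powr_minus powr_realpow)
  have "Lp_pow p w = ennreal (\<bar>l j\<bar> ^ DIM('a)) * (\<integral>\<^sup>+x. ennreal (\<bar>w (0 + l j *\<^sub>R x)\<bar> powr p) \<partial>lborel)"
    unfolding Lp_pow_def using nn_integral_lborel_affine[of "\<lambda>x. ennreal (\<bar>w x\<bar> powr p)" "l j" 0] lp by simp
  then have "ennreal (l j powr (- d)) * Lp_pow p w = ennreal (l j powr (- d) * \<bar>l j\<bar> ^ DIM('a)) * (\<integral>\<^sup>+x. ennreal (\<bar>w (0 + l j *\<^sub>R x)\<bar> powr p) \<partial>lborel)"
    using lp by (simp add: ennreal_mult mult.assoc)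
  then show ?thesis by (simp only: e ennreal_1 mult_1)
qed

text \<open>On the layer |f| is at most |w| / c1 at the dilated point, and the L_p bound for
  \<open>w\<close> is the case of no differences.\<close>

lemma layer_function_bound:
  obtains K where "0 \<le> K"
    "\<forall>u U f j. wnorm u = ennreal U \<longrightarrow> 0 \<le> U \<longrightarrow> f \<in> borel_measurable borel \<longrightarrow> locally_integrable D f \<longrightarrow>
       u = regular_distribution D f \<longrightarrow>
       (\<integral>\<^sup>+x\<in>A j. ennreal (\<bar>f x\<bar> powr \<tau>) \<partial>lborel) \<le> ennreal (K * U powr \<tau> * l j powr (- (\<tau> * (\<nu> + \<alpha> / d))))"
proof -
  obtain C where C: "0 \<le> C" "\<forall>u j. \<forall>g\<in>admissible u j. \<exists>w. w \<in> borel_measurable borel \<and> Lp_pow p w < \<infinity> \<and> represents u j w \<and>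
       (\<forall>h. \<forall>i\<le>n. Lp_pow p ((Dif h ^^ i) w) \<le> ennreal (((C * norm h powr (s / real n)) ^ i) powr p) * Lp_pow p g)"
    by (rule layer_functions)
  obtain H where H: "0 \<le> H"
    "\<forall>u U j k (F :: 'a \<Rightarrow> real). wnorm u = ennreal U \<longrightarrow> 0 \<le> U \<longrightarrow> 0 \<le> k \<longrightarrow> F \<in> borel_measurable borel \<longrightarrow> (\<forall>x. 0 \<le> F x) \<longrightarrow>
       (\<forall>g\<in>admissible u j. (\<integral>\<^sup>+x\<in>A j. ennreal (F x powr p) \<partial>lborel) \<le> ennreal (k * l j powr (- d)) * Lp_pow p g) \<longrightarrow>
       (\<integral>\<^sup>+x\<in>A j. ennreal (F x powr \<tau>) \<partial>lborel) \<le> ennreal (H * k powr (\<tau> / p) * U powr \<tau> * l j powr (- (\<tau> * (\<nu> + \<alpha> / d))))"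
    by (rule layer_holder)
  let ?k = "(1 / c1) powr p"
  show ?thesis
  proof (rule that[of "H * ?k powr (\<tau> / p)"], use H in simp, intro allI impI)
    fix u :: "('a \<Rightarrow> real) \<Rightarrow> real" and U and f :: "'a \<Rightarrow> real" and j
    assume U: "wnorm u = ennreal U" "0 \<le> U" and f: "f \<in> borel_measurable borel" "locally_integrable D f" "u = regular_distribution D f"
    show "(\<integral>\<^sup>+x\<in>A j. ennreal (\<bar>f x\<bar> powr \<tau>) \<partial>lborel) \<le> ennreal (H * ?k powr (\<tau> / p) * U powr \<tau> * l j powr (- (\<tau> * (\<nu> + \<alpha> / d))))"
    proof (rule H(2)[rule_format, OF U])
      fix g assume "g \<in> admissible u j"
      from C(2)[rule_format, OF this] obtain w where w[measurable]: "w \<in> borel_measurable borel" and wf: "Lp_pow p w < \<infinity>" and wr: "represents u j w"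
        and wb: "\<forall>h. \<forall>i\<le>n. Lp_pow p ((Dif h ^^ i) w) \<le> ennreal (((C * norm h powr (s / real n)) ^ i) powr p) * Lp_pow p g" by blast
      \<comment> \<open>At order 0 the constant is an empty power, that is 1, whatever the
        step.\<close>
      have wg: "Lp_pow p w \<le> Lp_pow p g" using wb[rule_format, of 0 0] by simp
      have "(\<integral>\<^sup>+x\<in>A j. ennreal (\<bar>f x\<bar> powr p) \<partial>lborel) \<le> (\<integral>\<^sup>+x. ennreal ?k * ennreal (\<bar>w (0 + l j *\<^sub>R x)\<bar> powr p) \<partial>lborel)"
      proof (rule nn_integral_mono_AE)
        show "AE x in lborel. ennreal (\<bar>f x\<bar> powr p) * indicator (A j) x \<le> ennreal ?k * ennreal (\<bar>w (0 + l j *\<^sub>R x)\<bar> powr p)"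
          using represents_unique[OF f(2,3) w p wf wr]
        proof eventually_elim
          fix x assume x: "x \<in> D \<longrightarrow> cut j x * f x = w (l j *\<^sub>R x)"
          show "ennreal (\<bar>f x\<bar> powr p) * indicator (A j) x \<le> ennreal ?k * ennreal (\<bar>w (0 + l j *\<^sub>R x)\<bar> powr p)"
          proof (cases "x \<in> A j")
            case True
            then have "c1 \<le> cut j x" "x \<in> D" by (auto simp: A_def)
            then have w: "w (l j *\<^sub>R x) = cut j x * f x" and "c1 * \<bar>f x\<bar> \<le> cut j x * \<bar>f x\<bar>"
              using x by (simp, intro mult_right_mono) auto
            moreover have "\<bar>w (l j *\<^sub>R x)\<bar> = cut j x * \<bar>f x\<bar>" unfolding w using \<open>c1 \<le> cut j x\<close> c1_pos by (simp add: abs_mult)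
            ultimately have "c1 * \<bar>f x\<bar> \<le> \<bar>w (l j *\<^sub>R x)\<bar>" by simp
            then have "\<bar>f x\<bar> \<le> (1 / c1) * \<bar>w (l j *\<^sub>R x)\<bar>" using c1_pos by (simp add: field_simps)
            then have "\<bar>f x\<bar> powr p \<le> ((1 / c1) * \<bar>w (l j *\<^sub>R x)\<bar>) powr p" using p by (intro powr_mono2) auto
            also have "\<dots> = ?k * \<bar>w (l j *\<^sub>R x)\<bar> powr p" by (rule powr_mult)
            finally show ?thesis using True by (simp add: ennreal_mult[symmetric] ennreal_leI)
          qed simp
        qed
      qed
      also have "\<dots> = ennreal ?k * (\<integral>\<^sup>+x. ennreal (\<bar>w (0 + l j *\<^sub>R x)\<bar> powr p) \<partial>lborel)"
        by (rule nn_integral_cmult) simp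
      also have "(\<integral>\<^sup>+x. ennreal (\<bar>w (0 + l j *\<^sub>R x)\<bar> powr p) \<partial>lborel) = ennreal (l j powr (- d)) * Lp_pow p w"
        by (rule nn_integral_dilate[OF w])
      also have "ennreal ?k * (ennreal (l j powr (- d)) * Lp_pow p w) \<le> ennreal ?k * (ennreal (l j powr (- d)) * Lp_pow p g)"
        by (intro mult_left_mono wg) auto
      also have "\<dots> = ennreal (?k * l j powr (- d)) * Lp_pow p g" by (simp add: ennreal_mult mult.assoc)
      finally show "(\<integral>\<^sup>+x\<in>A j. ennreal (\<bar>f x\<bar> powr p) \<partial>lborel) \<le> ennreal (?k * l j powr (- d)) * Lp_pow p g" .
    qed (use f in auto)
  qed
qed

end

section \<open>Differences of the representing function, near and far from the boundary\<close>

lemma Dif_pow_eq_dif: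
  "(Dif h ^^ i) f x = dif i (\<lambda>k. f (x + real k *\<^sub>R h)) 0"
proof (induction i arbitrary: x)
  case (Suc i)
  have "dif i (\<lambda>k. f (x + real k *\<^sub>R h)) (0 + 1) = dif i (\<lambda>k. f (x + real (k + 1) *\<^sub>R h)) 0"
    by (rule dif_shift)
  also have "(\<lambda>k. f (x + real (k + 1) *\<^sub>R h)) = (\<lambda>k. f (x + h + real k *\<^sub>R h))"
    by (simp add: scaleR_add_left add.assoc add.commute[of "_ *\<^sub>R h" h])
  finally show ?case by (simp add: Dif_def[of h "(Dif h ^^ i) f" x] Suc)
qed simp

lemma nth_difference_eq:
  "nth_difference G n h f x =
     (if \<forall>i\<le>n. x + real i *\<^sub>R h \<in> G then dif n (\<lambda>i. f (x + real i *\<^sub>R h)) 0 else 0)"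
proof (cases "\<forall>i\<le>n. x + real i *\<^sub>R h \<in> G")
  case True
  then show ?thesis by (simp add: nth_difference_def dif_eq_sum)
next
  case False
  then obtain i where "i \<le> n" "x + real i *\<^sub>R h \<notin> G" by blast
  then have "(\<Prod>i=0..n. indicator G (x + real i *\<^sub>R h)) = (0::real)"
    by (intro prod_zero) (auto intro: bexI[of _ i])
  then have "nth_difference G n h f x = 0" unfolding nth_difference_def by (simp only: mult_zero_left)
  then show ?thesis by (simp only: if_not_P[OF False])
qed

lemma measurable_nth_difference [measurable]:
  assumes [measurable]: "f \<in> borel_measurable borel" "G \<in> sets borel"
  shows "nth_difference G n h f \<in> borel_measurable borel"
  unfolding nth_difference_def[abs_def] by measurable

text \<open>No cancellation is used: the difference is at most a multiple of the sum of the values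
  at the shifted points. It is meant for points where the step is too large for their layer, with
  \<open>S\<close> a boundary strip that contains all the shifts.\<close>

lemma nth_difference_crude_bound:
  fixes f :: "'a::euclidean_space \<Rightarrow> real"
  assumes f[measurable]: "f \<in> borel_measurable borel" and S[measurable]: "S \<in> sets borel" and t: "0 \<le> t"
    and T: "\<And>x i. x \<in> T \<Longrightarrow> i \<le> n \<Longrightarrow> (\<forall>i\<le>n. x + real i *\<^sub>R h \<in> G) \<Longrightarrow> x + real i *\<^sub>R h \<in> S"
  shows "(\<integral>\<^sup>+x\<in>T. ennreal (\<bar>nth_difference G n h f x\<bar> powr t) \<partial>lborel)
    \<le> ennreal ((2 ^ n * (real n + 1)) powr t * (real n + 1)) * (\<integral>\<^sup>+x\<in>S. ennreal (\<bar>f x\<bar> powr t) \<partial>lborel)"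
proof -
  let ?q = "(2 ^ n * (real n + 1)) powr t"
  let ?F = "\<lambda>x. ennreal (\<bar>f x\<bar> powr t) * indicator S x"
  have pw: "ennreal (\<bar>nth_difference G n h f x\<bar> powr t) * indicator T x \<le> ennreal ?q * (\<Sum>i\<le>n. ?F (x + real i *\<^sub>R h))" for x
  proof (cases "x \<in> T \<and> (\<forall>i\<le>n. x + real i *\<^sub>R h \<in> G)")
    case True
    have "\<bar>dif n (\<lambda>i. f (x + real i *\<^sub>R h)) 0\<bar> powr t \<le> (2 ^ n * (\<Sum>i\<le>n. \<bar>f (x + real i *\<^sub>R h)\<bar>)) powr t"
      using dif_bound_sum[of n "\<lambda>i. f (x + real i *\<^sub>R h)" 0] t by (intro powr_mono2) auto
    also have "\<dots> = (2 ^ n) powr t * (\<Sum>i\<le>n. \<bar>f (x + real i *\<^sub>R h)\<bar>) powr t" by (rule powr_mult)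
    also have "\<dots> \<le> (2 ^ n) powr t * ((real n + 1) powr t * (\<Sum>i\<le>n. \<bar>f (x + real i *\<^sub>R h)\<bar> powr t))"
      by (intro mult_left_mono sum_powr_le t) auto
    also have "\<dots> = ?q * (\<Sum>i\<le>n. \<bar>f (x + real i *\<^sub>R h)\<bar> powr t)" by (simp add: powr_mult)
    finally have "ennreal (\<bar>nth_difference G n h f x\<bar> powr t) \<le> ennreal (?q * (\<Sum>i\<le>n. \<bar>f (x + real i *\<^sub>R h)\<bar> powr t))"
      using True by (simp add: nth_difference_eq ennreal_leI)
    also have "\<dots> = ennreal ?q * (\<Sum>i\<le>n. ennreal (\<bar>f (x + real i *\<^sub>R h)\<bar> powr t))"
      by (simp add: ennreal_mult sum_nonneg sum_ennreal)
    also have "(\<Sum>i\<le>n. ennreal (\<bar>f (x + real i *\<^sub>R h)\<bar> powr t)) = (\<Sum>i\<le>n. ?F (x + real i *\<^sub>R h))"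
    proof (rule sum.cong[OF refl])
      fix i assume "i \<in> {..n}"
      then have "x + real i *\<^sub>R h \<in> S" using T[of x i] True by simp
      then show "ennreal (\<bar>f (x + real i *\<^sub>R h)\<bar> powr t) = ?F (x + real i *\<^sub>R h)" by simp
    qed
    finally show ?thesis using True by simp
  next
    case False
    then have "ennreal (\<bar>nth_difference G n h f x\<bar> powr t) * indicator T x = 0"
      by (auto simp: nth_difference_eq indicator_def)
    then show ?thesis by (simp only: zero_le)
  qed
  have "(\<integral>\<^sup>+x\<in>T. ennreal (\<bar>nth_difference G n h f x\<bar> powr t) \<partial>lborel)
      \<le> (\<integral>\<^sup>+x. ennreal ?q * (\<Sum>i\<le>n. ?F (x + real i *\<^sub>R h)) \<partial>lborel)"
    by (rule nn_integral_mono) (rule pw)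
  also have "\<dots> = ennreal ?q * (\<integral>\<^sup>+x. (\<Sum>i\<le>n. ?F (x + real i *\<^sub>R h)) \<partial>lborel)"
    by (rule nn_integral_cmult) measurable
  also have "(\<integral>\<^sup>+x. (\<Sum>i\<le>n. ?F (x + real i *\<^sub>R h)) \<partial>lborel) = (\<Sum>i\<le>n. \<integral>\<^sup>+x. ?F (x + real i *\<^sub>R h) \<partial>lborel)"
    by (rule nn_integral_sum) measurable
  also have "\<dots> = (\<Sum>i\<le>n. \<integral>\<^sup>+x. ?F x \<partial>lborel)"
    by (intro sum.cong refl nn_integral_lborel_translate(1)[where f="?F"]) measurable
  also have "ennreal ?q * \<dots> = ennreal (?q * (real n + 1)) * (\<integral>\<^sup>+x. ?F x \<partial>lborel)"
    by (simp add: ennreal_mult mult.assoc ennreal_of_nat_eq_real_of_nat add.commute del: ennreal_plus)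
  finally show ?thesis .
qed

context embedding
begin

definition "L = (\<Sum>j. l j powr (- \<kappa>))"

lemma summable_layers: "summable (\<lambda>j. l j powr (- \<kappa>))"
proof -
  have "(\<lambda>j. l j powr (- \<kappa>)) = (\<lambda>j. exp (\<kappa> * of_int m0) * exp (- \<kappa>) ^ j)"
  proof
    fix j
    have "l j powr (- \<kappa>) = exp (\<kappa> * of_int m0 + real j * (- \<kappa>))"
      by (simp add: l_eq powr_def algebra_simps)
    also have "\<dots> = exp (\<kappa> * of_int m0) * exp (- \<kappa>) ^ j"
      by (simp only: exp_add exp_of_nat_mult)
    finally show "l j powr (- \<kappa>) = exp (\<kappa> * of_int m0) * exp (- \<kappa>) ^ j" .
  qed
  moreover have "summable (\<lambda>j. exp (\<kappa> * of_int m0) * exp (- \<kappa>) ^ j)"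
    using \<kappa>_pos by (intro summable_mult summable_geometric) simp
  ultimately show ?thesis by simp
qed

lemma L_nonneg: "0 \<le> L"
  unfolding L_def by (rule suminf_nonneg[OF summable_layers]) simp

text \<open>Overlaps of layers only enlarge the right side, so the integral is at most the sum over
  the layers, a convergent geometric series.\<close>

lemma nn_integral_layers_le:
  assumes F[measurable]: "F \<in> borel_measurable borel" and c: "0 \<le> c"
    and S: "S \<subseteq> (\<Union>j\<in>J. A j)"
    and b: "\<And>j. j \<in> J \<Longrightarrow> (\<integral>\<^sup>+x\<in>A j. F x \<partial>lborel) \<le> ennreal (c * l j powr (- \<kappa>))"
  shows "(\<integral>\<^sup>+x\<in>S. F x \<partial>lborel) \<le> ennreal (c * L)"
proof -
  let ?G = "\<lambda>j x. if j \<in> J then F x * indicator (A j) x else 0"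
  have "(\<integral>\<^sup>+x\<in>S. F x \<partial>lborel) \<le> (\<integral>\<^sup>+x. (\<Sum>j. ?G j x) \<partial>lborel)"
  proof (rule nn_integral_mono)
    fix x
    show "F x * indicator S x \<le> (\<Sum>j. ?G j x)"
    proof (cases "x \<in> S")
      case True
      then obtain j where j: "j \<in> J" "x \<in> A j" using S by blast
      have "?G j x \<le> (\<Sum>i\<in>{j}. ?G i x)" by simp
      also have "\<dots> \<le> (\<Sum>i. ?G i x)" by (rule sum_le_suminf) auto
      finally show ?thesis using j True by simp
    qed simp
  qed
  also have "\<dots> = (\<Sum>j. \<integral>\<^sup>+x. ?G j x \<partial>lborel)"
    by (rule nn_integral_suminf) measurable
  also have "\<dots> \<le> (\<Sum>j. ennreal (c * l j powr (- \<kappa>)))"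
  proof (rule suminf_le)
    show "(\<integral>\<^sup>+x. ?G j x \<partial>lborel) \<le> ennreal (c * l j powr (- \<kappa>))" for j
      using b[of j] by (cases "j \<in> J") simp_all
  qed auto
  also have "\<dots> = ennreal (\<Sum>j. c * l j powr (- \<kappa>))"
    by (rule suminf_ennreal2) (use c summable_mult[OF summable_layers] in auto)
  also have "(\<Sum>j. c * l j powr (- \<kappa>)) = c * L"
    unfolding L_def by (rule suminf_mult[OF summable_layers])
  finally show ?thesis .
qed

definition represented :: "(('a \<Rightarrow> real) \<Rightarrow> real) \<Rightarrow> real \<Rightarrow> ('a \<Rightarrow> real) \<Rightarrow> bool" where
  "represented u U f \<longleftrightarrow> wnorm u = ennreal U \<and> 0 \<le> U \<and> f \<in> borel_measurable borel \<and>
     locally_integrable D f \<and> u = regular_distribution D f"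

text \<open>In the dilated variable the step has length \<epsilon> = l j * norm h. The i-th
  difference of the potential is of order \<epsilon> powr (s i / n), the reciprocal cutoff
  contributes \<epsilon> ^ (n - i), and the product is at most \<epsilon> powr s. Writing \<epsilon>
  powr (s \<tau>) as \<open>norm h powr (s * \<tau>)\<close> times a power of \<open>l j\<close>
  reduces the decay of the layers to \<open>\<kappa>\<close>.\<close>

lemma near_layer:
  obtains \<delta> K where "0 < \<delta>" "0 \<le> K"
    "\<forall>u U f j h. represented u U f \<longrightarrow> l j * norm h \<le> \<delta> \<longrightarrow>
       (\<integral>\<^sup>+x\<in>A j. ennreal (\<bar>nth_difference D n h f x\<bar> powr \<tau>) \<partial>lborel)
         \<le> ennreal (K * U powr \<tau> * norm h powr (s * \<tau>) * l j powr (- \<kappa>))"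
proof -
  obtain C where C: "0 \<le> C" "\<forall>u j. \<forall>g\<in>admissible u j. \<exists>w. w \<in> borel_measurable borel \<and> Lp_pow p w < \<infinity> \<and> represents u j w \<and>
       (\<forall>h. \<forall>i\<le>n. Lp_pow p ((Dif h ^^ i) w) \<le> ennreal (((C * norm h powr (s / real n)) ^ i) powr p) * Lp_pow p g)"
    by (rule layer_functions)
  obtain H where H: "0 \<le> H"
    "\<forall>u U j k (F :: 'a \<Rightarrow> real). wnorm u = ennreal U \<longrightarrow> 0 \<le> U \<longrightarrow> 0 \<le> k \<longrightarrow> F \<in> borel_measurable borel \<longrightarrow> (\<forall>x. 0 \<le> F x) \<longrightarrow>
       (\<forall>g\<in>admissible u j. (\<integral>\<^sup>+x\<in>A j. ennreal (F x powr p) \<partial>lborel) \<le> ennreal (k * l j powr (- d)) * Lp_pow p g) \<longrightarrow>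
       (\<integral>\<^sup>+x\<in>A j. ennreal (F x powr \<tau>) \<partial>lborel) \<le> ennreal (H * k powr (\<tau> / p) * U powr \<tau> * l j powr (- (\<tau> * (\<nu> + \<alpha> / d))))"
    by (rule layer_holder)
  obtain \<delta> K0 where \<delta>: "0 < \<delta>" "\<delta> \<le> 1" and K0: "0 \<le> K0" and near:
    "\<forall>j x h (f :: 'a \<Rightarrow> real) w. x \<in> A j \<longrightarrow> l j * norm h \<le> \<delta> \<longrightarrow>
       (\<forall>i\<le>n. x + real i *\<^sub>R h \<in> D \<longrightarrow> cut j (x + real i *\<^sub>R h) * f (x + real i *\<^sub>R h) = w (x + real i *\<^sub>R h)) \<longrightarrow>
       \<bar>dif n (\<lambda>i. f (x + real i *\<^sub>R h)) 0\<bar>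
         \<le> K0 * (\<Sum>i\<le>n. (l j * norm h) ^ (n - i) * \<bar>dif i (\<lambda>k. w (x + real k *\<^sub>R h)) 0\<bar>)"
    by (rule near_layer_differences)
  \<comment> \<open>The constant of the cutoff, the n + 1 terms of the Leibniz sum, and a bound for
    \<open>C ^ i\<close> that is uniform in i \<le> n.\<close>
  define B where "B = K0 * (real n + 1) * (1 + C) ^ n"
  have B0: "0 \<le> B" using K0 C by (simp add: B_def)
  let ?K = "H * (B powr \<tau> * (real n + 1) powr (\<tau> / p))"
  show ?thesis
  proof (rule that[OF \<delta>(1), of ?K], use H in simp, intro allI impI)
    fix u U j and h :: 'a and f :: "'a \<Rightarrow> real"
    assume r: "represented u U f" and small: "l j * norm h \<le> \<delta>"
    have U: "wnorm u = ennreal U" "0 \<le> U" and f[measurable]: "f \<in> borel_measurable borel"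
      and fl: "locally_integrable D f" "u = regular_distribution D f" using r by (auto simp: represented_def)
    define \<epsilon> where "\<epsilon> = l j * norm h"
    have \<epsilon>: "0 \<le> \<epsilon>" "\<epsilon> \<le> 1" using small \<delta> l_pos[of j] by (auto simp: \<epsilon>_def)
    define k where "k = (B * \<epsilon> powr s) powr p * (real n + 1)"
    let ?F = "\<lambda>x. \<bar>nth_difference D n h f x\<bar>"
    have "(\<integral>\<^sup>+x\<in>A j. ennreal (?F x powr \<tau>) \<partial>lborel) \<le> ennreal (H * k powr (\<tau> / p) * U powr \<tau> * l j powr (- (\<tau> * (\<nu> + \<alpha> / d))))"
    proof (rule H(2)[rule_format, OF U])
      show "0 \<le> k" by (simp add: k_def)
      show "?F \<in> borel_measurable borel" by measurable
      fix g assume "g \<in> admissible u j"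
      from C(2)[rule_format, OF this] obtain w where w[measurable]: "w \<in> borel_measurable borel" and wf: "Lp_pow p w < \<infinity>" and wr: "represents u j w"
        and wb: "\<forall>h. \<forall>i\<le>n. Lp_pow p ((Dif h ^^ i) w) \<le> ennreal (((C * norm h powr (s / real n)) ^ i) powr p) * Lp_pow p g" by blast
      \<comment> \<open>The potential lives in the dilated variable, so a step \<open>h\<close> in
        \<open>D\<close> is a step \<open>l j h\<close> for \<open>w\<close>.\<close>
      let ?w = "\<lambda>i. (Dif (l j *\<^sub>R h) ^^ i) w"
      let ?c = "(K0 * (real n + 1)) powr p"
      have wm[measurable]: "?w i \<in> borel_measurable borel" for i by (rule measurable_Dif_pow[OF w])
      \<comment> \<open>The identity between \<open>f\<close> and \<open>w\<close> is needed at all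
        shifted points at once; there are countably many translates, so one null set
        suffices.\<close>
      have "AE x in lborel. \<forall>i. x + real i *\<^sub>R h \<in> D \<longrightarrow> cut j (x + real i *\<^sub>R h) * f (x + real i *\<^sub>R h) = w (l j *\<^sub>R (x + real i *\<^sub>R h))"
        unfolding AE_all_countable
        by (intro allI AE_lborel_translate[where P="\<lambda>y. y \<in> D \<longrightarrow> cut j y * f y = w (l j *\<^sub>R y)"] represents_unique[OF fl w p wf wr])
      then have "AE x in lborel. ennreal (?F x powr p) * indicator (A j) x
          \<le> ennreal ?c * (\<Sum>i\<le>n. ennreal ((\<epsilon> ^ (n - i)) powr p) * ennreal (\<bar>?w i (0 + l j *\<^sub>R x)\<bar> powr p))"
      proof eventually_elim
        fix x
        assume eq: "\<forall>i. x + real i *\<^sub>R h \<in> D \<longrightarrow> cut j (x + real i *\<^sub>R h) * f (x + real i *\<^sub>R h) = w (l j *\<^sub>R (x + real i *\<^sub>R h))"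
        show "ennreal (?F x powr p) * indicator (A j) x
          \<le> ennreal ?c * (\<Sum>i\<le>n. ennreal ((\<epsilon> ^ (n - i)) powr p) * ennreal (\<bar>?w i (0 + l j *\<^sub>R x)\<bar> powr p))"
        proof (cases "x \<in> A j")
          case True
          let ?W = "\<lambda>i. \<epsilon> ^ (n - i) * \<bar>?w i (0 + l j *\<^sub>R x)\<bar>"
          have "?F x \<le> \<bar>dif n (\<lambda>i. f (x + real i *\<^sub>R h)) 0\<bar>" by (simp add: nth_difference_eq)
          also have "\<bar>dif n (\<lambda>i. f (x + real i *\<^sub>R h)) 0\<bar>
              \<le> K0 * (\<Sum>i\<le>n. (l j * norm h) ^ (n - i) * \<bar>dif i (\<lambda>k. (\<lambda>y. w (l j *\<^sub>R y)) (x + real k *\<^sub>R h)) 0\<bar>)"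
            by (rule near[rule_format, OF True small, where w="\<lambda>y. w (l j *\<^sub>R y)"]) (use eq in blast)
          also have "\<dots> = K0 * (\<Sum>i\<le>n. ?W i)"
            by (simp add: Dif_pow_eq_dif \<epsilon>_def scaleR_add_right mult.commute)
          finally have "?F x powr p \<le> (K0 * (\<Sum>i\<le>n. ?W i)) powr p" using p by (intro powr_mono2) auto
          also have "\<dots> = K0 powr p * (\<Sum>i\<le>n. ?W i) powr p" by (rule powr_mult)
          also have "\<dots> \<le> K0 powr p * ((real n + 1) powr p * (\<Sum>i\<le>n. ?W i powr p))"
            using \<epsilon> p by (intro mult_left_mono sum_powr_le) auto
          also have "\<dots> = ?c * (\<Sum>i\<le>n. (\<epsilon> ^ (n - i)) powr p * \<bar>?w i (0 + l j *\<^sub>R x)\<bar> powr p)"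
            by (simp add: powr_mult)
          finally have "ennreal (?F x powr p) \<le> ennreal (?c * (\<Sum>i\<le>n. (\<epsilon> ^ (n - i)) powr p * \<bar>?w i (0 + l j *\<^sub>R x)\<bar> powr p))"
            by (rule ennreal_leI)
          then show ?thesis using True
            by (simp add: ennreal_mult sum_nonneg sum_ennreal[symmetric] del: sum_ennreal)
        qed simp
      qed
      then have "(\<integral>\<^sup>+x\<in>A j. ennreal (?F x powr p) \<partial>lborel)
          \<le> (\<integral>\<^sup>+x. ennreal ?c * (\<Sum>i\<le>n. ennreal ((\<epsilon> ^ (n - i)) powr p) * ennreal (\<bar>?w i (0 + l j *\<^sub>R x)\<bar> powr p)) \<partial>lborel)"
        by (rule nn_integral_mono_AE)
      also have "\<dots> = ennreal ?c * (\<integral>\<^sup>+x. (\<Sum>i\<le>n. ennreal ((\<epsilon> ^ (n - i)) powr p) * ennreal (\<bar>?w i (0 + l j *\<^sub>R x)\<bar> powr p)) \<partial>lborel)"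
        by (rule nn_integral_cmult) measurable
      also have "(\<integral>\<^sup>+x. (\<Sum>i\<le>n. ennreal ((\<epsilon> ^ (n - i)) powr p) * ennreal (\<bar>?w i (0 + l j *\<^sub>R x)\<bar> powr p)) \<partial>lborel)
          = (\<Sum>i\<le>n. \<integral>\<^sup>+x. ennreal ((\<epsilon> ^ (n - i)) powr p) * ennreal (\<bar>?w i (0 + l j *\<^sub>R x)\<bar> powr p) \<partial>lborel)"
        by (rule nn_integral_sum) measurable
      also have "\<dots> = (\<Sum>i\<le>n. ennreal ((\<epsilon> ^ (n - i)) powr p) * (ennreal (l j powr (- d)) * Lp_pow p (?w i)))"
      proof (rule sum.cong[OF refl])
        fix i
        have "(\<integral>\<^sup>+x. ennreal ((\<epsilon> ^ (n - i)) powr p) * ennreal (\<bar>?w i (0 + l j *\<^sub>R x)\<bar> powr p) \<partial>lborel)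
            = ennreal ((\<epsilon> ^ (n - i)) powr p) * (\<integral>\<^sup>+x. ennreal (\<bar>?w i (0 + l j *\<^sub>R x)\<bar> powr p) \<partial>lborel)"
          by (rule nn_integral_cmult) measurable
        then show "(\<integral>\<^sup>+x. ennreal ((\<epsilon> ^ (n - i)) powr p) * ennreal (\<bar>?w i (0 + l j *\<^sub>R x)\<bar> powr p) \<partial>lborel)
            = ennreal ((\<epsilon> ^ (n - i)) powr p) * (ennreal (l j powr (- d)) * Lp_pow p (?w i))"
          by (simp only: nn_integral_dilate[OF wm])
      qed
      also have "\<dots> \<le> (\<Sum>i\<le>n. ennreal (((1 + C) ^ n * \<epsilon> powr s) powr p) * (ennreal (l j powr (- d)) * Lp_pow p g))"
      proof (rule sum_mono)
        fix i assume "i \<in> {..n}"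
        then have i: "i \<le> n" by simp
        let ?y = "(C * \<epsilon> powr (s / real n)) ^ i"
        have nh: "norm (l j *\<^sub>R h) = \<epsilon>" using l_pos[of j] by (simp add: \<epsilon>_def)
        have "\<epsilon> ^ (n - i) * ?y = C ^ i * (\<epsilon> ^ (n - i) * (\<epsilon> powr (s / real n)) ^ i)"
          by (simp add: power_mult_distrib)
        also have "\<dots> \<le> (1 + C) ^ n * \<epsilon> powr s"
        proof (rule mult_mono)
          have "C ^ i \<le> (1 + C) ^ i" using C by (intro power_mono) auto
          also have "\<dots> \<le> (1 + C) ^ n" using C i by (intro power_increasing) auto
          finally show "C ^ i \<le> (1 + C) ^ n" .
          show "\<epsilon> ^ (n - i) * (\<epsilon> powr (s / real n)) ^ i \<le> \<epsilon> powr s"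
            by (rule interpolation_power_le[OF \<epsilon> i n s_pos s(3)])
        qed (use C \<epsilon> in auto)
        finally have "(\<epsilon> ^ (n - i) * ?y) powr p \<le> ((1 + C) ^ n * \<epsilon> powr s) powr p"
          using p C \<epsilon> by (intro powr_mono2) auto
        then have e: "ennreal ((\<epsilon> ^ (n - i)) powr p) * ennreal (?y powr p) \<le> ennreal (((1 + C) ^ n * \<epsilon> powr s) powr p)"
          by (simp add: ennreal_mult[symmetric] powr_mult ennreal_leI)
        have "ennreal ((\<epsilon> ^ (n - i)) powr p) * (ennreal (l j powr (- d)) * Lp_pow p (?w i))
            \<le> ennreal ((\<epsilon> ^ (n - i)) powr p) * (ennreal (l j powr (- d)) * (ennreal (?y powr p) * Lp_pow p g))"
          using wb[rule_format, OF i, of "l j *\<^sub>R h"] unfolding nh by (intro mult_left_mono) auto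
        also have "\<dots> = (ennreal ((\<epsilon> ^ (n - i)) powr p) * ennreal (?y powr p)) * (ennreal (l j powr (- d)) * Lp_pow p g)"
          by (simp only: mult_ac)
        also have "\<dots> \<le> ennreal (((1 + C) ^ n * \<epsilon> powr s) powr p) * (ennreal (l j powr (- d)) * Lp_pow p g)"
          by (rule mult_right_mono[OF e]) simp
        finally show "ennreal ((\<epsilon> ^ (n - i)) powr p) * (ennreal (l j powr (- d)) * Lp_pow p (?w i))
            \<le> ennreal (((1 + C) ^ n * \<epsilon> powr s) powr p) * (ennreal (l j powr (- d)) * Lp_pow p g)" .
      qed
      also have "ennreal ?c * \<dots> = ennreal (k * l j powr (- d)) * Lp_pow p g"
      proof -
        have eq: "?c * ((real n + 1) * (((1 + C) ^ n * \<epsilon> powr s) powr p * l j powr (- d))) = k * l j powr (- d)"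
          by (simp add: k_def B_def powr_mult mult_ac)
        have "ennreal (?c * ((real n + 1) * (((1 + C) ^ n * \<epsilon> powr s) powr p * l j powr (- d)))) = ennreal ?c * (ennreal (real n + 1) * (ennreal (((1 + C) ^ n * \<epsilon> powr s) powr p) * ennreal (l j powr (- d))))"
          by (simp add: ennreal_mult del: ennreal_plus)
        then show ?thesis unfolding eq
          by (simp add: mult.assoc ennreal_of_nat_eq_real_of_nat add.commute)
      qed
      finally show "(\<integral>\<^sup>+x\<in>A j. ennreal (?F x powr p) \<partial>lborel) \<le> ennreal (k * l j powr (- d)) * Lp_pow p g"
        by (simp add: mult_left_mono)
    qed auto
    also have "H * k powr (\<tau> / p) * U powr \<tau> * l j powr (- (\<tau> * (\<nu> + \<alpha> / d))) = ?K * U powr \<tau> * norm h powr (s * \<tau>) * l j powr (- \<kappa>)"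
    proof -
      have "((B * \<epsilon> powr s) powr p) powr (\<tau> / p) = (B * \<epsilon> powr s) powr \<tau>" using p by (simp add: powr_powr)
      also have "\<dots> = B powr \<tau> * \<epsilon> powr (s * \<tau>)" by (simp add: powr_mult powr_powr)
      finally have "k powr (\<tau> / p) = B powr \<tau> * \<epsilon> powr (s * \<tau>) * (real n + 1) powr (\<tau> / p)"
        unfolding k_def powr_mult by simp
      moreover have "\<epsilon> powr (s * \<tau>) * l j powr (- (\<tau> * (\<nu> + \<alpha> / d))) = norm h powr (s * \<tau>) * l j powr (- \<kappa>)"
      proof -
        have "\<epsilon> powr (s * \<tau>) = norm h powr (s * \<tau>) * l j powr (s * \<tau>)" by (simp add: \<epsilon>_def powr_mult mult.commute)
        moreover have "l j powr (s * \<tau>) * l j powr (- (\<tau> * (\<nu> + \<alpha> / d))) = l j powr (- \<kappa>)"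
          by (simp add: powr_add[symmetric] \<kappa>_def algebra_simps)
        ultimately show ?thesis by (simp add: mult.assoc)
      qed
      ultimately show ?thesis by (simp add: mult_ac)
    qed
    finally show "(\<integral>\<^sup>+x\<in>A j. ennreal (?F x powr \<tau>) \<partial>lborel) \<le> ennreal (?K * U powr \<tau> * norm h powr (s * \<tau>) * l j powr (- \<kappa>))" .
  qed
qed

text \<open>Only layers with 1 / l j \<le> r * N0 / a meet the strip. Their decay splits into l powr
  (- s \<tau>), which is at most a multiple of r powr (s \<tau>), and l powr (- \<kappa>), which is
  summable.\<close>

lemma boundary_layer_bound:
  obtains K where "0 \<le> K"
    "\<forall>u U f r. represented u U f \<longrightarrow> 0 \<le> r \<longrightarrow>
       (\<integral>\<^sup>+x\<in>{x \<in> D. bdist D x \<le> r}. ennreal (\<bar>f x\<bar> powr \<tau>) \<partial>lborel) \<le> ennreal (K * U powr \<tau> * r powr (s * \<tau>))"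
proof -
  obtain K1 where K1: "0 \<le> K1"
    "\<forall>u U f j. wnorm u = ennreal U \<longrightarrow> 0 \<le> U \<longrightarrow> f \<in> borel_measurable borel \<longrightarrow> locally_integrable D f \<longrightarrow>
       u = regular_distribution D f \<longrightarrow>
       (\<integral>\<^sup>+x\<in>A j. ennreal (\<bar>f x\<bar> powr \<tau>) \<partial>lborel) \<le> ennreal (K1 * U powr \<tau> * l j powr (- (\<tau> * (\<nu> + \<alpha> / d))))"
    by (rule layer_function_bound)
  let ?e = "(N0 / a) powr (s * \<tau>)"
  show ?thesis
  proof (rule that[of "K1 * ?e * L"], use K1 L_nonneg in simp, intro allI impI)
    fix u :: "('a \<Rightarrow> real) \<Rightarrow> real" and U r :: real and f :: "'a \<Rightarrow> real"
    assume rep: "represented u U f" and r: "0 \<le> r"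
    then have f[measurable]: "f \<in> borel_measurable borel" by (simp add: represented_def)
    let ?S = "{x \<in> D. bdist D x \<le> r}"
    let ?J = "{j. A j \<inter> ?S \<noteq> {}}"
    have "(\<integral>\<^sup>+x\<in>?S. ennreal (\<bar>f x\<bar> powr \<tau>) \<partial>lborel) \<le> ennreal ((K1 * U powr \<tau> * (r * (N0 / a)) powr (s * \<tau>)) * L)"
    proof (rule nn_integral_layers_le)
      show "?S \<subseteq> (\<Union>j\<in>?J. A j)" using A_cover by blast
      fix j assume "j \<in> ?J"
      then obtain x where x: "x \<in> A j" "bdist D x \<le> r" by blast
      have lp: "0 < l j" by (rule l_pos)
      have "a / N0 \<le> l j * bdist D x" by (rule cut_nonzero_bounds(1)[OF A_D[OF x(1)] A_cut[OF x(1)]])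
      also have "\<dots> \<le> l j * r" using x lp by simp
      finally have "1 / l j \<le> r * (N0 / a)" using ab N_pos lp by (simp add: field_simps)
      then have "(1 / l j) powr (s * \<tau>) \<le> (r * (N0 / a)) powr (s * \<tau>)"
        using lp s_pos \<tau>_pos by (intro powr_mono2) auto
      then have e: "l j powr (- (s * \<tau>)) \<le> (r * (N0 / a)) powr (s * \<tau>)"
        using lp by (simp add: powr_divide powr_minus divide_inverse inverse_powr)
      have "(\<integral>\<^sup>+x\<in>A j. ennreal (\<bar>f x\<bar> powr \<tau>) \<partial>lborel) \<le> ennreal (K1 * U powr \<tau> * l j powr (- (\<tau> * (\<nu> + \<alpha> / d))))"
        using K1(2) rep unfolding represented_def by blast
      also have "\<dots> \<le> ennreal (K1 * U powr \<tau> * (r * (N0 / a)) powr (s * \<tau>) * l j powr (- \<kappa>))"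
      proof (rule ennreal_leI)
        have "l j powr (- (\<tau> * (\<nu> + \<alpha> / d))) = l j powr (- (s * \<tau>)) * l j powr (- \<kappa>)"
          by (simp add: powr_add[symmetric] \<kappa>_def algebra_simps)
        also have "\<dots> \<le> (r * (N0 / a)) powr (s * \<tau>) * l j powr (- \<kappa>)"
          by (rule mult_right_mono[OF e]) simp
        finally show "K1 * U powr \<tau> * l j powr (- (\<tau> * (\<nu> + \<alpha> / d))) \<le> K1 * U powr \<tau> * (r * (N0 / a)) powr (s * \<tau>) * l j powr (- \<kappa>)"
          unfolding mult.assoc using K1(1) by (intro mult_left_mono) auto
      qed
      finally show "(\<integral>\<^sup>+x\<in>A j. ennreal (\<bar>f x\<bar> powr \<tau>) \<partial>lborel) \<le> ennreal (K1 * U powr \<tau> * (r * (N0 / a)) powr (s * \<tau>) * l j powr (- \<kappa>))" .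
    qed (use K1 in auto)
    also have "K1 * U powr \<tau> * (r * (N0 / a)) powr (s * \<tau>) * L = K1 * ?e * L * U powr \<tau> * r powr (s * \<tau>)"
      unfolding powr_mult by (simp only: mult_ac)
    finally show "(\<integral>\<^sup>+x\<in>?S. ennreal (\<bar>f x\<bar> powr \<tau>) \<partial>lborel) \<le> ennreal (K1 * ?e * L * U powr \<tau> * r powr (s * \<tau>))" .
  qed
qed

text \<open>Layers on which the step is small are summed with the sharp bound, all other points lie
  in a strip of width proportional to \<open>norm h\<close>, and for large \<open>h\<close> the
  crude bound by \<open>f\<close> itself supplies the 1 in the minimum.\<close>

lemma difference_estimates:
  obtains Q where "0 \<le> Q"
    "\<forall>u U f. represented u U f \<longrightarrow> (\<integral>\<^sup>+x\<in>D. ennreal (\<bar>f x\<bar> powr \<tau>) \<partial>lborel) \<le> ennreal (Q * U powr \<tau>)"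
    "\<forall>u U f h. represented u U f \<longrightarrow>
       (\<integral>\<^sup>+x\<in>D. ennreal (\<bar>nth_difference D n h f x\<bar> powr \<tau>) \<partial>lborel) \<le> ennreal (Q * U powr \<tau> * min 1 (norm h powr (s * \<tau>)))"
proof -
  obtain KF where KF: "0 \<le> KF"
    "\<forall>u U f r. represented u U f \<longrightarrow> 0 \<le> r \<longrightarrow>
       (\<integral>\<^sup>+x\<in>{x \<in> D. bdist D x \<le> r}. ennreal (\<bar>f x\<bar> powr \<tau>) \<partial>lborel) \<le> ennreal (KF * U powr \<tau> * r powr (s * \<tau>))"
    by (rule boundary_layer_bound)
  obtain \<delta> KN where \<delta>: "0 < \<delta>" and KN: "0 \<le> KN" and near:
    "\<forall>u U f j h. represented u U f \<longrightarrow> l j * norm h \<le> \<delta> \<longrightarrow>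
       (\<integral>\<^sup>+x\<in>A j. ennreal (\<bar>nth_difference D n h f x\<bar> powr \<tau>) \<partial>lborel)
         \<le> ennreal (KN * U powr \<tau> * norm h powr (s * \<tau>) * l j powr (- \<kappa>))"
    by (rule near_layer)
  obtain y0 where y0: "y0 \<in> D" using nonempty_D by blast
  obtain e0 where e0: "\<And>y. y \<in> D \<Longrightarrow> dist y0 y \<le> e0" using bounded_D by (auto simp: bounded_any_center[of _ y0])
  \<comment> \<open>With this radius the boundary strip is all of \<open>D\<close>, so the bound for
    \<open>f\<close> on \<open>D\<close> is a case of the strip estimate.\<close>
  define R where "R = \<bar>bdist D y0 + e0\<bar>"
  have R: "bdist D y \<le> R" if "y \<in> D" for y
    using bdist_triangle[of y y0] e0[OF that] unfolding R_def by (simp add: dist_commute)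
  have R0: "0 \<le> R" by (simp add: R_def)
  define KG where "KG = KF * R powr (s * \<tau>)"
  have KG0: "0 \<le> KG" using KF by (simp add: KG_def)
  have DR: "{x \<in> D. bdist D x \<le> R} = D" using R by blast
  have G: "(\<integral>\<^sup>+x\<in>D. ennreal (\<bar>f x\<bar> powr \<tau>) \<partial>lborel) \<le> ennreal (KG * U powr \<tau>)" if "represented u U f" for u U f
    using KF(2)[rule_format, OF that R0] unfolding DR KG_def by (simp add: mult_ac)
  define q where "q = (2 ^ n * (real n + 1)) powr \<tau> * (real n + 1)"
  have q: "0 \<le> q" by (simp add: q_def)
  \<comment> \<open>If \<open>l j * norm h > \<delta>\<close> on a layer, then its points have
    distance at most \<open>c * norm h\<close> from the boundary.\<close>
  define c where "c = N1 * b / \<delta>"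
  have c: "0 \<le> c" using N_pos ab \<delta> by (simp add: c_def)
  define K1 where "K1 = KN * L + q * KF * (c + real n) powr (s * \<tau>)"
  have K1: "0 \<le> K1" using KN L_nonneg q KF by (simp add: K1_def)
  define Q where "Q = KG + q * KG + K1"
  have qK: "0 \<le> q * KG" using q KG0 by simp
  show ?thesis
  proof (rule that[of Q])
    show "0 \<le> Q" using KG0 qK K1 by (simp add: Q_def)
    show "\<forall>u U f. represented u U f \<longrightarrow> (\<integral>\<^sup>+x\<in>D. ennreal (\<bar>f x\<bar> powr \<tau>) \<partial>lborel) \<le> ennreal (Q * U powr \<tau>)"
    proof (intro allI impI)
      fix u U f assume "represented u U f"
      from G[OF this] show "(\<integral>\<^sup>+x\<in>D. ennreal (\<bar>f x\<bar> powr \<tau>) \<partial>lborel) \<le> ennreal (Q * U powr \<tau>)"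
      proof (rule order_trans)
        show "ennreal (KG * U powr \<tau>) \<le> ennreal (Q * U powr \<tau>)"
          unfolding Q_def using qK K1 by (intro ennreal_leI mult_right_mono) auto
      qed
    qed
    show "\<forall>u U f h. represented u U f \<longrightarrow>
       (\<integral>\<^sup>+x\<in>D. ennreal (\<bar>nth_difference D n h f x\<bar> powr \<tau>) \<partial>lborel) \<le> ennreal (Q * U powr \<tau> * min 1 (norm h powr (s * \<tau>)))"
    proof (intro allI impI)
      fix u U and f :: "'a \<Rightarrow> real" and h :: 'a assume rep: "represented u U f"
      then have f[measurable]: "f \<in> borel_measurable borel" by (simp add: represented_def)
      let ?F = "\<lambda>x. ennreal (\<bar>nth_difference D n h f x\<bar> powr \<tau>)"
      let ?u = "U powr \<tau>" and ?h = "norm h powr (s * \<tau>)"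
      have t: "0 \<le> \<tau>" using \<tau>_pos by simp
      have 1: "(\<integral>\<^sup>+x\<in>D. ?F x \<partial>lborel) \<le> ennreal (q * KG * ?u)"
      proof -
        have "(\<integral>\<^sup>+x\<in>D. ?F x \<partial>lborel) \<le> ennreal q * (\<integral>\<^sup>+x\<in>D. ennreal (\<bar>f x\<bar> powr \<tau>) \<partial>lborel)"
          unfolding q_def by (rule nth_difference_crude_bound[OF f borel_D t]) auto
        also have "\<dots> \<le> ennreal q * ennreal (KG * ?u)" by (intro mult_left_mono G[OF rep]) simp
        also have "\<dots> = ennreal (q * KG * ?u)" using q KG0 by (simp add: ennreal_mult mult.assoc)
        finally show ?thesis .
      qed
      have 2: "(\<integral>\<^sup>+x\<in>D. ?F x \<partial>lborel) \<le> ennreal (K1 * ?u * ?h)"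
      proof -
        let ?J = "{j. l j * norm h \<le> \<delta>}"
        let ?N = "\<Union>j\<in>?J. A j" and ?S = "{x \<in> D. bdist D x \<le> (c + real n) * norm h}"
        \<comment> \<open>Points off \<open>?N\<close> are at most \<open>c * norm h\<close> from
          the boundary, and each of the shifts moves them by at most \<open>n * norm h\<close>;
          hence the width of \<open>?S\<close>.\<close>
        have [measurable]: "?S \<in> sets borel" by measurable
        have N[measurable]: "?N \<in> sets borel" by measurable
        have "(\<integral>\<^sup>+x\<in>?N. ?F x \<partial>lborel) \<le> ennreal (KN * ?u * ?h * L)"
          by (rule nn_integral_layers_le[where J="?J"]) (use near rep KN in auto)
        moreover have "(\<integral>\<^sup>+x\<in>D - ?N. ?F x \<partial>lborel) \<le> ennreal (q * KF * ?u * ((c + real n) * norm h) powr (s * \<tau>))"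
        proof -
          have "(\<integral>\<^sup>+x\<in>D - ?N. ?F x \<partial>lborel) \<le> ennreal q * (\<integral>\<^sup>+x\<in>?S. ennreal (\<bar>f x\<bar> powr \<tau>) \<partial>lborel)"
            unfolding q_def
          proof (rule nth_difference_crude_bound[OF f _ t])
            fix x i assume x: "x \<in> D - ?N" and i: "i \<le> n" and D: "\<forall>i\<le>n. x + real i *\<^sub>R h \<in> D"
            obtain j where j: "x \<in> A j" using A_cover x by blast
            then have far: "\<delta> < l j * norm h" using x by force
            have "l j * bdist D x \<le> N1 * b" by (rule cut_nonzero_bounds(2)[OF A_D[OF j] A_cut[OF j]])
            also have "\<dots> = c * \<delta>" using \<delta> by (simp add: c_def)
            also have "\<dots> \<le> c * (l j * norm h)" using far c by (intro mult_left_mono) auto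
            also have "\<dots> = l j * (c * norm h)" by simp
            finally have "bdist D x \<le> c * norm h" using l_pos[of j] by simp
            moreover have "bdist D (x + real i *\<^sub>R h) \<le> bdist D x + real i * norm h"
              using bdist_triangle[of "x + real i *\<^sub>R h" x] by (simp add: dist_norm)
            moreover have "real i * norm h \<le> real n * norm h" using i by (intro mult_right_mono) auto
            ultimately have "bdist D (x + real i *\<^sub>R h) \<le> (c + real n) * norm h" by (simp add: distrib_right)
            then show "x + real i *\<^sub>R h \<in> ?S" using D i by simp
          qed simp
          also have "\<dots> \<le> ennreal q * ennreal (KF * ?u * ((c + real n) * norm h) powr (s * \<tau>))"
            by (intro mult_left_mono KF(2)[rule_format, OF rep]) (use c in auto)
          also have "\<dots> = ennreal (q * KF * ?u * ((c + real n) * norm h) powr (s * \<tau>))"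
            using q KF by (simp add: ennreal_mult mult.assoc)
          finally show ?thesis .
        qed
        moreover have "(\<integral>\<^sup>+x\<in>D. ?F x \<partial>lborel) \<le> (\<integral>\<^sup>+x\<in>?N. ?F x \<partial>lborel) + (\<integral>\<^sup>+x\<in>D - ?N. ?F x \<partial>lborel)"
        proof -
          have "(\<integral>\<^sup>+x\<in>D. ?F x \<partial>lborel) \<le> (\<integral>\<^sup>+x. ?F x * indicator ?N x + ?F x * indicator (D - ?N) x \<partial>lborel)"
            by (intro nn_integral_mono) (simp add: indicator_def)
          also have "\<dots> = (\<integral>\<^sup>+x\<in>?N. ?F x \<partial>lborel) + (\<integral>\<^sup>+x\<in>D - ?N. ?F x \<partial>lborel)"
            by (rule nn_integral_add) measurable
          finally show ?thesis .
        qed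
        ultimately have "(\<integral>\<^sup>+x\<in>D. ?F x \<partial>lborel)
            \<le> ennreal (KN * ?u * ?h * L) + ennreal (q * KF * ?u * ((c + real n) * norm h) powr (s * \<tau>))"
          by (meson add_mono order_trans)
        also have "\<dots> = ennreal (KN * ?u * ?h * L + q * KF * ?u * ((c + real n) * norm h) powr (s * \<tau>))"
          using KN L_nonneg q KF by (intro ennreal_plus[symmetric]) auto
        also have "KN * ?u * ?h * L + q * KF * ?u * ((c + real n) * norm h) powr (s * \<tau>) = K1 * ?u * ?h"
          unfolding K1_def powr_mult by (simp add: algebra_simps)
        finally show ?thesis .
      qed
      show "(\<integral>\<^sup>+x\<in>D. ?F x \<partial>lborel) \<le> ennreal (Q * ?u * min 1 ?h)"
      proof (cases "?h \<le> 1")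
        case True
        have "K1 * ?u * ?h \<le> Q * ?u * ?h" unfolding Q_def using KG0 qK by (intro mult_right_mono) auto
        then show ?thesis using 2 True by (simp add: min_def) (meson ennreal_leI order_trans)
      next
        case False
        have "q * KG * ?u \<le> Q * ?u" unfolding Q_def using KG0 K1 by (intro mult_right_mono) auto
        then show ?thesis using 1 False by (simp add: min_def) (meson ennreal_leI order_trans)
      qed
    qed
  qed
qed

end


section \<open>The embedding\<close>

lemma ennreal_powr_le:
  assumes "X \<le> ennreal x" "0 \<le> x" "0 < r"
  shows "ennreal_powr X r \<le> ennreal (x powr r)"
proof -
  have "X \<noteq> \<infinity>" using assms(1) by (auto simp: top_unique)
  moreover have "enn2real X \<le> x" using enn2real_mono[OF assms(1)] assms(2) by simp
  ultimately show ?thesis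
    using assms(3) by (auto simp: ennreal_powr_def intro!: ennreal_leI powr_mono2)
qed

lemma Lp_norm_le:
  assumes "(\<integral>\<^sup>+x\<in>G. ennreal (\<bar>f x\<bar> powr t) \<partial>lborel) \<le> ennreal x" "0 \<le> x" "0 < t"
  shows "Lp_norm t G f \<le> ennreal (x powr (1 / t))"
  unfolding Lp_norm_def by (rule ennreal_powr_le) (use assms in auto)

text \<open>Near 0 the integrand is a power with exponent e - a - 1 > -1. Near infinity the minimum
  caps it at the exponent - a - 1 < -1.\<close>

lemma besov_weight_integral:
  fixes a e :: real
  assumes "0 < a" "a < e"
  obtains I where "0 \<le> I"
    "(\<integral>\<^sup>+t\<in>{0<..}. ennreal (t powr (- a) * min 1 (t powr e) * (1 / t)) \<partial>lborel) \<le> ennreal I"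
proof -
  let ?f = "\<lambda>t::real. t powr (e - a - 1)" and ?g = "\<lambda>t::real. t powr (- a - 1)"
  have "(?f has_integral (1 powr (e - a - 1 + 1) / (e - a - 1 + 1))) {0..1}"
    by (rule has_integral_powr_from_0) (use assms in auto)
  then have f: "(\<integral>\<^sup>+t. ennreal (?f t) * indicator {0..1} t \<partial>lborel) = ennreal (1 / (e - a))"
    by (subst nn_integral_has_integral_lebesgue') auto
  have "(?g has_integral (- (1 powr (- a - 1 + 1)) / (- a - 1 + 1))) {1..}"
    by (rule has_integral_powr_to_inf) (use assms in auto)
  then have g: "(\<integral>\<^sup>+t. ennreal (?g t) * indicator {1..} t \<partial>lborel) = ennreal (1 / a)"
    by (subst nn_integral_has_integral_lebesgue') auto
  show ?thesis
  proof (rule that)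
    show "0 \<le> 1 / (e - a) + 1 / a" using assms by simp
    have "(\<integral>\<^sup>+t\<in>{0<..}. ennreal (t powr (- a) * min 1 (t powr e) * (1 / t)) \<partial>lborel)
        \<le> (\<integral>\<^sup>+t. ennreal (?f t) * indicator {0..1} t + ennreal (?g t) * indicator {1..} t \<partial>lborel)"
    proof (rule nn_integral_mono)
      fix t :: real
      show "ennreal (t powr (- a) * min 1 (t powr e) * (1 / t)) * indicator {0<..} t
          \<le> ennreal (?f t) * indicator {0..1} t + ennreal (?g t) * indicator {1..} t"
      proof (cases "0 < t")
        case True
        have pw: "?f t = t powr (- a) * t powr e * (1 / t)" "?g t = t powr (- a) * (1 / t)"
          using True by (simp_all add: powr_diff powr_minus divide_inverse mult.commute)
        show ?thesis
        proof (cases "t \<le> 1")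
          case True
          then have "t powr (- a) * min 1 (t powr e) * (1 / t) \<le> ?f t"
            unfolding pw using \<open>0 < t\<close> by (intro mult_right_mono mult_left_mono) auto
          then have "ennreal (t powr (- a) * min 1 (t powr e) * (1 / t)) \<le> ennreal (?f t)" by (rule ennreal_leI)
          then show ?thesis using True \<open>0 < t\<close> by (simp add: add_increasing2)
        next
          case False
          then have "t powr (- a) * min 1 (t powr e) * (1 / t) \<le> t powr (- a) * 1 * (1 / t)"
            using \<open>0 < t\<close> by (intro mult_right_mono mult_left_mono) auto
          then have "ennreal (t powr (- a) * min 1 (t powr e) * (1 / t)) \<le> ennreal (?g t)"
            unfolding pw by (intro ennreal_leI) simp
          then show ?thesis using False \<open>0 < t\<close> by (simp add: add_increasing)
        qed
      qed simp
    qed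
    also have "\<dots> = (\<integral>\<^sup>+t. ennreal (?f t) * indicator {0..1} t \<partial>lborel) + (\<integral>\<^sup>+t. ennreal (?g t) * indicator {1..} t \<partial>lborel)"
      by (rule nn_integral_add) measurable
    also have "\<dots> = ennreal (1 / (e - a) + 1 / a)"
      unfolding f g using assms by (intro ennreal_plus[symmetric]) auto
    finally show "(\<integral>\<^sup>+t\<in>{0<..}. ennreal (t powr (- a) * min 1 (t powr e) * (1 / t)) \<partial>lborel) \<le> ennreal (1 / (e - a) + 1 / a)" .
  qed
qed

text \<open>The integrability and the fine index of the Besov space are equal, so the outer power
  cancels the root in the modulus and the \<tau>-th powers of differences enter linearly.\<close>

lemma besov_seminorm_le:
  fixes f :: "'a::euclidean_space \<Rightarrow> real"
  assumes t: "0 < t" and a: "0 < a" "a < e" and Q: "0 \<le> Q"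
    and I: "0 \<le> I" "(\<integral>\<^sup>+r\<in>{0<..}. ennreal (r powr (- (a * t)) * min 1 (r powr (e * t)) * (1 / r)) \<partial>lborel) \<le> ennreal I"
    and b: "\<And>h. (\<integral>\<^sup>+x\<in>G. ennreal (\<bar>nth_difference G n h f x\<bar> powr t) \<partial>lborel) \<le> ennreal (Q * min 1 (norm h powr (e * t)))"
  shows "besov_seminorm G n a t t f \<le> ennreal ((Q * I) powr (1 / t))"
proof -
  let ?m = "\<lambda>r::real. min 1 (r powr (e * t))"
  have mod: "modulus_of_smoothness G n t r f \<le> ennreal ((Q * ?m r) powr (1 / t))" for r
    unfolding modulus_of_smoothness_def
  proof (rule SUP_least)
    fix h :: 'a assume "h \<in> {h. norm h < r}"
    then have "norm h powr (e * t) \<le> r powr (e * t)" using t a by (intro powr_mono2) auto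
    then have "ennreal (Q * ?m (norm h)) \<le> ennreal (Q * ?m r)" using Q by (intro ennreal_leI mult_left_mono) auto
    with b[of h] have "(\<integral>\<^sup>+x\<in>G. ennreal (\<bar>nth_difference G n h f x\<bar> powr t) \<partial>lborel) \<le> ennreal (Q * ?m r)" by (rule order_trans)
    then show "Lp_norm t G (nth_difference G n h f) \<le> ennreal ((Q * ?m r) powr (1 / t))"
      by (rule Lp_norm_le) (use Q t in auto)
  qed
  have "(\<integral>\<^sup>+r\<in>{0<..}. ennreal_powr (ennreal (r powr (- a)) * modulus_of_smoothness G n t r f) t * ennreal (1 / r) \<partial>lborel)
      \<le> (\<integral>\<^sup>+r. ennreal Q * (ennreal (r powr (- (a * t)) * ?m r * (1 / r)) * indicator {0<..} r) \<partial>lborel)"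
  proof (rule nn_integral_mono)
    fix r :: real
    show "ennreal_powr (ennreal (r powr (- a)) * modulus_of_smoothness G n t r f) t * ennreal (1 / r) * indicator {0<..} r
        \<le> ennreal Q * (ennreal (r powr (- (a * t)) * ?m r * (1 / r)) * indicator {0<..} r)"
    proof (cases "0 < r")
      case True
      have "ennreal (r powr (- a)) * modulus_of_smoothness G n t r f \<le> ennreal (r powr (- a)) * ennreal ((Q * ?m r) powr (1 / t))"
        by (intro mult_left_mono mod) simp
      also have "\<dots> = ennreal (r powr (- a) * (Q * ?m r) powr (1 / t))" by (simp add: ennreal_mult)
      finally have "ennreal_powr (ennreal (r powr (- a)) * modulus_of_smoothness G n t r f) t
          \<le> ennreal ((r powr (- a) * (Q * ?m r) powr (1 / t)) powr t)"
        by (rule ennreal_powr_le) (use t in auto)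
      also have "(r powr (- a) * (Q * ?m r) powr (1 / t)) powr t = r powr (- (a * t)) * (Q * ?m r)"
        using t Q by (simp add: powr_mult powr_powr)
      finally have "ennreal_powr (ennreal (r powr (- a)) * modulus_of_smoothness G n t r f) t * ennreal (1 / r)
          \<le> ennreal (r powr (- (a * t)) * (Q * ?m r)) * ennreal (1 / r)"
        by (rule mult_right_mono) simp
      also have "\<dots> = ennreal (Q * (r powr (- (a * t)) * ?m r * (1 / r)))"
        using Q True by (subst ennreal_mult[symmetric]) (auto simp: mult_ac)
      also have "\<dots> = ennreal Q * ennreal (r powr (- (a * t)) * ?m r * (1 / r))"
        using Q True by (intro ennreal_mult) auto
      finally show ?thesis using True by simp
    qed simp
  qed
  also have "\<dots> = ennreal Q * (\<integral>\<^sup>+r\<in>{0<..}. ennreal (r powr (- (a * t)) * ?m r * (1 / r)) \<partial>lborel)"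
    by (rule nn_integral_cmult) measurable
  also have "\<dots> \<le> ennreal Q * ennreal I" by (intro mult_left_mono I) simp
  also have "\<dots> = ennreal (Q * I)" using Q I by (simp add: ennreal_mult)
  finally show ?thesis
    unfolding besov_seminorm_def by (rule ennreal_powr_le) (use Q I t in auto)
qed

lemma regular_distribution_linear:
  fixes f g :: "'a::euclidean_space \<Rightarrow> real"
  assumes "locally_integrable D f" "locally_integrable D g"
  shows "locally_integrable D (\<lambda>x. a * f x + b * g x)"
    and "regular_distribution D (\<lambda>x. a * f x + b * g x)
      = (\<lambda>\<phi>. a * regular_distribution D f \<phi> + b * regular_distribution D g \<phi>)"
proof -
  show "locally_integrable D (\<lambda>x. a * f x + b * g x)"
    using assms by (auto simp: locally_integrable_def intro!: set_integral_add set_integrable_mult_right)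
  show "regular_distribution D (\<lambda>x. a * f x + b * g x)
      = (\<lambda>\<phi>. a * regular_distribution D f \<phi> + b * regular_distribution D g \<phi>)"
  proof
    fix \<phi>
    show "regular_distribution D (\<lambda>x. a * f x + b * g x) \<phi>
      = a * regular_distribution D f \<phi> + b * regular_distribution D g \<phi>"
    proof (cases "\<phi> \<in> test_functions D")
      case True
      note i = locally_integrable_test_function[OF assms(1) True] locally_integrable_test_function[OF assms(2) True]
      have "(LINT x:D|lborel. (a * f x + b * g x) * \<phi> x) = (LINT x:D|lborel. a * (f x * \<phi> x) + b * (g x * \<phi> x))"
        by (simp add: algebra_simps)
      also have "\<dots> = (LINT x:D|lborel. a * (f x * \<phi> x)) + (LINT x:D|lborel. b * (g x * \<phi> x))"
        by (intro set_integral_add set_integrable_mult_right i)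
      also have "\<dots> = a * (LINT x:D|lborel. f x * \<phi> x) + b * (LINT x:D|lborel. g x * \<phi> x)"
        by simp
      finally show ?thesis using True by (simp add: regular_distribution_def)
    qed (simp add: regular_distribution_def)
  qed
qed

lemma regular_distribution_cong_AE:
  fixes f g :: "'a::euclidean_space \<Rightarrow> real"
  assumes [measurable]: "f \<in> borel_measurable borel" "g \<in> borel_measurable borel" "D \<in> sets borel"
    and ae: "AE x in lborel. x \<in> D \<longrightarrow> f x = g x"
  shows "regular_distribution D f = regular_distribution D g"
proof
  fix \<phi>
  show "regular_distribution D f \<phi> = regular_distribution D g \<phi>"
  proof (cases "\<phi> \<in> test_functions D")
    case True
    have [measurable]: "\<phi> \<in> borel_measurable borel" by (rule smooth_borel_measurable[OF test_functions_smooth[OF True]])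
    have "(LINT x:D|lborel. f x * \<phi> x) = (LINT x:D|lborel. g x * \<phi> x)"
    proof (rule set_lebesgue_integral_cong_AE)
      show "AE x\<in>D in lborel. f x * \<phi> x = g x * \<phi> x" using ae by eventually_elim simp
    qed measurable
    then show ?thesis by (simp add: regular_distribution_def)
  qed (simp add: regular_distribution_def)
qed

lemma regular_distribution_inject_AE:
  fixes f g :: "'a::euclidean_space \<Rightarrow> real"
  assumes D: "open D" and prof: "partition_profile \<zeta>"
    and li: "locally_integrable D f" "locally_integrable D g"
    and eq: "regular_distribution D f = regular_distribution D g"
  shows "AE x in lborel. x \<in> D \<longrightarrow> f x = g x"
proof -
  have "AE x in lborel. x \<in> D \<longrightarrow> f x - g x = 0"
  proof (rule fundamental_lemma_calculus_of_variations[OF prof D locally_integrable_diff[OF li]])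
    fix \<eta> assume \<eta>: "\<eta> \<in> test_functions D"
    have "(LINT y:D|lborel. (f y - g y) * \<eta> y) = (LINT y:D|lborel. f y * \<eta> y) - (LINT y:D|lborel. g y * \<eta> y)"
      unfolding left_diff_distrib
      by (intro set_integral_diff locally_integrable_test_function[OF _ \<eta>] li)
    then show "(LINT y:D|lborel. (f y - g y) * \<eta> y) = 0"
      using fun_cong[OF eq, of \<eta>] \<eta> by (simp add: regular_distribution_def)
  qed
  then show ?thesis by eventually_elim simp
qed

context embedding
begin

lemma representation:
  assumes u: "u \<in> distributions D" and U: "wnorm u = ennreal U" "0 \<le> U"
  shows "\<exists>f. f \<in> borel_measurable borel \<and> locally_integrable D f \<and> u = regular_distribution D f"
proof -
  obtain C where C: "\<forall>u j. \<forall>g\<in>admissible u j. \<exists>w. w \<in> borel_measurable borel \<and> Lp_pow p w < \<infinity> \<and> represents u j w \<and>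
       (\<forall>h. \<forall>i\<le>n. Lp_pow p ((Dif h ^^ i) w) \<le> ennreal (((C * norm h powr (s / real n)) ^ i) powr p) * Lp_pow p g)"
    by (rule layer_functions)
  have "\<exists>w. w \<in> borel_measurable borel \<and> Lp_pow p w < \<infinity> \<and> represents u j w" for j
  proof -
    obtain g where "g \<in> admissible u j" using admissible_nonempty[OF U] by blast
    from C[rule_format, OF this] show ?thesis by blast
  qed
  then obtain w where "\<forall>j. w j \<in> borel_measurable borel \<and> Lp_pow p (w j) < \<infinity> \<and> represents u j (w j)" by metis
  then show ?thesis by (intro distribution_representation[OF u p]) blast+
qed

lemma besov_bounds:
  obtains C where "0 \<le> C"
    "\<forall>u U f. represented u U f \<longrightarrow> Lp_norm \<tau> D f \<le> ennreal (C * U) \<and> besov_seminorm D n \<alpha> \<tau> \<tau> f \<le> ennreal (C * U)"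
proof -
  obtain Q where Q: "0 \<le> Q"
    "\<forall>u U f. represented u U f \<longrightarrow> (\<integral>\<^sup>+x\<in>D. ennreal (\<bar>f x\<bar> powr \<tau>) \<partial>lborel) \<le> ennreal (Q * U powr \<tau>)"
    "\<forall>u U f h. represented u U f \<longrightarrow>
       (\<integral>\<^sup>+x\<in>D. ennreal (\<bar>nth_difference D n h f x\<bar> powr \<tau>) \<partial>lborel) \<le> ennreal (Q * U powr \<tau> * min 1 (norm h powr (s * \<tau>)))"
    by (rule difference_estimates)
  have at: "0 < \<alpha> * \<tau>" "\<alpha> * \<tau> < s * \<tau>" using \<alpha> s \<tau>_pos by auto
  obtain I where I: "0 \<le> I"
    "(\<integral>\<^sup>+t\<in>{0<..}. ennreal (t powr (- (\<alpha> * \<tau>)) * min 1 (t powr (s * \<tau>)) * (1 / t)) \<partial>lborel) \<le> ennreal I"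
    by (rule besov_weight_integral[OF at])
  define C where "C = Q powr (1 / \<tau>) + (Q * I) powr (1 / \<tau>)"
  show ?thesis
  proof (rule that[of C], simp add: C_def, intro allI impI)
    fix u U and f :: "'a \<Rightarrow> real" assume rep: "represented u U f"
    then have U: "0 \<le> U" by (simp add: represented_def)
    have Qu: "0 \<le> Q * U powr \<tau>" using Q by simp
    have root: "(x * U powr \<tau>) powr (1 / \<tau>) = x powr (1 / \<tau>) * U" for x
      using U \<tau>_pos by (simp add: powr_mult powr_powr)
    have "Lp_norm \<tau> D f \<le> ennreal ((Q * U powr \<tau>) powr (1 / \<tau>))"
      by (rule Lp_norm_le[OF Q(2)[rule_format, OF rep] Qu \<tau>_pos])
    also have "\<dots> \<le> ennreal (C * U)"
      unfolding root C_def using U by (intro ennreal_leI mult_right_mono) auto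
    finally have 1: "Lp_norm \<tau> D f \<le> ennreal (C * U)" .
    have "besov_seminorm D n \<alpha> \<tau> \<tau> f \<le> ennreal ((Q * U powr \<tau> * I) powr (1 / \<tau>))"
      by (rule besov_seminorm_le[OF \<tau>_pos \<alpha> s(1) Qu I Q(3)[rule_format, OF rep]])
    also have "Q * U powr \<tau> * I = (Q * I) * U powr \<tau>" by simp
    also have "ennreal (((Q * I) * U powr \<tau>) powr (1 / \<tau>)) \<le> ennreal (C * U)"
      unfolding root C_def using U by (intro ennreal_leI mult_right_mono) auto
    finally show "Lp_norm \<tau> D f \<le> ennreal (C * U) \<and> besov_seminorm D n \<alpha> \<tau> \<tau> f \<le> ennreal (C * U)"
      using 1 by blast
  qed
qed

lemma embedded:
  "continuously_linearly_embedded D (weighted_sobolev_space D \<psi> \<zeta> \<gamma> p \<theta>) (weighted_sobolev_norm D \<psi> \<zeta> \<gamma> p \<theta>)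
     (besov_space D n \<alpha> \<tau> \<tau>) (besov_norm D n \<alpha> \<tau> \<tau>)"
proof -
  let ?X = "weighted_sobolev_space D \<psi> \<zeta> \<gamma> p \<theta>"
  define P where "P u f \<longleftrightarrow> f \<in> borel_measurable borel \<and> locally_integrable D f \<and> u = regular_distribution D f"
    for u and f :: "'a \<Rightarrow> real"
  \<comment> \<open>A representing function is unique only almost everywhere, so one is chosen;
    linearity and injectivity follow from uniqueness rather than from the choice.\<close>
  define \<iota> where "\<iota> u = (SOME f. P u f)" for u
  have \<iota>: "P u (\<iota> u)" if "P u f" for u f unfolding \<iota>_def by (rule someI[of "P u", OF that])
  have XU: "wnorm u = ennreal (enn2real (wnorm u))" if "u \<in> ?X" for u
  proof -
    have "wnorm u < \<infinity>" using that by (simp add: weighted_sobolev_space_def wnorm_def)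
    then show ?thesis by simp
  qed
  have XP: "P u (\<iota> u)" if "u \<in> ?X" for u
  proof -
    have "u \<in> distributions D" using that by (simp add: weighted_sobolev_space_def)
    from representation[OF this XU[OF that] enn2real_nonneg] obtain f where "P u f" unfolding P_def by blast
    then show ?thesis by (rule \<iota>)
  qed
  have rep: "represented u (enn2real (wnorm u)) (\<iota> u)" if "u \<in> ?X" for u
    using XU[OF that] XP[OF that] unfolding represented_def P_def by simp
  obtain C where C: "0 \<le> C"
    "\<forall>u U f. represented u U f \<longrightarrow> Lp_norm \<tau> D f \<le> ennreal (C * U) \<and> besov_seminorm D n \<alpha> \<tau> \<tau> f \<le> ennreal (C * U)"
    by (rule besov_bounds)
  have bounds: "Lp_norm \<tau> D (\<iota> u) \<le> ennreal (C * enn2real (wnorm u))"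
    "besov_seminorm D n \<alpha> \<tau> \<tau> (\<iota> u) \<le> ennreal (C * enn2real (wnorm u))" if "u \<in> ?X" for u
    using C(2) rep[OF that] by blast+
  show ?thesis
    unfolding continuously_linearly_embedded_def
  proof (intro exI[of _ \<iota>] conjI ballI allI impI)
    fix u assume u: "u \<in> ?X"
    have m: "\<iota> u \<in> borel_measurable borel" using XP[OF u] by (simp add: P_def)
    have "set_borel_measurable lborel D (\<iota> u)"
      unfolding set_borel_measurable_def using m by measurable
    then show "\<iota> u \<in> besov_space D n \<alpha> \<tau> \<tau>"
      using bounds[OF u] by (auto simp: besov_space_def Lp_space_def intro: le_less_trans)
    show "locally_integrable D (\<iota> u)" "u = regular_distribution D (\<iota> u)" using XP[OF u] unfolding P_def by blast+
  next
    fix u v a b assume u: "u \<in> ?X" and v: "v \<in> ?X"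
    let ?w = "\<lambda>\<phi>. a * u \<phi> + b * v \<phi>" and ?f = "\<lambda>x. a * \<iota> u x + b * \<iota> v x"
    have Pu: "\<iota> u \<in> borel_measurable borel" "locally_integrable D (\<iota> u)" "regular_distribution D (\<iota> u) = u"
      and Pv: "\<iota> v \<in> borel_measurable borel" "locally_integrable D (\<iota> v)" "regular_distribution D (\<iota> v) = v"
      using XP[OF u] XP[OF v] unfolding P_def by simp_all
    note lin = regular_distribution_linear[OF Pu(2) Pv(2), of a b, unfolded Pu(3) Pv(3)]
    \<comment> \<open>\<open>?f\<close> witnesses that the combination is represented, so the choice
      succeeds there. The chosen function and \<open>?f\<close> represent the same distribution,
      hence agree almost everywhere.\<close>
    have "P ?w ?f" unfolding P_def using lin Pu(1) Pv(1) by simp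
    then have "P ?w (\<iota> ?w)" by (rule \<iota>)
    then have w: "locally_integrable D (\<iota> ?w)" "regular_distribution D (\<iota> ?w) = ?w" unfolding P_def by simp_all
    show "AE x in lborel. x \<in> D \<longrightarrow> \<iota> ?w x = a * \<iota> u x + b * \<iota> v x"
      by (rule regular_distribution_inject_AE[OF open_D profile w(1) lin(1)]) (simp only: w(2) lin(2))
  next
    fix u v assume u: "u \<in> ?X" and v: "v \<in> ?X" and ae: "AE x in lborel. x \<in> D \<longrightarrow> \<iota> u x = \<iota> v x"
    have Pu: "\<iota> u \<in> borel_measurable borel" "regular_distribution D (\<iota> u) = u"
      and Pv: "\<iota> v \<in> borel_measurable borel" "regular_distribution D (\<iota> v) = v"
      using XP[OF u] XP[OF v] unfolding P_def by simp_all
    show "u = v" using regular_distribution_cong_AE[OF Pu(1) Pv(1) borel_D ae] unfolding Pu(2) Pv(2) .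
  next
    show "\<exists>C::real. \<forall>u\<in>?X. besov_norm D n \<alpha> \<tau> \<tau> (\<iota> u) \<le> ennreal C * weighted_sobolev_norm D \<psi> \<zeta> \<gamma> p \<theta> u"
    proof (intro exI[of _ "2 * C"] ballI)
      fix u assume u: "u \<in> ?X"
      let ?U = "enn2real (wnorm u)"
      have "besov_norm D n \<alpha> \<tau> \<tau> (\<iota> u) \<le> ennreal (C * ?U) + ennreal (C * ?U)"
        unfolding besov_norm_def by (intro add_mono bounds u)
      also have "\<dots> = ennreal (C * ?U + C * ?U)"
        using C by (intro ennreal_plus[symmetric]) auto
      also have "C * ?U + C * ?U = 2 * C * ?U" by simp
      also have "ennreal (2 * C * ?U) = ennreal (2 * C) * ennreal ?U" using C by (intro ennreal_mult) auto
      also have "ennreal ?U = weighted_sobolev_norm D \<psi> \<zeta> \<gamma> p \<theta> u" using XU[OF u] by (simp add: wnorm_def)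
      finally show "besov_norm D n \<alpha> \<tau> \<tau> (\<iota> u) \<le> ennreal (2 * C) * weighted_sobolev_norm D \<psi> \<zeta> \<gamma> p \<theta> u" .
    qed
  qed
qed

end

text \<open>The order \<open>n\<close> of the differences is any integer above \<alpha>; the same
  number serves as the number of kernels into which the Bessel potential is split.\<close>

theorem theorem6p9:
  fixes D :: "'a::euclidean_space set"
    and \<psi> :: "'a \<Rightarrow> real" and \<zeta> :: "real \<Rightarrow> real"
    and p \<gamma> \<nu> \<alpha> \<tau> :: real and n :: nat
  assumes "bounded_lipschitz_domain D"
    and "regularized_distance D \<psi>" and "partition_profile \<zeta>"
    and "2 \<le> p" and "0 < \<gamma>" and "0 < \<nu>"
    and "0 < \<alpha>"
    and "ereal \<alpha> < min (ereal \<gamma>) (ereal \<nu> * (ereal (real DIM('a)) / ereal (real DIM('a) - 1)))"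
    and "1 / \<tau> = \<alpha> / real DIM('a) + 1 / p"
    and "\<alpha> < real n"
  shows "continuously_linearly_embedded D
           (weighted_sobolev_space D \<psi> \<zeta> \<gamma> p (real DIM('a) - \<nu> * p))
           (weighted_sobolev_norm D \<psi> \<zeta> \<gamma> p (real DIM('a) - \<nu> * p))
           (besov_space D n \<alpha> \<tau> \<tau>)
           (besov_norm D n \<alpha> \<tau> \<tau>)"
proof -
  define d where "d = real DIM('a)"
  have \<alpha>\<gamma>: "\<alpha> < \<gamma>" using assms(8) by simp
  \<comment> \<open>This is \<alpha> < \<nu> d / (d - 1) multiplied by (d - 1) / d. For d = 1 that
    bound is infinite, and the claim reduces to 0 < \<nu>.\<close>
  have \<alpha>\<nu>: "\<alpha> < \<nu> + \<alpha> / d"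
  proof (cases "DIM('a) = 1")
    case True
    then show ?thesis using assms(6) by (simp add: d_def)
  next
    case False
    then have d: "2 \<le> d" using DIM_positive[where 'a='a] unfolding d_def by linarith
    have "ereal \<alpha> < ereal \<nu> * (ereal d / ereal (d - 1))" using assms(8) by (simp add: d_def)
    also have "\<dots> = ereal (\<nu> * (d / (d - 1)))" using d by simp
    finally have "\<alpha> < \<nu> * (d / (d - 1))" by simp
    then have "\<alpha> * (d - 1) < \<nu> * d" using d by (simp add: field_simps)
    then have "\<alpha> * (d - 1) / d < \<nu>" using d by (simp add: field_simps)
    moreover have "\<alpha> * (d - 1) / d = \<alpha> - \<alpha> / d" using d by (simp add: field_simps)
    ultimately show ?thesis by linarith
  qed
  \<comment> \<open>All the upper bounds on \<alpha> are strict, which leaves room for an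
    \<open>s\<close> above \<alpha> that still obeys them.\<close>
  have "\<alpha> < min (min \<gamma> (real n)) (\<nu> + \<alpha> / d)" using \<alpha>\<gamma> \<alpha>\<nu> assms(10) by simp
  from dense[OF this] obtain s where s: "\<alpha> < s" "s < \<gamma>" "s < real n" "s < \<nu> + \<alpha> / d" by auto
  have n: "1 \<le> n" using assms(7,10) by (cases n) auto
  obtain a b c1 N0 N1 Nd m0 where "layers D \<psi> \<zeta> a b c1 N0 N1 Nd m0"
    using layers_exist[OF assms(1-3)] by blast
  then interpret embedding D \<psi> \<zeta> a b c1 N0 N1 Nd m0 \<gamma> p \<nu> \<alpha> \<tau> s d n
    by (intro embedding.intro embedding_axioms.intro) (use assms s n in \<open>auto simp: d_def\<close>)
  show ?thesis using embedded unfolding \<theta>_def unfolding d_def .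
qed

end
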